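(* Let $P:\mathbb{R}\to\mathbb{R}$ be a polynomial without constant term whose degree is greater than one. There exist a small constant $s_0>0$ and large constants $l_0>0$ and $\gamma_0>0$, depending only on $P$, such that $$\|T_l(f,g)\|_{H^{s_0}}\le 2^{\gamma_0 l}\,\|f\|_{H^{-s_0}}\,\|g\|_{H^{-s_0}}$$ for every integer $l\ge l_0$ and all Schwartz functions $f$ and $g$ on $\mathbb{R}$, where $$T_l(f,g)(x):=\int_{\mathbb{R}} f(x+t)\,g(x+P(t))\,\tau_l(t)\,dt .$$
   Context: $\tau_0:\mathbb{R}\to\mathbb{R}$ is a non-negative smooth bump function supported on $[1,2]$, fixed once and for all (dependence of constants on $\tau_0$ is not tracked), and $\tau_l(t):=\tau_0(2^l t)$. For $s\in\mathbb{R}$, $\|f\|_{H^s}:=\big(\int_{\mathbb{R}}|\hat f(\xi)|^2(1+|\xi|^2)^s\,d\xi\big)^{1/2}$, where $\hat f$ is the Fourier transform of $f$ on $\mathbb{R}$. *)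

theory Defs
  imports "HOL-Analysis.Analysis" "HOL-Computational_Algebra.Polynomial"
begin

definition iter_deriv :: "nat \<Rightarrow> (real \<Rightarrow> 'a::real_normed_vector) \<Rightarrow> real \<Rightarrow> 'a" where
  "iter_deriv k f = ((\<lambda>h x. vector_derivative h (at x)) ^^ k) f"

definition smooth :: "(real \<Rightarrow> 'a::real_normed_vector) \<Rightarrow> bool" where
  "smooth f \<longleftrightarrow> (\<forall>k x. iter_deriv k f differentiable (at x))"

definition schwartz :: "(real \<Rightarrow> complex) \<Rightarrow> bool" where
  "schwartz f \<longleftrightarrow> smooth f \<and> (\<forall>m n. bounded (range (\<lambda>x. x ^ m *\<^sub>R iter_deriv n f x)))"

(* Normalisation e^{-2 pi i x xi}. *)
definition fourier :: "(real \<Rightarrow> complex) \<Rightarrow> real \<Rightarrow> complex" where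
  "fourier f \<xi> = (LINT x|lborel. f x * cis (- 2 * pi * x * \<xi>))"

(* Extended-valued: an inequality against a finite bound also says that the norm is finite. *)
definition sobolev_norm :: "real \<Rightarrow> (real \<Rightarrow> complex) \<Rightarrow> ennreal" where
  "sobolev_norm s f =
    (let I = (\<integral>\<^sup>+ \<xi>. ennreal ((cmod (fourier f \<xi>))\<^sup>2 * (1 + \<bar>\<xi>\<bar>\<^sup>2) powr s) \<partial>lborel)
     in if I = \<infinity> then \<infinity> else ennreal (sqrt (enn2real I)))"

definition bump_on_1_2 :: "(real \<Rightarrow> real) \<Rightarrow> bool" where
  "bump_on_1_2 \<tau> \<longleftrightarrow> smooth \<tau> \<and> (\<forall>t. \<tau> t \<ge> 0) \<and> closure {t. \<tau> t \<noteq> 0} \<subseteq> {1..2}"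

definition dyadic_scale :: "(real \<Rightarrow> real) \<Rightarrow> int \<Rightarrow> real \<Rightarrow> real" where
  "dyadic_scale \<tau> l t = \<tau> (2 powi l * t)"

definition bilinear_T ::
    "(real \<Rightarrow> real) \<Rightarrow> real poly \<Rightarrow> int \<Rightarrow> (real \<Rightarrow> complex) \<Rightarrow> (real \<Rightarrow> complex) \<Rightarrow> real \<Rightarrow> complex" where
  "bilinear_T \<tau> P l f g x =
    (LINT t|lborel. f (x + t) * g (x + poly P t) * of_real (dyadic_scale \<tau> l t))"

end

theory Submission
  imports Defs "HOL-Probability.Probability" "HOL-Real_Asymp.Real_Asymp"
begin

text \<open>On the Fourier side \<open>T\<^sub>l(f, g)\<close> is \<open>B(\<xi>) = \<integral> F(\<eta>) G(\<xi> - \<eta>) m(\<eta>, \<xi> - \<eta>) d\<eta>\<close> with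
  \<open>m(\<eta>, \<zeta>) = \<integral> \<tau>\<^sub>l(t) e(\<eta> t + \<zeta> P(t)) dt\<close>. After a dyadic decomposition of \<open>F\<close> and \<open>G\<close> it suffices to gain a
  power of the largest frequency in the trivial bound of the \<open>L\<^sup>2\<close> norm of \<open>B\<close> by those of \<open>F\<close> and \<open>G\<close>.
  Absolute values do not suffice: the decay of \<open>m\<close> only breaks even.

  Opening the square gives an integral over pairs \<open>p, q\<close> of points of the curve. The part \<open>\<bar>p - q\<bar> < \<rho>\<close> is
  \<open>O(\<rho>)\<close>. The rest is an integral over a frequency difference \<open>\<tau>\<close> of the forms
  \<open>\<integral>\<integral> \<alpha>(q - p) \<gamma>(P(q) - P(p)) e(\<tau> (P(p) - q)) dp dq\<close>, where the \<open>L\<^sup>2\<close> norms of \<open>\<alpha>\<close>, \<open>\<gamma>\<close> are controlled by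
  Bessel's inequality. For small \<open>\<tau>\<close> the van der Corput decay of \<open>m\<close> gives the gain, since the \<open>\<tau>\<close>-interval is
  short. For large \<open>\<tau>\<close> the form is estimated by a \<open>TT\<^sup>*\<close> argument in the coordinates \<open>q - p\<close> and
  \<open>P(q) - P(p)\<close>; the phase is nondegenerate because \<open>P'' / (P' (P' - 1))\<close> is strictly monotone near \<open>0\<^sup>+\<close>. Every
  constant is bounded by a power of \<open>2\<^sup>l\<close>, because a nonzero polynomial is bounded below by a power of \<open>t\<close> for
  small \<open>t > 0\<close>.\<close>

subsection \<open>Fourier integrals on the line\<close>

text \<open>Why the square must be opened: on a block of frequency \<lambda>, Cauchy-Schwarz in the
  inner frequency loses \<open>\<lambda>^(1/2)\<close>, exactly what the best possible decay
  \<open>\<lambda>^(-1/2)\<close> of \<open>m\<close> returns. After opening the square any positive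
  power of decay suffices, so only the cheap rate \<open>\<lambda>^(-1/3)\<close> is proved. Each
  condition on the curve has its own role. \<open>P' \<noteq> 1\<close> makes
  \<open>(x, t) -> (x + t, x + P t)\<close> nonsingular and bounds the diagonal energy.
  \<open>P'' \<noteq> 0\<close> gives the decay of \<open>m\<close> and makes
  \<open>p -> P (p + r) - P p\<close> monotone, so that \<open>r = q - p\<close> and
  \<open>v = P q - P p\<close> are coordinates. In them the phase \<open>P p - p\<close> has
  v-derivative \<open>(P' p - 1) / (P' q - P' p)\<close>, and nondegeneracy means that this slope
  changes with \<open>r\<close> at fixed \<open>v\<close>. Since \<open>W\<close> is the derivative
  of \<open>log |1 - 1 / P'|\<close>, a constant \<open>W\<close> would make
  \<open>1 - 1 / P'\<close> an exponential, which is impossible for a nonconstant polynomial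
  \<open>P'\<close>.\<close>

definition ee :: "real \<Rightarrow> complex" where "ee x = cis (2 * pi * x)"

lemma norm_ee [simp]: "cmod (ee x) = 1" by (simp add: ee_def)
lemma ee_add: "ee (x + y) = ee x * ee y" by (simp add: ee_def cis_mult algebra_simps)
lemma ee_minus: "ee (- x) = cnj (ee x)" by (simp add: ee_def cis_cnj)
lemma ee_diff: "ee (x - y) = ee x * cnj (ee y)" using ee_add[of x "- y"] by (simp add: ee_minus)
lemma continuous_on_ee [continuous_intros]: "continuous_on A f \<Longrightarrow> continuous_on A (\<lambda>x. ee (f x))"
  unfolding ee_def cis_conv_exp by (intro continuous_intros)
lemma ee_measurable [measurable]: "ee \<in> borel_measurable borel"
  by (intro borel_measurable_continuous_onI continuous_intros)

lemma fourier_ee: "fourier f \<xi> = (LINT x|lborel. f x * ee (- (x * \<xi>)))"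
  unfolding fourier_def ee_def by (simp add: mult.assoc)

section \<open>Absolute integrability on products, for the Fubini arguments\<close>

lemma integrable_prod_bounded:
  fixes f :: "'a \<Rightarrow> complex" and g :: "'b \<Rightarrow> complex"
  assumes "sigma_finite_measure M1" "sigma_finite_measure M2"
    and f: "integrable M1 f" and g: "integrable M2 g"
    and w[measurable]: "w \<in> borel_measurable (M1 \<Otimes>\<^sub>M M2)" and wb: "\<And>z. z \<in> space (M1 \<Otimes>\<^sub>M M2) \<Longrightarrow> norm (w z) \<le> C"
  shows "integrable (M1 \<Otimes>\<^sub>M M2) (\<lambda>z. f (fst z) * g (snd z) * w z)"
proof -
  interpret pair_sigma_finite M1 M2 using assms by (simp add: pair_sigma_finite_def)
  have [measurable]: "f \<in> borel_measurable M1" "g \<in> borel_measurable M2" using f g by auto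
  have 1: "integrable (M1 \<Otimes>\<^sub>M M2) (\<lambda>z. f (fst z) * g (snd z))"
  proof (rule Fubini_integrable)
    show "integrable M1 (\<lambda>x. LINT y|M2. norm (f (fst (x, y)) * g (snd (x, y))))"
      using f by (simp add: norm_mult)
    show "AE x in M1. integrable M2 (\<lambda>y. f (fst (x, y)) * g (snd (x, y)))" using g by auto
  qed measurable
  show ?thesis
  proof (rule Bochner_Integration.integrable_bound[of _ "\<lambda>z. C * norm (f (fst z) * g (snd z))"])
    show "integrable (M1 \<Otimes>\<^sub>M M2) (\<lambda>z. C * norm (f (fst z) * g (snd z)))" using 1 by auto
    show "AE z in M1 \<Otimes>\<^sub>M M2. norm (f (fst z) * g (snd z) * w z) \<le> norm (C * norm (f (fst z) * g (snd z)))"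
    proof (rule AE_I2)
      fix z assume z: "z \<in> space (M1 \<Otimes>\<^sub>M M2)"
      have "norm (f (fst z) * g (snd z) * w z) = norm (w z) * norm (f (fst z) * g (snd z))" by (simp add: norm_mult)
      also have "\<dots> \<le> C * norm (f (fst z) * g (snd z))" by (intro mult_right_mono wb z) auto
      finally show "norm (f (fst z) * g (snd z) * w z) \<le> norm (C * norm (f (fst z) * g (snd z)))" by (simp add: abs_le_iff)
    qed
  qed measurable
qed

lemma integrable_shift:
  fixes f :: "real \<Rightarrow> 'a :: {banach, second_countable_topology}"
  assumes "integrable lborel f"
  shows "integrable lborel (\<lambda>x. f (x - t))" "integrable lborel (\<lambda>x. f (x + t))" "integrable lborel (\<lambda>x. f (t - x))"
  using lborel_integrable_real_affine[OF assms, of 1 "-t"] lborel_integrable_real_affine[OF assms, of 1 "t"]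
    lborel_integrable_real_affine[OF assms, of "-1" "t"] by (simp_all add: add.commute)

lemma LINT_shift:
  fixes f :: "real \<Rightarrow> 'a :: {banach, second_countable_topology}"
  shows "(LINT x|lborel. f (x + t)) = (LINT x|lborel. f x)" "(LINT x|lborel. f (x - t)) = (LINT x|lborel. f x)"
    "(LINT x|lborel. f (t - x)) = (LINT x|lborel. f x)"
  using lborel_integral_real_affine[of 1 f t] lborel_integral_real_affine[of 1 f "-t"] lborel_integral_real_affine[of "-1" f "t"]
  by (simp_all add: add.commute)

text \<open>For a fixed first variable the second factor is a translate of \<open>g\<close>, so its
  L1 norm does not depend on that variable. The sign \<open>s\<close> in the proof treats
  convolution and correlation at once.\<close>

lemma integrable_conv_bounded:
  fixes f g :: "real \<Rightarrow> complex"
  assumes f: "integrable lborel f" and g: "integrable lborel g"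
    and w[measurable]: "w \<in> borel_measurable (lborel \<Otimes>\<^sub>M lborel)" and wb: "\<And>z. norm (w z) \<le> C"
  shows "integrable (lborel \<Otimes>\<^sub>M lborel) (\<lambda>z. f (fst z) * g (snd z - fst z) * w z)"
    and "integrable (lborel \<Otimes>\<^sub>M lborel) (\<lambda>z. f (fst z) * g (snd z + fst z) * w z)"
proof -
  have [measurable]: "f \<in> borel_measurable borel" "g \<in> borel_measurable borel" using f g by auto
  have *: "integrable (lborel \<Otimes>\<^sub>M lborel) (\<lambda>z. f (fst z) * g (snd z + s * fst z) * w z)" for s
  proof -
    have 1: "integrable (lborel \<Otimes>\<^sub>M lborel) (\<lambda>z. f (fst z) * g (snd z + s * fst z))"
    proof (rule lborel_pair.Fubini_integrable)
      have "(LINT y|lborel. cmod (g (y + s * x))) = (LINT y|lborel. cmod (g y))" for x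
        by (rule LINT_shift(1)[of "\<lambda>y. cmod (g y)" "s * x"])
      then show "integrable lborel (\<lambda>x. LINT y|lborel. norm (f (fst (x, y)) * g (snd (x, y) + s * fst (x, y))))"
        using f by (simp add: norm_mult)
      show "AE x in lborel. integrable lborel (\<lambda>y. f (fst (x, y)) * g (snd (x, y) + s * fst (x, y)))"
        using g by (auto intro!: integrable_shift)
    qed measurable
    show ?thesis
    proof (rule Bochner_Integration.integrable_bound[of _ "\<lambda>z. C * norm (f (fst z) * g (snd z + s * fst z))"])
      show "integrable (lborel \<Otimes>\<^sub>M lborel) (\<lambda>z. C * norm (f (fst z) * g (snd z + s * fst z)))" using 1 by auto
      show "AE z in lborel \<Otimes>\<^sub>M lborel. norm (f (fst z) * g (snd z + s * fst z) * w z) \<le> norm (C * norm (f (fst z) * g (snd z + s * fst z)))"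
      proof (rule AE_I2)
        fix z :: "real \<times> real"
        have "norm (f (fst z) * g (snd z + s * fst z) * w z) = norm (w z) * norm (f (fst z) * g (snd z + s * fst z))" by (simp add: norm_mult)
        also have "\<dots> \<le> C * norm (f (fst z) * g (snd z + s * fst z))" by (intro mult_right_mono wb) auto
        finally show "norm (f (fst z) * g (snd z + s * fst z) * w z) \<le> norm (C * norm (f (fst z) * g (snd z + s * fst z)))" by (simp add: abs_le_iff)
      qed
    qed measurable
  qed
  show "integrable (lborel \<Otimes>\<^sub>M lborel) (\<lambda>z. f (fst z) * g (snd z - fst z) * w z)" using *[of "-1"] by simp
  show "integrable (lborel \<Otimes>\<^sub>M lborel) (\<lambda>z. f (fst z) * g (snd z + fst z) * w z)" using *[of "1"] by simp
qed

lemma integrable_mult_bounded: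
  fixes f w :: "'a \<Rightarrow> complex"
  assumes f: "integrable M f" and [measurable]: "w \<in> borel_measurable M" and wb: "\<And>z. norm (w z) \<le> C"
  shows "integrable M (\<lambda>x. f x * w x)"
proof (rule Bochner_Integration.integrable_bound[of _ "\<lambda>z. C * norm (f z)"])
  have [measurable]: "f \<in> borel_measurable M" using f by auto
  show "(\<lambda>x. f x * w x) \<in> borel_measurable M" by measurable
  show "integrable M (\<lambda>z. C * norm (f z))" using f by auto
  show "AE z in M. norm (f z * w z) \<le> norm (C * norm (f z))"
  proof (rule AE_I2)
    fix z
    have "norm (f z * w z) = norm (w z) * norm (f z)" by (simp add: norm_mult)
    also have "\<dots> \<le> C * norm (f z)" by (intro mult_right_mono wb) auto
    finally show "norm (f z * w z) \<le> norm (C * norm (f z))" by (simp add: abs_le_iff)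
  qed
qed

lemma integral_Cauchy_Schwarz:
  fixes f g :: "'a \<Rightarrow> real"
  assumes [measurable]: "f \<in> borel_measurable M" "g \<in> borel_measurable M"
    and f0: "\<And>x. f x \<ge> 0" and g0: "\<And>x. g x \<ge> 0"
    and f: "integrable M (\<lambda>x. (f x)\<^sup>2)" and g: "integrable M (\<lambda>x. (g x)\<^sup>2)"
  shows "integrable M (\<lambda>x. f x * g x)"
    and "(LINT x|M. f x * g x) \<le> sqrt (LINT x|M. (f x)\<^sup>2) * sqrt (LINT x|M. (g x)\<^sup>2)"
proof -
  show i: "integrable M (\<lambda>x. f x * g x)"
  proof (rule Bochner_Integration.integrable_bound[of _ "\<lambda>x. (f x)\<^sup>2 + (g x)\<^sup>2"])
    show "AE x in M. norm (f x * g x) \<le> norm ((f x)\<^sup>2 + (g x)\<^sup>2)"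
    proof (rule AE_I2)
      fix x
      have "2 * (f x * g x) \<le> (f x)\<^sup>2 + (g x)\<^sup>2" using sum_squares_bound[of "f x" "g x"] by (simp add: mult.assoc)
      then show "norm (f x * g x) \<le> norm ((f x)\<^sup>2 + (g x)\<^sup>2)" using f0[of x] g0[of x]
        by (simp add: abs_mult) (smt (verit) mult_nonneg_nonneg)
    qed
  qed (use f g in auto)
  have e1: "(\<integral>\<^sup>+x. ennreal (f x) * ennreal (g x) \<partial>M) = ennreal (LINT x|M. f x * g x)"
    using nn_integral_eq_integral[OF i] f0 g0 by (simp add: ennreal_mult)
  have e2: "(\<integral>\<^sup>+x. (ennreal (f x))\<^sup>2 \<partial>M) = ennreal (LINT x|M. (f x)\<^sup>2)"
    using nn_integral_eq_integral[OF f] f0 by (simp add: ennreal_power)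
  have e3: "(\<integral>\<^sup>+x. (ennreal (g x))\<^sup>2 \<partial>M) = ennreal (LINT x|M. (g x)\<^sup>2)"
    using nn_integral_eq_integral[OF g] g0 by (simp add: ennreal_power)
  have "(ennreal (LINT x|M. f x * g x))\<^sup>2 \<le> ennreal (LINT x|M. (f x)\<^sup>2) * ennreal (LINT x|M. (g x)\<^sup>2)"
    using Cauchy_Schwarz_nn_integral[of "\<lambda>x. ennreal (f x)" M "\<lambda>x. ennreal (g x)"] unfolding e1 e2 e3 by simp
  then have "ennreal ((LINT x|M. f x * g x)\<^sup>2) \<le> ennreal ((LINT x|M. (f x)\<^sup>2) * (LINT x|M. (g x)\<^sup>2))"
    by (simp add: ennreal_power[symmetric] ennreal_mult integral_nonneg_AE f0 g0 flip: ennreal_power)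
  then have "(LINT x|M. f x * g x)\<^sup>2 \<le> (LINT x|M. (f x)\<^sup>2) * (LINT x|M. (g x)\<^sup>2)"
    by (simp add: ennreal_le_iff)
  then show "(LINT x|M. f x * g x) \<le> sqrt (LINT x|M. (f x)\<^sup>2) * sqrt (LINT x|M. (g x)\<^sup>2)"
    by (metis real_le_rsqrt real_sqrt_mult)
qed

section \<open>Gaussian regularisation: Bessel's inequality and Fourier inversion\<close>

lemma fourier_gaussian:
  assumes e: "\<epsilon> > 0"
  shows "(LINT r|lborel. complex_of_real (exp (- (\<epsilon> * r)\<^sup>2 / 2)) * ee (r * z)) = of_real (normal_density 0 (\<epsilon> / (2 * pi)) z)"
proof -
  have sn: "(LINT x|lborel. complex_of_real (std_normal_density x) * iexp (t * x)) = of_real (exp (- (t\<^sup>2) / 2))" for t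
  proof -
    have "char std_normal_distribution t = (LINT x|std_normal_distribution. iexp (t * x))" by (simp add: char_def)
    also have "\<dots> = (LINT x|lborel. std_normal_density x *\<^sub>R iexp (t * x))"
      by (intro integral_density) auto
    finally show ?thesis by (simp add: char_std_normal_distribution scaleR_conv_of_real)
  qed
  have "(LINT r|lborel. complex_of_real (exp (- (\<epsilon> * r)\<^sup>2 / 2)) * ee (r * z))
     = \<bar>1 / \<epsilon>\<bar> *\<^sub>R (LINT x|lborel. complex_of_real (exp (- (\<epsilon> * (0 + 1 / \<epsilon> * x))\<^sup>2 / 2)) * ee ((0 + 1 / \<epsilon> * x) * z))"
    using e by (intro lborel_integral_real_affine) auto
  also have "\<dots> = (1 / \<epsilon>) *\<^sub>R (LINT x|lborel. complex_of_real (sqrt (2 * pi)) * (complex_of_real (std_normal_density x) * iexp ((2 * pi * z / \<epsilon>) * x)))"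
    using e by (auto simp: std_normal_density_def ee_def cis_conv_exp mult_ac intro!: Bochner_Integration.integral_cong arg_cong[of _ _ "scaleR _"])
  also have "\<dots> = (1 / \<epsilon>) *\<^sub>R (complex_of_real (sqrt (2 * pi)) * of_real (exp (- ((2 * pi * z / \<epsilon>)\<^sup>2) / 2)))"
    by (subst integral_mult_right_zero, subst sn) simp
  also have "\<dots> = of_real (normal_density 0 (\<epsilon> / (2 * pi)) z)"
  proof -
    have "1 / \<epsilon> * (sqrt (2 * pi) * exp (- ((2 * pi * z / \<epsilon>)\<^sup>2) / 2)) = normal_density 0 (\<epsilon> / (2 * pi)) z"
    proof -
      have a: "sqrt (2 * pi * (\<epsilon> / (2 * pi))\<^sup>2) = \<epsilon> / sqrt (2 * pi)"
        using e by (simp add: real_sqrt_mult real_sqrt_divide power_divide) (simp add: field_simps real_sqrt_mult)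
      show ?thesis unfolding normal_density_def a using e by (simp add: field_simps power2_eq_square)
    qed
    then show ?thesis by (metis of_real_mult scaleR_conv_of_real)
  qed
  finally show ?thesis .
qed

lemma integrable_gauss:
  fixes \<epsilon> :: real
  assumes e: "\<epsilon> > 0"
  shows "integrable lborel (\<lambda>r. exp (- (\<epsilon> * r)\<^sup>2 / 2))"
proof -
  have "exp (- (\<epsilon> * r)\<^sup>2 / 2) = sqrt (2 * pi * (1/\<epsilon>)\<^sup>2) * normal_density 0 (1/\<epsilon>) r" for r :: real
    unfolding normal_density_def using e by (simp add: field_simps)
  then show ?thesis using integrable_normal_density[of "1/\<epsilon>" 0] e by simp
qed

lemma cnj_measurable [measurable]: "cnj \<in> borel_measurable borel"
  by (intro borel_measurable_continuous_onI continuous_intros)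

lemma normal_density_even: "normal_density 0 s (- x) = normal_density 0 s x"
  by (simp add: normal_density_def)

lemma fourier_bounded:
  assumes "integrable lborel f"
  shows "cmod (LINT x|lborel. f x * ee (g x)) \<le> (LINT x|lborel. cmod (f x))"
  by (rule order_trans[OF integral_norm_bound]) (simp add: norm_mult)

lemma continuous_fourier:
  assumes c: "integrable lborel c"
  shows "continuous_on UNIV (\<lambda>r. LINT z|lborel. c z * ee (- (z * r)))"
proof (rule continuous_at_imp_continuous_on, rule ballI)
  fix x :: real
  have [measurable]: "c \<in> borel_measurable borel" using c by auto
  show "isCont (\<lambda>r. LINT z|lborel. c z * ee (- (z * r))) x"
    unfolding continuous_at_sequentially comp_def
  proof (intro allI impI)
    fix X :: "nat \<Rightarrow> real" assume X: "X \<longlonglongrightarrow> x"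
    show "(\<lambda>n. LINT z|lborel. c z * ee (- (z * X n))) \<longlonglongrightarrow> (LINT z|lborel. c z * ee (- (z * x)))"
    proof (rule integral_dominated_convergence[where w="\<lambda>z. norm (c z)"])
      show "AE z in lborel. (\<lambda>n. c z * ee (- (z * X n))) \<longlonglongrightarrow> c z * ee (- (z * x))"
        unfolding ee_def cis_conv_exp by (intro AE_I2 tendsto_intros X)
    qed (use c in \<open>auto simp: norm_mult\<close>)
  qed
qed

text \<open>The Gaussian weight makes all integrals absolutely convergent, so that Fubini turns the
  left side into the double integral of \<open>c z * k (y - z) * cnj (c y)\<close> with
  \<open>k\<close> an even probability density. Then \<open>2 |u v| \<le> |u|^2 + |v|^2\<close>
  gives the bound with constant 1, uniformly in the width of the weight.\<close>

lemma bessel_fourier_weighted: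
  assumes c: "integrable lborel c" and c2: "integrable lborel (\<lambda>x. (cmod (c x))\<^sup>2)" and e: "\<epsilon> > 0"
  shows "(\<integral>\<^sup>+r. ennreal ((cmod (LINT z|lborel. c z * ee (- (z * r))))\<^sup>2 * exp (- (\<epsilon> * r)\<^sup>2 / 2)) \<partial>lborel)
     \<le> ennreal (LINT x|lborel. (cmod (c x))\<^sup>2)"
proof -
  define h where "h r = (LINT z|lborel. c z * ee (- (z * r)))" for r
  define w where "w r = exp (- (\<epsilon> * r)\<^sup>2 / 2)" for r :: real
  define k where "k z = normal_density 0 (\<epsilon> / (2 * pi)) z" for z
  have [measurable]: "c \<in> borel_measurable borel" using c by auto
  have [measurable]: "h \<in> borel_measurable borel" unfolding h_def
    by (intro borel_measurable_continuous_onI continuous_fourier c)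
  have [measurable]: "w \<in> borel_measurable borel" unfolding w_def by measurable
  have [measurable]: "k \<in> borel_measurable borel" unfolding k_def by measurable
  have wint: "integrable lborel w" unfolding w_def by (rule integrable_gauss[OF e])
  have w0: "w r \<ge> 0" for r by (simp add: w_def)
  have k0: "k z \<ge> 0" for z by (simp add: k_def)
  have k_int: "integrable lborel k" unfolding k_def using e by (intro integrable_normal_density) auto
  have k_1: "(LINT z|lborel. k z) = 1" unfolding k_def using e by (intro integral_normal_density) auto
  have kb: "k z \<le> k 0" for z by (simp add: k_def normal_density_def divide_right_mono)
  define M where "M = (LINT x|lborel. cmod (c x))"
  have hb: "cmod (h r) \<le> M" for r unfolding h_def M_def by (rule fourier_bounded[OF c])
  have M0: "M \<ge> 0" by (simp add: M_def)
  have hw: "integrable lborel (\<lambda>r. (cmod (h r))\<^sup>2 * w r)"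
  proof (rule Bochner_Integration.integrable_bound[of _ "\<lambda>r. M\<^sup>2 * w r"])
    show "AE r in lborel. norm ((cmod (h r))\<^sup>2 * w r) \<le> norm (M\<^sup>2 * w r)"
      using hb M0 w0 by (auto intro!: AE_I2 mult_right_mono power_mono simp: abs_mult)
  qed (use wint in auto)
  have wc: "integrable lborel (\<lambda>r. complex_of_real (w r))" using wint by auto
  have lborel_sigma_finite: "sigma_finite_measure (lborel :: real measure)" by unfold_locales
  have 1: "complex_of_real (LINT r|lborel. (cmod (h r))\<^sup>2 * w r) = (LINT r|lborel. h r * (of_real (w r) * cnj (h r)))"
    by (subst integral_complex_of_real[symmetric])
       (auto simp: complex_norm_square mult_ac intro!: Bochner_Integration.integral_cong simp del: of_real_power)
  have 2: "\<dots> = (LINT r|lborel. LINT z|lborel. c z * (ee (- (z * r)) * (of_real (w r) * cnj (h r))))"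
  proof -
    have "h r * Y = (LINT z|lborel. c z * (ee (- (z * r)) * Y))" for r Y
      unfolding h_def by (simp flip: integral_mult_left_zero add: mult_ac)
    then show ?thesis by simp
  qed
  have 3: "\<dots> = (LINT z|lborel. LINT r|lborel. c z * (ee (- (z * r)) * (of_real (w r) * cnj (h r))))"
  proof (rule lborel_pair.Fubini_integral)
    have "integrable (lborel \<Otimes>\<^sub>M lborel) (\<lambda>p. c (fst p) * complex_of_real (w (snd p)) * (ee (- (fst p * snd p)) * cnj (h (snd p))))"
      using hb by (intro integrable_prod_bounded[where C=M] lborel_sigma_finite c wc) (measurable, auto simp: norm_mult)
    then show "integrable (lborel \<Otimes>\<^sub>M lborel) (\<lambda>(x, y). c x * (ee (- (x * y)) * (of_real (w y) * cnj (h y))))"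
      by (simp add: case_prod_beta' mult_ac)
  qed
  \<comment> \<open>The two characters combine to \<open>ee (r * (y - z))\<close>, so
    \<open>fourier_gaussian\<close> evaluates the r-integral.\<close>
  have 4: "(LINT r|lborel. ee (- (z * r)) * (of_real (w r) * cnj (h r))) = (LINT y|lborel. cnj (c y) * of_real (k (y - z)))" for z
  proof -
    have "(LINT r|lborel. ee (- (z * r)) * (of_real (w r) * cnj (h r)))
       = (LINT r|lborel. LINT y|lborel. cnj (c y) * (of_real (w r) * ee (r * (y - z))))"
      unfolding h_def by (simp flip: integral_mult_right_zero Bochner_Integration.integral_cnj add: mult_ac ee_diff ee_minus right_diff_distrib)
    also have "\<dots> = (LINT y|lborel. LINT r|lborel. cnj (c y) * (of_real (w r) * ee (r * (y - z))))"
    proof (rule lborel_pair.Fubini_integral)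
      have "integrable (lborel \<Otimes>\<^sub>M lborel) (\<lambda>p. complex_of_real (w (fst p)) * cnj (c (snd p)) * (ee (fst p * (snd p - z))))"
        by (intro integrable_prod_bounded[where C=1] lborel_sigma_finite wc) (use c in auto)
      then have "integrable (lborel \<Otimes>\<^sub>M lborel) (\<lambda>(y, x). cnj (c x) * (of_real (w y) * ee (y * (x - z))))"
        by (simp add: case_prod_beta' mult_ac)
      from lborel_pair.integrable_product_swap[OF this]
      show "integrable (lborel \<Otimes>\<^sub>M lborel) (\<lambda>(x, y). cnj (c x) * (of_real (w y) * ee (y * (x - z))))"
        by simp
    qed
    also have "\<dots> = (LINT y|lborel. cnj (c y) * of_real (k (y - z)))"
      unfolding w_def k_def by (simp only: integral_mult_right_zero fourier_gaussian[OF e])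
    finally show ?thesis .
  qed
  have kk: "integrable (lborel \<Otimes>\<^sub>M lborel) (\<lambda>p. c (fst p) * of_real (k (snd p - fst p)) * cnj (c (snd p)))"
   and k2: "integrable (lborel \<Otimes>\<^sub>M lborel) (\<lambda>p. (cmod (c (fst p)))\<^sup>2 * k (snd p - fst p))"
  proof -
    have "integrable (lborel \<Otimes>\<^sub>M lborel) (\<lambda>p. complex_of_real ((cmod (c (fst p)))\<^sup>2) * of_real (k (snd p - fst p)) * 1)"
      using c2 k_int by (intro integrable_conv_bounded[where C=1]) (auto simp del: of_real_power)
    from integrable_norm[OF this] show *: "integrable (lborel \<Otimes>\<^sub>M lborel) (\<lambda>p. (cmod (c (fst p)))\<^sup>2 * k (snd p - fst p))"
      using k0 by (simp add: norm_mult norm_power)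
    have "integrable (lborel \<Otimes>\<^sub>M lborel) (\<lambda>p. c (fst p) * cnj (c (snd p)) * of_real (k (snd p - fst p)))"
      using c kb k0 by (intro integrable_prod_bounded[where C="k 0"] lborel_sigma_finite) auto
    then show "integrable (lborel \<Otimes>\<^sub>M lborel) (\<lambda>p. c (fst p) * of_real (k (snd p - fst p)) * cnj (c (snd p)))"
      by (simp add: mult_ac)
  qed
  have k2': "integrable (lborel \<Otimes>\<^sub>M lborel) (\<lambda>p. (cmod (c (snd p)))\<^sup>2 * k (snd p - fst p))"
  proof -
    have ev: "k (fst p - snd p) = k (snd p - fst p)" for p
      unfolding k_def using normal_density_even[of _ "snd p - fst p"] by simp
    show ?thesis using lborel_pair.integrable_product_swap[OF k2] by (simp add: case_prod_beta' ev)
  qed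
  have i1: "(LINT p|(lborel \<Otimes>\<^sub>M lborel). (cmod (c (fst p)))\<^sup>2 * k (snd p - fst p)) = (LINT x|lborel. (cmod (c x))\<^sup>2)"
    using lborel_pair.integral_fst[of "\<lambda>x y. (cmod (c x))\<^sup>2 * k (y - x)"] k2 k_1
    by (simp add: case_prod_beta' LINT_shift)
  have i2: "(LINT p|(lborel \<Otimes>\<^sub>M lborel). (cmod (c (snd p)))\<^sup>2 * k (snd p - fst p)) = (LINT x|lborel. (cmod (c x))\<^sup>2)"
    using lborel_pair.integral_snd[of "\<lambda>x y. (cmod (c y))\<^sup>2 * k (y - x)"] k2' k_1
    by (simp add: case_prod_beta' LINT_shift)
  have "complex_of_real (LINT r|lborel. (cmod (h r))\<^sup>2 * w r) = (LINT z|lborel. LINT y|lborel. c z * of_real (k (y - z)) * cnj (c y))"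
    unfolding 1 2 3 by (simp add: 4) (simp flip: integral_mult_right_zero add: mult_ac)
  also have "\<dots> = (LINT p|(lborel \<Otimes>\<^sub>M lborel). c (fst p) * of_real (k (snd p - fst p)) * cnj (c (snd p)))"
    using lborel_pair.integral_fst[of "\<lambda>x y. c x * of_real (k (y - x)) * cnj (c y)"] kk by (simp add: case_prod_beta')
  finally have 5: "complex_of_real (LINT r|lborel. (cmod (h r))\<^sup>2 * w r) = \<dots>" .
  have "(LINT r|lborel. (cmod (h r))\<^sup>2 * w r) \<le> cmod (complex_of_real (LINT r|lborel. (cmod (h r))\<^sup>2 * w r))"
    by simp
  also have "\<dots> \<le> (LINT p|(lborel \<Otimes>\<^sub>M lborel). cmod (c (fst p) * of_real (k (snd p - fst p)) * cnj (c (snd p))))"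
    unfolding 5 by (rule integral_norm_bound)
  also have "\<dots> \<le> (LINT p|(lborel \<Otimes>\<^sub>M lborel). ((cmod (c (fst p)))\<^sup>2 * k (snd p - fst p) + (cmod (c (snd p)))\<^sup>2 * k (snd p - fst p)) / 2)"
  proof (rule integral_mono)
    show "integrable (lborel \<Otimes>\<^sub>M lborel) (\<lambda>p. cmod (c (fst p) * of_real (k (snd p - fst p)) * cnj (c (snd p))))"
      using kk by (rule integrable_norm)
    show "integrable (lborel \<Otimes>\<^sub>M lborel) (\<lambda>p. ((cmod (c (fst p)))\<^sup>2 * k (snd p - fst p) + (cmod (c (snd p)))\<^sup>2 * k (snd p - fst p)) / 2)"
      using k2 k2' by auto
    fix p
    have "2 * (cmod (c (fst p)) * cmod (c (snd p))) \<le> (cmod (c (fst p)))\<^sup>2 + (cmod (c (snd p)))\<^sup>2"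
      using sum_squares_bound[of "cmod (c (fst p))" "cmod (c (snd p))"] by (simp add: mult.assoc)
    from mult_right_mono[OF this k0[of "snd p - fst p"]]
    show "cmod (c (fst p) * of_real (k (snd p - fst p)) * cnj (c (snd p))) \<le> ((cmod (c (fst p)))\<^sup>2 * k (snd p - fst p) + (cmod (c (snd p)))\<^sup>2 * k (snd p - fst p)) / 2"
      using k0 by (simp add: norm_mult algebra_simps)
  qed
  also have "\<dots> = (LINT x|lborel. (cmod (c x))\<^sup>2)"
    using k2 k2' i1 i2 by simp
  finally have "(LINT r|lborel. (cmod (h r))\<^sup>2 * w r) \<le> (LINT x|lborel. (cmod (c x))\<^sup>2)" .
  then show ?thesis using hw w0 unfolding h_def[symmetric] w_def[symmetric]
    by (subst nn_integral_eq_integral) (auto intro!: ennreal_leI)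
qed

text \<open>The weights increase to 1 along the widths \<open>1 / (n + 1)\<close>; Fatou's lemma
  passes to the limit in the uniform bound.\<close>

lemma bessel_fourier:
  assumes c: "integrable lborel c" and c2: "integrable lborel (\<lambda>x. (cmod (c x))\<^sup>2)"
  shows "integrable lborel (\<lambda>r. (cmod (LINT z|lborel. c z * ee (- (z * r))))\<^sup>2)"
    and "(LINT r|lborel. (cmod (LINT z|lborel. c z * ee (- (z * r))))\<^sup>2) \<le> (LINT x|lborel. (cmod (c x))\<^sup>2)"
proof -
  define h where "h r = (LINT z|lborel. c z * ee (- (z * r)))" for r
  have [measurable]: "h \<in> borel_measurable borel" unfolding h_def
    by (intro borel_measurable_continuous_onI continuous_fourier c)
  define e where "e n = 1 / real (Suc n)" for n
  have e0: "e n > 0" for n by (simp add: e_def)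
  have el: "e \<longlonglongrightarrow> 0" unfolding e_def by (rule LIMSEQ_Suc[OF lim_1_over_n])
  have "(\<integral>\<^sup>+r. ennreal ((cmod (h r))\<^sup>2) \<partial>lborel) = (\<integral>\<^sup>+r. liminf (\<lambda>n. ennreal ((cmod (h r))\<^sup>2 * exp (- (e n * r)\<^sup>2 / 2))) \<partial>lborel)"
  proof (rule nn_integral_cong)
    fix r
    have lim: "(\<lambda>n. ennreal ((cmod (h r))\<^sup>2 * exp (- (e n * r)\<^sup>2 / 2))) \<longlonglongrightarrow> ennreal ((cmod (h r))\<^sup>2 * exp (- (0 * r)\<^sup>2 / 2))"
      by (intro tendsto_intros el) auto
    then show "ennreal ((cmod (h r))\<^sup>2) = liminf (\<lambda>n. ennreal ((cmod (h r))\<^sup>2 * exp (- (e n * r)\<^sup>2 / 2)))"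
      using lim_imp_Liminf[OF _ lim] by simp
  qed
  also have "\<dots> \<le> liminf (\<lambda>n. \<integral>\<^sup>+r. ennreal ((cmod (h r))\<^sup>2 * exp (- (e n * r)\<^sup>2 / 2)) \<partial>lborel)"
    by (rule nn_integral_liminf) auto
  also have "\<dots> \<le> liminf (\<lambda>n. ennreal (LINT x|lborel. (cmod (c x))\<^sup>2))"
    using bessel_fourier_weighted[OF c c2 e0] unfolding h_def by (intro Liminf_mono) auto
  also have "\<dots> = ennreal (LINT x|lborel. (cmod (c x))\<^sup>2)" by (simp add: Liminf_const)
  finally have *: "(\<integral>\<^sup>+r. ennreal ((cmod (h r))\<^sup>2) \<partial>lborel) \<le> ennreal (LINT x|lborel. (cmod (c x))\<^sup>2)" .
  show "integrable lborel (\<lambda>r. (cmod (LINT z|lborel. c z * ee (- (z * r))))\<^sup>2)"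
    unfolding h_def[symmetric] using * by (intro integrableI_bounded) (auto simp: le_less_trans[OF _ ennreal_less_top])
  from nn_integral_eq_integral[OF this] * 
  show "(LINT r|lborel. (cmod (LINT z|lborel. c z * ee (- (z * r))))\<^sup>2) \<le> (LINT x|lborel. (cmod (c x))\<^sup>2)"
    unfolding h_def[symmetric] by simp
qed

text \<open>Gaussian summation. Damping the inversion integral turns it into an average of
  \<open>f\<close> around \<open>x\<close> against a narrowing normal density. Both sides converge
  by dominated convergence: the frequency side because \<open>fourier f\<close> is integrable, the
  space side because \<open>f\<close> is bounded and continuous.\<close>

lemma fourier_inversion:
  assumes f: "integrable lborel f" and fc: "continuous_on UNIV f" and fb: "\<And>x. cmod (f x) \<le> B"
    and F: "integrable lborel (fourier f)"
  shows "(LINT \<xi>|lborel. fourier f \<xi> * ee (\<xi> * x)) = f x"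
proof -
  define e where "e n = 1 / real (Suc n)" for n
  have e0: "e n > 0" for n by (simp add: e_def)
  have el: "e \<longlonglongrightarrow> 0" unfolding e_def by (rule LIMSEQ_Suc[OF lim_1_over_n])
  have [measurable]: "f \<in> borel_measurable borel" "fourier f \<in> borel_measurable borel" using f F by auto
  have lborel_sigma_finite: "sigma_finite_measure (lborel :: real measure)" by unfold_locales
  define I where "I n = (LINT \<xi>|lborel. fourier f \<xi> * ee (\<xi> * x) * of_real (exp (- (e n * \<xi>)\<^sup>2 / 2)))" for n
  have "I \<longlonglongrightarrow> (LINT \<xi>|lborel. fourier f \<xi> * ee (\<xi> * x))" unfolding I_def
  proof (rule integral_dominated_convergence[where w="\<lambda>\<xi>. norm (fourier f \<xi>)"])
    show "AE \<xi> in lborel. (\<lambda>n. fourier f \<xi> * ee (\<xi> * x) * of_real (exp (- (e n * \<xi>)\<^sup>2 / 2))) \<longlonglongrightarrow> fourier f \<xi> * ee (\<xi> * x)"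
    proof (rule AE_I2)
      fix \<xi>
      have "(\<lambda>n. fourier f \<xi> * ee (\<xi> * x) * of_real (exp (- (e n * \<xi>)\<^sup>2 / 2))) \<longlonglongrightarrow> fourier f \<xi> * ee (\<xi> * x) * of_real (exp (- (0 * \<xi>)\<^sup>2 / 2))"
        by (intro tendsto_intros el) auto
      then show "(\<lambda>n. fourier f \<xi> * ee (\<xi> * x) * of_real (exp (- (e n * \<xi>)\<^sup>2 / 2))) \<longlonglongrightarrow> fourier f \<xi> * ee (\<xi> * x)" by simp
    qed
    show "AE \<xi> in lborel. norm (fourier f \<xi> * ee (\<xi> * x) * of_real (exp (- (e n * \<xi>)\<^sup>2 / 2))) \<le> norm (fourier f \<xi>)" for n
      by (auto simp: norm_mult intro!: AE_I2 mult_left_le)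
  qed (use F in auto)
  moreover have "I \<longlonglongrightarrow> f x"
  proof -
    define k where "k z = normal_density 0 (1 / (2 * pi)) z" for z
    have [measurable]: "k \<in> borel_measurable borel" unfolding k_def by measurable
    have k0: "k z \<ge> 0" for z by (simp add: k_def)
    have k_int: "integrable lborel k" unfolding k_def by (intro integrable_normal_density) auto
    have k_1: "(LINT z|lborel. k z) = 1" unfolding k_def by (intro integral_normal_density) auto
    have In: "I n = (LINT z|lborel. f (x + e n * z) * of_real (k z))" for n
    proof -
      have wc: "integrable lborel (\<lambda>r. complex_of_real (exp (- (e n * r)\<^sup>2 / 2)))" using integrable_gauss[OF e0[of n]] by auto
      have "I n = (LINT \<xi>|lborel. LINT y|lborel. f y * (of_real (exp (- (e n * \<xi>)\<^sup>2 / 2)) * ee (\<xi> * (x - y))))"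
      proof -
        have "fourier f \<xi> * ee (\<xi> * x) * Y = (LINT y|lborel. f y * (Y * ee (\<xi> * (x - y))))" for \<xi> Y
        proof -
          have "fourier f \<xi> * ee (\<xi> * x) * Y = (LINT y|lborel. f y * ee (- (y * \<xi>)) * (ee (\<xi> * x) * Y))"
            unfolding fourier_ee by simp
          then show ?thesis by (simp add: mult_ac ee_diff ee_minus right_diff_distrib)
        qed
        then show ?thesis unfolding I_def by simp
      qed
      also have "\<dots> = (LINT y|lborel. LINT \<xi>|lborel. f y * (of_real (exp (- (e n * \<xi>)\<^sup>2 / 2)) * ee (\<xi> * (x - y))))"
      proof (rule lborel_pair.Fubini_integral)
        have "integrable (lborel \<Otimes>\<^sub>M lborel) (\<lambda>p. f (fst p) * complex_of_real (exp (- (e n * snd p)\<^sup>2 / 2)) * (ee (snd p * (x - fst p))))"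
          by (intro integrable_prod_bounded[where C=1] lborel_sigma_finite f wc) auto
        then show "integrable (lborel \<Otimes>\<^sub>M lborel) (\<lambda>(y, \<xi>). f y * (of_real (exp (- (e n * \<xi>)\<^sup>2 / 2)) * ee (\<xi> * (x - y))))"
          by (simp add: case_prod_beta' mult_ac)
      qed
      also have "\<dots> = (LINT y|lborel. f y * of_real (normal_density 0 (e n / (2 * pi)) (x - y)))"
        by (simp only: integral_mult_right_zero fourier_gaussian[OF e0])
      \<comment> \<open>The substitution \<open>y = x + e n * z\<close> replaces the narrowing
        density by the fixed \<open>k\<close>, so that the limit acts on \<open>f\<close>
        alone.\<close>
      also have "\<dots> = \<bar>e n\<bar> *\<^sub>R (LINT z|lborel. f (x + e n * z) * of_real (normal_density 0 (e n / (2 * pi)) (x - (x + e n * z))))"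
        using e0[of n] by (intro lborel_integral_real_affine) auto
      also have "\<dots> = (LINT z|lborel. f (x + e n * z) * of_real (k z))"
      proof -
        have "normal_density 0 (e n / (2 * pi)) (x - (x + e n * z)) = k z / e n" for z
          unfolding k_def normal_density_def using e0[of n]
          by (simp add: field_simps real_sqrt_mult real_sqrt_divide power_mult_distrib)
        then have "\<bar>e n\<bar> *\<^sub>R (LINT z|lborel. f (x + e n * z) * of_real (normal_density 0 (e n / (2 * pi)) (x - (x + e n * z))))
          = (LINT z|lborel. \<bar>e n\<bar> *\<^sub>R (f (x + e n * z) * of_real (k z / e n)))" by (simp only: integral_scaleR_right)
        also have "\<dots> = (LINT z|lborel. f (x + e n * z) * of_real (k z))"
          using e0[of n] by (intro Bochner_Integration.integral_cong) (auto simp: scaleR_conv_of_real)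
        finally show ?thesis .
      qed
      finally show ?thesis .
    qed
    have "I \<longlonglongrightarrow> (LINT z|lborel. f x * of_real (k z))" unfolding In
    proof (rule integral_dominated_convergence[where w="\<lambda>z. B * k z"])
      show "AE z in lborel. (\<lambda>n. f (x + e n * z) * of_real (k z)) \<longlonglongrightarrow> f x * of_real (k z)"
      proof (rule AE_I2)
        fix z
        have "(\<lambda>n. x + e n * z) \<longlonglongrightarrow> x + 0 * z" by (intro tendsto_intros el)
        then have "(\<lambda>n. f (x + e n * z)) \<longlonglongrightarrow> f x"
          using fc by (intro isCont_tendsto_compose[of x f]) (auto simp: continuous_on_eq_continuous_at)
        then show "(\<lambda>n. f (x + e n * z) * of_real (k z)) \<longlonglongrightarrow> f x * of_real (k z)" by (intro tendsto_intros)
      qed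
      show "AE z in lborel. norm (f (x + e n * z) * of_real (k z)) \<le> B * k z" for n
        using fb k0 by (auto simp: norm_mult intro!: AE_I2 mult_right_mono)
    qed (use k_int in auto)
    then show ?thesis using k_1 by simp
  qed
  ultimately show ?thesis by (rule LIMSEQ_unique)
qed

text \<open>Inversion is inserted for the factor \<open>f\<close> only; integrability of
  \<open>fourier f\<close> and of \<open>g\<close> then justifies exchanging the integrals.\<close>

lemma fourier_mult:
  assumes f: "integrable lborel f" and fc: "continuous_on UNIV f" and fb: "\<And>x. cmod (f x) \<le> B"
    and F: "integrable lborel (fourier f)" and g: "integrable lborel g"
  shows "fourier (\<lambda>x. f x * g x) \<xi> = (LINT \<eta>|lborel. fourier f \<eta> * fourier g (\<xi> - \<eta>))"
proof -
  have lborel_sigma_finite: "sigma_finite_measure (lborel :: real measure)" by unfold_locales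
  have [measurable]: "f \<in> borel_measurable borel" "fourier f \<in> borel_measurable borel" "g \<in> borel_measurable borel" using f F g by auto
  have "fourier (\<lambda>x. f x * g x) \<xi> = (LINT x|lborel. LINT \<eta>|lborel. fourier f \<eta> * (g x * ee (- (x * (\<xi> - \<eta>)))))"
  proof -
    have "f x * g x * ee (- (x * \<xi>)) = (LINT \<eta>|lborel. fourier f \<eta> * (g x * ee (- (x * (\<xi> - \<eta>)))))" for x
    proof -
      have "f x * g x * ee (- (x * \<xi>)) = (LINT \<eta>|lborel. fourier f \<eta> * ee (\<eta> * x)) * (g x * ee (- (x * \<xi>)))"
        unfolding fourier_inversion[OF f fc fb F] by simp
      also have "\<dots> = (LINT \<eta>|lborel. fourier f \<eta> * ee (\<eta> * x) * (g x * ee (- (x * \<xi>))))" by simp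
      also have "\<dots> = (LINT \<eta>|lborel. fourier f \<eta> * (g x * ee (- (x * (\<xi> - \<eta>)))))"
        by (simp add: mult_ac ee_diff ee_minus right_diff_distrib)
      finally show ?thesis .
    qed
    then show ?thesis unfolding fourier_ee[of "\<lambda>x. f x * g x"] by simp
  qed
  also have "\<dots> = (LINT \<eta>|lborel. LINT x|lborel. fourier f \<eta> * (g x * ee (- (x * (\<xi> - \<eta>)))))"
  proof (rule lborel_pair.Fubini_integral)
    have "integrable (lborel \<Otimes>\<^sub>M lborel) (\<lambda>p. fourier f (fst p) * g (snd p) * ee (- (snd p * (\<xi> - fst p))))"
      by (intro integrable_prod_bounded[where C=1] lborel_sigma_finite F g) auto
    then show "integrable (lborel \<Otimes>\<^sub>M lborel) (\<lambda>(\<eta>, x). fourier f \<eta> * (g x * ee (- (x * (\<xi> - \<eta>)))))"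
      by (simp add: case_prod_beta' mult_ac)
  qed
  also have "\<dots> = (LINT \<eta>|lborel. fourier f \<eta> * fourier g (\<xi> - \<eta>))"
    by (simp add: fourier_ee)
  finally show ?thesis .
qed

subsection \<open>Oscillatory integrals in one variable\<close>

lemma has_vector_derivative_cis:
  assumes "(\<Phi> has_real_derivative \<Phi>1) (at x within S)"
  shows "((\<lambda>x. cis (\<Phi> x)) has_vector_derivative (of_real \<Phi>1 * (\<i> * cis (\<Phi> x)))) (at x within S)"
proof -
  have "((\<lambda>x. \<i> * of_real (\<Phi> x)) has_vector_derivative (\<i> * of_real \<Phi>1)) (at x within S)"
    using assms by (intro has_vector_derivative_mult_right has_vector_derivative_of_real)
  then have "((exp \<circ> (\<lambda>x. \<i> * of_real (\<Phi> x))) has_vector_derivative (\<i> * of_real \<Phi>1 * exp (\<i> * of_real (\<Phi> x)))) (at x within S)"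
    by (rule field_vector_diff_chain_within) (rule DERIV_exp[THEN has_field_derivative_at_within])
  then show ?thesis by (simp add: cis_conv_exp mult_ac comp_def)
qed

text \<open>One integration by parts: \<open>b e^(i \<Phi>)\<close> is the derivative of
  \<open>(b / \<Phi>1) e^(i \<Phi>) / i\<close> up to a term with the derivative of
  \<open>b / \<Phi>1\<close>. The boundary values give \<open>2 * B0 / \<kappa>\<close>, the
  remaining term the rest. Derivatives are assumed only in the open interval, because the inverse
  functions to which this is applied later are controlled only there.\<close>

lemma nonstationary_phase:
  fixes \<Phi> \<Phi>1 \<Phi>2 b b1 :: "real \<Rightarrow> real"
  assumes cd: "c \<le> d"
    and cont: "continuous_on {c..d} \<Phi>" "continuous_on {c..d} \<Phi>1" "continuous_on {c..d} b"
    and d1: "\<And>x. c < x \<Longrightarrow> x < d \<Longrightarrow> (\<Phi> has_real_derivative \<Phi>1 x) (at x)"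
    and d2: "\<And>x. c < x \<Longrightarrow> x < d \<Longrightarrow> (\<Phi>1 has_real_derivative \<Phi>2 x) (at x)"
    and db: "\<And>x. c < x \<Longrightarrow> x < d \<Longrightarrow> (b has_real_derivative b1 x) (at x)"
    and k: "\<kappa> > 0" "\<And>x. c \<le> x \<Longrightarrow> x \<le> d \<Longrightarrow> \<bar>\<Phi>1 x\<bar> \<ge> \<kappa>"
    and M: "\<And>x. c < x \<Longrightarrow> x < d \<Longrightarrow> \<bar>\<Phi>2 x\<bar> \<le> M"
    and B0: "\<And>x. c \<le> x \<Longrightarrow> x \<le> d \<Longrightarrow> \<bar>b x\<bar> \<le> B0"
    and B1: "\<And>x. c < x \<Longrightarrow> x < d \<Longrightarrow> \<bar>b1 x\<bar> \<le> B1"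
    and M0: "M \<ge> 0" and B10: "B1 \<ge> 0"
  shows "cmod (integral {c..d} (\<lambda>x. of_real (b x) * cis (\<Phi> x))) \<le> 2 * B0 / \<kappa> + (d - c) * (B1 / \<kappa> + B0 * M / \<kappa>\<^sup>2)"
proof -
  have B00: "B0 \<ge> 0" by (rule order_trans[OF abs_ge_zero B0[of c]]) (use cd in auto)
  have nz: "\<Phi>1 x \<noteq> 0" if "c \<le> x" "x \<le> d" for x using k(2)[OF that] k(1) by auto
  define q where "q x = b x / \<Phi>1 x" for x
  define q1 where "q1 x = (b1 x * \<Phi>1 x - b x * \<Phi>2 x) / (\<Phi>1 x * \<Phi>1 x)" for x
  define u where "u x = of_real (q x) * (cis (\<Phi> x) / \<i>)" for x
  define r where "r x = of_real (q1 x) * (cis (\<Phi> x) / \<i>)" for x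
  have qc: "continuous_on {c..d} q" unfolding q_def by (intro continuous_intros cont) (use nz in auto)
  have uc: "continuous_on {c..d} u" unfolding u_def cis_conv_exp by (intro continuous_intros cont qc) auto
  have ud: "(u has_vector_derivative (of_real (b x) * cis (\<Phi> x) + r x)) (at x)" if x: "c < x" "x < d" for x
  proof -
    have qd: "(q has_real_derivative q1 x) (at x)" unfolding q_def q1_def
      by (intro DERIV_divide db d1 d2 x nz) (use x in auto)
    have "((\<lambda>x. complex_of_real (q x)) has_vector_derivative of_real (q1 x)) (at x)"
      using qd by (rule has_vector_derivative_of_real)
    moreover have "((\<lambda>x. cis (\<Phi> x) / \<i>) has_vector_derivative (of_real (\<Phi>1 x) * (\<i> * cis (\<Phi> x)) / \<i>)) (at x)"
      by (intro has_vector_derivative_divide has_vector_derivative_cis d1 x)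
    ultimately have "(u has_vector_derivative (of_real (q x) * (of_real (\<Phi>1 x) * (\<i> * cis (\<Phi> x)) / \<i>) + of_real (q1 x) * (cis (\<Phi> x) / \<i>))) (at x)"
      unfolding u_def by (rule has_vector_derivative_mult)
    moreover have "of_real (q x) * (of_real (\<Phi>1 x) * (\<i> * cis (\<Phi> x)) / \<i>) = of_real (b x) * cis (\<Phi> x)"
    proof -
      have "q x * \<Phi>1 x = b x" using nz[of x] x by (simp add: q_def)
      then have "complex_of_real (q x) * of_real (\<Phi>1 x) = of_real (b x)" by (metis of_real_mult)
      then show ?thesis by (metis (no_types, lifting) mult.assoc mult.left_commute nonzero_mult_div_cancel_left complex_i_not_zero times_divide_eq_right)
    qed
    ultimately show ?thesis by (simp add: r_def)
  qed
  define f where "f x = of_real (b x) * cis (\<Phi> x)" for x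
  have i1: "((\<lambda>x. f x + r x) has_integral (u d - u c)) {c..d}"
    using fundamental_theorem_of_calculus_interior[OF cd uc] ud unfolding f_def by auto
  have fc: "continuous_on {c..d} f" unfolding f_def cis_conv_exp by (intro continuous_intros cont)
  have i2: "(f has_integral integral {c..d} f) {c..d}"
    using fc by (simp add: integrable_continuous_real integrable_integral)
  have i3: "(r has_integral (u d - u c - integral {c..d} f)) {c..d}"
    using has_integral_diff[OF i1 i2] by simp
  have ub: "cmod (u x) \<le> B0 / \<kappa>" if "c \<le> x" "x \<le> d" for x
  proof -
    have "\<bar>b x\<bar> / \<bar>\<Phi>1 x\<bar> \<le> B0 / \<kappa>" using that k B0 B00 by (intro frac_le) auto
    then show ?thesis by (simp add: u_def q_def norm_mult norm_divide)
  qed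
  define C where "C = B1 / \<kappa> + B0 * M / \<kappa>\<^sup>2"
  have C0: "C \<ge> 0" using B00 M0 B10 k by (simp add: C_def)
  have rb: "cmod (r x) \<le> C" if x: "c < x" "x < d" for x
  proof -
    have "q1 x = b1 x / \<Phi>1 x - b x * \<Phi>2 x / (\<Phi>1 x)\<^sup>2" using nz[of x] x
      by (simp add: q1_def field_simps power2_eq_square)
    then have "\<bar>q1 x\<bar> \<le> \<bar>b1 x\<bar> / \<bar>\<Phi>1 x\<bar> + (\<bar>b x\<bar> * \<bar>\<Phi>2 x\<bar>) / \<bar>\<Phi>1 x\<bar>\<^sup>2"
      by (metis abs_divide abs_mult abs_power2 abs_triangle_ineq4 power2_abs)
    also have "\<dots> \<le> C" unfolding C_def using x k B0 B1 M B00 M0 B10 k(2)[of x]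
      by (intro add_mono frac_le mult_mono power_mono) (auto intro: less_imp_le)
    finally show ?thesis by (simp add: r_def norm_mult norm_divide)
  qed
  have "cmod (u d - u c - integral {c..d} f) \<le> C * (d - c)"
  proof -
    \<comment> \<open>The remainder is bounded only at interior points, so it is set to 0 at the two
      endpoints, a null set.\<close>
    define r' where "r' x = (if x \<in> {c<..<d} then r x else 0)" for x
    have "(r' has_integral (u d - u c - integral {c..d} f)) {c..d}"
      by (rule has_integral_spike[OF _ _ i3, of "{c,d}"]) (auto simp: r'_def)
    then have "cmod (u d - u c - integral {c..d} f) \<le> C * measure lborel (cbox c d)"
      using rb C0 by (intro has_integral_bound[of C r']) (auto simp: r'_def)
    then show ?thesis using cd by simp
  qed
  moreover have "cmod (u d) \<le> B0 / \<kappa>" "cmod (u c) \<le> B0 / \<kappa>" using ub cd by auto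
  moreover have "cmod (integral {c..d} f) \<le> cmod (u d) + cmod (u c) + cmod (u d - u c - integral {c..d} f)"
  proof -
    have "cmod (integral {c..d} f) \<le> cmod (u d - u c) + cmod (u d - u c - integral {c..d} f)"
      using norm_triangle_ineq4[of "u d - u c" "u d - u c - integral {c..d} f"] by simp
    then show ?thesis using norm_triangle_ineq4[of "u d" "u c"] by linarith
  qed
  ultimately have "cmod (integral {c..d} f) \<le> 2 * (B0 / \<kappa>) + C * (d - c)" by linarith
  then show ?thesis unfolding f_def C_def by (simp add: mult.commute)
qed


text \<open>A single constant \<open>K\<close> controls everything; in the application it is a power of \<open>2\<^sup>l\<close>. The last
  assumption makes \<open>W = P'' / (P' (P' - 1))\<close> quantitatively strictly monotone, which is the nondegeneracy
  of the pair of curves \<open>t\<close>, \<open>P t\<close> used below.\<close>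

locale curve =
  fixes P P1 P2 P3 chi chi1 chi2 :: "real \<Rightarrow> real" and a b K :: real
  assumes ab: "a < b" "b - a \<le> 1" and K2: "K \<ge> 2"
    and dP: "\<And>x. (P has_real_derivative P1 x) (at x)" "\<And>x. (P1 has_real_derivative P2 x) (at x)"
      "\<And>x. (P2 has_real_derivative P3 x) (at x)"
    and dchi: "\<And>x. (chi has_real_derivative chi1 x) (at x)" "\<And>x. (chi1 has_real_derivative chi2 x) (at x)"
    and chi_nonneg: "\<And>x. chi x \<ge> 0" and chi_supp: "\<And>x. x \<le> a \<or> b \<le> x \<Longrightarrow> chi x = 0"
    and chi_le: "\<And>x. chi x \<le> K" "\<And>x. \<bar>chi1 x\<bar> \<le> K" "\<And>x. \<bar>chi2 x\<bar> \<le> K"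
    and P_le: "\<And>x. a \<le> x \<Longrightarrow> x \<le> b \<Longrightarrow> \<bar>P1 x\<bar> \<le> K" "\<And>x. a \<le> x \<Longrightarrow> x \<le> b \<Longrightarrow> \<bar>P2 x\<bar> \<le> K"
      "\<And>x. a \<le> x \<Longrightarrow> x \<le> b \<Longrightarrow> \<bar>P3 x\<bar> \<le> K"
    and P_ge: "\<And>x. a \<le> x \<Longrightarrow> x \<le> b \<Longrightarrow> \<bar>P1 x\<bar> \<ge> 1 / K" "\<And>x. a \<le> x \<Longrightarrow> x \<le> b \<Longrightarrow> \<bar>P1 x - 1\<bar> \<ge> 1 / K"
      "\<And>x. a \<le> x \<Longrightarrow> x \<le> b \<Longrightarrow> \<bar>P2 x\<bar> \<ge> 1 / K"
    and W_ge: "\<And>x y. a \<le> x \<Longrightarrow> x \<le> b \<Longrightarrow> a \<le> y \<Longrightarrow> y \<le> b \<Longrightarrow>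
       \<bar>P2 x / (P1 x * (P1 x - 1)) - P2 y / (P1 y * (P1 y - 1))\<bar> \<ge> \<bar>x - y\<bar> / K"
begin

lemma contP: "continuous_on S P" "continuous_on S P1" "continuous_on S P2"
  by (rule DERIV_continuous_on[OF has_field_derivative_at_within[OF dP(1)]],
    rule DERIV_continuous_on[OF has_field_derivative_at_within[OF dP(2)]],
    rule DERIV_continuous_on[OF has_field_derivative_at_within[OF dP(3)]])

lemma contchi: "continuous_on S chi" "continuous_on S chi1"
  by (rule DERIV_continuous_on[OF has_field_derivative_at_within[OF dchi(1)]],
    rule DERIV_continuous_on[OF has_field_derivative_at_within[OF dchi(2)]])

lemma K_pos: "K > 0" using K2 by simp

lemma K_power: "m \<le> n \<Longrightarrow> K ^ m \<le> K ^ n" using K2 by (intro power_increasing) auto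

lemma measP [measurable]: "P \<in> borel_measurable borel" "P1 \<in> borel_measurable borel" "P2 \<in> borel_measurable borel"
    "chi \<in> borel_measurable borel"
  by (intro borel_measurable_continuous_onI contP contchi)+

lemma chi_abs: "\<bar>chi x\<bar> \<le> K" using chi_le chi_nonneg by simp

lemma P1_lipschitz_below:
  assumes "a \<le> x" "x \<le> b" "a \<le> y" "y \<le> b"
  shows "\<bar>P1 x - P1 y\<bar> \<ge> \<bar>x - y\<bar> / K"
proof -
  have *: "\<bar>P1 x - P1 y\<bar> \<ge> \<bar>x - y\<bar> / K" if "x < y" "a \<le> x" "y \<le> b" for x y
  proof -
    obtain z where z: "x < z" "z < y" "P1 y - P1 x = (y - x) * P2 z"
      using MVT2[OF \<open>x < y\<close>, of P1 P2] dP(2) by blast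
    have "\<bar>P1 x - P1 y\<bar> = \<bar>x - y\<bar> * \<bar>P2 z\<bar>" using z by (metis abs_minus_commute abs_mult)
    also have "\<dots> \<ge> \<bar>x - y\<bar> * (1 / K)" using P_ge(3)[of z] z that by (intro mult_left_mono) auto
    finally show ?thesis by simp
  qed
  show ?thesis using *[of x y] *[of y x] assms by (cases x y rule: linorder_cases) (auto simp: abs_minus_commute)
qed

text \<open>The phase derivative is at least \<open>\<delta>\<close> times the frequency at distance \<open>\<delta>\<close> from the point where its
  absolute value is smallest, whether or not a stationary point exists.\<close>

lemma oscillatory_stationary:
  assumes c: "a \<le> c" "c \<le> d" "d \<le> b" and \<zeta>: "\<zeta> \<noteq> 0" and \<delta>: "0 < \<delta>" "\<delta> \<le> 1"
  shows "cmod (integral {c..d} (\<lambda>t. of_real (chi t) * cis (2 * pi * (\<eta> * t + \<zeta> * P t)))) \<le> 2 * \<delta> * K + 4 * K ^ 4 / (\<bar>\<zeta>\<bar> * \<delta>\<^sup>2)"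
proof -
  define \<Phi>1 where "\<Phi>1 t = 2 * pi * (\<eta> + \<zeta> * P1 t)" for t
  define f where "f t = of_real (chi t) * cis (2 * pi * (\<eta> * t + \<zeta> * P t))" for t
  have fc: "continuous_on S f" for S unfolding f_def cis_conv_exp by (intro continuous_intros contP contchi)
  have fi: "f integrable_on {u..v}" for u v by (intro integrable_continuous_real fc)
  have cont1: "continuous_on S \<Phi>1" for S unfolding \<Phi>1_def by (intro continuous_intros contP)
  obtain t0 where t0: "c \<le> t0" "t0 \<le> d" "\<And>t. c \<le> t \<Longrightarrow> t \<le> d \<Longrightarrow> \<bar>\<Phi>1 t0\<bar> \<le> \<bar>\<Phi>1 t\<bar>"
  proof -
    have "\<exists>x\<in>{c..d}. \<forall>y\<in>{c..d}. \<bar>\<Phi>1 x\<bar> \<le> \<bar>\<Phi>1 y\<bar>"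
      using c by (intro continuous_attains_inf continuous_intros cont1) auto
    then show ?thesis using that by auto
  qed
  \<comment> \<open>Half of the variation \<open>2 * pi * |\<zeta>| * \<delta> / K\<close> of the
    phase derivative: minimality at \<open>t0\<close> gives
    \<open>|\<Phi>1 t - \<Phi>1 t0| \<le> 2 * |\<Phi>1 t|\<close>.\<close>
  define \<kappa> where "\<kappa> = pi * \<bar>\<zeta>\<bar> * \<delta> / K"
  have kp: "\<kappa> > 0" using \<zeta> \<delta> K_pos by (simp add: \<kappa>_def)
  have low: "\<bar>\<Phi>1 t\<bar> \<ge> \<kappa>" if t: "c \<le> t" "t \<le> d" "\<bar>t - t0\<bar> \<ge> \<delta>" for t
  proof -
    have "\<bar>\<Phi>1 t - \<Phi>1 t0\<bar> = 2 * pi * \<bar>\<zeta>\<bar> * \<bar>P1 t - P1 t0\<bar>"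
      unfolding \<Phi>1_def by (simp flip: right_diff_distrib add: abs_mult)
    also have "\<dots> \<ge> 2 * pi * \<bar>\<zeta>\<bar> * (\<bar>t - t0\<bar> / K)"
      using P1_lipschitz_below[of t t0] t t0 c by (intro mult_left_mono) auto
    also have "2 * pi * \<bar>\<zeta>\<bar> * (\<bar>t - t0\<bar> / K) \<ge> 2 * pi * \<bar>\<zeta>\<bar> * (\<delta> / K)"
      using t K_pos by (intro mult_left_mono divide_right_mono) auto
    finally have "2 * \<kappa> \<le> \<bar>\<Phi>1 t - \<Phi>1 t0\<bar>" by (simp add: \<kappa>_def)
    also have "\<dots> \<le> 2 * \<bar>\<Phi>1 t\<bar>" using t0(3)[of t] t by linarith
    finally show ?thesis by simp
  qed
  have piece: "cmod (integral {u..v} f) \<le> 2 * K ^ 4 / (\<bar>\<zeta>\<bar> * \<delta>\<^sup>2)"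
    if uv: "c \<le> u" "u \<le> v" "v \<le> d" "\<And>x. u \<le> x \<Longrightarrow> x \<le> v \<Longrightarrow> \<bar>x - t0\<bar> \<ge> \<delta>" for u v
  proof -
    have "cmod (integral {u..v} f) \<le> 2 * K / \<kappa> + (v - u) * (K / \<kappa> + K * (2 * pi * \<bar>\<zeta>\<bar> * K) / \<kappa>\<^sup>2)"
      unfolding f_def
    proof (rule nonstationary_phase[where ?\<Phi>1.0=\<Phi>1 and ?\<Phi>2.0="\<lambda>t. 2 * pi * (\<zeta> * P2 t)" and ?b1.0=chi1])
      show "continuous_on {u..v} (\<lambda>x. 2 * pi * (\<eta> * x + \<zeta> * P x))" by (intro continuous_intros contP)
      show "((\<lambda>x. 2 * pi * (\<eta> * x + \<zeta> * P x)) has_real_derivative \<Phi>1 x) (at x)" for x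
        unfolding \<Phi>1_def by (auto intro!: derivative_eq_intros dP)
      show "(\<Phi>1 has_real_derivative 2 * pi * (\<zeta> * P2 x)) (at x)" for x
        unfolding \<Phi>1_def by (auto intro!: derivative_eq_intros dP)
      show "\<bar>2 * pi * (\<zeta> * P2 x)\<bar> \<le> 2 * pi * \<bar>\<zeta>\<bar> * K" if "u < x" "x < v" for x
        using P_le(2)[of x] that uv c by (simp add: abs_mult mult_left_mono)
    qed (use uv c low kp chi_abs chi_le K_pos cont1 contchi dchi in auto)
    also have "\<dots> \<le> 2 * K / \<kappa> + 1 * (K / \<kappa> + K * (2 * pi * \<bar>\<zeta>\<bar> * K) / \<kappa>\<^sup>2)"
      using uv c ab kp K_pos by (intro add_left_mono mult_right_mono) auto
    also have "\<dots> = (3 * \<delta> + 2 * K\<^sup>2) * K\<^sup>2 / (pi * (\<bar>\<zeta>\<bar> * \<delta>\<^sup>2))"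
      using \<zeta> \<delta> K_pos unfolding \<kappa>_def by (simp add: divide_simps) (simp add: algebra_simps power2_eq_square)
    also have "\<dots> \<le> (3 * \<delta> + 2 * K\<^sup>2) * K\<^sup>2 / (3 * (\<bar>\<zeta>\<bar> * \<delta>\<^sup>2))"
      using \<zeta> \<delta> K_pos pi_gt3 by (intro divide_left_mono mult_right_mono mult_pos_pos) auto
    also have "\<dots> \<le> (6 * K\<^sup>2) * K\<^sup>2 / (3 * (\<bar>\<zeta>\<bar> * \<delta>\<^sup>2))"
    proof -
      have "3 * \<delta> \<le> 4 * K\<^sup>2" using \<delta> K2 power_mono[of 2 K 2] by simp
      then show ?thesis using \<zeta> \<delta> by (intro divide_right_mono mult_right_mono) auto
    qed
    also have "\<dots> = 2 * K ^ 4 / (\<bar>\<zeta>\<bar> * \<delta>\<^sup>2)" by (simp add: power4_eq_xxxx power2_eq_square mult_ac)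
    finally show ?thesis .
  qed
  \<comment> \<open>The window of radius \<delta> around \<open>t0\<close> is estimated trivially;
    each remaining side, possibly empty, is nonstationary.\<close>
  define c1 where "c1 = max c (t0 - \<delta>)"
  define d1 where "d1 = min d (t0 + \<delta>)"
  have o: "c \<le> c1" "c1 \<le> d1" "d1 \<le> d" using t0 \<delta> c by (auto simp: c1_def d1_def)
  define Z where "Z = 2 * K ^ 4 / (\<bar>\<zeta>\<bar> * \<delta>\<^sup>2)"
  have Z0: "Z \<ge> 0" using K_pos by (simp add: Z_def)
  have 1: "cmod (integral {c..c1} f) \<le> Z"
  proof (cases "c1 = c")
    case False
    then have "c1 = t0 - \<delta>" by (auto simp: c1_def max_def split: if_splits)
    then show ?thesis unfolding Z_def using o by (intro piece) auto
  qed (use Z0 in auto)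
  have 3: "cmod (integral {d1..d} f) \<le> Z"
  proof (cases "d1 = d")
    case False
    then have "d1 = t0 + \<delta>" by (auto simp: d1_def min_def split: if_splits)
    then show ?thesis unfolding Z_def using o by (intro piece) auto
  qed (use Z0 in auto)
  have 2: "cmod (integral {c1..d1} f) \<le> K * (d1 - c1)"
    using integral_bound[of c1 d1 f K] o fc chi_abs by (auto simp: f_def norm_mult)
  have "integral {c..d} f = integral {c..c1} f + integral {c1..d1} f + integral {d1..d} f"
    using Henstock_Kurzweil_Integration.integral_combine[of c c1 d f] Henstock_Kurzweil_Integration.integral_combine[of c1 d1 d f] o fi
    by (metis add.assoc order_trans)
  then have "cmod (integral {c..d} f) \<le> Z + K * (d1 - c1) + Z"
    using 1 2 3 norm_triangle_ineq[of "integral {c..c1} f + integral {c1..d1} f" "integral {d1..d} f"]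
      norm_triangle_ineq[of "integral {c..c1} f" "integral {c1..d1} f"] by simp
  also have "\<dots> \<le> Z + K * (2 * \<delta>) + Z" using K_pos by (intro add_mono mult_left_mono) (auto simp: c1_def d1_def)
  finally show ?thesis unfolding Z_def f_def by (simp add: mult_ac)
qed

text \<open>If \<open>|\<eta>| \<ge> 2 * K * |\<zeta>|\<close>, the linear term dominates and the
  phase has no stationary point. Otherwise \<open>|\<zeta>| \<ge> L / (2 * K)\<close>, and the
  curvature of \<open>P\<close> acts through \<open>oscillatory_stationary\<close>. The endpoints
  are arbitrary because the off-diagonal region later truncates the integral.\<close>

lemma oscillatory_decay:
  assumes c: "a \<le> c" "c \<le> d" "d \<le> b" and \<delta>: "0 < \<delta>" "\<delta> \<le> 1" and l: "L > 0" "\<bar>\<eta>\<bar> \<ge> L \<or> \<bar>\<zeta>\<bar> \<ge> L"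
  shows "cmod (integral {c..d} (\<lambda>t. of_real (chi t) * cis (2 * pi * (\<eta> * t + \<zeta> * P t)))) \<le> 2 * \<delta> * K + 8 * K ^ 5 / (L * \<delta>\<^sup>2)"
proof (cases "\<bar>\<eta>\<bar> \<ge> 2 * K * \<bar>\<zeta>\<bar>")
  case True
  have "1 * \<bar>\<zeta>\<bar> \<le> 2 * K * \<bar>\<zeta>\<bar>" using K2 by (intro mult_right_mono) auto
  then have \<eta>: "\<bar>\<eta>\<bar> \<ge> L" using True l by auto
  have sm: "\<bar>\<zeta>\<bar> * K \<le> \<bar>\<eta>\<bar> / 2" using True by (simp add: mult_ac)
  define \<kappa> where "\<kappa> = pi * \<bar>\<eta>\<bar>"
  have kp: "\<kappa> > 0" using \<eta> l by (simp add: \<kappa>_def)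
  define \<Phi>1 where "\<Phi>1 t = 2 * pi * (\<eta> + \<zeta> * P1 t)" for t
  have zP: "\<bar>\<zeta> * P1 x\<bar> \<le> \<bar>\<eta>\<bar> / 2" "\<bar>\<zeta> * P2 x\<bar> \<le> \<bar>\<eta>\<bar> / 2" if "c \<le> x" "x \<le> d" for x
  proof -
    have "\<bar>\<zeta>\<bar> * \<bar>P1 x\<bar> \<le> \<bar>\<zeta>\<bar> * K" "\<bar>\<zeta>\<bar> * \<bar>P2 x\<bar> \<le> \<bar>\<zeta>\<bar> * K" using P_le[of x] that c by (auto intro!: mult_left_mono)
    then show "\<bar>\<zeta> * P1 x\<bar> \<le> \<bar>\<eta>\<bar> / 2" "\<bar>\<zeta> * P2 x\<bar> \<le> \<bar>\<eta>\<bar> / 2" using sm by (auto simp: abs_mult)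
  qed
  have "cmod (integral {c..d} (\<lambda>t. of_real (chi t) * cis (2 * pi * (\<eta> * t + \<zeta> * P t)))) \<le> 2 * K / \<kappa> + (d - c) * (K / \<kappa> + K * \<kappa> / \<kappa>\<^sup>2)"
  proof (rule nonstationary_phase[where ?\<Phi>1.0=\<Phi>1 and ?\<Phi>2.0="\<lambda>t. 2 * pi * (\<zeta> * P2 t)" and ?b1.0=chi1])
    show "continuous_on {c..d} (\<lambda>x. 2 * pi * (\<eta> * x + \<zeta> * P x))" "continuous_on {c..d} \<Phi>1" unfolding \<Phi>1_def by (intro continuous_intros contP)+
    show "((\<lambda>x. 2 * pi * (\<eta> * x + \<zeta> * P x)) has_real_derivative \<Phi>1 x) (at x)" for x
      unfolding \<Phi>1_def by (auto intro!: derivative_eq_intros dP)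
    show "(\<Phi>1 has_real_derivative 2 * pi * (\<zeta> * P2 x)) (at x)" for x
      unfolding \<Phi>1_def by (auto intro!: derivative_eq_intros dP)
    show "\<bar>2 * pi * (\<zeta> * P2 x)\<bar> \<le> \<kappa>" if "c < x" "x < d" for x
      using zP(2)[of x] that unfolding \<kappa>_def by (simp add: abs_mult)
    show "\<kappa> \<le> \<bar>\<Phi>1 x\<bar>" if "c \<le> x" "x \<le> d" for x
    proof -
      have "\<bar>\<eta> + \<zeta> * P1 x\<bar> \<ge> \<bar>\<eta>\<bar> / 2" using zP(1)[OF that] by linarith
      then have "2 * pi * \<bar>\<eta> + \<zeta> * P1 x\<bar> \<ge> 2 * pi * (\<bar>\<eta>\<bar> / 2)" by (intro mult_left_mono) auto
      then show ?thesis by (simp add: \<kappa>_def \<Phi>1_def abs_mult)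
    qed
  qed (use c kp chi_abs chi_le K_pos contchi dchi in auto)
  also have "\<dots> \<le> 2 * K / \<kappa> + 1 * (K / \<kappa> + K * \<kappa> / \<kappa>\<^sup>2)"
    using c ab kp K_pos by (intro add_left_mono mult_right_mono) auto
  also have "\<dots> = 4 * K / \<kappa>" using kp by (simp add: field_simps power2_eq_square)
  also have "\<dots> \<le> 4 * K / (1 * L)" unfolding \<kappa>_def using \<eta> l K_pos pi_ge_two by (intro divide_left_mono mult_mono) auto
  also have "\<dots> \<le> 8 * K ^ 5 / (L * \<delta>\<^sup>2)"
  proof -
    have "\<delta>\<^sup>2 \<le> 1" using \<delta> by (simp add: power_le_one)
    then have "4 * K / (1 * L) \<le> 4 * K / (L * \<delta>\<^sup>2)" using \<delta> l K_pos by (intro divide_left_mono mult_pos_pos) auto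
    also have "\<dots> \<le> 8 * K ^ 5 / (L * \<delta>\<^sup>2)" using K_power[of 1 5] l K_pos by (intro divide_right_mono) auto
    finally show ?thesis .
  qed
  finally show ?thesis using \<delta> K_pos by (smt (verit) mult_pos_pos)
next
  case False
  have "1 * L \<le> 2 * K * \<bar>\<zeta>\<bar>" 
  proof (cases "\<bar>\<zeta>\<bar> \<ge> L")
    case True then show ?thesis using K2 l by (intro mult_mono) auto
  qed (use False l in auto)
  then have z: "\<bar>\<zeta>\<bar> \<ge> L / (2 * K)" using K_pos by (simp add: field_simps)
  then have z0: "\<zeta> \<noteq> 0" using l K_pos by (smt (verit) divide_pos_pos)
  have "4 * K ^ 4 / (\<bar>\<zeta>\<bar> * \<delta>\<^sup>2) \<le> 4 * K ^ 4 / (L / (2 * K) * \<delta>\<^sup>2)"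
    using z \<delta> l K_pos z0 by (intro divide_left_mono mult_right_mono mult_pos_pos divide_pos_pos) auto
  also have "\<dots> = 8 * K ^ 5 / (L * \<delta>\<^sup>2)" by (simp add: power_numeral_reduce)
  finally show ?thesis using oscillatory_stationary[OF c z0 \<delta>, of \<eta>] by linarith
qed

text \<open>The phase derivative is a multiple of \<open>P1 - 1\<close>, which is bounded away from
  0. The first integration by parts has no boundary terms since \<open>chi\<close> vanishes at
  \<open>a\<close> and \<open>b\<close>; the second is \<open>nonstationary_phase\<close>. Two
  powers of \<tau> are gained so that the bound is integrable at infinity.\<close>

lemma oscillatory_no_stationary:
  assumes t: "\<tau> \<noteq> 0"
  shows "cmod (integral {a..b} (\<lambda>t. of_real (chi t) * cis (2 * pi * (\<tau> * (P t - t))))) \<le> K ^ 7 / \<tau>\<^sup>2"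
proof -
  define g where "g t = (chi1 t * (P1 t - 1) - chi t * P2 t) / ((P1 t - 1) * (P1 t - 1))" for t
  define Q where "Q t = P1 t - 1" for t
  define g1 where "g1 t = ((chi2 t * Q t + chi1 t * P2 t - (chi1 t * P2 t + chi t * P3 t)) * (Q t * Q t) - (chi1 t * Q t - chi t * P2 t) * (P2 t * Q t + Q t * P2 t)) / ((Q t * Q t) * (Q t * Q t))" for t
  have nz: "Q t \<noteq> 0" if "a \<le> t" "t \<le> b" for t using P_ge(2)[OF that] K_pos by (auto simp: Q_def)
  have qinv: "1 / \<bar>Q t\<bar> \<le> K" if "a \<le> t" "t \<le> b" for t using P_ge(2)[OF that] K_pos nz[OF that] by (auto simp: Q_def field_simps)
  define \<Phi> where "\<Phi> t = 2 * pi * (\<tau> * (P t - t))" for t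
  define f where "f t = of_real (chi t) * cis (\<Phi> t)" for t
  have fc: "continuous_on S f" for S unfolding f_def \<Phi>_def cis_conv_exp by (intro continuous_intros contP contchi)
  have gc: "continuous_on {a..b} g" unfolding g_def by (intro continuous_intros contP contchi) (use nz in \<open>auto simp: Q_def\<close>)
  have d1: "(\<Phi> has_real_derivative 2 * pi * (\<tau> * Q x)) (at x)" for x
    unfolding \<Phi>_def Q_def by (auto intro!: derivative_eq_intros dP)
  define C where "C = 2 * pi * \<tau>"
  have C0: "C \<noteq> 0" using t by (simp add: C_def)
  define u where "u x = of_real (chi x / Q x) * (cis (\<Phi> x) / (\<i> * of_real C))" for x
  define h where "h x = of_real (g x) * cis (\<Phi> x)" for x
  have hc: "continuous_on {a..b} h" unfolding h_def \<Phi>_def cis_conv_exp by (intro continuous_intros contP gc)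
  have uc: "continuous_on {a..b} u" unfolding u_def \<Phi>_def Q_def cis_conv_exp
    by (intro continuous_intros contP contchi) (use nz C0 in \<open>auto simp: Q_def\<close>)
  have Qd: "(Q has_real_derivative P2 x) (at x)" for x unfolding Q_def by (auto intro!: derivative_eq_intros dP)
  have ud: "(u has_vector_derivative (f x + h x / (\<i> * of_real C))) (at x)" if x: "x \<in> {a<..<b}" for x
  proof -
    have qd: "((\<lambda>x. chi x / Q x) has_real_derivative g x) (at x)" unfolding g_def Q_def[symmetric]
      by (intro DERIV_divide dchi Qd nz) (use x in auto)
    have "((\<lambda>x. complex_of_real (chi x / Q x)) has_vector_derivative of_real (g x)) (at x)"
      using qd by (rule has_vector_derivative_of_real)
    moreover have "((\<lambda>x. cis (\<Phi> x) / (\<i> * of_real C)) has_vector_derivative (of_real (2 * pi * (\<tau> * Q x)) * (\<i> * cis (\<Phi> x)) / (\<i> * of_real C))) (at x)"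
      by (intro has_vector_derivative_divide has_vector_derivative_cis d1)
    ultimately have "(u has_vector_derivative (of_real (chi x / Q x) * (of_real (2 * pi * (\<tau> * Q x)) * (\<i> * cis (\<Phi> x)) / (\<i> * of_real C)) + of_real (g x) * (cis (\<Phi> x) / (\<i> * of_real C)))) (at x)"
      unfolding u_def by (rule has_vector_derivative_mult)
    moreover have "of_real (chi x / Q x) * (of_real (2 * pi * (\<tau> * Q x)) * (\<i> * cis (\<Phi> x)) / (\<i> * of_real C)) = f x"
      using nz[of x] x C0 by (simp add: f_def C_def field_simps)
    ultimately show ?thesis by (simp add: h_def)
  qed
  have fint: "((\<lambda>x. f x + h x / (\<i> * of_real C)) has_integral (u b - u a)) {a..b}"
    using fundamental_theorem_of_calculus_interior[OF _ uc] ud ab by auto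
  have uab: "u b = 0" "u a = 0" using chi_supp by (auto simp: u_def)
  have fint2: "((\<lambda>x. f x + h x / (\<i> * of_real C)) has_integral (integral {a..b} f + integral {a..b} h / (\<i> * of_real C))) {a..b}"
    by (intro has_integral_add has_integral_divide integrable_integral integrable_continuous_real fc hc)
  have "integral {a..b} f + integral {a..b} h / (\<i> * of_real C) = 0"
    using has_integral_unique[OF fint fint2] uab by simp
  then have "integral {a..b} f = - (integral {a..b} h / (\<i> * of_real C))" by (simp add: add_eq_0_iff2)
  then have nf: "cmod (integral {a..b} f) = cmod (integral {a..b} h) / \<bar>C\<bar>" by (simp add: norm_divide norm_mult)
  define \<kappa> where "\<kappa> = 2 * pi * \<bar>\<tau>\<bar> / K"
  have kp: "\<kappa> > 0" using t K_pos by (simp add: \<kappa>_def)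
  have Qi: "\<bar>x / Q t\<bar> \<le> y * K" if "a \<le> t" "t \<le> b" "\<bar>x\<bar> \<le> y" for t x y
  proof -
    have "\<bar>x / Q t\<bar> = \<bar>x\<bar> * (1 / \<bar>Q t\<bar>)" by simp
    also have "\<dots> \<le> y * K" using that qinv[of t] by (intro mult_mono) auto
    finally show ?thesis .
  qed
  have gb: "\<bar>g x\<bar> \<le> 2 * K ^ 4" if x: "a \<le> x" "x \<le> b" for x
  proof -
    have ge: "g x = chi1 x / Q x - chi x * P2 x / Q x / Q x" using nz[OF x] by (simp add: g_def Q_def[symmetric] field_simps)
    have "\<bar>chi1 x / Q x\<bar> \<le> K * K" by (intro Qi x chi_le)
    moreover have "\<bar>chi x * P2 x / Q x / Q x\<bar> \<le> K * K * K * K"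
      using chi_abs P_le(2)[OF x] K_pos by (intro Qi x) (auto simp: abs_mult intro!: mult_mono)
    ultimately have "\<bar>g x\<bar> \<le> K * K + K * K * K * K" unfolding ge by linarith
    then show ?thesis using K_power[of 2 4] by (simp add: power4_eq_xxxx power2_eq_square)
  qed
  have g1b: "\<bar>g1 x\<bar> \<le> 6 * K ^ 6" if x: "a \<le> x" "x \<le> b" for x
  proof -
    have ge: "g1 x = chi2 x / Q x - chi x * P3 x / Q x / Q x - 2 * (chi1 x * P2 x / Q x / Q x) + 2 * (chi x * (P2 x * P2 x) / Q x / Q x / Q x)"
      using nz[OF x] by (simp add: g1_def divide_simps) (simp add: algebra_simps)
    have 1: "\<bar>chi2 x / Q x\<bar> \<le> K * K" by (intro Qi x chi_le)
    have 2: "\<bar>chi x * P3 x / Q x / Q x\<bar> \<le> K * K * K * K"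
      using chi_abs P_le(3)[OF x] K_pos by (intro Qi x) (auto simp: abs_mult intro!: mult_mono)
    have 3: "\<bar>chi1 x * P2 x / Q x / Q x\<bar> \<le> K * K * K * K"
      using chi_le P_le(2)[OF x] K_pos by (intro Qi x) (auto simp: abs_mult intro!: mult_mono)
    have 4: "\<bar>chi x * (P2 x * P2 x) / Q x / Q x / Q x\<bar> \<le> K * (K * K) * K * K * K"
      using chi_abs P_le(2)[OF x] K_pos by (intro Qi x) (simp only: abs_mult, intro mult_mono, auto)
    have "\<bar>g1 x\<bar> \<le> K * K + K * K * K * K + 2 * (K * K * K * K) + 2 * (K * (K * K) * K * K * K)"
    proof -
      have "\<bar>A - B - 2 * C + 2 * D\<bar> \<le> x + y + 2 * z + 2 * w" if "\<bar>A\<bar> \<le> x" "\<bar>B\<bar> \<le> y" "\<bar>C\<bar> \<le> z" "\<bar>D\<bar> \<le> w" for A B C D x y z w :: real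
        using that by linarith
      then show ?thesis unfolding ge using 1 2 3 4 by blast
    qed
    also have "\<dots> = K ^ 2 + 3 * K ^ 4 + 2 * K ^ 6" by (simp add: power_numeral_reduce)
    finally show ?thesis using K_power[of 2 6] K_power[of 4 6] by linarith
  qed
  have "cmod (integral {a..b} h) \<le> 2 * (2 * K ^ 4) / \<kappa> + (b - a) * (6 * K ^ 6 / \<kappa> + (2 * K ^ 4) * (2 * pi * \<bar>\<tau>\<bar> * K) / \<kappa>\<^sup>2)"
    unfolding h_def
  proof (rule nonstationary_phase[where ?\<Phi>1.0="\<lambda>t. 2 * pi * (\<tau> * Q t)" and ?\<Phi>2.0="\<lambda>t. 2 * pi * (\<tau> * P2 t)" and ?b1.0=g1])
    show "continuous_on {a..b} \<Phi>" unfolding \<Phi>_def by (intro continuous_intros contP)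
    show "continuous_on {a..b} (\<lambda>t. 2 * pi * (\<tau> * Q t))" unfolding Q_def by (intro continuous_intros contP)
    show "((\<lambda>t. 2 * pi * (\<tau> * Q t)) has_real_derivative 2 * pi * (\<tau> * P2 x)) (at x)" for x
      by (auto intro!: derivative_eq_intros Qd)
    show "(g has_real_derivative g1 x) (at x)" if "a < x" "x < b" for x
    proof -
      have "((\<lambda>t. (chi1 t * Q t - chi t * P2 t) / (Q t * Q t)) has_real_derivative g1 x) (at x)"
        unfolding g1_def
        by (rule DERIV_cong[OF DERIV_divide[OF DERIV_diff[OF DERIV_mult[OF dchi(2) Qd] DERIV_mult[OF dchi(1) dP(3)]] DERIV_mult[OF Qd Qd]]])
          (use nz[of x] that in \<open>auto simp: mult_ac\<close>)
      then show ?thesis by (simp add: g_def[abs_def] Q_def)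
    qed
    show "\<bar>2 * pi * (\<tau> * P2 x)\<bar> \<le> 2 * pi * \<bar>\<tau>\<bar> * K" if "a < x" "x < b" for x
      using P_le(2)[of x] that by (simp add: abs_mult mult_left_mono)
    show "\<kappa> \<le> \<bar>2 * pi * (\<tau> * Q x)\<bar>" if "a \<le> x" "x \<le> b" for x
    proof -
      have "2 * pi * \<bar>\<tau>\<bar> * (1 / K) \<le> 2 * pi * \<bar>\<tau>\<bar> * \<bar>Q x\<bar>" using P_ge(2)[OF that] by (intro mult_left_mono) (auto simp: Q_def)
      then show ?thesis by (simp add: \<kappa>_def abs_mult)
    qed
  qed (use ab kp gb g1b K_pos gc d1 in auto)
  also have "\<dots> \<le> 2 * (2 * K ^ 4) / \<kappa> + 1 * (6 * K ^ 6 / \<kappa> + (2 * K ^ 4) * (2 * pi * \<bar>\<tau>\<bar> * K) / \<kappa>\<^sup>2)"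
    using ab kp K_pos by (intro add_left_mono mult_right_mono) auto
  also have "\<dots> = (4 * K ^ 5 + 8 * K ^ 7) / \<bar>C\<bar>"
    using t K_pos unfolding \<kappa>_def C_def by (simp add: divide_simps abs_mult) (simp add: algebra_simps power_numeral_reduce)
  also have "\<dots> \<le> 12 * K ^ 7 / \<bar>C\<bar>" using K_power[of 5 7] by (intro divide_right_mono) auto
  finally have "cmod (integral {a..b} f) \<le> 12 * K ^ 7 / \<bar>C\<bar> / \<bar>C\<bar>" unfolding nf by (intro divide_right_mono) auto
  also have "\<dots> = (12 * K ^ 7) / (4 * pi\<^sup>2 * \<tau>\<^sup>2)" by (simp add: C_def power2_eq_square abs_mult)
  also have "\<dots> \<le> (12 * K ^ 7) / (12 * \<tau>\<^sup>2)"
  proof -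
    have "4 * pi\<^sup>2 \<ge> 12" using pi_gt3 power_mono[of 3 pi 2] by simp
    then show ?thesis using t K_pos by (intro divide_left_mono mult_right_mono mult_pos_pos) auto
  qed
  also have "\<dots> = K ^ 7 / \<tau>\<^sup>2" by simp
  finally show ?thesis unfolding f_def \<Phi>_def .
qed

end

subsection \<open>An oscillatory bilinear form on the curve\<close>

text \<open>The left inverse \<open>g\<close> supplies injectivity for either sign of
  \<open>f'\<close>. Compactness makes \<open>g\<close> continuous on the image, and the inverse
  function rule applies at interior points of the image.\<close>

lemma monotone_inverse:
  fixes f f' g :: "real \<Rightarrow> real"
  assumes uv: "u < v" and d: "\<And>x. (f has_real_derivative f' x) (at x)"
    and nz: "\<And>x. u \<le> x \<Longrightarrow> x \<le> v \<Longrightarrow> f' x \<noteq> 0"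
    and g: "\<And>x. u \<le> x \<Longrightarrow> x \<le> v \<Longrightarrow> g (f x) = x"
  obtains c d where "c \<le> d" "f ` {u..v} = {c..d}" "continuous_on {c..d} g"
    "\<And>y. c \<le> y \<Longrightarrow> y \<le> d \<Longrightarrow> u \<le> g y \<and> g y \<le> v \<and> f (g y) = y"
    "\<And>y. c < y \<Longrightarrow> y < d \<Longrightarrow> (g has_real_derivative 1 / f' (g y)) (at y)"
proof -
  have fc: "continuous_on S f" for S by (rule DERIV_continuous_on[OF has_field_derivative_at_within[OF d]])
  obtain c d' where cd: "f ` {u..v} = {c..d'}" "c \<le> d'"
    using continuous_image_closed_interval[of u v f] uv fc by auto
  have gc: "continuous_on {c..d'} g"
    using continuous_on_inv[OF fc[of "{u..v}"], of g] g cd by auto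
  have gy: "u \<le> g y \<and> g y \<le> v \<and> f (g y) = y" if "c \<le> y" "y \<le> d'" for y
  proof -
    have "y \<in> f ` {u..v}" using that cd by auto
    then show ?thesis using g by auto
  qed
  have "(g has_real_derivative 1 / f' (g y)) (at y)" if y: "c < y" "y < d'" for y
  proof -
    have "(g has_real_derivative inverse (f' (g y))) (at y)"
    proof (rule DERIV_inverse_function[OF d _ y])
      show "f' (g y) \<noteq> 0" using gy[of y] y nz by auto
      show "f (g z) = z" if "c < z" "z < d'" for z using gy[of z] that by auto
      show "isCont g y" using continuous_on_interior[OF gc, of y] y by simp
    qed
    then show ?thesis by (simp add: inverse_eq_divide)
  qed
  with cd gc gy show ?thesis using that[of c d'] by blast
qed

text \<open>A non-integrable function has Bochner integral 0 by convention, so the bound may be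
  applied before integrability is known.\<close>

lemma norm_LINT_le_nn_integral:
  fixes f :: "'a \<Rightarrow> 'b :: {banach, second_countable_topology}"
  shows "ennreal (norm (integral\<^sup>L M f)) \<le> (\<integral>\<^sup>+x. ennreal (norm (f x)) \<partial>M)"
  by (cases "integrable M f") (simp_all add: integral_norm_bound_ennreal not_integrable_integral_eq)

text \<open>Cauchy-Schwarz in \<open>v\<close> removes \<gamma> and leaves the L2 norm of
  \<open>Hh\<close>, the image of \<alpha> under the kernel. Its square is a quadratic form in
  \<alpha> whose kernel \<open>I r r'\<close> is the correlation of two rows of \<open>k\<close>.
  Schur's test for that form uses \<open>T0\<close> for \<open>|r - r'| < \<delta>\<close>, a set of
  measure \<open>2 * \<delta>\<close>, and \<open>S0\<close> on the rest of the unit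
  interval.\<close>

lemma kernel_TTstar:
  fixes k :: "real \<Rightarrow> real \<Rightarrow> complex" and \<alpha> \<gamma> :: "real \<Rightarrow> complex"
  assumes km[measurable]: "case_prod k \<in> borel_measurable (borel \<Otimes>\<^sub>M borel)" and kB: "\<And>r v. cmod (k r v) \<le> B"
    and ks: "\<And>r v. k r v \<noteq> 0 \<Longrightarrow> 0 \<le> r \<and> r \<le> 1 \<and> - V \<le> v \<and> v \<le> V"
    and I1: "\<And>r r'. cmod (LINT v|lborel. k r v * cnj (k r' v)) \<le> T0"
    and I2: "\<And>r r'. \<bar>r - r'\<bar> \<ge> \<delta> \<Longrightarrow> cmod (LINT v|lborel. k r v * cnj (k r' v)) \<le> S0"
    and \<delta>: "\<delta> > 0"
    and am[measurable]: "\<alpha> \<in> borel_measurable borel" and aB: "\<And>x. cmod (\<alpha> x) \<le> Ba" and a2: "integrable lborel (\<lambda>x. (cmod (\<alpha> x))\<^sup>2)"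
    and gm[measurable]: "\<gamma> \<in> borel_measurable borel" and gB: "\<And>x. cmod (\<gamma> x) \<le> Bg" and g2: "integrable lborel (\<lambda>x. (cmod (\<gamma> x))\<^sup>2)"
  shows "(cmod (LINT r|lborel. \<alpha> r * (LINT v|lborel. \<gamma> v * k r v)))\<^sup>2
    \<le> (2 * \<delta> * T0 + S0) * (LINT r|lborel. (cmod (\<alpha> r))\<^sup>2) * (LINT v|lborel. (cmod (\<gamma> v))\<^sup>2)"
proof -
  have lborel_sigma_finite: "sigma_finite_measure (lborel :: real measure)" by unfold_locales
  have km'[measurable]: "(\<lambda>v. k r v) \<in> borel_measurable borel" for r
    using measurable_compose[OF measurable_Pair1'[of r borel borel] km] by (simp add: comp_def)
  have T0: "T0 \<ge> 0" by (rule order_trans[OF norm_ge_zero I1[of 0 0]])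
  have S0: "S0 \<ge> 0" by (rule order_trans[OF norm_ge_zero I2[of 0 \<delta>]]) (use \<delta> in auto)
  have B0: "B \<ge> 0" by (rule order_trans[OF norm_ge_zero kB[of 0 0]])
  have Ba0: "Ba \<ge> 0" by (rule order_trans[OF norm_ge_zero aB[of 0]])
  \<comment> \<open>Cutting \<alpha> and \<gamma> to the support of \<open>k\<close> leaves all
    products with \<open>k\<close> unchanged and makes them integrable, as bounded functions with
    bounded support.\<close>
  define \<alpha>0 where "\<alpha>0 r = indicator {0..1} r * \<alpha> r" for r
  define \<gamma>0 where "\<gamma>0 v = indicator {- V..V} v * \<gamma> v" for v
  define i1 where "i1 r = (indicator {0..1} r :: complex)" for r :: real
  have [measurable]: "\<alpha>0 \<in> borel_measurable borel" "\<gamma>0 \<in> borel_measurable borel" unfolding \<alpha>0_def \<gamma>0_def by measurable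
  have ind_int: "integrable lborel (\<lambda>x. indicator {u..v} x * f x)" if "f \<in> borel_measurable borel" "\<And>x. cmod (f x) \<le> C" for u v C and f :: "real \<Rightarrow> complex"
  proof (rule integrable_mult_bounded[where C=C])
    have "integrable lborel (indicator {u..v} :: real \<Rightarrow> real)" by (rule integrable_real_indicator) (auto simp: emeasure_lborel_Icc_eq)
    then have "integrable lborel (\<lambda>x. complex_of_real (indicator {u..v} x))" by (rule integrable_of_real)
    then show "integrable lborel (indicator {u..v} :: real \<Rightarrow> complex)" by (simp add: of_real_indicator)
  qed (use that in auto)
  have a0i: "integrable lborel \<alpha>0" unfolding \<alpha>0_def by (rule ind_int[where C=Ba]) (use aB in auto)
  have g0i: "integrable lborel \<gamma>0" unfolding \<gamma>0_def by (rule ind_int[where C=Bg]) (use gB in auto)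
  have ak: "\<alpha> r * k r v = \<alpha>0 r * k r v" for r v using ks[of r v] by (cases "k r v = 0") (auto simp: \<alpha>0_def)
  have gk: "\<gamma> v * k r v = \<gamma>0 v * k r v" for r v using ks[of r v] by (cases "k r v = 0") (auto simp: \<gamma>0_def)
  define Hh where "Hh v = (LINT r|lborel. \<alpha>0 r * k r v)" for v
  have [measurable]: "Hh \<in> borel_measurable borel"
  proof -
    have "(\<lambda>v. LINT r|lborel. (\<lambda>(v, r). \<alpha>0 r * k r v) (v, r)) \<in> borel_measurable borel"
      by (intro lborel.borel_measurable_lebesgue_integral) measurable
    then show ?thesis by (simp add: Hh_def[abs_def])
  qed
  have HB: "cmod (Hh v) \<le> (LINT r|lborel. cmod (\<alpha>0 r)) * B" for v
  proof -
    have "cmod (Hh v) \<le> (LINT r|lborel. cmod (\<alpha>0 r * k r v))" unfolding Hh_def by (rule integral_norm_bound)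
    also have "\<dots> \<le> (LINT r|lborel. cmod (\<alpha>0 r) * B)"
    proof (rule integral_mono')
      show "integrable lborel (\<lambda>r. cmod (\<alpha>0 r) * B)" using a0i by auto
    qed (use kB B0 in \<open>auto simp: norm_mult intro!: mult_left_mono\<close>)
    finally show ?thesis by simp
  qed
  have Hs: "Hh v = 0" if "v \<notin> {-V..V}" for v
  proof -
    have "k r v = 0" for r using ks[of r v] that by auto
    then show ?thesis by (simp add: Hh_def)
  qed
  have Hi: "Hh v = indicator {-V..V} v * Hh v" for v using Hs[of v] by (auto simp: indicator_def)
  have Hint: "integrable lborel Hh"
    using ind_int[of Hh _ "-V" V, OF _ HB] Hi by simp
  have H2: "integrable lborel (\<lambda>v. (cmod (Hh v))\<^sup>2)"
  proof -
    have "integrable lborel (\<lambda>v. Hh v * cnj (Hh v))"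
      by (rule integrable_mult_bounded[OF Hint _, where C="(LINT r|lborel. cmod (\<alpha>0 r)) * B"]) (use HB in auto)
    from integrable_norm[OF this] show ?thesis by (simp add: norm_mult power2_eq_square)
  qed
  have eq1: "(LINT r|lborel. \<alpha> r * (LINT v|lborel. \<gamma> v * k r v)) = (LINT v|lborel. \<gamma> v * Hh v)"
  proof -
    have "(LINT r|lborel. \<alpha> r * (LINT v|lborel. \<gamma> v * k r v)) = (LINT r|lborel. LINT v|lborel. \<alpha>0 r * (\<gamma>0 v * k r v))"
    proof (rule Bochner_Integration.integral_cong)
      fix r
      have "\<alpha> r * (LINT v|lborel. \<gamma> v * k r v) = (LINT v|lborel. \<alpha> r * (\<gamma> v * k r v))" by simp
      also have "\<dots> = (LINT v|lborel. \<alpha>0 r * (\<gamma>0 v * k r v))"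
      proof (rule Bochner_Integration.integral_cong)
        show "\<alpha> r * (\<gamma> v * k r v) = \<alpha>0 r * (\<gamma>0 v * k r v)" for v
          using ak[of r v] gk[of v r] by auto
      qed auto
      finally show "\<alpha> r * (LINT v|lborel. \<gamma> v * k r v) = \<dots>" .
    qed auto
    also have "\<dots> = (LINT v|lborel. LINT r|lborel. \<alpha>0 r * (\<gamma>0 v * k r v))"
    proof (rule lborel_pair.Fubini_integral[symmetric])
      have "integrable (lborel \<Otimes>\<^sub>M lborel) (\<lambda>p. \<alpha>0 (fst p) * \<gamma>0 (snd p) * case_prod k p)"
        using kB by (intro integrable_prod_bounded[where C=B] lborel_sigma_finite a0i g0i) (auto simp: case_prod_beta')
      then show "integrable (lborel \<Otimes>\<^sub>M lborel) (\<lambda>(r, v). \<alpha>0 r * (\<gamma>0 v * k r v))"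
        by (simp add: case_prod_beta' mult_ac)
    qed
    also have "\<dots> = (LINT v|lborel. \<gamma>0 v * Hh v)"
      unfolding Hh_def by (simp flip: integral_mult_right_zero add: mult_ac)
    also have "\<dots> = (LINT v|lborel. \<gamma> v * Hh v)"
    proof (rule Bochner_Integration.integral_cong)
      show "\<gamma>0 v * Hh v = \<gamma> v * Hh v" for v using Hs[of v] by (auto simp: \<gamma>0_def indicator_def)
    qed auto
    finally show ?thesis .
  qed
  have c1: "cmod (LINT v|lborel. \<gamma> v * Hh v) \<le> sqrt (LINT v|lborel. (cmod (\<gamma> v))\<^sup>2) * sqrt (LINT v|lborel. (cmod (Hh v))\<^sup>2)"
  proof -
    have "cmod (LINT v|lborel. \<gamma> v * Hh v) \<le> (LINT v|lborel. cmod (\<gamma> v * Hh v))" by (rule integral_norm_bound)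
    also have "\<dots> = (LINT v|lborel. cmod (\<gamma> v) * cmod (Hh v))" by (simp add: norm_mult)
    also have "\<dots> \<le> sqrt (LINT v|lborel. (cmod (\<gamma> v))\<^sup>2) * sqrt (LINT v|lborel. (cmod (Hh v))\<^sup>2)"
      by (intro integral_Cauchy_Schwarz g2 H2) auto
    finally show ?thesis .
  qed
  define I where "I r r' = (LINT v|lborel. k r v * cnj (k r' v))" for r r'
  have eq2: "complex_of_real (LINT v|lborel. (cmod (Hh v))\<^sup>2) = (LINT r|lborel. \<alpha>0 r * (LINT r'|lborel. cnj (\<alpha>0 r') * I r r'))"
  proof -
    have "complex_of_real (LINT v|lborel. (cmod (Hh v))\<^sup>2) = (LINT v|lborel. Hh v * cnj (Hh v))"
      by (subst integral_complex_of_real[symmetric]) (simp only: complex_norm_square)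
    also have "\<dots> = (LINT v|lborel. LINT r|lborel. \<alpha>0 r * (k r v * cnj (Hh v)))"
      unfolding Hh_def by (simp flip: integral_mult_left_zero add: mult.assoc)
    also have "\<dots> = (LINT r|lborel. LINT v|lborel. \<alpha>0 r * (k r v * cnj (Hh v)))"
    proof (rule lborel_pair.Fubini_integral)
      have "integrable (lborel \<Otimes>\<^sub>M lborel) (\<lambda>p. \<alpha>0 (fst p) * cnj (Hh (snd p)) * case_prod k p)"
        using kB Hint by (intro integrable_prod_bounded[where C=B] lborel_sigma_finite a0i g0i) (auto simp: case_prod_beta')
      then show "integrable (lborel \<Otimes>\<^sub>M lborel) (\<lambda>(r, v). \<alpha>0 r * (k r v * cnj (Hh v)))"
        by (simp add: case_prod_beta' mult_ac)
    qed
    also have "\<dots> = (LINT r|lborel. \<alpha>0 r * (LINT r'|lborel. cnj (\<alpha>0 r') * I r r'))"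
    proof (rule Bochner_Integration.integral_cong)
      fix r
      have "(LINT v|lborel. k r v * cnj (Hh v)) = (LINT v|lborel. LINT r'|lborel. cnj (\<alpha>0 r') * (k r v * cnj (k r' v)))"
      proof (rule Bochner_Integration.integral_cong)
        fix v
        have "cnj (Hh v) = (LINT r'|lborel. cnj (\<alpha>0 r') * cnj (k r' v))"
          unfolding Hh_def by (simp flip: Bochner_Integration.integral_cnj)
        then have "k r v * cnj (Hh v) = (LINT r'|lborel. k r v * (cnj (\<alpha>0 r') * cnj (k r' v)))" by simp
        then show "k r v * cnj (Hh v) = (LINT r'|lborel. cnj (\<alpha>0 r') * (k r v * cnj (k r' v)))" by (simp add: mult_ac)
      qed auto
      also have "\<dots> = (LINT r'|lborel. LINT v|lborel. cnj (\<alpha>0 r') * (k r v * cnj (k r' v)))"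
      proof (rule lborel_pair.Fubini_integral)
        have kk: "indicator {- V..V} v * k r v = k r v" for v using ks[of r v] by (cases "k r v = 0") (auto simp: indicator_def)
        have kri: "integrable lborel (\<lambda>v. k r v)"
          using ind_int[of "k r" B "-V" V] kB unfolding kk by auto
        have "integrable (lborel \<Otimes>\<^sub>M lborel) (\<lambda>p. cnj (\<alpha>0 (fst p)) * k r (snd p) * cnj (case_prod k p))"
          using kB a0i by (intro integrable_prod_bounded[where C=B] lborel_sigma_finite kri) (auto simp: case_prod_beta')
        then show "integrable (lborel \<Otimes>\<^sub>M lborel) (\<lambda>(r', v). cnj (\<alpha>0 r') * (k r v * cnj (k r' v)))"
          by (simp add: case_prod_beta' mult_ac)
      qed
      also have "\<dots> = (LINT r'|lborel. cnj (\<alpha>0 r') * I r r')" by (simp add: I_def)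
      finally show "(LINT v|lborel. \<alpha>0 r * (k r v * cnj (Hh v))) = \<alpha>0 r * (LINT r'|lborel. cnj (\<alpha>0 r') * I r r')" by simp
    qed auto
    finally show ?thesis .
  qed
  define w where "w x = T0 * indicator {-\<delta><..<\<delta>} x + S0" for x :: real
  have [measurable]: "w \<in> borel_measurable borel" unfolding w_def by measurable
  have w0: "w x \<ge> 0" for x using T0 S0 by (simp add: w_def)
  have Iw: "cmod (I r r') \<le> w (r' - r)" for r r'
    using I1[of r r'] I2[of r r'] S0 T0 unfolding I_def w_def by (cases "\<bar>r - r'\<bar> \<ge> \<delta>") (auto simp: indicator_def)
  define A where "A r = (cmod (\<alpha>0 r))\<^sup>2" for r
  have [measurable]: "A \<in> borel_measurable borel" unfolding A_def by measurable
  have A0: "A r \<ge> 0" for r by (simp add: A_def)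
  \<comment> \<open>The cut-off to the unit interval gives the constant part \<open>S0\<close> of
    the majorant finite mass in each row.\<close>
  define j where "j r = (indicator {0..1} r :: real)" for r :: real
  have [measurable]: "j \<in> borel_measurable borel" unfolding j_def by measurable
  have j0: "j r \<ge> 0" for r by (simp add: j_def)
  have wj: "(\<integral>\<^sup>+r'. ennreal (w (r' - r) * j r') \<partial>lborel) \<le> ennreal (2 * \<delta> * T0 + S0)" for r
  proof -
    have "(\<integral>\<^sup>+r'. ennreal (w (r' - r) * j r') \<partial>lborel) \<le> (\<integral>\<^sup>+r'. (ennreal T0 * indicator {r-\<delta><..<r+\<delta>} r' + ennreal S0 * indicator {0..1} r') \<partial>lborel)"
    proof (rule nn_integral_mono)
      fix r'
      have "w (r' - r) * j r' \<le> T0 * indicator {r-\<delta><..<r+\<delta>} r' + S0 * indicator {0..1} r'"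
        using T0 S0 by (auto simp: w_def j_def indicator_def)
      then have "ennreal (w (r' - r) * j r') \<le> ennreal (T0 * indicator {r-\<delta><..<r+\<delta>} r' + S0 * indicator {0..1} r')" by (rule ennreal_leI)
      also have "\<dots> = ennreal T0 * indicator {r-\<delta><..<r+\<delta>} r' + ennreal S0 * indicator {0..1} r'"
        using T0 S0 by (auto simp: indicator_def)
      finally show "ennreal (w (r' - r) * j r') \<le> \<dots>" .
    qed
    also have "\<dots> = ennreal (2 * \<delta> * T0 + S0)"
      using T0 S0 \<delta> by (simp add: nn_integral_add nn_integral_cmult_indicator ennreal_mult' ennreal_plus mult_ac flip: ennreal_mult)
    finally show ?thesis .
  qed
  have ws: "w (- x) = w x" for x by (auto simp: w_def indicator_def)
  have fin: "(\<integral>\<^sup>+r. \<integral>\<^sup>+r'. ennreal (A r * j r' * w (r' - r)) \<partial>lborel \<partial>lborel) \<le> ennreal (2 * \<delta> * T0 + S0) * (\<integral>\<^sup>+r. ennreal (A r) \<partial>lborel)"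
  proof -
    have "(\<integral>\<^sup>+r. \<integral>\<^sup>+r'. ennreal (A r * j r' * w (r' - r)) \<partial>lborel \<partial>lborel) = (\<integral>\<^sup>+r. ennreal (A r) * (\<integral>\<^sup>+r'. ennreal (w (r' - r) * j r') \<partial>lborel) \<partial>lborel)"
      using A0 j0 w0 by (simp flip: nn_integral_cmult ennreal_mult add: mult_ac)
    also have "\<dots> \<le> (\<integral>\<^sup>+r. ennreal (A r) * ennreal (2 * \<delta> * T0 + S0) \<partial>lborel)"
      by (intro nn_integral_mono mult_left_mono wj) auto
    finally show ?thesis by (simp add: nn_integral_multc mult.commute)
  qed
  have fin': "(\<integral>\<^sup>+r. \<integral>\<^sup>+r'. ennreal (A r' * j r * w (r' - r)) \<partial>lborel \<partial>lborel) \<le> ennreal (2 * \<delta> * T0 + S0) * (\<integral>\<^sup>+r. ennreal (A r) \<partial>lborel)"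
  proof -
    have "(\<integral>\<^sup>+r. \<integral>\<^sup>+r'. ennreal (A r' * j r * w (r' - r)) \<partial>lborel \<partial>lborel) = (\<integral>\<^sup>+r'. \<integral>\<^sup>+r. ennreal (A r' * j r * w (r' - r)) \<partial>lborel \<partial>lborel)"
      by (rule lborel_pair.Fubini') measurable
    also have "\<dots> = (\<integral>\<^sup>+r'. \<integral>\<^sup>+r. ennreal (A r' * j r * w (r - r')) \<partial>lborel \<partial>lborel)"
    proof -
      have "w (r' - r) = w (r - r')" for r r' using ws[of "r - r'"] by simp
      then show ?thesis by simp
    qed
    finally show ?thesis using fin by simp
  qed
  have "cmod (LINT r|lborel. \<alpha>0 r * (LINT r'|lborel. cnj (\<alpha>0 r') * I r r')) \<le> (2 * \<delta> * T0 + S0) * (LINT r|lborel. A r)"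
  proof -
    have Ai: "integrable lborel A" unfolding A_def \<alpha>0_def
      by (rule Bochner_Integration.integrable_bound[OF a2]) (auto simp: indicator_def)
    have "ennreal (cmod (LINT r|lborel. \<alpha>0 r * (LINT r'|lborel. cnj (\<alpha>0 r') * I r r'))) \<le> (\<integral>\<^sup>+r. cmod (\<alpha>0 r * (LINT r'|lborel. cnj (\<alpha>0 r') * I r r')) \<partial>lborel)"
      by (rule norm_LINT_le_nn_integral)
    also have "\<dots> \<le> (\<integral>\<^sup>+r. \<integral>\<^sup>+r'. ennreal ((A r * j r' * w (r' - r) + A r' * j r * w (r' - r)) / 2) \<partial>lborel \<partial>lborel)"
    proof (rule nn_integral_mono)
      fix r
      have "ennreal (cmod (\<alpha>0 r * (LINT r'|lborel. cnj (\<alpha>0 r') * I r r'))) = ennreal (cmod (LINT r'|lborel. \<alpha>0 r * (cnj (\<alpha>0 r') * I r r')))" by simp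
      also have "\<dots> \<le> (\<integral>\<^sup>+r'. ennreal (cmod (\<alpha>0 r * (cnj (\<alpha>0 r') * I r r'))) \<partial>lborel)"
        by (rule norm_LINT_le_nn_integral)
      also have "\<dots> \<le> (\<integral>\<^sup>+r'. ennreal ((A r * j r' * w (r' - r) + A r' * j r * w (r' - r)) / 2) \<partial>lborel)"
      proof (intro nn_integral_mono ennreal_leI)
        fix r'
        have "cmod (\<alpha>0 r) * cmod (\<alpha>0 r') \<le> (A r * j r' + A r' * j r) / 2"
          using sum_squares_bound[of "cmod (\<alpha>0 r)" "cmod (\<alpha>0 r')"]
          by (auto simp: A_def j_def \<alpha>0_def indicator_def)
        then have "cmod (\<alpha>0 r) * cmod (\<alpha>0 r') * cmod (I r r') \<le> (A r * j r' + A r' * j r) / 2 * w (r' - r)"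
          using Iw A0 j0 by (intro mult_mono) auto
        then show "cmod (\<alpha>0 r * (cnj (\<alpha>0 r') * I r r')) \<le> (A r * j r' * w (r' - r) + A r' * j r * w (r' - r)) / 2"
          by (simp add: norm_mult algebra_simps)
      qed
      finally show "ennreal (cmod (\<alpha>0 r * (LINT r'|lborel. cnj (\<alpha>0 r') * I r r'))) \<le> \<dots>" .
    qed
    also have "\<dots> = (\<integral>\<^sup>+r. \<integral>\<^sup>+r'. (ennreal (1/2) * ennreal (A r * j r' * w (r' - r)) + ennreal (1/2) * ennreal (A r' * j r * w (r' - r))) \<partial>lborel \<partial>lborel)"
    proof (intro nn_integral_cong)
      have half: "ennreal ((x + y) / 2) = ennreal (1/2) * ennreal x + ennreal (1/2) * ennreal y" if "0 \<le> x" "0 \<le> y" for x y :: real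
      proof -
        have "ennreal ((x + y) / 2) = ennreal (1/2 * x + 1/2 * y)" by (rule arg_cong[of _ _ ennreal]) simp
        also have "\<dots> = ennreal (1/2 * x) + ennreal (1/2 * y)" using that by (intro ennreal_plus) auto
        also have "\<dots> = ennreal (1/2) * ennreal x + ennreal (1/2) * ennreal y"
          using that ennreal_mult[of "1/2" x] ennreal_mult[of "1/2" y] by (simp only: zero_le_divide_1_iff zero_le_numeral)
        finally show ?thesis .
      qed
      fix r r'
      show "ennreal ((A r * j r' * w (r' - r) + A r' * j r * w (r' - r)) / 2) = ennreal (1/2) * ennreal (A r * j r' * w (r' - r)) + ennreal (1/2) * ennreal (A r' * j r * w (r' - r))"
        by (intro half mult_nonneg_nonneg A0 j0 w0)
    qed
    also have "\<dots> = ennreal (1/2) * (\<integral>\<^sup>+r. \<integral>\<^sup>+r'. ennreal (A r * j r' * w (r' - r)) \<partial>lborel \<partial>lborel) + ennreal (1/2) * (\<integral>\<^sup>+r. \<integral>\<^sup>+r'. ennreal (A r' * j r * w (r' - r)) \<partial>lborel \<partial>lborel)"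
      by (simp add: nn_integral_add nn_integral_cmult)
    also have "\<dots> \<le> ennreal (1/2) * (ennreal (2 * \<delta> * T0 + S0) * (\<integral>\<^sup>+r. ennreal (A r) \<partial>lborel)) + ennreal (1/2) * (ennreal (2 * \<delta> * T0 + S0) * (\<integral>\<^sup>+r. ennreal (A r) \<partial>lborel))"
      by (intro add_mono mult_left_mono fin fin') auto
    also have "\<dots> = ennreal ((2 * \<delta> * T0 + S0) * (LINT r|lborel. A r))"
    proof -
      have "(\<integral>\<^sup>+r. ennreal (A r) \<partial>lborel) = ennreal (LINT r|lborel. A r)" using Ai A0 by (intro nn_integral_eq_integral) auto
      moreover have "ennreal (1/2) * X + ennreal (1/2) * X = X" for X
      proof -
        have "ennreal (1/2) + ennreal (1/2) = ennreal (1/2 + 1/2)" by (rule ennreal_plus[symmetric]) auto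
        then have h1: "ennreal (1/2) + ennreal (1/2) = 1" by (simp only: field_sum_of_halves ennreal_1)
        show ?thesis by (simp only: distrib_right[symmetric] h1 mult_1_left)
      qed
      ultimately show ?thesis using T0 S0 \<delta> A0 by (simp only: ennreal_mult integral_nonneg_AE add_nonneg_nonneg mult_nonneg_nonneg) (simp add: ennreal_mult integral_nonneg_AE)
    qed
    finally show ?thesis using T0 S0 \<delta> A0 by (subst (asm) ennreal_le_iff) (auto simp: integral_nonneg_AE)
  qed
  moreover have "(LINT r|lborel. A r) \<le> (LINT r|lborel. (cmod (\<alpha> r))\<^sup>2)"
    unfolding A_def \<alpha>0_def by (rule integral_mono'[OF a2]) (auto simp: indicator_def)
  ultimately have H2b: "(LINT v|lborel. (cmod (Hh v))\<^sup>2) \<le> (2 * \<delta> * T0 + S0) * (LINT r|lborel. (cmod (\<alpha> r))\<^sup>2)"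
    unfolding eq2[symmetric] using T0 S0 \<delta>
    by (smt (verit) mult_left_mono mult_nonneg_nonneg norm_of_real abs_ge_self)
  have "(cmod (LINT r|lborel. \<alpha> r * (LINT v|lborel. \<gamma> v * k r v)))\<^sup>2 \<le> (sqrt (LINT v|lborel. (cmod (\<gamma> v))\<^sup>2) * sqrt (LINT v|lborel. (cmod (Hh v))\<^sup>2))\<^sup>2"
    unfolding eq1 by (intro power_mono c1) auto
  also have "\<dots> = (LINT v|lborel. (cmod (\<gamma> v))\<^sup>2) * (LINT v|lborel. (cmod (Hh v))\<^sup>2)"
    by (simp add: power_mult_distrib)
  also have "\<dots> \<le> (LINT v|lborel. (cmod (\<gamma> v))\<^sup>2) * ((2 * \<delta> * T0 + S0) * (LINT r|lborel. (cmod (\<alpha> r))\<^sup>2))"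
    by (intro mult_left_mono H2b) auto
  finally show ?thesis by (simp add: mult_ac)
qed

text \<open>Convexity of the exponential, in the form \<open>exp (A - B) - 1 \<ge> A - B\<close>. It
  converts a separation of logarithms into a separation of ratios.\<close>

lemma exp_diff_lower:
  fixes A B m :: real
  assumes "exp A \<ge> m" "exp B \<ge> m" "m \<ge> 0"
  shows "\<bar>exp A - exp B\<bar> \<ge> m * \<bar>A - B\<bar>"
proof -
  have *: "\<bar>exp A - exp B\<bar> \<ge> m * \<bar>A - B\<bar>" if "A \<ge> B" "exp B \<ge> m" for A B
  proof -
    have "exp A - exp B = exp B * (exp (A - B) - 1)" by (simp add: exp_diff field_simps)
    also have "\<dots> \<ge> m * (A - B)"
    proof (intro mult_mono)
      show "A - B \<le> exp (A - B) - 1" using exp_ge_add_one_self[of "A - B"] by linarith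
    qed (use that assms(3) in auto)
    finally show ?thesis using that by simp
  qed
  show ?thesis using *[of A B] *[of B A] assms by (cases "A \<ge> B") (auto simp: abs_minus_commute)
qed

section \<open>Separation of slopes along a level curve\<close>

context curve
begin

lemma P_lipschitz_below:
  assumes "a \<le> x" "x \<le> b" "a \<le> y" "y \<le> b"
  shows "\<bar>P x - P y\<bar> \<ge> \<bar>x - y\<bar> / K"
proof -
  have *: "\<bar>P x - P y\<bar> \<ge> \<bar>x - y\<bar> / K" if "x < y" "a \<le> x" "y \<le> b" for x y
  proof -
    obtain z where z: "x < z" "z < y" "P y - P x = (y - x) * P1 z"
      using MVT2[OF \<open>x < y\<close>, of P P1] dP(1) by blast
    have "\<bar>P x - P y\<bar> = \<bar>x - y\<bar> * \<bar>P1 z\<bar>" using z by (metis abs_minus_commute abs_mult)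
    also have "\<dots> \<ge> \<bar>x - y\<bar> * (1 / K)" using P_ge(1)[of z] z that by (intro mult_left_mono) auto
    finally show ?thesis by simp
  qed
  show ?thesis using *[of x y] *[of y x] assms by (cases x y rule: linorder_cases) (auto simp: abs_minus_commute)
qed

lemma P_lipschitz:
  assumes "a \<le> x" "x \<le> b" "a \<le> y" "y \<le> b"
  shows "\<bar>P x - P y\<bar> \<le> K * \<bar>x - y\<bar>"
proof -
  have *: "\<bar>P x - P y\<bar> \<le> K * \<bar>x - y\<bar>" if "x < y" "a \<le> x" "y \<le> b" for x y
  proof -
    obtain z where z: "x < z" "z < y" "P y - P x = (y - x) * P1 z"
      using MVT2[OF \<open>x < y\<close>, of P P1] dP(1) by blast
    have "\<bar>P x - P y\<bar> = \<bar>x - y\<bar> * \<bar>P1 z\<bar>" using z by (metis abs_minus_commute abs_mult)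
    also have "\<dots> \<le> \<bar>x - y\<bar> * K" using P_le(1)[of z] z that by (intro mult_left_mono) auto
    finally show ?thesis by (simp add: mult.commute)
  qed
  show ?thesis using *[of x y] *[of y x] assms by (cases x y rule: linorder_cases) (auto simp: abs_minus_commute)
qed

lemma P1m1_le: "a \<le> x \<Longrightarrow> x \<le> b \<Longrightarrow> \<bar>P1 x - 1\<bar> \<le> 2 * K"
  using P_le(1)[of x] K2 by linarith

lemma P1_nz: "a \<le> x \<Longrightarrow> x \<le> b \<Longrightarrow> P1 x \<noteq> 0"
  and P1m1_nz: "a \<le> x \<Longrightarrow> x \<le> b \<Longrightarrow> P1 x - 1 \<noteq> 0"
  and P2_nz: "a \<le> x \<Longrightarrow> x \<le> b \<Longrightarrow> P2 x \<noteq> 0"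
  using P_ge[of x] K_pos by (smt (verit) divide_pos_pos)+

text \<open>The logarithm of the ratio \<open>(P' q - 1) / (P' p - 1)\<close>, as a function of \<open>P p\<close> along the level
  curve \<open>P q - P p = v\<close>, has derivative \<open>W q - W p\<close> with \<open>W = P'' / (P' (P' - 1))\<close>; its square is used to
  avoid a sign discussion.\<close>

lemma slope_separation:
  assumes \<rho>: "\<rho> > 0" and pq: "a \<le> p" "p + \<rho> \<le> q" "q \<le> b" and pq': "a \<le> p'" "p' + \<rho> \<le> q'" "q' \<le> b"
    and level: "P q - P p = P q' - P p'"
  shows "\<bar>(P1 p - 1) / (P1 q - P1 p) - (P1 p' - 1) / (P1 q' - P1 p')\<bar> \<ge> \<rho> * \<bar>(q - p) - (q' - p')\<bar> / (64 * K ^ 16)"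
proof -
  define v where "v = P q - P p"
  have injP: "inj_on P {a..b}"
  proof (rule inj_onI)
    fix x y assume "x \<in> {a..b}" "y \<in> {a..b}" "P x = P y"
    then show "x = y" using P_lipschitz_below[of x y] K_pos by (auto simp: field_simps)
  qed
  define \<phi> where "\<phi> = inv_into {a..b} P"
  have \<phi>P: "\<phi> (P x) = x" if "a \<le> x" "x \<le> b" for x unfolding \<phi>_def using injP that by (intro inv_into_f_f) auto
  obtain c d where cd: "c \<le> d" "P ` {a..b} = {c..d}" "continuous_on {c..d} \<phi>"
    and \<phi>: "\<And>y. c \<le> y \<Longrightarrow> y \<le> d \<Longrightarrow> a \<le> \<phi> y \<and> \<phi> y \<le> b \<and> P (\<phi> y) = y"
    and d\<phi>: "\<And>y. c < y \<Longrightarrow> y < d \<Longrightarrow> (\<phi> has_real_derivative 1 / P1 (\<phi> y)) (at y)"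
    by (rule monotone_inverse[OF ab(1) dP(1) P1_nz \<phi>P]) auto
  have Pcd: "c \<le> P x \<and> P x \<le> d" if "a \<le> x" "x \<le> b" for x using cd(2) that by (metis atLeastAtMost_iff image_eqI)
  define N where "N y = ln ((P1 (\<phi> y) - 1)\<^sup>2)" for y
  define W where "W x = P2 x / (P1 x * (P1 x - 1))" for x
  have Nc: "continuous_on {c..d} N" unfolding N_def
    by (intro continuous_intros continuous_on_compose2[OF contP(2)[of UNIV] cd(3)]) (use \<phi> P1m1_nz in auto)
  have dN: "(N has_real_derivative 2 * W (\<phi> y)) (at y)" if y: "c < y" "y < d" for y
  proof -
    have nz: "P1 (\<phi> y) - 1 \<noteq> 0" "P1 (\<phi> y) \<noteq> 0" using \<phi>[of y] y P1m1_nz P1_nz by auto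
    have "((\<lambda>y. P1 (\<phi> y)) has_real_derivative P2 (\<phi> y) * (1 / P1 (\<phi> y))) (at y)"
      by (rule DERIV_chain2[OF dP(2) d\<phi>[OF y]])
    from DERIV_power[OF DERIV_diff[OF this DERIV_const[of 1]], of 2]
    have "((\<lambda>y. (P1 (\<phi> y) - 1)\<^sup>2) has_real_derivative 2 * (P2 (\<phi> y) / P1 (\<phi> y)) * (P1 (\<phi> y) - 1)) (at y)"
      by (simp add: mult_ac)
    from DERIV_chain2[OF DERIV_ln this]
    have "(N has_real_derivative inverse ((P1 (\<phi> y) - 1)\<^sup>2) * (2 * (P2 (\<phi> y) / P1 (\<phi> y)) * (P1 (\<phi> y) - 1))) (at y)"
      unfolding N_def using nz by simp
    moreover have "inverse ((P1 (\<phi> y) - 1)\<^sup>2) * (2 * (P2 (\<phi> y) / P1 (\<phi> y)) * (P1 (\<phi> y) - 1)) = 2 * W (\<phi> y)"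
    proof -
      have "inverse (u\<^sup>2) * (2 * (t / w) * u) = 2 * (t / (w * u))" if "u \<noteq> 0" "w \<noteq> 0" for u w t :: real
        using that by (simp add: field_simps power2_eq_square)
      then show ?thesis unfolding W_def using nz by blast
    qed
    ultimately show ?thesis by simp
  qed
  have vge: "\<bar>v\<bar> \<ge> \<rho> / K"
  proof -
    have "\<rho> / K \<le> \<bar>q - p\<bar> / K" using pq \<rho> K_pos by (intro divide_right_mono) auto
    also have "\<dots> \<le> \<bar>v\<bar>" unfolding v_def using pq \<rho> by (intro P_lipschitz_below) auto
    finally show ?thesis .
  qed
  define G where "G y = N (y + v) - N y" for y
  \<comment> \<open>The parameters \<open>\<phi> z\<close> and \<open>\<phi> (z + v)\<close> stay at
    least \<open>\<rho> / K ^ 2\<close> apart, because their images under \<open>P\<close> differ by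
    \<open>v\<close>. So \<open>W_ge\<close> keeps the derivative of \<open>G\<close> away from 0,
    and the mean value theorem applies.\<close>
  have Gsep: "\<bar>G y1 - G y2\<bar> \<ge> 2 * \<rho> * \<bar>y1 - y2\<bar> / K ^ 3"
    if y: "y1 < y2" "c \<le> y1" "c \<le> y1 + v" "y2 \<le> d" "y2 + v \<le> d" for y1 y2
  proof -
    have Gc: "continuous_on {y1..y2} G" unfolding G_def
      by (intro continuous_intros continuous_on_compose2[OF Nc] continuous_on_subset[OF Nc]) (use y in auto)
    have dG: "(G has_real_derivative 2 * W (\<phi> (z + v)) - 2 * W (\<phi> z)) (at z)" if "y1 < z" "z < y2" for z
    proof -
      have "((\<lambda>y. N (y + v)) has_real_derivative 2 * W (\<phi> (z + v)) * 1) (at z)"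
        by (rule DERIV_chain2[OF dN]) (use that y in \<open>auto intro!: derivative_eq_intros\<close>)
      moreover have "(N has_real_derivative 2 * W (\<phi> z)) (at z)" using that y by (intro dN) auto
      ultimately show ?thesis unfolding G_def by (intro DERIV_diff) auto
    qed
    obtain l z where z: "y1 < z" "z < y2" "(G has_real_derivative l) (at z)" "G y2 - G y1 = (y2 - y1) * l"
      using MVT[OF y(1) Gc] dG unfolding real_differentiable_def by blast
    have l: "l = 2 * W (\<phi> (z + v)) - 2 * W (\<phi> z)" using DERIV_unique[OF z(3) dG[OF z(1,2)]] .
    have f1: "a \<le> \<phi> z \<and> \<phi> z \<le> b \<and> P (\<phi> z) = z" using \<phi>[of z] z y by auto
    have f2: "a \<le> \<phi> (z + v) \<and> \<phi> (z + v) \<le> b \<and> P (\<phi> (z + v)) = z + v" using \<phi>[of "z + v"] z y by auto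
    have "\<rho> / K \<le> \<bar>P (\<phi> (z + v)) - P (\<phi> z)\<bar>" using f1 f2 vge by simp
    also have "\<dots> \<le> K * \<bar>\<phi> (z + v) - \<phi> z\<bar>" using f1 f2 by (intro P_lipschitz) auto
    finally have s1: "\<bar>\<phi> (z + v) - \<phi> z\<bar> \<ge> \<rho> / K ^ 2" using K_pos by (simp add: field_simps power2_eq_square)
    have "\<rho> / K ^ 3 = \<rho> / K ^ 2 / K" by (simp add: power_numeral_reduce)
    also have "\<dots> \<le> \<bar>\<phi> (z + v) - \<phi> z\<bar> / K" using s1 K_pos by (intro divide_right_mono) auto
    also have "\<dots> \<le> \<bar>W (\<phi> (z + v)) - W (\<phi> z)\<bar>" unfolding W_def using f1 f2 by (intro W_ge) auto
    finally have "\<bar>l\<bar> \<ge> 2 * (\<rho> / K ^ 3)" unfolding l by linarith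
    then have "(y2 - y1) * (2 * (\<rho> / K ^ 3)) \<le> (y2 - y1) * \<bar>l\<bar>" using y by (intro mult_left_mono) auto
    also have "\<dots> = \<bar>G y1 - G y2\<bar>" using z(4) y(1) by (metis abs_minus_commute abs_mult abs_of_pos diff_gt_0_iff_gt)
    finally show ?thesis using y by (simp add: mult_ac)
  qed
  have in_cd: "c \<le> P p" "c \<le> P p + v" "P p \<le> d" "P p + v \<le> d" "c \<le> P p'" "c \<le> P p' + v" "P p' \<le> d" "P p' + v \<le> d"
    using Pcd[of p] Pcd[of q] Pcd[of p'] Pcd[of q'] pq pq' \<rho> level by (auto simp: v_def)
  have GG: "\<bar>G (P p) - G (P p')\<bar> \<ge> 2 * \<rho> * \<bar>P p - P p'\<bar> / K ^ 3"
    using Gsep[of "P p" "P p'"] Gsep[of "P p'" "P p"] in_cd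
    by (cases "P p" "P p'" rule: linorder_cases) (auto simp: abs_minus_commute)
  define x where "x = (P1 q - 1) / (P1 p - 1)"
  define x' where "x' = (P1 q' - 1) / (P1 p' - 1)"
  have exG: "exp (G (P p)) = ((P1 q - 1) / (P1 p - 1))\<^sup>2" if "a \<le> p" "p \<le> b" "a \<le> q" "q \<le> b" "P q - P p = v" for p q
  proof -
    have "P p + v = P q" using that by simp
    then have "G (P p) = ln ((P1 q - 1)\<^sup>2) - ln ((P1 p - 1)\<^sup>2)" using that(1-4) \<phi>P by (simp add: G_def N_def)
    also have "\<dots> = ln ((P1 q - 1)\<^sup>2 / (P1 p - 1)\<^sup>2)" using that P1m1_nz by (simp add: ln_div)
    finally show ?thesis using that P1m1_nz by (simp add: power_divide)
  qed
  have xe: "exp (G (P p)) = x\<^sup>2" "exp (G (P p')) = x'\<^sup>2"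
    unfolding x_def x'_def by (rule exG; use pq pq' \<rho> level in \<open>auto simp: v_def\<close>)+
  have ratio: "\<bar>(P1 q - 1) / (P1 p - 1)\<bar> \<le> 2 * K\<^sup>2 \<and> \<bar>(P1 q - 1) / (P1 p - 1)\<bar> \<ge> 1 / (2 * K\<^sup>2)"
    if "a \<le> p" "p \<le> b" "a \<le> q" "q \<le> b" for p q
  proof
    have "\<bar>(P1 q - 1) / (P1 p - 1)\<bar> \<le> 2 * K / (1 / K)" unfolding abs_divide using that K_pos
      by (intro frac_le P1m1_le P_ge) auto
    then show "\<bar>(P1 q - 1) / (P1 p - 1)\<bar> \<le> 2 * K\<^sup>2" by (simp add: power2_eq_square)
    have "\<bar>(P1 q - 1) / (P1 p - 1)\<bar> \<ge> (1 / K) / (2 * K)" unfolding abs_divide using that K_pos P1m1_nz[of p]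
      by (intro frac_le P1m1_le P_ge) auto
    then show "\<bar>(P1 q - 1) / (P1 p - 1)\<bar> \<ge> 1 / (2 * K\<^sup>2)" by (simp add: power2_eq_square)
  qed
  have xb: "\<bar>x\<bar> \<le> 2 * K\<^sup>2" "\<bar>x\<bar> \<ge> 1 / (2 * K\<^sup>2)" "\<bar>x'\<bar> \<le> 2 * K\<^sup>2" "\<bar>x'\<bar> \<ge> 1 / (2 * K\<^sup>2)"
    unfolding x_def x'_def using ratio[of p q] ratio[of p' q'] pq pq' \<rho> by auto
  have sqb: "y\<^sup>2 \<ge> 1 / (4 * K ^ 4)" if "\<bar>y\<bar> \<ge> 1 / (2 * K\<^sup>2)" for y :: real
  proof -
    have "(1 / (2 * K\<^sup>2))\<^sup>2 \<le> \<bar>y\<bar>\<^sup>2" using that K_pos by (intro power_mono) auto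
    then show ?thesis by (simp add: power_divide power_mult_distrib flip: power_mult)
  qed
  have "\<bar>x\<^sup>2 - x'\<^sup>2\<bar> \<ge> 1 / (4 * K ^ 4) * \<bar>G (P p) - G (P p')\<bar>"
    unfolding xe[symmetric] using sqb[OF xb(2)] sqb[OF xb(4)] K_pos by (intro exp_diff_lower) (auto simp: xe)
  moreover have "1 / (4 * K ^ 4) * \<bar>G (P p) - G (P p')\<bar> \<ge> 1 / (4 * K ^ 4) * (2 * \<rho> * (\<bar>p - p'\<bar> / K) / K ^ 3)"
  proof (intro mult_left_mono order_trans[OF _ GG] divide_right_mono)
    show "\<bar>p - p'\<bar> / K \<le> \<bar>P p - P p'\<bar>" using pq pq' \<rho> by (intro P_lipschitz_below) auto
  qed (use K_pos \<rho> in auto)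
  moreover have "\<bar>x\<^sup>2 - x'\<^sup>2\<bar> \<le> \<bar>x - x'\<bar> * (4 * K\<^sup>2)"
  proof -
    have "\<bar>x\<^sup>2 - x'\<^sup>2\<bar> = \<bar>x - x'\<bar> * \<bar>x + x'\<bar>" by (simp add: abs_mult[symmetric] power2_eq_square algebra_simps)
    also have "\<dots> \<le> \<bar>x - x'\<bar> * (4 * K\<^sup>2)" using xb by (intro mult_left_mono) auto
    finally show ?thesis .
  qed
  ultimately have "1 / (4 * K ^ 4) * (2 * \<rho> * (\<bar>p - p'\<bar> / K) / K ^ 3) \<le> \<bar>x - x'\<bar> * (4 * K\<^sup>2)" by linarith
  then have xd: "\<rho> * \<bar>p - p'\<bar> / (8 * K ^ 10) \<le> \<bar>x - x'\<bar>" using K_pos by (simp add: field_simps power_numeral_reduce)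
  \<comment> \<open>On a common level \<open>P q - P q' = P p - P p'\<close>, so
    \<open>p - p'\<close> controls \<open>q - q'\<close> and with it the difference of the two
    gaps.\<close>
  have rr: "\<bar>(q - p) - (q' - p')\<bar> \<le> 2 * K\<^sup>2 * \<bar>p - p'\<bar>"
  proof -
    have "\<bar>q - q'\<bar> / K \<le> \<bar>P q - P q'\<bar>" using pq pq' \<rho> by (intro P_lipschitz_below) auto
    also have "\<dots> = \<bar>P p - P p'\<bar>" using level by (simp add: abs_if)
    also have "\<dots> \<le> K * \<bar>p - p'\<bar>" using pq pq' \<rho> by (intro P_lipschitz) auto
    finally have "\<bar>q - q'\<bar> \<le> K\<^sup>2 * \<bar>p - p'\<bar>" using K_pos by (simp add: field_simps power2_eq_square)
    moreover have "1 * \<bar>p - p'\<bar> \<le> K\<^sup>2 * \<bar>p - p'\<bar>" using K_power[of 0 2] by (intro mult_right_mono) auto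
    moreover have "\<bar>(q - p) - (q' - p')\<bar> \<le> \<bar>q - q'\<bar> + \<bar>p - p'\<bar>" by linarith
    ultimately have "\<bar>(q - p) - (q' - p')\<bar> \<le> K\<^sup>2 * \<bar>p - p'\<bar> + K\<^sup>2 * \<bar>p - p'\<bar>"
      unfolding mult_1_left by (meson add_mono order_trans)
    then show ?thesis by (simp only: mult_2 distrib_right)
  qed
  \<comment> \<open>The slope equals \<open>1 / (x - 1)\<close> for the ratio
    \<open>x = (P1 q - 1) / (P1 p - 1)\<close>. Since \<open>|x - 1| \<le> 2 * K^2\<close>,
    separated ratios have separated slopes.\<close>
  have Lx: "(P1 p - 1) / (P1 q - P1 p) = 1 / ((P1 q - 1) / (P1 p - 1) - 1)" "(P1 q - 1) / (P1 p - 1) - 1 \<noteq> 0" "\<bar>(P1 q - 1) / (P1 p - 1) - 1\<bar> \<le> 2 * K\<^sup>2"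
    if "a \<le> p" "p < q" "q \<le> b" for p q
  proof -
    have nz: "P1 p - 1 \<noteq> 0" using that P1m1_nz by auto
    have e: "(P1 q - 1) / (P1 p - 1) - 1 = (P1 q - P1 p) / (P1 p - 1)" using nz by (simp add: field_simps)
    have "\<bar>P1 q - P1 p\<bar> \<ge> \<bar>q - p\<bar> / K" using that by (intro P1_lipschitz_below) auto
    moreover have "\<bar>q - p\<bar> / K > 0" using that K_pos by auto
    ultimately have d: "P1 q - P1 p \<noteq> 0" by auto
    show "(P1 p - 1) / (P1 q - P1 p) = 1 / ((P1 q - 1) / (P1 p - 1) - 1)" "(P1 q - 1) / (P1 p - 1) - 1 \<noteq> 0" unfolding e using nz d by simp_all
    have "\<bar>P1 q - P1 p\<bar> \<le> 2 * K" using P_le(1)[of p] P_le(1)[of q] that by linarith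
    then have "\<bar>P1 q - P1 p\<bar> / \<bar>P1 p - 1\<bar> \<le> 2 * K / (1 / K)" using that K_pos by (intro frac_le P_ge) auto
    then show "\<bar>(P1 q - 1) / (P1 p - 1) - 1\<bar> \<le> 2 * K\<^sup>2" unfolding e by (simp add: abs_divide power2_eq_square)
  qed
  have pq2: "p < q" "p' < q'" using pq pq' \<rho> by auto
  have "\<bar>(P1 p - 1) / (P1 q - P1 p) - (P1 p' - 1) / (P1 q' - P1 p')\<bar> = \<bar>x - x'\<bar> / (\<bar>x - 1\<bar> * \<bar>x' - 1\<bar>)"
  proof -
    have nz: "x - 1 \<noteq> 0" "x' - 1 \<noteq> 0" unfolding x_def x'_def using Lx(2)[of p q] Lx(2)[of p' q'] pq pq' pq2 by auto
    have "(P1 p - 1) / (P1 q - P1 p) - (P1 p' - 1) / (P1 q' - P1 p') = 1 / (x - 1) - 1 / (x' - 1)"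
      unfolding x_def x'_def using Lx(1)[of p q] Lx(1)[of p' q'] pq pq' pq2 by auto
    also have "\<dots> = (x' - x) / ((x - 1) * (x' - 1))" using nz by (simp add: field_simps)
    finally show ?thesis by (simp add: abs_divide abs_mult abs_minus_commute)
  qed
  also have "\<dots> \<ge> \<bar>x - x'\<bar> / ((2 * K\<^sup>2) * (2 * K\<^sup>2))"
    using Lx(2,3)[of p q] Lx(2,3)[of p' q'] pq pq' pq2 K_pos unfolding x_def[symmetric] x'_def[symmetric]
    by (intro divide_left_mono mult_mono mult_pos_pos) auto
  also have "\<bar>x - x'\<bar> / ((2 * K\<^sup>2) * (2 * K\<^sup>2)) \<ge> (\<rho> * \<bar>p - p'\<bar> / (8 * K ^ 10)) / ((2 * K\<^sup>2) * (2 * K\<^sup>2))"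
    using xd by (intro divide_right_mono) auto
  also have "(\<rho> * \<bar>p - p'\<bar> / (8 * K ^ 10)) / ((2 * K\<^sup>2) * (2 * K\<^sup>2)) \<ge> (\<rho> * (\<bar>(q - p) - (q' - p')\<bar> / (2 * K\<^sup>2)) / (8 * K ^ 10)) / ((2 * K\<^sup>2) * (2 * K\<^sup>2))"
    using rr \<rho> K_pos by (intro divide_right_mono mult_left_mono) (auto simp: field_simps)
  also have "(\<rho> * (\<bar>(q - p) - (q' - p')\<bar> / (2 * K\<^sup>2)) / (8 * K ^ 10)) / ((2 * K\<^sup>2) * (2 * K\<^sup>2)) = \<rho> * \<bar>(q - p) - (q' - p')\<bar> / (64 * K ^ 16)"
    using K_pos by (simp add: field_simps power_numeral_reduce)
  finally show ?thesis .
qed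

end

lemma LINT_Icc_eq_integral:
  fixes f :: "real \<Rightarrow> complex"
  assumes "continuous_on {c..d} f"
  shows "(LINT v|lborel. (if c \<le> v \<and> v \<le> d then f v else 0)) = integral {c..d} f"
    and "integrable lborel (\<lambda>v. if c \<le> v \<and> v \<le> d then f v else 0)"
proof -
  have e: "(\<lambda>v. indicator {c..d} v *\<^sub>R f v) = (\<lambda>v. if c \<le> v \<and> v \<le> d then f v else 0)" by (auto simp: indicator_def)
  show "(LINT v|lborel. (if c \<le> v \<and> v \<le> d then f v else 0)) = integral {c..d} f"
    using set_borel_integral_eq_integral(2)[OF borel_integrable_atLeastAtMost'[OF assms]]
    unfolding set_lebesgue_integral_def e .
  show "integrable lborel (\<lambda>v. if c \<le> v \<and> v \<le> d then f v else 0)"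
    using borel_integrable_atLeastAtMost'[OF assms] unfolding set_integrable_def e .
qed

section \<open>The kernel in the coordinates \<open>r\<close> and \<open>v\<close>\<close>

context curve
begin

text \<open>Pairs of points \<open>p\<close>, \<open>q = p + r\<close> of the parameter interval are described by \<open>r\<close> and
  \<open>v = P q - P p = lev r p\<close>; \<open>kern\<close> is the amplitude and phase in these coordinates, including the Jacobian
  of \<open>p \<mapsto> v\<close>.\<close>

definition lev :: "real \<Rightarrow> real \<Rightarrow> real" where "lev r p = P (p + r) - P p"

definition kdom :: "real \<Rightarrow> (real \<times> real) set" where
  "kdom \<rho> = {z. \<rho> \<le> fst z \<and> a \<le> snd z \<and> snd z + fst z \<le> b}"

definition kmap :: "real \<times> real \<Rightarrow> real \<times> real" where "kmap z = (fst z, lev (fst z) (snd z))"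

definition kinv :: "real \<Rightarrow> real \<Rightarrow> real \<Rightarrow> real" where
  "kinv \<rho> r v = snd (inv_into (kdom \<rho>) kmap (r, v))"

definition kern :: "real \<Rightarrow> real \<Rightarrow> real \<Rightarrow> real \<Rightarrow> complex" where
  "kern \<rho> \<tau> r v = (if (r, v) \<in> kmap ` kdom \<rho>
     then of_real (chi (kinv \<rho> r v) * chi (kinv \<rho> r v + r) / \<bar>P1 (kinv \<rho> r v + r) - P1 (kinv \<rho> r v)\<bar>)
       * ee (\<tau> * (P (kinv \<rho> r v) - kinv \<rho> r v)) else 0)"

lemma lev_deriv: "(lev r has_real_derivative P1 (p + r) - P1 p) (at p)"
  unfolding lev_def by (auto intro!: derivative_eq_intros DERIV_chain2[OF dP(1)] dP)

lemma lev_deriv_ge: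
  assumes "a \<le> p" "p + r \<le> b" "\<rho> \<le> r" "0 < \<rho>"
  shows "\<bar>P1 (p + r) - P1 p\<bar> \<ge> \<rho> / K" "P1 (p + r) - P1 p \<noteq> 0" "1 / \<bar>P1 (p + r) - P1 p\<bar> \<le> K / \<rho>"
proof -
  have "\<rho> / K \<le> \<bar>(p + r) - p\<bar> / K" using assms K_pos by (intro divide_right_mono) auto
  also have "\<dots> \<le> \<bar>P1 (p + r) - P1 p\<bar>" using assms by (intro P1_lipschitz_below) auto
  finally show *: "\<bar>P1 (p + r) - P1 p\<bar> \<ge> \<rho> / K" .
  moreover have "\<rho> / K > 0" using assms K_pos by auto
  ultimately show nz: "P1 (p + r) - P1 p \<noteq> 0" by auto
  show "1 / \<bar>P1 (p + r) - P1 p\<bar> \<le> K / \<rho>" using * nz assms K_pos by (simp add: field_simps)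
qed

lemma lev_inj:
  assumes r: "r > 0" and p: "a \<le> p" "p + r \<le> b" "a \<le> p'" "p' + r \<le> b" and e: "lev r p = lev r p'"
  shows "p = p'"
proof -
  have *: False if "p < p'" "a \<le> p" "p' + r \<le> b" "lev r p = lev r p'" for p p'
  proof -
    obtain z where z: "p < z" "z < p'" "lev r p' - lev r p = (p' - p) * (P1 (z + r) - P1 z)"
      using MVT2[OF \<open>p < p'\<close>, of "lev r" "\<lambda>z. P1 (z + r) - P1 z"] lev_deriv by blast
    then show False using lev_deriv_ge(2)[of z r r] that r by auto
  qed
  show ?thesis using *[of p p'] *[of p' p] p e by (cases p p' rule: linorder_cases) auto
qed

lemma kmap_inj: "\<rho> > 0 \<Longrightarrow> inj_on kmap (kdom \<rho>)"
proof (rule inj_onI)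
  fix x y assume \<rho>: "\<rho> > 0" and xy: "x \<in> kdom \<rho>" "y \<in> kdom \<rho>" "kmap x = kmap y"
  then have f: "fst x = fst y" "lev (fst x) (snd x) = lev (fst x) (snd y)" by (auto simp: kmap_def)
  have "snd x = snd y" by (rule lev_inj[of "fst x"]) (use xy f \<rho> in \<open>auto simp: kdom_def\<close>)
  with f show "x = y" by (simp add: prod_eq_iff)
qed

lemma kinv_lev: "0 < \<rho> \<Longrightarrow> \<rho> \<le> r \<Longrightarrow> a \<le> p \<Longrightarrow> p + r \<le> b \<Longrightarrow> kinv \<rho> r (lev r p) = p"
  using inv_into_f_f[OF kmap_inj[of \<rho>], of "(r, p)"] by (simp add: kinv_def kmap_def kdom_def)

text \<open>\<open>kmap\<close> is a continuous injection on the compact set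
  \<open>kdom \<rho>\<close>, hence its inverse is continuous on the closed image. So
  \<open>kern\<close> is a function continuous on a closed set, extended by 0.\<close>

lemma kern_measurable:
  assumes \<rho>: "\<rho> > 0"
  shows "case_prod (kern \<rho> \<tau>) \<in> borel_measurable (borel \<Otimes>\<^sub>M borel)"
proof -
  define S where "S = kmap ` kdom \<rho>"
  define g where "g = inv_into (kdom \<rho>) kmap"
  have cl: "closed (kdom \<rho>)" unfolding kdom_def
    by (intro closed_Collect_conj closed_Collect_le continuous_intros)
  have sub: "kdom \<rho> \<subseteq> {\<rho>..b-a} \<times> {a..b}"
    using \<rho> by (auto simp: kdom_def)
  have "compact ({\<rho>..b-a} \<times> {a..b})" by (intro compact_Times compact_Icc)
  then have cp: "compact (kdom \<rho>)"
    using compact_Int_closed[OF _ cl, of "{\<rho>..b-a} \<times> {a..b}"] sub by (simp add: Int_absorb1 inf.absorb2)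
  have kc: "continuous_on (kdom \<rho>) kmap" unfolding kmap_def lev_def
    by (intro continuous_intros continuous_on_compose2[OF contP(1)[of UNIV]]) auto
  have gc: "continuous_on S g" unfolding S_def g_def
    by (rule continuous_on_inv[OF kc cp]) (auto intro: inv_into_f_f kmap_inj \<rho>)
  have Sc: "closed S" unfolding S_def by (intro compact_imp_closed compact_continuous_image kc cp)
  have gin: "g z \<in> kdom \<rho>" if "z \<in> S" for z using that unfolding g_def S_def by (rule inv_into_into)
  have gfst: "fst (g z) = fst z" if "z \<in> S" for z
  proof -
    have "kmap (g z) = z" using that unfolding g_def S_def by (rule f_inv_into_f)
    then have "fst (kmap (g z)) = fst z" by simp
    then show ?thesis by (simp add: kmap_def)
  qed
  have ki: "kinv \<rho> (fst z) (snd z) = snd (g z)" for z by (simp add: kinv_def g_def)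
  define f where "f z = of_real (chi (snd (g z)) * chi (snd (g z) + fst z) / \<bar>P1 (snd (g z) + fst z) - P1 (snd (g z))\<bar>)
       * ee (\<tau> * (P (snd (g z)) - snd (g z)))" for z
  have fc: "continuous_on S f" unfolding f_def
  proof (intro continuous_intros continuous_on_compose2[OF contchi(1)[of UNIV]] continuous_on_compose2[OF contP(1)[of UNIV]] continuous_on_compose2[OF contP(2)[of UNIV]] gc)
    show "\<forall>z\<in>S. \<bar>P1 (snd (g z) + fst z) - P1 (snd (g z))\<bar> \<noteq> 0"
    proof
      fix z assume z: "z \<in> S"
      then show "\<bar>P1 (snd (g z) + fst z) - P1 (snd (g z))\<bar> \<noteq> 0"
        using gin[OF z] gfst[OF z] lev_deriv_ge(2)[of "snd (g z)" "fst z" \<rho>] \<rho> by (simp add: kdom_def)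
    qed
  qed auto
  have "(\<lambda>z. indicator S z *\<^sub>R f z) \<in> borel_measurable borel"
    by (rule borel_measurable_continuous_on_indicator[OF _ fc]) (use Sc in auto)
  also have "(\<lambda>z. indicator S z *\<^sub>R f z) = case_prod (kern \<rho> \<tau>)"
  proof (rule ext)
    fix z :: "real \<times> real"
    show "indicator S z *\<^sub>R f z = case_prod (kern \<rho> \<tau>) z"
      unfolding case_prod_beta' kern_def ki S_def[symmetric] prod.collapse f_def by (simp add: indicator_def)
  qed
  finally show ?thesis by (simp add: borel_prod)
qed

text \<open>\<open>P2\<close> has no zero on the connected interval. The sign \<open>s\<close>
  allows the Jacobian \<open>|P1 q - P1 p|\<close> to be differentiated as
  \<open>s * (P1 q - P1 p)\<close>.\<close>

lemma P1_sign: obtains s :: real where "s = 1 \<or> s = -1" "\<And>p q. a \<le> p \<Longrightarrow> p < q \<Longrightarrow> q \<le> b \<Longrightarrow> s * (P1 q - P1 p) = \<bar>P1 q - P1 p\<bar>"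
proof -
  have 1: "(\<forall>x\<in>{a..b}. P2 x > 0) \<or> (\<forall>x\<in>{a..b}. P2 x < 0)"
  proof (rule ccontr)
    assume "\<not> ?thesis"
    then obtain x y where xy: "x \<in> {a..b}" "y \<in> {a..b}" "P2 x \<le> 0" "P2 y \<ge> 0" by force
    have "connected (P2 ` {a..b})" by (intro connected_continuous_image contP) auto
    then have "0 \<in> P2 ` {a..b}" using xy connected_contains_Icc[of "P2 ` {a..b}" "P2 x" "P2 y"] by auto
    then show False using P2_nz by auto
  qed
  define s where "s = (if \<forall>x\<in>{a..b}. P2 x > 0 then 1 else - 1 :: real)"
  show ?thesis
  proof (rule that[of s])
    show "s = 1 \<or> s = -1" by (simp add: s_def)
    fix p q assume pq: "a \<le> p" "p < q" "q \<le> b"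
    obtain z where z: "p < z" "z < q" "P1 q - P1 p = (q - p) * P2 z"
      using MVT2[OF \<open>p < q\<close>, of P1 P2] dP(2) by blast
    have zz: "z \<in> {a..b}" using z pq by auto
    show "s * (P1 q - P1 p) = \<bar>P1 q - P1 p\<bar>"
    proof (cases "\<forall>x\<in>{a..b}. P2 x > 0")
      case True
      then have "P2 z > 0" using zz by blast
      moreover have "s = 1" using True by (simp add: s_def)
      ultimately show ?thesis using pq z by (simp add: abs_mult)
    next
      case False then have "P2 z < 0" using 1 zz by blast
      then show ?thesis using False pq z by (simp add: s_def abs_mult)
    qed
  qed
qed

text \<open>In the extreme case \<open>r = b - a\<close> the only admissible \<open>p\<close> is
  \<open>a\<close>, where \<open>chi\<close> vanishes. Hence \<open>r < b - a\<close> may be assumed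
  later, and the interval \<open>{a..b - r}\<close> is nondegenerate.\<close>

lemma kern_outside:
  assumes "0 < \<rho>" "\<not> (\<rho> \<le> r \<and> r < b - a)"
  shows "kern \<rho> \<tau> r v = 0"
proof (cases "(r, v) \<in> kmap ` kdom \<rho>")
  case True
  then obtain p where p: "(r, p) \<in> kdom \<rho>" "v = lev r p" by (auto simp: kmap_def)
  then have "r = b - a" "p = a" using assms by (auto simp: kdom_def)
  then have "kinv \<rho> r v = a" using p assms kinv_lev[of \<rho> r p] by (auto simp: kdom_def)
  then show ?thesis using chi_supp by (simp add: kern_def)
qed (simp add: kern_def)

text \<open>For fixed \<open>r\<close> the level map is injective on \<open>{a..b - r}\<close>;
  \<open>g\<close> is its inverse and \<open>A\<close> the amplitude of the kernel. The quotient
  \<open>(P1 (g v) - 1) / (P1 (g v + r) - P1 (g v))\<close> is the v-derivative of the phase, the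
  slope separated in \<open>slope_separation\<close>. All denominators are at least
  \<open>\<rho> / K\<close>, so differentiation in \<open>v\<close> costs only powers of
  \<open>K\<close> and \<open>K / \<rho>\<close>.\<close>

lemma kern_branch:
  assumes \<rho>: "0 < \<rho>" "\<rho> \<le> 1" and r: "\<rho> \<le> r" "r < b - a"
  obtains c d g A A1 L1 where
    "c \<le> d" "- K \<le> c" "d \<le> K" "lev r ` {a..b-r} = {c..d}"
    "\<And>p. a \<le> p \<Longrightarrow> p \<le> b - r \<Longrightarrow> g (lev r p) = p"
    "continuous_on {c..d} g" "continuous_on {c..d} A" "continuous_on {c..d} (\<lambda>v. (P1 (g v) - 1) / (P1 (g v + r) - P1 (g v)))"
    "\<And>v. c \<le> v \<Longrightarrow> v \<le> d \<Longrightarrow> a \<le> g v \<and> g v + r \<le> b \<and> P (g v + r) - P (g v) = v"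
    "\<And>v. c < v \<Longrightarrow> v < d \<Longrightarrow> (A has_real_derivative A1 v) (at v)"
    "\<And>v. c < v \<Longrightarrow> v < d \<Longrightarrow> ((\<lambda>v. P (g v) - g v) has_real_derivative (P1 (g v) - 1) / (P1 (g v + r) - P1 (g v))) (at v)"
    "\<And>v. c < v \<Longrightarrow> v < d \<Longrightarrow> ((\<lambda>v. (P1 (g v) - 1) / (P1 (g v + r) - P1 (g v))) has_real_derivative L1 v) (at v)"
    "\<And>v. c \<le> v \<Longrightarrow> v \<le> d \<Longrightarrow> \<bar>A v\<bar> \<le> K\<^sup>2 * (K / \<rho>)"
    "\<And>v. c < v \<Longrightarrow> v < d \<Longrightarrow> \<bar>A1 v\<bar> \<le> 4 * K ^ 3 * (K / \<rho>) ^ 3"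
    "\<And>v. c < v \<Longrightarrow> v < d \<Longrightarrow> \<bar>L1 v\<bar> \<le> 5 * K ^ 2 * (K / \<rho>) ^ 3"
    "\<And>v. c \<le> v \<Longrightarrow> v \<le> d \<Longrightarrow> A v = chi (g v) * chi (g v + r) / \<bar>P1 (g v + r) - P1 (g v)\<bar>"
    "\<And>\<tau> v. kern \<rho> \<tau> r v = (if c \<le> v \<and> v \<le> d then of_real (A v) * ee (\<tau> * (P (g v) - g v)) else 0)"
proof -
  define g where "g = kinv \<rho> r"
  define m where "m = K / \<rho>"
  have r0: "r > 0" using \<rho> r by simp
  have gl: "g (lev r p) = p" if "a \<le> p" "p \<le> b - r" for p unfolding g_def using that \<rho> r by (intro kinv_lev) auto
  obtain s where s: "s = 1 \<or> s = -1" "\<And>p q. a \<le> p \<Longrightarrow> p < q \<Longrightarrow> q \<le> b \<Longrightarrow> s * (P1 q - P1 p) = \<bar>P1 q - P1 p\<bar>"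
    by (rule P1_sign) blast
  have abr: "a < b - r" using r by simp
  have lnz: "P1 (x + r) - P1 x \<noteq> 0" if "a \<le> x" "x \<le> b - r" for x using lev_deriv_ge(2)[of x r \<rho>] that r \<rho> by auto
  obtain c d where cd: "c \<le> d" "lev r ` {a..b-r} = {c..d}" "continuous_on {c..d} g"
    and g: "\<And>y. c \<le> y \<Longrightarrow> y \<le> d \<Longrightarrow> a \<le> g y \<and> g y \<le> b - r \<and> lev r (g y) = y"
    and dg: "\<And>y. c < y \<Longrightarrow> y < d \<Longrightarrow> (g has_real_derivative 1 / (P1 (g y + r) - P1 (g y))) (at y)"
    by (rule monotone_inverse[OF abr lev_deriv lnz gl]) auto
  define D where "D v = P1 (g v + r) - P1 (g v)" for v
  define D1 where "D1 v = (P2 (g v + r) - P2 (g v)) / D v" for v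
  define num where "num v = chi (g v) * chi (g v + r)" for v
  define num1 where "num1 v = (chi1 (g v) * chi (g v + r) + chi1 (g v + r) * chi (g v)) / D v" for v
  define A where "A v = num v / (s * D v)" for v
  define A1 where "A1 v = (num1 v * (s * D v) - num v * (s * D1 v)) / (s * D v * (s * D v))" for v
  define L where "L v = (P1 (g v) - 1) / D v" for v
  define L1 where "L1 v = (P2 (g v) / D v * D v - (P1 (g v) - 1) * D1 v) / (D v * D v)" for v
  have gin: "a \<le> g v" "g v + r \<le> b" "g v \<le> b" "a \<le> g v + r" if "c \<le> v" "v \<le> d" for v using g[OF that] r0 by auto
  have Dnz: "D v \<noteq> 0" and Dinv: "1 / \<bar>D v\<bar> \<le> m" if "c \<le> v" "v \<le> d" for v
    using lev_deriv_ge(2,3)[of "g v" r \<rho>] gin[OF that] r \<rho> by (auto simp: D_def m_def)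
  have m1: "m \<ge> K" "m \<ge> 1" "m > 0"
  proof -
    show "m \<ge> K" unfolding m_def using \<rho> K_pos by (simp add: field_simps)
    then show "m \<ge> 1" "m > 0" using K2 by auto
  qed
  have sD: "s * D v = \<bar>D v\<bar>" if "c \<le> v" "v \<le> d" for v
    unfolding D_def using gin[OF that] r0 by (intro s) auto
  have dP1g: "((\<lambda>v. P1 (g v)) has_real_derivative P2 (g v) / D v) (at v)" if "c < v" "v < d" for v
    using DERIV_chain2[OF dP(2) dg[OF that]] by (simp add: D_def)
  have dgr: "((\<lambda>v. g v + r) has_real_derivative 1 / D v) (at v)" if "c < v" "v < d" for v
    using DERIV_add[OF dg[OF that] DERIV_const[of r]] by (simp add: D_def)
  have dD: "(D has_real_derivative D1 v) (at v)" if "c < v" "v < d" for v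
    using DERIV_diff[OF DERIV_chain2[OF dP(2) dgr[OF that]] dP1g[OF that]] unfolding D_def[abs_def, symmetric]
    by (simp add: D1_def diff_divide_distrib D_def[symmetric])
  have dnum: "(num has_real_derivative num1 v) (at v)" if "c < v" "v < d" for v
  proof -
    have "((\<lambda>v. chi (g v)) has_real_derivative chi1 (g v) / D v) (at v)"
      using DERIV_chain2[OF dchi(1) dg[OF that]] by (simp add: D_def)
    moreover have "((\<lambda>v. chi (g v + r)) has_real_derivative chi1 (g v + r) / D v) (at v)"
      using DERIV_chain2[OF dchi(1) dgr[OF that]] by simp
    ultimately have "(num has_real_derivative chi1 (g v) / D v * chi (g v + r) + chi1 (g v + r) / D v * chi (g v)) (at v)"
      unfolding num_def by (rule DERIV_mult)
    then show ?thesis by (simp add: num1_def add_divide_distrib)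
  qed
  have dA: "(A has_real_derivative A1 v) (at v)" if "c < v" "v < d" for v
  proof -
    have "((\<lambda>v. s * D v) has_real_derivative s * D1 v) (at v)" by (rule DERIV_cmult[OF dD[OF that]])
    then show ?thesis unfolding A_def A1_def using Dnz[of v] s that by (intro DERIV_divide dnum) auto
  qed
  have dL: "(L has_real_derivative L1 v) (at v)" if "c < v" "v < d" for v
  proof -
    have "((\<lambda>v. P1 (g v) - 1) has_real_derivative P2 (g v) / D v) (at v)"
      using DERIV_diff[OF dP1g[OF that] DERIV_const[of 1]] by simp
    then show ?thesis unfolding L_def L1_def using Dnz[of v] that by (intro DERIV_divide dD) auto
  qed
  have dPg: "((\<lambda>v. P (g v) - g v) has_real_derivative L v) (at v)" if "c < v" "v < d" for v
  proof -
    have "((\<lambda>v. P (g v) - g v) has_real_derivative P1 (g v) * (1 / D v) - 1 / D v) (at v)"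
      using DERIV_diff[OF DERIV_chain2[OF dP(1) dg[OF that]] dg[OF that]] by (simp add: D_def)
    then show ?thesis by (simp add: L_def diff_divide_distrib)
  qed
  have gc: "continuous_on {c..d} g" by fact
  have Dc: "continuous_on {c..d} D" unfolding D_def
    by (intro continuous_intros continuous_on_compose2[OF contP(2)[of UNIV]] gc) auto
  have Ac: "continuous_on {c..d} A" unfolding A_def num_def
    by (intro continuous_intros continuous_on_compose2[OF contchi(1)[of UNIV]] gc Dc) (use Dnz s in auto)
  have Lc: "continuous_on {c..d} L" unfolding L_def
    by (intro continuous_intros continuous_on_compose2[OF contP(2)[of UNIV]] gc Dc) (use Dnz in auto)
  have q: "\<bar>x / D v\<bar> \<le> y * m" if "c \<le> v" "v \<le> d" "\<bar>x\<bar> \<le> y" for x y v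
  proof -
    have "\<bar>x / D v\<bar> = \<bar>x\<bar> * (1 / \<bar>D v\<bar>)" by simp
    also have "\<dots> \<le> y * m" using that Dinv[of v] by (intro mult_mono) auto
    finally show ?thesis .
  qed
  have sabs: "\<bar>s\<bar> = 1" using s by auto
  have nb: "\<bar>num v\<bar> \<le> K * K" for v
    unfolding num_def abs_mult using chi_abs K_pos by (intro mult_mono) auto
  have Ab: "\<bar>A v\<bar> \<le> K\<^sup>2 * m" if v: "c \<le> v" "v \<le> d" for v
  proof -
    have "\<bar>A v\<bar> = \<bar>num v / D v\<bar>" using sabs by (simp add: A_def abs_mult)
    also have "\<dots> \<le> K * K * m" by (intro q v nb)
    finally show ?thesis by (simp add: power2_eq_square)
  qed
  have D1b: "\<bar>D1 v\<bar> \<le> 2 * K * m" if v: "c \<le> v" "v \<le> d" for v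
    unfolding D1_def using P_le(2)[of "g v"] P_le(2)[of "g v + r"] gin[OF v] by (intro q v) linarith
  have n1b: "\<bar>num1 v\<bar> \<le> 2 * (K * K) * m" if v: "c \<le> v" "v \<le> d" for v
  proof -
    have "\<bar>chi1 (g v) * chi (g v + r)\<bar> \<le> K * K" "\<bar>chi1 (g v + r) * chi (g v)\<bar> \<le> K * K"
      unfolding abs_mult using chi_abs chi_le K_pos by (auto intro!: mult_mono)
    then show ?thesis unfolding num1_def by (intro q v) linarith
  qed
  have mm: "m\<^sup>2 \<le> m ^ 3" using m1 by (intro power_increasing) auto
  have A1b: "\<bar>A1 v\<bar> \<le> 4 * K ^ 3 * m ^ 3" if v: "c \<le> v" "v \<le> d" for v
  proof -
    have "A1 v = s * (num1 v / D v - num v * D1 v / D v / D v)"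
      using Dnz[OF v] s by (auto simp: A1_def field_simps)
    then have "\<bar>A1 v\<bar> = \<bar>num1 v / D v - num v * D1 v / D v / D v\<bar>" by (simp add: abs_mult sabs)
    also have "\<dots> \<le> \<bar>num1 v / D v\<bar> + \<bar>num v * D1 v / D v / D v\<bar>" by (rule abs_triangle_ineq4)
    also have "\<dots> \<le> 2 * (K * K) * m * m + K * K * (2 * K * m) * m * m"
    proof (intro add_mono)
      show "\<bar>num1 v / D v\<bar> \<le> 2 * (K * K) * m * m" by (intro q v n1b)
      have "\<bar>num v * D1 v\<bar> \<le> K * K * (2 * K * m)" unfolding abs_mult using nb D1b[OF v] K_pos by (intro mult_mono) auto
      then show "\<bar>num v * D1 v / D v / D v\<bar> \<le> K * K * (2 * K * m) * m * m" by (intro q v)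
    qed
    also have "\<dots> = 2 * (K\<^sup>2 * m\<^sup>2) + 2 * (K ^ 3 * m ^ 3)" by (simp add: power_numeral_reduce)
    also have "\<dots> \<le> 2 * (K ^ 3 * m ^ 3) + 2 * (K ^ 3 * m ^ 3)"
      using K_power[of 2 3] mm K_pos m1 by (intro add_mono mult_left_mono mult_mono) auto
    finally show ?thesis by simp
  qed
  have L1b: "\<bar>L1 v\<bar> \<le> 5 * K ^ 2 * m ^ 3" if v: "c \<le> v" "v \<le> d" for v
  proof -
    have "L1 v = P2 (g v) / D v / D v - (P1 (g v) - 1) * D1 v / D v / D v"
      using Dnz[OF v] by (auto simp: L1_def field_simps)
    then have "\<bar>L1 v\<bar> \<le> \<bar>P2 (g v) / D v / D v\<bar> + \<bar>(P1 (g v) - 1) * D1 v / D v / D v\<bar>" using abs_triangle_ineq4 by metis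
    also have "\<dots> \<le> K * m * m + 2 * K * (2 * K * m) * m * m"
    proof (intro add_mono)
      show "\<bar>P2 (g v) / D v / D v\<bar> \<le> K * m * m" using gin[OF v] by (intro q v P_le) auto
      have "\<bar>(P1 (g v) - 1) * D1 v\<bar> \<le> 2 * K * (2 * K * m)" unfolding abs_mult using P1m1_le[of "g v"] gin[OF v] D1b[OF v] K_pos by (intro mult_mono) auto
      then show "\<bar>(P1 (g v) - 1) * D1 v / D v / D v\<bar> \<le> 2 * K * (2 * K * m) * m * m" by (intro q v)
    qed
    also have "\<dots> = K ^ 1 * m\<^sup>2 + 4 * (K ^ 2 * m ^ 3)" by (simp add: power_numeral_reduce)
    also have "\<dots> \<le> K ^ 2 * m ^ 3 + 4 * (K ^ 2 * m ^ 3)"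
      using K_power[of 1 2] mm K_pos m1 by (intro add_mono mult_mono) auto
    finally show ?thesis by simp
  qed
  have vK: "\<bar>v\<bar> \<le> K" if v: "c \<le> v" "v \<le> d" for v
  proof -
    have "\<bar>v\<bar> = \<bar>P (g v + r) - P (g v)\<bar>" using g[OF v] by (simp add: lev_def)
    also have "\<dots> \<le> K * \<bar>(g v + r) - g v\<bar>" using gin[OF v] by (intro P_lipschitz)
    also have "\<dots> \<le> K * 1" using r r0 ab K_pos by (intro mult_left_mono) auto
    finally show ?thesis by simp
  qed
  have dom: "(r, v) \<in> kmap ` kdom \<rho> \<longleftrightarrow> c \<le> v \<and> v \<le> d" for v
  proof -
    have "(r, v) \<in> kmap ` kdom \<rho> \<longleftrightarrow> v \<in> lev r ` {a..b-r}"
      using r by (force simp: kmap_def kdom_def image_iff)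
    then show ?thesis using cd by simp
  qed
  have AA: "A v = chi (g v) * chi (g v + r) / \<bar>P1 (g v + r) - P1 (g v)\<bar>" if "c \<le> v" "v \<le> d" for v
    using sD[OF that] by (simp add: A_def num_def D_def)
  have kA: "kern \<rho> \<tau> r v = (if c \<le> v \<and> v \<le> d then of_real (A v) * ee (\<tau> * (P (g v) - g v)) else 0)" for \<tau> v
    unfolding kern_def dom g_def[symmetric] using AA[of v] by simp
  have gfin: "a \<le> g v \<and> g v + r \<le> b \<and> P (g v + r) - P (g v) = v" if "c \<le> v" "v \<le> d" for v
    using g[OF that] by (auto simp: lev_def)
  show ?thesis
  proof (rule that[of c d g A A1 L1])
    show "- K \<le> c" "d \<le> K" using vK[of c] vK[of d] cd by auto
  qed (use cd gl gc Ac Lc dA dPg dL Ab A1b L1b AA kA gfin in \<open>auto simp: L_def[abs_def] D_def m_def\<close>)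
qed

end

section \<open>Size and correlations of the kernel\<close>

context curve
begin

lemma kern_bound:
  assumes \<rho>: "0 < \<rho>" "\<rho> \<le> 1"
  shows "cmod (kern \<rho> \<tau> r v) \<le> K\<^sup>2 * (K / \<rho>)"
    and "kern \<rho> \<tau> r v \<noteq> 0 \<Longrightarrow> \<rho> \<le> r \<and> r \<le> 1 \<and> - K \<le> v \<and> v \<le> K"
proof -
  have "cmod (kern \<rho> \<tau> r v) \<le> K\<^sup>2 * (K / \<rho>) \<and> (kern \<rho> \<tau> r v \<noteq> 0 \<longrightarrow> \<rho> \<le> r \<and> r \<le> 1 \<and> - K \<le> v \<and> v \<le> K)"
  proof (cases "\<rho> \<le> r \<and> r < b - a")
    case False then show ?thesis using kern_outside[OF \<rho>(1) False] \<rho> K_pos by simp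
  next
    case True
    show ?thesis
    proof (rule kern_branch[OF \<rho> True[THEN conjunct1] True[THEN conjunct2]], goal_cases)
      case (1 c d g A A1 L1)
      show ?case using 1(17)[of \<tau> v] 1(13)[of v] 1(2,3) True ab \<rho> K_pos by (auto simp: norm_mult)
    qed
  qed
  then show "cmod (kern \<rho> \<tau> r v) \<le> K\<^sup>2 * (K / \<rho>)" "kern \<rho> \<tau> r v \<noteq> 0 \<Longrightarrow> \<rho> \<le> r \<and> r \<le> 1 \<and> - K \<le> v \<and> v \<le> K" by auto
qed

lemma kern_correlation_trivial:
  assumes \<rho>: "0 < \<rho>" "\<rho> \<le> 1"
  shows "cmod (LINT v|lborel. kern \<rho> \<tau> r v * cnj (kern \<rho> \<tau> r' v)) \<le> 2 * K ^ 5 * (K / \<rho>)\<^sup>2"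
proof -
  define B where "B = K\<^sup>2 * (K / \<rho>)"
  have B0: "B \<ge> 0" using K_pos \<rho> by (simp add: B_def)
  have "cmod (LINT v|lborel. kern \<rho> \<tau> r v * cnj (kern \<rho> \<tau> r' v)) \<le> (LINT v|lborel. B\<^sup>2 * indicator {-K..K} v)"
  proof (rule order_trans[OF integral_norm_bound integral_mono'])
    show "integrable lborel (\<lambda>v. B\<^sup>2 * indicator {-K..K} v)"
      by (intro integrable_mult_right integrable_real_indicator) (auto simp: emeasure_lborel_Icc_eq)
    fix v
    show "cmod (kern \<rho> \<tau> r v * cnj (kern \<rho> \<tau> r' v)) \<le> B\<^sup>2 * indicator {-K..K} v"
    proof (cases "kern \<rho> \<tau> r v = 0")
      case False
      have "cmod (kern \<rho> \<tau> r v * cnj (kern \<rho> \<tau> r' v)) \<le> B * B"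
        unfolding norm_mult complex_mod_cnj B_def using kern_bound(1)[OF \<rho>] \<rho> K_pos by (intro mult_mono) auto
      then show ?thesis using kern_bound(2)[OF \<rho> False] by (simp add: power2_eq_square)
    qed (use B0 in auto)
  qed auto
  also have "\<dots> = B\<^sup>2 * (2 * K)" using K_pos by simp
  also have "\<dots> = 2 * K ^ 5 * (K / \<rho>)\<^sup>2" by (simp add: B_def power_mult_distrib power_numeral_reduce)
  finally show ?thesis .
qed

text \<open>Both branches are evaluated at the same \<open>v\<close>, that is, on a common level, so
  \<open>slope_separation\<close> bounds the derivative of the phase difference from below by a
  multiple of \<open>|\<tau>| * \<delta>\<close>. One integration by parts then gives
  \<open>1 / |\<tau>|\<close>; the term with the second derivative of the phase has the square of
  the separation in the denominator, hence \<delta> squared.\<close>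

lemma kern_correlation:
  assumes \<rho>: "0 < \<rho>" "\<rho> \<le> 1" and \<delta>: "0 < \<delta>" "\<delta> \<le> 1" and rr: "\<bar>r - r'\<bar> \<ge> \<delta>" and \<tau>: "\<tau> \<noteq> 0"
  shows "cmod (LINT v|lborel. kern \<rho> \<tau> r v * cnj (kern \<rho> \<tau> r' v)) \<le> K ^ 55 * (K / \<rho>) ^ 7 / (\<bar>\<tau>\<bar> * \<delta>\<^sup>2)"
proof (cases "(\<rho> \<le> r \<and> r < b - a) \<and> (\<rho> \<le> r' \<and> r' < b - a)")
  case False
  then have z: "kern \<rho> \<tau> r v * cnj (kern \<rho> \<tau> r' v) = 0" for v using kern_outside[OF \<rho>(1)] by auto
  show ?thesis unfolding z using K_pos \<rho> \<delta> by simp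
next
  case True
  define m where "m = K / \<rho>"
  have m1: "m \<ge> K" "m \<ge> 1" "m > 0"
  proof -
    show "m \<ge> K" unfolding m_def using \<rho> K_pos by (simp add: field_simps)
    then show "m \<ge> 1" "m > 0" using K2 by auto
  qed
  from True have r: "\<rho> \<le> r" "r < b - a" "\<rho> \<le> r'" "r' < b - a" by auto
  define LL where "LL r g v = (P1 (g v) - 1) / (P1 (g v + r) - P1 (g v))" for r v and g :: "real \<Rightarrow> real"
  obtain c d g A A1 L1 where B:
    "c \<le> d" "- K \<le> c" "d \<le> K"
    "continuous_on {c..d} g" "continuous_on {c..d} A" "continuous_on {c..d} (LL r g)"
    "\<And>v. c \<le> v \<Longrightarrow> v \<le> d \<Longrightarrow> a \<le> g v \<and> g v + r \<le> b \<and> P (g v + r) - P (g v) = v"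
    "\<And>v. c < v \<Longrightarrow> v < d \<Longrightarrow> (A has_real_derivative A1 v) (at v)"
    "\<And>v. c < v \<Longrightarrow> v < d \<Longrightarrow> ((\<lambda>v. P (g v) - g v) has_real_derivative LL r g v) (at v)"
    "\<And>v. c < v \<Longrightarrow> v < d \<Longrightarrow> (LL r g has_real_derivative L1 v) (at v)"
    "\<And>v. c \<le> v \<Longrightarrow> v \<le> d \<Longrightarrow> \<bar>A v\<bar> \<le> K\<^sup>2 * m"
    "\<And>v. c < v \<Longrightarrow> v < d \<Longrightarrow> \<bar>A1 v\<bar> \<le> 4 * K ^ 3 * m ^ 3"
    "\<And>v. c < v \<Longrightarrow> v < d \<Longrightarrow> \<bar>L1 v\<bar> \<le> 5 * K ^ 2 * m ^ 3"
    "\<And>\<tau> v. kern \<rho> \<tau> r v = (if c \<le> v \<and> v \<le> d then of_real (A v) * ee (\<tau> * (P (g v) - g v)) else 0)"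
    unfolding m_def LL_def[abs_def] by (rule kern_branch[OF \<rho> r(1,2)]) blast
  obtain c' d' g' A' A1' L1' where B':
    "c' \<le> d'" "- K \<le> c'" "d' \<le> K"
    "continuous_on {c'..d'} g'" "continuous_on {c'..d'} A'" "continuous_on {c'..d'} (LL r' g')"
    "\<And>v. c' \<le> v \<Longrightarrow> v \<le> d' \<Longrightarrow> a \<le> g' v \<and> g' v + r' \<le> b \<and> P (g' v + r') - P (g' v) = v"
    "\<And>v. c' < v \<Longrightarrow> v < d' \<Longrightarrow> (A' has_real_derivative A1' v) (at v)"
    "\<And>v. c' < v \<Longrightarrow> v < d' \<Longrightarrow> ((\<lambda>v. P (g' v) - g' v) has_real_derivative LL r' g' v) (at v)"
    "\<And>v. c' < v \<Longrightarrow> v < d' \<Longrightarrow> (LL r' g' has_real_derivative L1' v) (at v)"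
    "\<And>v. c' \<le> v \<Longrightarrow> v \<le> d' \<Longrightarrow> \<bar>A' v\<bar> \<le> K\<^sup>2 * m"
    "\<And>v. c' < v \<Longrightarrow> v < d' \<Longrightarrow> \<bar>A1' v\<bar> \<le> 4 * K ^ 3 * m ^ 3"
    "\<And>v. c' < v \<Longrightarrow> v < d' \<Longrightarrow> \<bar>L1' v\<bar> \<le> 5 * K ^ 2 * m ^ 3"
    "\<And>\<tau> v. kern \<rho> \<tau> r' v = (if c' \<le> v \<and> v \<le> d' then of_real (A' v) * ee (\<tau> * (P (g' v) - g' v)) else 0)"
    unfolding m_def LL_def[abs_def] by (rule kern_branch[OF \<rho> r(3,4)]) blast
  define C where "C = max c c'"
  define D where "D = min d d'"
  define \<Psi> where "\<Psi> v = 2 * pi * \<tau> * ((P (g v) - g v) - (P (g' v) - g' v))" for v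
  define f where "f v = of_real (A v * A' v) * cis (\<Psi> v)" for v
  have kf: "kern \<rho> \<tau> r v * cnj (kern \<rho> \<tau> r' v) = (if C \<le> v \<and> v \<le> D then f v else 0)" for v
    unfolding B(14) B'(14) C_def D_def f_def \<Psi>_def
    by (auto simp: ee_def cis_cnj cis_mult algebra_simps)
  show ?thesis
  proof (cases "C \<le> D")
    case False
    then have z: "kern \<rho> \<tau> r v * cnj (kern \<rho> \<tau> r' v) = 0" for v unfolding kf by auto
    show ?thesis unfolding z using K_pos \<rho> \<delta> by simp
  next
    case CD: True
    have sub: "{C..D} \<subseteq> {c..d}" "{C..D} \<subseteq> {c'..d'}" by (auto simp: C_def D_def)
    have in1: "c \<le> v" "v \<le> d" "c' \<le> v" "v \<le> d'" if "C \<le> v" "v \<le> D" for v using that by (auto simp: C_def D_def)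
    have in2: "c < v" "v < d" "c' < v" "v < d'" if "C < v" "v < D" for v using that by (auto simp: C_def D_def)
    have gc: "continuous_on {C..D} g" "continuous_on {C..D} g'" using B(4) B'(4) sub continuous_on_subset by blast+
    have Ac: "continuous_on {C..D} (\<lambda>v. A v * A' v)"
      by (intro continuous_on_mult continuous_on_subset[OF B(5)] continuous_on_subset[OF B'(5)] sub)
    have \<Psi>c: "continuous_on {C..D} \<Psi>" unfolding \<Psi>_def
      by (intro continuous_intros gc continuous_on_compose2[OF contP(1)[of UNIV]]) auto
    have fc: "continuous_on {C..D} f" unfolding f_def cis_conv_exp by (intro continuous_intros Ac \<Psi>c)
    \<comment> \<open>Chosen so that \<open>1 / E = \<rho> * \<delta> / (64 * K ^ 16)\<close>, the
      bound of \<open>slope_separation\<close> for gaps that differ by \<delta>.\<close>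
    define E where "E = 64 * K ^ 15 * m / \<delta>"
    define t where "t = 2 * pi * \<bar>\<tau>\<bar>"
    have t0: "t > 0" using \<tau> by (simp add: t_def)
    have E1: "E \<ge> 1"
    proof -
      have "1 * 1 \<le> 64 * K ^ 15 * m" using K_power[of 0 15] m1 K_pos by (intro mult_mono) auto
      then show ?thesis using \<delta> by (simp add: E_def le_divide_eq)
    qed
    have LLsep: "\<bar>LL r g v - LL r' g' v\<bar> \<ge> 1 / E" if "C \<le> v" "v \<le> D" for v
    proof -
      have "1 / E = \<rho> * \<delta> / (64 * K ^ 16)" unfolding E_def m_def by (simp add: power_numeral_reduce)
      also have "\<dots> \<le> \<rho> * \<bar>r - r'\<bar> / (64 * K ^ 16)" using rr \<rho> K_pos by (intro divide_right_mono mult_left_mono) auto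
      also have "\<dots> \<le> \<bar>LL r g v - LL r' g' v\<bar>"
        using slope_separation[OF \<rho>(1), of "g v" "g v + r" "g' v" "g' v + r'"] B(7)[of v] B'(7)[of v] in1[OF that] r
        unfolding LL_def by simp
      finally show ?thesis .
    qed
    have "cmod (integral {C..D} f) \<le> 2 * (K ^ 4 * m\<^sup>2) / (t / E) + (D - C) * (8 * K ^ 5 * m ^ 4 / (t / E) + (K ^ 4 * m\<^sup>2) * (t * (10 * K ^ 2 * m ^ 3)) / (t / E)\<^sup>2)"
      unfolding f_def
    proof (rule nonstationary_phase[where ?\<Phi>1.0="\<lambda>v. 2 * pi * \<tau> * (LL r g v - LL r' g' v)" and ?\<Phi>2.0="\<lambda>v. 2 * pi * \<tau> * (L1 v - L1' v)" and ?b1.0="\<lambda>v. A1 v * A' v + A1' v * A v"])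
      show "continuous_on {C..D} (\<lambda>v. 2 * pi * \<tau> * (LL r g v - LL r' g' v))"
        by (intro continuous_intros continuous_on_subset[OF B(6)] continuous_on_subset[OF B'(6)] sub)
      show "(\<Psi> has_real_derivative 2 * pi * \<tau> * (LL r g v - LL r' g' v)) (at v)" if "C < v" "v < D" for v
        unfolding \<Psi>_def by (intro DERIV_cmult DERIV_diff[OF B(9) B'(9)] in2 that)
      show "((\<lambda>v. 2 * pi * \<tau> * (LL r g v - LL r' g' v)) has_real_derivative 2 * pi * \<tau> * (L1 v - L1' v)) (at v)" if "C < v" "v < D" for v
        by (intro DERIV_cmult DERIV_diff B(10) B'(10) in2 that)
      show "((\<lambda>v. A v * A' v) has_real_derivative A1 v * A' v + A1' v * A v) (at v)" if "C < v" "v < D" for v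
        by (intro DERIV_mult B(8) B'(8) in2 that)
      show "t / E \<le> \<bar>2 * pi * \<tau> * (LL r g v - LL r' g' v)\<bar>" if "C \<le> v" "v \<le> D" for v
      proof -
        have "t * (1 / E) \<le> t * \<bar>LL r g v - LL r' g' v\<bar>" using LLsep[OF that] t0 by (intro mult_left_mono) auto
        then show ?thesis by (simp add: t_def abs_mult)
      qed
      show "\<bar>2 * pi * \<tau> * (L1 v - L1' v)\<bar> \<le> t * (10 * K ^ 2 * m ^ 3)" if "C < v" "v < D" for v
      proof -
        have "\<bar>L1 v - L1' v\<bar> \<le> 10 * K ^ 2 * m ^ 3" using B(13)[of v] B'(13)[of v] in2[OF that] by linarith
        then have "t * \<bar>L1 v - L1' v\<bar> \<le> t * (10 * K ^ 2 * m ^ 3)" using t0 by (intro mult_left_mono) auto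
        then show ?thesis by (simp add: t_def abs_mult)
      qed
      show "\<bar>A v * A' v\<bar> \<le> K ^ 4 * m\<^sup>2" if "C \<le> v" "v \<le> D" for v
      proof -
        have "\<bar>A v\<bar> * \<bar>A' v\<bar> \<le> (K\<^sup>2 * m) * (K\<^sup>2 * m)" using B(11)[of v] B'(11)[of v] in1[OF that] m1 by (intro mult_mono) auto
        then show ?thesis by (simp add: abs_mult power_numeral_reduce mult_ac)
      qed
      show "\<bar>A1 v * A' v + A1' v * A v\<bar> \<le> 8 * K ^ 5 * m ^ 4" if v: "C < v" "v < D" for v
      proof -
        have "\<bar>A1 v\<bar> * \<bar>A' v\<bar> \<le> (4 * K ^ 3 * m ^ 3) * (K\<^sup>2 * m)" "\<bar>A1' v\<bar> * \<bar>A v\<bar> \<le> (4 * K ^ 3 * m ^ 3) * (K\<^sup>2 * m)"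
          using B(11,12)[of v] B'(11,12)[of v] in2[OF v] m1 K_pos by (auto intro!: mult_mono)
        then have "\<bar>A1 v * A' v + A1' v * A v\<bar> \<le> 2 * ((4 * K ^ 3 * m ^ 3) * (K\<^sup>2 * m))"
          by (intro order_trans[OF abs_triangle_ineq]) (simp add: abs_mult)
        then show ?thesis by (simp add: power_numeral_reduce mult_ac)
      qed
    qed (use CD \<Psi>c Ac t0 E1 m1 K_pos in auto)
    also have "\<dots> \<le> 2 * (K ^ 4 * m\<^sup>2) / (t / E) + (2 * K) * (8 * K ^ 5 * m ^ 4 / (t / E) + (K ^ 4 * m\<^sup>2) * (t * (10 * K ^ 2 * m ^ 3)) / (t / E)\<^sup>2)"
      using B(2,3) B'(2,3) t0 E1 m1 K_pos by (intro add_left_mono mult_right_mono) (auto simp: C_def D_def)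
    also have "\<dots> = (2 * (K ^ 4 * m\<^sup>2 * E) + 16 * (K ^ 6 * m ^ 4 * E) + 20 * (K ^ 7 * m ^ 5 * E\<^sup>2)) / t"
      using t0 E1 by (simp add: field_simps power_numeral_reduce)
    also have "\<dots> \<le> (2 * (K ^ 7 * m ^ 5 * E\<^sup>2) + 16 * (K ^ 7 * m ^ 5 * E\<^sup>2) + 20 * (K ^ 7 * m ^ 5 * E\<^sup>2)) / t"
    proof -
      have "E \<le> E\<^sup>2" using E1 by (simp add: power2_eq_square)
      moreover have "K ^ 4 * m\<^sup>2 \<le> K ^ 7 * m ^ 5" "K ^ 6 * m ^ 4 \<le> K ^ 7 * m ^ 5"
        using m1 K2 K_pos by (auto intro!: mult_mono power_increasing)
      ultimately have "K ^ 4 * m\<^sup>2 * E \<le> K ^ 7 * m ^ 5 * E\<^sup>2" "K ^ 6 * m ^ 4 * E \<le> K ^ 7 * m ^ 5 * E\<^sup>2"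
        using E1 m1 K_pos by (auto intro!: mult_mono[of "_ * _"])
      then show ?thesis using t0 by (intro divide_right_mono add_mono) auto
    qed
    also have "\<dots> = 38 * (K ^ 7 * m ^ 5) * (64 * K ^ 15 * m)\<^sup>2 / (\<delta>\<^sup>2 * t)" by (simp add: E_def power_divide)
    also have "\<dots> \<le> 38 * (K ^ 7 * m ^ 5) * (64 * K ^ 15 * m)\<^sup>2 / (\<delta>\<^sup>2 * \<bar>\<tau>\<bar>)"
    proof -
      have "1 * \<bar>\<tau>\<bar> \<le> t" unfolding t_def using pi_ge_two by (intro mult_right_mono) auto
      then show ?thesis using \<tau> \<delta> t0 m1 K_pos by (intro divide_left_mono mult_left_mono mult_pos_pos) auto
    qed
    also have "\<dots> = 155648 * (K ^ 37 * m ^ 7) / (\<delta>\<^sup>2 * \<bar>\<tau>\<bar>)" by (simp add: power_mult_distrib flip: power_mult power_add mult.assoc) (simp add: power_numeral_reduce mult_ac)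
    \<comment> \<open>The constant is \<open>38 * 64^2\<close>, below \<open>2^18\<close> and thus
      below \<open>K ^ 18\<close>.\<close>
    also have "\<dots> \<le> (K ^ 18) * (K ^ 37 * m ^ 7) / (\<delta>\<^sup>2 * \<bar>\<tau>\<bar>)"
    proof -
      have "(2::real) ^ 18 \<le> K ^ 18" using K2 by (intro power_mono) auto
      then show ?thesis using K_pos m1 by (intro divide_right_mono mult_right_mono) auto
    qed
    finally have "cmod (integral {C..D} f) \<le> K ^ 55 * m ^ 7 / (\<bar>\<tau>\<bar> * \<delta>\<^sup>2)" by (simp add: mult_ac flip: power_add mult.assoc)
    then show ?thesis unfolding kf LINT_Icc_eq_integral(1)[OF fc] m_def .
  qed
qed


text \<open>The substitution \<open>v = lev r p\<close> has Jacobian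
  \<open>|P1 (p + r) - P1 p|\<close>, which cancels the denominator in \<open>kern\<close>. For
  \<open>r \<ge> b - a\<close> both sides vanish, since \<open>p\<close> and \<open>p + r\<close>
  cannot both lie inside the support of \<open>chi\<close>.\<close>

lemma kern_substitution:
  assumes \<rho>: "0 < \<rho>" "\<rho> \<le> 1" and r: "\<rho> \<le> r" and gc: "continuous_on UNIV \<gamma>"
  shows "(LINT v|lborel. \<gamma> v * kern \<rho> \<tau> r v) = (LINT p|lborel. of_real (chi p * chi (p + r)) * \<gamma> (lev r p) * ee (\<tau> * (P p - p)))"
proof (cases "r < b - a")
  case False
  then have 1: "kern \<rho> \<tau> r v = 0" for v using kern_outside[OF \<rho>(1)] by auto
  have 2: "chi p * chi (p + r) = 0" for p
    using chi_supp[of p] chi_supp[of "p + r"] False by (cases "p \<le> a") auto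
  show ?thesis unfolding 1 2 by simp
next
  case True
  obtain s where s: "s = 1 \<or> s = -1" "\<And>p q. a \<le> p \<Longrightarrow> p < q \<Longrightarrow> q \<le> b \<Longrightarrow> s * (P1 q - P1 p) = \<bar>P1 q - P1 p\<bar>"
    by (rule P1_sign) blast
  have sD: "s * (P1 (p + r) - P1 p) = \<bar>P1 (p + r) - P1 p\<bar>" if "a \<le> p" "p \<le> b - r" for p
    using that r \<rho> by (intro s) auto
  show ?thesis
  proof (rule kern_branch[OF \<rho> r True], goal_cases)
    case (1 c d g A A1 L1)
    define f where "f v = \<gamma> v * (of_real (A v) * ee (\<tau> * (P (g v) - g v)))" for v
    define h where "h p = of_real (chi p * chi (p + r)) * \<gamma> (lev r p) * ee (\<tau> * (P p - p))" for p
    have fc: "continuous_on {c..d} f" unfolding f_def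
      by (intro continuous_intros continuous_on_compose2[OF contP(1)[of UNIV]] 1(6,7) continuous_on_subset[OF gc]) auto
    have lc: "continuous_on S (lev r)" for S by (rule DERIV_continuous_on[OF has_field_derivative_at_within[OF lev_deriv]])
    have hc: "continuous_on S h" for S unfolding h_def
      by (intro continuous_intros contP contchi continuous_on_compose2[OF contchi(1)[of UNIV]] continuous_on_compose2[OF gc] lc) auto
    have l1: "(LINT v|lborel. \<gamma> v * kern \<rho> \<tau> r v) = integral {c..d} f"
      unfolding LINT_Icc_eq_integral(1)[OF fc, symmetric] 1(17) f_def by (intro Bochner_Integration.integral_cong) auto
    have hsupp: "h p = (if a \<le> p \<and> p \<le> b - r then h p else 0)" for p
      using chi_supp[of p] chi_supp[of "p + r"] by (cases "p \<le> a") (auto simp: h_def)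
    have l2: "(LINT p|lborel. h p) = integral {a..b - r} h"
      using LINT_Icc_eq_integral(1)[OF hc[of "{a..b-r}"]] hsupp by simp
    have sub: "((\<lambda>p. (P1 (p + r) - P1 p) *\<^sub>R f (lev r p)) has_integral (integral {lev r a..lev r (b - r)} f - integral {lev r (b - r)..lev r a} f)) {a..b - r}"
      by (rule has_integral_substitution_general[of "{}" _ _ _ c d])
        (use True 1(4) in \<open>auto intro!: fc lc has_field_derivative_at_within[OF lev_deriv]\<close>)
    have fh: "(P1 (p + r) - P1 p) *\<^sub>R f (lev r p) = s *\<^sub>R h p" if p: "p \<in> {a..b-r}" for p
    proof -
      have cdp: "c \<le> lev r p" "lev r p \<le> d" using 1(4) p by auto
      have gp: "g (lev r p) = p" using 1(5) p by auto
      define D where "D = P1 (p + r) - P1 p"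
      have D: "s * D = \<bar>D\<bar>" unfolding D_def using sD p by auto
      have nz: "D \<noteq> 0" unfolding D_def using lev_deriv_ge(2)[of p r \<rho>] p r \<rho> by auto
      have "D * A (lev r p) = s * (chi p * chi (p + r))"
        unfolding 1(16)[OF cdp] gp D_def[symmetric] using D nz s(1) by (auto simp: field_simps)
      then have "complex_of_real D * of_real (A (lev r p)) = of_real s * of_real (chi p * chi (p + r))"
        by (metis of_real_mult)
      then show ?thesis unfolding f_def h_def gp D_def[symmetric] scaleR_conv_of_real by (simp add: mult_ac) 
    qed
    \<comment> \<open>Depending on the sign of the monotonicity, one of the two integrals runs over
      \<open>{c..d}\<close> and the other over the reversed interval, where it is 0. The sign
      \<open>s\<close> records which case occurs.\<close>
    have ends: "integral {lev r a..lev r (b - r)} f - integral {lev r (b - r)..lev r a} f = s *\<^sub>R integral {c..d} f"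
    proof -
      have z: "integral {d..c} f = 0" using 1(1) by (cases "c = d") auto
      have cin: "c \<in> lev r ` {a..b-r}" "d \<in> lev r ` {a..b-r}" unfolding 1(4) using 1(1) by auto
      have ain: "lev r a \<in> {c..d}" "lev r (b-r) \<in> {c..d}" unfolding 1(4)[symmetric] using True by auto
      show ?thesis
      proof (cases "s = 1")
        case s1: True
        have mono: "lev r x \<le> lev r y" if "a \<le> x" "x \<le> y" "y \<le> b - r" for x y
        proof (rule DERIV_nonneg_imp_nondecreasing[OF that(2)])
          fix z assume "x \<le> z" "z \<le> y"
          then show "\<exists>D. (lev r has_real_derivative D) (at z) \<and> D \<ge> 0"
            using lev_deriv[of r z] sD[of z] s1 that by (intro exI[of _ "P1 (z + r) - P1 z"]) auto
        qed
        obtain x y where xy: "a \<le> x" "x \<le> b - r" "a \<le> y" "y \<le> b - r" "c = lev r x" "d = lev r y" using cin by auto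
        have "lev r a = c" "lev r (b - r) = d" using mono[of a x] mono[of y "b - r"] xy ain by auto
        then show ?thesis using z s1 by simp
      next
        case False
        then have s1: "s = - 1" using s by auto
        have mono: "lev r y \<le> lev r x" if "a \<le> x" "x \<le> y" "y \<le> b - r" for x y
        proof (rule DERIV_nonpos_imp_nonincreasing[OF that(2)])
          fix z assume "x \<le> z" "z \<le> y"
          then show "\<exists>D. (lev r has_real_derivative D) (at z) \<and> D \<le> 0"
            using lev_deriv[of r z] sD[of z] s1 that by (intro exI[of _ "P1 (z + r) - P1 z"]) auto
        qed
        obtain x y where xy: "a \<le> x" "x \<le> b - r" "a \<le> y" "y \<le> b - r" "d = lev r x" "c = lev r y" using cin by auto
        have "lev r a = d" "lev r (b - r) = c" using mono[of a x] mono[of y "b - r"] xy ain by auto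
        then show ?thesis using z s1 by simp
      qed
    qed
    have "((\<lambda>p. s *\<^sub>R h p) has_integral (s *\<^sub>R integral {c..d} f)) {a..b - r}"
      using sub unfolding ends by (rule has_integral_eq[rotated]) (use fh in auto)
    moreover have "((\<lambda>p. s *\<^sub>R h p) has_integral (s *\<^sub>R integral {a..b-r} h)) {a..b - r}"
      by (intro has_integral_cmul integrable_integral integrable_continuous_real hc)
    ultimately have "s *\<^sub>R integral {c..d} f = s *\<^sub>R integral {a..b-r} h" by (rule has_integral_unique)
    then have "integral {c..d} f = integral {a..b-r} h" using s by auto
    then show ?case using l1 l2 by (simp add: h_def[abs_def])
  qed
qed

text \<open>A Hoermander-type L2 bound for a nondegenerate phase: \<open>kernel_TTstar\<close>
  applied to \<open>kern\<close>, with the trivial correlation bound when the gaps are within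
  \<delta> and the oscillatory one otherwise. The parameter \<delta> is left free, to be balanced
  against the frequency \<tau>.\<close>

lemma hoermander:
  assumes \<rho>: "0 < \<rho>" "\<rho> \<le> 1" and \<delta>: "0 < \<delta>" "\<delta> \<le> 1" and \<tau>: "\<tau> \<noteq> 0"
    and am: "\<alpha> \<in> borel_measurable borel" and aB: "\<And>x. cmod (\<alpha> x) \<le> Ba" and a2: "integrable lborel (\<lambda>x. (cmod (\<alpha> x))\<^sup>2)"
    and gc: "continuous_on UNIV \<gamma>" and gB: "\<And>x. cmod (\<gamma> x) \<le> Bg" and g2: "integrable lborel (\<lambda>x. (cmod (\<gamma> x))\<^sup>2)"
  shows "(cmod (LINT r|lborel. (if \<rho> \<le> r then \<alpha> r * (LINT p|lborel. of_real (chi p * chi (p + r)) * \<gamma> (lev r p) * ee (\<tau> * (P p - p))) else 0)))\<^sup>2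
    \<le> (2 * \<delta> * (2 * K ^ 5 * (K / \<rho>)\<^sup>2) + K ^ 55 * (K / \<rho>) ^ 7 / (\<bar>\<tau>\<bar> * \<delta>\<^sup>2))
       * (LINT r|lborel. (cmod (\<alpha> r))\<^sup>2) * (LINT v|lborel. (cmod (\<gamma> v))\<^sup>2)"
proof -
  have "(cmod (LINT r|lborel. \<alpha> r * (LINT v|lborel. \<gamma> v * kern \<rho> \<tau> r v)))\<^sup>2
    \<le> (2 * \<delta> * (2 * K ^ 5 * (K / \<rho>)\<^sup>2) + K ^ 55 * (K / \<rho>) ^ 7 / (\<bar>\<tau>\<bar> * \<delta>\<^sup>2))
       * (LINT r|lborel. (cmod (\<alpha> r))\<^sup>2) * (LINT v|lborel. (cmod (\<gamma> v))\<^sup>2)"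
  proof (rule kernel_TTstar[where B="K\<^sup>2 * (K / \<rho>)" and V=K, OF kern_measurable[OF \<rho>(1)] kern_bound(1)[OF \<rho>] _ kern_correlation_trivial[OF \<rho>] kern_correlation[OF \<rho> \<delta> _ \<tau>] \<delta>(1) am aB a2 _ gB g2])
    show "0 \<le> r \<and> r \<le> 1 \<and> - K \<le> v \<and> v \<le> K" if "kern \<rho> \<tau> r v \<noteq> 0" for r v using kern_bound(2)[OF \<rho> that] \<rho> by auto
    show "\<gamma> \<in> borel_measurable borel" by (rule borel_measurable_continuous_onI[OF gc])
  qed
  moreover have "\<alpha> r * (LINT v|lborel. \<gamma> v * kern \<rho> \<tau> r v) = (if \<rho> \<le> r then \<alpha> r * (LINT p|lborel. of_real (chi p * chi (p + r)) * \<gamma> (lev r p) * ee (\<tau> * (P p - p))) else 0)" for r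
    using kern_substitution[OF \<rho> _ gc, of r \<tau>] kern_outside[OF \<rho>(1), of r \<tau>] by auto
  ultimately show ?thesis by simp
qed

end

subsection \<open>The energy of the bilinear form\<close>

lemma integrable_prod_dominated:
  fixes h :: "'a \<times> 'b \<Rightarrow> complex" and f :: "'a \<Rightarrow> real" and g :: "'b \<Rightarrow> real"
  assumes "sigma_finite_measure M1" "sigma_finite_measure M2"
    and f: "integrable M1 f" and g: "integrable M2 g"
    and h[measurable]: "h \<in> borel_measurable (M1 \<Otimes>\<^sub>M M2)"
    and hb: "\<And>x y. cmod (h (x, y)) \<le> f x * g y"
  shows "integrable (M1 \<Otimes>\<^sub>M M2) h"
proof -
  have "integrable (M1 \<Otimes>\<^sub>M M2) (\<lambda>z. complex_of_real (f (fst z)) * of_real (g (snd z)) * 1)"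
    by (rule integrable_prod_bounded[where C=1]) (use assms in auto)
  from integrable_norm[OF this] have 1: "integrable (M1 \<Otimes>\<^sub>M M2) (\<lambda>z. cmod (complex_of_real (f (fst z)) * of_real (g (snd z)) * 1))" .
  show ?thesis
  proof (rule Bochner_Integration.integrable_bound[OF 1 h AE_I2])
    fix z
    have "cmod (h z) \<le> f (fst z) * g (snd z)" using hb[of "fst z" "snd z"] by simp
    also have "\<dots> \<le> \<bar>f (fst z)\<bar> * \<bar>g (snd z)\<bar>" by (simp flip: abs_mult)
    finally show "norm (h z) \<le> norm (cmod (complex_of_real (f (fst z)) * of_real (g (snd z)) * 1))" by (simp add: norm_mult)
  qed
qed

lemma conv_measurable:
  fixes u v :: "real \<Rightarrow> complex"
  assumes [measurable]: "u \<in> borel_measurable borel" "v \<in> borel_measurable borel"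
  shows "(\<lambda>\<xi>. LINT \<eta>|lborel. u \<eta> * v (\<xi> - \<eta>)) \<in> borel_measurable borel"
    "(\<lambda>\<tau>. LINT \<eta>|lborel. u \<eta> * v (\<eta> + \<tau>)) \<in> borel_measurable borel"
proof -
  have "(\<lambda>\<xi>. LINT \<eta>|lborel. (\<lambda>(\<xi>, \<eta>). u \<eta> * v (\<xi> - \<eta>)) (\<xi>, \<eta>)) \<in> borel_measurable borel"
    by (intro lborel.borel_measurable_lebesgue_integral) measurable
  then show "(\<lambda>\<xi>. LINT \<eta>|lborel. u \<eta> * v (\<xi> - \<eta>)) \<in> borel_measurable borel" by simp
  have "(\<lambda>\<tau>. LINT \<eta>|lborel. (\<lambda>(\<tau>, \<eta>). u \<eta> * v (\<eta> + \<tau>)) (\<tau>, \<eta>)) \<in> borel_measurable borel"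
    by (intro lborel.borel_measurable_lebesgue_integral) measurable
  then show "(\<lambda>\<tau>. LINT \<eta>|lborel. u \<eta> * v (\<eta> + \<tau>)) \<in> borel_measurable borel" by simp
qed

lemma integral_mult_norm_bound:
  fixes u v :: "'a \<Rightarrow> complex"
  assumes u: "integrable M u" and v: "\<And>x. cmod (v x) \<le> B"
  shows "cmod (LINT x|M. u x * v x) \<le> (LINT x|M. cmod (u x)) * B"
proof -
  have B: "B \<ge> 0" by (rule order_trans[OF norm_ge_zero v[of undefined]])
  have "cmod (LINT x|M. u x * v x) \<le> (LINT x|M. cmod (u x) * B)"
    by (rule order_trans[OF integral_norm_bound integral_mono']) (use u v B in \<open>auto simp: norm_mult intro!: mult_left_mono\<close>)
  then show ?thesis by simp
qed

text \<open>On the left two pairs of frequencies have the same sum \<xi>. Hence the differences of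
  their first and of their second members agree up to sign; taking this difference \<tau> as the
  variable decouples the integral into two correlations.\<close>

lemma conv_inner:
  fixes u1 v1 u2 v2 :: "real \<Rightarrow> complex"
  assumes i: "integrable lborel u1" "integrable lborel v1" "integrable lborel u2" "integrable lborel v2"
    and b: "\<And>x. cmod (u2 x) \<le> Bu" "\<And>x. cmod (v2 x) \<le> Bv"
  shows "(LINT \<xi>|lborel. (LINT \<eta>|lborel. u1 \<eta> * v1 (\<xi> - \<eta>)) * cnj (LINT \<eta>|lborel. u2 \<eta> * v2 (\<xi> - \<eta>)))
    = (LINT \<tau>|lborel. (LINT \<eta>|lborel. u1 \<eta> * cnj (u2 (\<eta> + \<tau>))) * (LINT \<zeta>|lborel. v1 (\<zeta> + \<tau>) * cnj (v2 \<zeta>)))"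
proof -
  have [measurable]: "u1 \<in> borel_measurable borel" "v1 \<in> borel_measurable borel" "u2 \<in> borel_measurable borel" "v2 \<in> borel_measurable borel"
    using i by auto
  define U where "U \<xi> = (LINT \<eta>|lborel. u2 \<eta> * v2 (\<xi> - \<eta>))" for \<xi>
  define c where "c \<tau> = (LINT \<zeta>|lborel. v1 (\<zeta> + \<tau>) * cnj (v2 \<zeta>))" for \<tau>
  have [measurable]: "U \<in> borel_measurable borel" unfolding U_def by (rule conv_measurable) measurable
  have c_alt: "c \<tau> = (LINT \<zeta>|lborel. cnj (v2 \<zeta>) * v1 (\<zeta> + \<tau>))" for \<tau> by (simp add: c_def mult.commute)
  have [measurable]: "c \<in> borel_measurable borel" unfolding c_alt by (rule conv_measurable) measurable
  have Ub: "cmod (U \<xi>) \<le> (LINT \<eta>|lborel. cmod (u2 \<eta>)) * Bv" for \<xi>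
    unfolding U_def by (rule integral_mult_norm_bound) (use i b in auto)
  have cb: "cmod (c \<tau>) \<le> (LINT \<zeta>|lborel. cmod (v1 \<zeta>)) * Bv" for \<tau>
    using integral_mult_norm_bound[OF integrable_shift(2)[OF i(2), of \<tau>], of "\<lambda>\<zeta>. cnj (v2 \<zeta>)" Bv] b
    unfolding c_def by (simp add: LINT_shift(1)[of "\<lambda>x. cmod (v1 x)"])
  have "(LINT \<xi>|lborel. (LINT \<eta>|lborel. u1 \<eta> * v1 (\<xi> - \<eta>)) * cnj (U \<xi>)) = (LINT \<xi>|lborel. LINT \<eta>|lborel. u1 \<eta> * (v1 (\<xi> - \<eta>) * cnj (U \<xi>)))"
    by (simp flip: integral_mult_left_zero add: mult.assoc)
  also have "\<dots> = (LINT \<eta>|lborel. LINT \<xi>|lborel. u1 \<eta> * (v1 (\<xi> - \<eta>) * cnj (U \<xi>)))"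
  proof (rule lborel_pair.Fubini_integral)
    have "integrable (lborel \<Otimes>\<^sub>M lborel) (\<lambda>z. u1 (fst z) * v1 (snd z - fst z) * cnj (U (snd z)))"
      by (rule integrable_conv_bounded(1)[OF i(1) i(2), where C="(LINT \<eta>|lborel. cmod (u2 \<eta>)) * Bv"]) (measurable, simp add: Ub)
    then show "integrable (lborel \<Otimes>\<^sub>M lborel) (\<lambda>(\<eta>, \<xi>). u1 \<eta> * (v1 (\<xi> - \<eta>) * cnj (U \<xi>)))"
      by (simp add: case_prod_beta' mult.assoc)
  qed
  also have "\<dots> = (LINT \<eta>|lborel. u1 \<eta> * (LINT \<tau>|lborel. cnj (u2 (\<tau> + \<eta>)) * c \<tau>))"
  proof (rule Bochner_Integration.integral_cong)
    fix \<eta>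
    have "(LINT \<xi>|lborel. v1 (\<xi> - \<eta>) * cnj (U \<xi>)) = (LINT \<zeta>|lborel. v1 \<zeta> * cnj (U (\<zeta> + \<eta>)))"
      using LINT_shift(2)[of "\<lambda>\<zeta>. v1 \<zeta> * cnj (U (\<zeta> + \<eta>))" \<eta>] by simp
    also have "\<dots> = (LINT \<zeta>|lborel. LINT \<tau>|lborel. v1 \<zeta> * (cnj (v2 (\<zeta> - \<tau>)) * cnj (u2 (\<tau> + \<eta>))))"
    proof (rule Bochner_Integration.integral_cong)
      fix \<zeta>
      have "U (\<zeta> + \<eta>) = (LINT \<tau>|lborel. u2 (\<tau> + \<eta>) * v2 (\<zeta> + \<eta> - (\<tau> + \<eta>)))"
        unfolding U_def by (rule LINT_shift(1)[symmetric])
      then have "cnj (U (\<zeta> + \<eta>)) = (LINT \<tau>|lborel. cnj (v2 (\<zeta> - \<tau>)) * cnj (u2 (\<tau> + \<eta>)))"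
        by (simp flip: Bochner_Integration.integral_cnj add: mult.commute)
      then show "v1 \<zeta> * cnj (U (\<zeta> + \<eta>)) = (LINT \<tau>|lborel. v1 \<zeta> * (cnj (v2 (\<zeta> - \<tau>)) * cnj (u2 (\<tau> + \<eta>))))" by simp
    qed auto
    also have "\<dots> = (LINT \<tau>|lborel. LINT \<zeta>|lborel. v1 \<zeta> * (cnj (v2 (\<zeta> - \<tau>)) * cnj (u2 (\<tau> + \<eta>))))"
    proof (rule lborel_pair.Fubini_integral[symmetric])
      have "integrable lborel (\<lambda>x. cnj (v2 (0 - x)))" using integrable_shift(3)[OF i(4), of 0] by simp
      from integrable_conv_bounded(1)[OF i(2) this, of "\<lambda>z. cnj (u2 (snd z + \<eta>))" Bu] b(1)
      show "integrable (lborel \<Otimes>\<^sub>M lborel) (\<lambda>(\<zeta>, \<tau>). v1 \<zeta> * (cnj (v2 (\<zeta> - \<tau>)) * cnj (u2 (\<tau> + \<eta>))))"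
        by (simp add: case_prod_beta' mult.assoc)
    qed
    also have "\<dots> = (LINT \<tau>|lborel. cnj (u2 (\<tau> + \<eta>)) * c \<tau>)"
    proof (rule Bochner_Integration.integral_cong)
      fix \<tau>
      have "c \<tau> = (LINT \<zeta>|lborel. v1 \<zeta> * cnj (v2 (\<zeta> - \<tau>)))"
        using LINT_shift(1)[of "\<lambda>\<zeta>. v1 \<zeta> * cnj (v2 (\<zeta> - \<tau>))" \<tau>] by (simp add: c_def)
      then have "cnj (u2 (\<tau> + \<eta>)) * c \<tau> = (LINT \<zeta>|lborel. cnj (u2 (\<tau> + \<eta>)) * (v1 \<zeta> * cnj (v2 (\<zeta> - \<tau>))))" by simp
      then show "(LINT \<zeta>|lborel. v1 \<zeta> * (cnj (v2 (\<zeta> - \<tau>)) * cnj (u2 (\<tau> + \<eta>)))) = cnj (u2 (\<tau> + \<eta>)) * c \<tau>"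
        by (simp add: mult_ac)
    qed auto
    finally show "(LINT \<xi>|lborel. u1 \<eta> * (v1 (\<xi> - \<eta>) * cnj (U \<xi>))) = u1 \<eta> * (LINT \<tau>|lborel. cnj (u2 (\<tau> + \<eta>)) * c \<tau>)" by simp
  qed auto
  also have "\<dots> = (LINT \<eta>|lborel. LINT \<tau>|lborel. u1 \<eta> * (cnj (u2 (\<tau> + \<eta>)) * c \<tau>))" by simp
  also have "\<dots> = (LINT \<tau>|lborel. LINT \<eta>|lborel. u1 \<eta> * (cnj (u2 (\<tau> + \<eta>)) * c \<tau>))"
  proof (rule lborel_pair.Fubini_integral[symmetric])
    have "integrable lborel (\<lambda>x. cnj (u2 x))" using i by simp
    from integrable_conv_bounded(2)[OF i(1) this, of "\<lambda>z. c (snd z)"  "(LINT \<zeta>|lborel. cmod (v1 \<zeta>)) * Bv"] cb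
    show "integrable (lborel \<Otimes>\<^sub>M lborel) (\<lambda>(\<eta>, \<tau>). u1 \<eta> * (cnj (u2 (\<tau> + \<eta>)) * c \<tau>))"
      by (simp add: case_prod_beta' mult.assoc)
  qed
  also have "\<dots> = (LINT \<tau>|lborel. (LINT \<eta>|lborel. u1 \<eta> * cnj (u2 (\<eta> + \<tau>))) * c \<tau>)"
    by (simp flip: integral_mult_left_zero add: mult_ac add_ac)
  finally show ?thesis unfolding U_def c_def .
qed

text \<open>The last identity is Fubini: over all shifts the correlations of \<open>F\<close> carry
  the total energy \<open>||F||^4\<close>. Cauchy-Schwarz in \<tau> in \<open>energy_bound\<close>
  therefore produces exactly \<open>nF * nG\<close>.\<close>

lemma autocorrelation:
  fixes F :: "real \<Rightarrow> complex"
  assumes F: "integrable lborel F" and Fb: "\<And>x. cmod (F x) \<le> B"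
  shows "integrable lborel (\<lambda>x. (cmod (F x))\<^sup>2)"
    "integrable lborel (\<lambda>\<eta>. F \<eta> * cnj (F (\<eta> + \<tau>)))"
    "integrable lborel (\<lambda>\<eta>. (cmod (F \<eta> * cnj (F (\<eta> + \<tau>))))\<^sup>2)"
    "(LINT \<eta>|lborel. cmod (F \<eta> * cnj (F (\<eta> + \<tau>)))) \<le> (LINT x|lborel. (cmod (F x))\<^sup>2)"
    "integrable lborel (\<lambda>\<tau>. LINT \<eta>|lborel. cmod (F \<eta> * cnj (F (\<eta> + \<tau>))))"
    "integrable lborel (\<lambda>\<tau>. LINT \<eta>|lborel. (cmod (F \<eta> * cnj (F (\<eta> + \<tau>))))\<^sup>2)"
    "(LINT \<tau>|lborel. LINT \<eta>|lborel. (cmod (F \<eta> * cnj (F (\<eta> + \<tau>))))\<^sup>2) = (LINT x|lborel. (cmod (F x))\<^sup>2)\<^sup>2"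
proof -
  have [measurable]: "F \<in> borel_measurable borel" using F by auto
  have sq: "integrable M (\<lambda>x. (cmod (h x))\<^sup>2)" if "integrable M h" "\<And>x. cmod (h x) \<le> C" for h :: "real \<Rightarrow> complex" and C M
  proof -
    have "integrable M (\<lambda>x. h x * cnj (h x))" by (rule integrable_mult_bounded[where C=C]) (use that in auto)
    from integrable_norm[OF this] show ?thesis by (simp add: norm_mult power2_eq_square)
  qed
  show F2: "integrable lborel (\<lambda>x. (cmod (F x))\<^sup>2)" by (rule sq[OF F Fb])
  have cF: "integrable lborel (\<lambda>x. cnj (F x))" using F by simp
  have F2': "integrable lborel (\<lambda>x. complex_of_real ((cmod (F x))\<^sup>2))" using F2 by (rule integrable_of_real)
  show i1: "integrable lborel (\<lambda>\<eta>. F \<eta> * cnj (F (\<eta> + \<tau>)))" for \<tau>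
    by (rule integrable_mult_bounded[where C=B]) (use F Fb in auto)
  have B0: "B \<ge> 0" by (rule order_trans[OF norm_ge_zero Fb[of 0]])
  show "integrable lborel (\<lambda>\<eta>. (cmod (F \<eta> * cnj (F (\<eta> + \<tau>))))\<^sup>2)"
    by (rule sq[OF i1, of _ "B * B"]) (use Fb B0 in \<open>auto simp: norm_mult intro!: mult_mono\<close>)
  have "(LINT \<eta>|lborel. cmod (F \<eta> * cnj (F (\<eta> + \<tau>)))) \<le> (LINT \<eta>|lborel. ((cmod (F \<eta>))\<^sup>2 + (cmod (F (\<eta> + \<tau>)))\<^sup>2) / 2)"
  proof (rule integral_mono)
    show "integrable lborel (\<lambda>\<eta>. cmod (F \<eta> * cnj (F (\<eta> + \<tau>))))" using i1 by (rule integrable_norm)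
    show "integrable lborel (\<lambda>\<eta>. ((cmod (F \<eta>))\<^sup>2 + (cmod (F (\<eta> + \<tau>)))\<^sup>2) / 2)"
      using F2 integrable_shift(2)[OF F2, of \<tau>] by auto
    show "cmod (F \<eta> * cnj (F (\<eta> + \<tau>))) \<le> ((cmod (F \<eta>))\<^sup>2 + (cmod (F (\<eta> + \<tau>)))\<^sup>2) / 2" for \<eta>
      using sum_squares_bound[of "cmod (F \<eta>)" "cmod (F (\<eta> + \<tau>))"] by (simp add: norm_mult)
  qed
  also have "\<dots> = (LINT x|lborel. (cmod (F x))\<^sup>2)"
    using F2 integrable_shift(2)[OF F2, of \<tau>] by (simp add: LINT_shift(1)[of "\<lambda>x. (cmod (F x))\<^sup>2"])
  finally show "(LINT \<eta>|lborel. cmod (F \<eta> * cnj (F (\<eta> + \<tau>)))) \<le> (LINT x|lborel. (cmod (F x))\<^sup>2)" .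
  have j1: "integrable (lborel \<Otimes>\<^sub>M lborel) (\<lambda>z. cmod (F (fst z) * cnj (F (snd z + fst z)) * 1))"
    by (intro integrable_norm integrable_conv_bounded(2)[OF F cF, where C=1]) auto
  have j2: "integrable (lborel \<Otimes>\<^sub>M lborel) (\<lambda>z. cmod (complex_of_real ((cmod (F (fst z)))\<^sup>2) * complex_of_real ((cmod (F (snd z + fst z)))\<^sup>2) * 1))"
    by (intro integrable_norm integrable_conv_bounded(2)[OF F2' F2', where C=1]) auto
  have j2': "integrable (lborel \<Otimes>\<^sub>M lborel) (\<lambda>z. (cmod (F (fst z) * cnj (F (fst z + snd z))))\<^sup>2)"
    using j2 by (simp add: norm_mult norm_power power_mult_distrib add.commute del: of_real_power)
  show "integrable lborel (\<lambda>\<tau>. LINT \<eta>|lborel. cmod (F \<eta> * cnj (F (\<eta> + \<tau>))))"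
    using lborel_pair.integrable_snd[of "\<lambda>\<eta> \<tau>. cmod (F \<eta> * cnj (F (\<eta> + \<tau>)))"] j1 by (simp add: case_prod_beta' add.commute)
  show "integrable lborel (\<lambda>\<tau>. LINT \<eta>|lborel. (cmod (F \<eta> * cnj (F (\<eta> + \<tau>))))\<^sup>2)"
    using lborel_pair.integrable_snd[of "\<lambda>\<eta> \<tau>. (cmod (F \<eta> * cnj (F (\<eta> + \<tau>))))\<^sup>2"] j2' by (simp add: case_prod_beta')
  have "(LINT \<tau>|lborel. LINT \<eta>|lborel. (cmod (F \<eta> * cnj (F (\<eta> + \<tau>))))\<^sup>2) = (LINT \<eta>|lborel. LINT \<tau>|lborel. (cmod (F \<eta> * cnj (F (\<eta> + \<tau>))))\<^sup>2)"
    by (rule lborel_pair.Fubini_integral) (use j2' in \<open>simp add: case_prod_beta'\<close>)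
  also have "\<dots> = (LINT \<eta>|lborel. (cmod (F \<eta>))\<^sup>2 * (LINT \<tau>|lborel. (cmod (F (\<tau> + \<eta>)))\<^sup>2))"
    by (simp add: norm_mult power_mult_distrib add.commute)
  also have "\<dots> = (LINT x|lborel. (cmod (F x))\<^sup>2)\<^sup>2"
    by (simp add: LINT_shift(1)[of "\<lambda>x. (cmod (F x))\<^sup>2"]) (simp add: power2_eq_square)
  finally show "(LINT \<tau>|lborel. LINT \<eta>|lborel. (cmod (F \<eta> * cnj (F (\<eta> + \<tau>))))\<^sup>2) = (LINT x|lborel. (cmod (F x))\<^sup>2)\<^sup>2" .
qed

text \<open>\<open>F\<close> and \<open>G\<close> stand for the Fourier transforms of two functions \<open>f\<close> and \<open>g\<close>. Then \<open>slice p\<close> is the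
  Fourier transform of \<open>f (x + p) g (x + P p)\<close>, and \<open>alphaF \<tau>\<close>, \<open>gammaG \<tau>\<close> are the Fourier transforms of
  \<open>F \<eta> cnj (F (\<eta> + \<tau>))\<close> and \<open>G (\<zeta> + \<tau>) cnj (G \<zeta>)\<close>; the inner product of two slices is an integral of
  their product over \<open>\<tau>\<close>.\<close>

locale curve_pair = curve +
  fixes F G :: "real \<Rightarrow> complex" and BF BG :: real
  assumes F: "integrable lborel F" and G: "integrable lborel G"
    and FB: "\<And>x. cmod (F x) \<le> BF" and GB: "\<And>x. cmod (G x) \<le> BG"
begin

definition slice :: "real \<Rightarrow> real \<Rightarrow> complex" where
  "slice p \<xi> = (LINT \<eta>|lborel. (F \<eta> * ee (\<eta> * p)) * (G (\<xi> - \<eta>) * ee ((\<xi> - \<eta>) * P p)))"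

definition slice_form :: "real \<Rightarrow> complex" where "slice_form \<xi> = (LINT p|lborel. of_real (chi p) * slice p \<xi>)"

definition nF :: real where "nF = (LINT x|lborel. (cmod (F x))\<^sup>2)"
definition nG :: real where "nG = (LINT x|lborel. (cmod (G x))\<^sup>2)"

definition aF :: "real \<Rightarrow> real \<Rightarrow> complex" where "aF \<tau> \<eta> = F \<eta> * cnj (F (\<eta> + \<tau>))"
definition cG :: "real \<Rightarrow> real \<Rightarrow> complex" where "cG \<tau> \<zeta> = G (\<zeta> + \<tau>) * cnj (G \<zeta>)"
definition alphaF :: "real \<Rightarrow> real \<Rightarrow> complex" where "alphaF \<tau> r = (LINT \<eta>|lborel. aF \<tau> \<eta> * ee (- (\<eta> * r)))"
definition gammaG :: "real \<Rightarrow> real \<Rightarrow> complex" where "gammaG \<tau> v = (LINT \<zeta>|lborel. cG \<tau> \<zeta> * ee (- (\<zeta> * v)))"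
definition envF :: "real \<Rightarrow> real" where "envF \<tau> = (LINT \<eta>|lborel. cmod (aF \<tau> \<eta>))"
text \<open>Integrable majorant of all slices, uniform in \<open>p\<close>, with supremum at most
  \<open>MB\<close>. Both serve the exchange of integrals and do not enter the energy
  bounds.\<close>

definition env :: "real \<Rightarrow> real" where "env \<xi> = (LINT \<eta>|lborel. cmod (F \<eta>) * cmod (G (\<xi> - \<eta>)))"
definition MB :: real where "MB = (LINT \<eta>|lborel. cmod (F \<eta>)) * BG"

lemma FGmeas [measurable]: "F \<in> borel_measurable borel" "G \<in> borel_measurable borel"
  using F G by auto

lemma lborel_sigma_finite: "sigma_finite_measure (lborel :: real measure)" "sigma_finite_measure (lborel \<Otimes>\<^sub>M lborel :: (real \<times> real) measure)"
  by (unfold_locales) (metis lborel_prod lborel.sigma_finite_countable)+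

lemma nF_nonneg: "nF \<ge> 0" "nG \<ge> 0" by (simp_all add: nF_def nG_def)
lemma BFG_nonneg: "BF \<ge> 0" "BG \<ge> 0" using FB[of 0] GB[of 0] norm_ge_zero order_trans by blast+

lemma slice_measurable [measurable]: "case_prod slice \<in> borel_measurable (borel \<Otimes>\<^sub>M borel)"
proof -
  have "(\<lambda>x. LINT \<eta>|lborel. (\<lambda>(x, \<eta>). (F \<eta> * ee (\<eta> * fst x)) * (G (snd x - \<eta>) * ee ((snd x - \<eta>) * P (fst x)))) (x, \<eta>)) \<in> borel_measurable (borel \<Otimes>\<^sub>M borel)"
    by (intro lborel.borel_measurable_lebesgue_integral) measurable
  then show ?thesis unfolding slice_def case_prod_beta' by simp
qed

lemma slice_meas2 [measurable]: "f \<in> borel_measurable M \<Longrightarrow> g \<in> borel_measurable M \<Longrightarrow> (\<lambda>x. slice (f x) (g x)) \<in> borel_measurable M"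
  using measurable_compose[OF borel_measurable_Pair slice_measurable[unfolded borel_prod], of f M g] by simp

lemma env_integrable: "integrable lborel env"
proof -
  have "integrable (lborel \<Otimes>\<^sub>M lborel) (\<lambda>z. F (fst z) * G (snd z - fst z) * 1)"
    by (rule integrable_conv_bounded(1)[OF F G, where C=1]) auto
  from integrable_norm[OF this] have "integrable (lborel \<Otimes>\<^sub>M lborel) (\<lambda>(\<eta>, \<xi>). cmod (F \<eta>) * cmod (G (\<xi> - \<eta>)))"
    by (simp add: norm_mult case_prod_beta')
  from lborel_pair.integrable_snd[OF this] show ?thesis by (simp add: env_def[abs_def])
qed

lemma env_le: "env \<xi> \<le> MB" "env \<xi> \<ge> 0" "MB \<ge> 0"
proof -
  have i: "integrable lborel (\<lambda>\<eta>. cmod (F \<eta>) * BG)" using F by auto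
  show "env \<xi> \<le> MB" unfolding env_def MB_def
    by (subst integral_mult_left_zero[symmetric], rule integral_mono'[OF i]) (use GB BFG_nonneg in \<open>auto intro!: mult_left_mono\<close>)
  show "env \<xi> \<ge> 0" "MB \<ge> 0" by (auto simp: env_def MB_def BFG_nonneg)
qed

lemma slice_le: "cmod (slice p \<xi>) \<le> env \<xi>" "cmod (slice p \<xi>) \<le> MB"
proof -
  show "cmod (slice p \<xi>) \<le> env \<xi>" unfolding slice_def env_def
    by (rule order_trans[OF integral_norm_bound]) (simp add: norm_mult)
  then show "cmod (slice p \<xi>) \<le> MB" using env_le(1)[of \<xi>] by linarith
qed

lemma chi_integrable: "integrable lborel chi" "integrable lborel (\<lambda>p. complex_of_real (chi p))"
  and chi_integral: "(LINT p|lborel. chi p) \<le> K" "(LINT p|lborel. chi p) \<ge> 0"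
proof -
  have i: "integrable lborel (\<lambda>p. K * indicator {a..b} p)"
    by (intro integrable_mult_right integrable_real_indicator) (auto simp: emeasure_lborel_Icc_eq)
  have le: "chi p \<le> K * indicator {a..b} p" for p using chi_le[of p] chi_supp[of p] by (auto simp: indicator_def)
  show 1: "integrable lborel chi"
    by (rule Bochner_Integration.integrable_bound[OF i]) (use le chi_nonneg K_pos in auto)
  then show "integrable lborel (\<lambda>p. complex_of_real (chi p))" by (rule integrable_of_real)
  have "(LINT p|lborel. chi p) \<le> (LINT p|lborel. K * indicator {a..b} p)" by (rule integral_mono[OF 1 i le])
  also have "\<dots> = K * (b - a)" using ab by simp
  also have "\<dots> \<le> K * 1" using ab K_pos by (intro mult_left_mono) auto
  finally show "(LINT p|lborel. chi p) \<le> K" by simp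
  show "(LINT p|lborel. chi p) \<ge> 0" using chi_nonneg by simp
qed

lemma aF_facts: "integrable lborel (aF \<tau>)" "integrable lborel (\<lambda>\<eta>. (cmod (aF \<tau> \<eta>))\<^sup>2)" "envF \<tau> \<le> nF"
    "integrable lborel envF" "integrable lborel (\<lambda>\<tau>. LINT \<eta>|lborel. (cmod (aF \<tau> \<eta>))\<^sup>2)"
    "(LINT \<tau>|lborel. LINT \<eta>|lborel. (cmod (aF \<tau> \<eta>))\<^sup>2) = nF\<^sup>2"
  unfolding aF_def[abs_def] envF_def[abs_def] nF_def using autocorrelation[OF F FB] by auto

lemma cG_conj: "cG \<tau> \<zeta> = cnj (G \<zeta> * cnj (G (\<zeta> + \<tau>)))" by (simp add: cG_def mult.commute)

lemma cG_facts: "integrable lborel (cG \<tau>)" "integrable lborel (\<lambda>\<eta>. (cmod (cG \<tau> \<eta>))\<^sup>2)" "(LINT \<zeta>|lborel. cmod (cG \<tau> \<zeta>)) \<le> nG"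
    "integrable lborel (\<lambda>\<tau>. LINT \<eta>|lborel. (cmod (cG \<tau> \<eta>))\<^sup>2)"
    "(LINT \<tau>|lborel. LINT \<eta>|lborel. (cmod (cG \<tau> \<eta>))\<^sup>2) = nG\<^sup>2"
  unfolding cG_conj[abs_def] nG_def complex_mod_cnj using autocorrelation[OF G GB] by (simp_all only: complex_integrable_cnj)

lemma alphaF_le: "cmod (alphaF \<tau> r) \<le> envF \<tau>" unfolding alphaF_def envF_def by (rule fourier_bounded[OF aF_facts(1)])
lemma gammaG_le: "cmod (gammaG \<tau> v) \<le> nG" unfolding gammaG_def
  by (rule order_trans[OF fourier_bounded[OF cG_facts(1)] cG_facts(3)])

lemma alphaF_measurable [measurable]: "case_prod alphaF \<in> borel_measurable (borel \<Otimes>\<^sub>M borel)"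
  and gammaG_measurable [measurable]: "case_prod gammaG \<in> borel_measurable (borel \<Otimes>\<^sub>M borel)"
proof -
  have "(\<lambda>x. LINT \<eta>|lborel. (\<lambda>(x, \<eta>). (F \<eta> * cnj (F (\<eta> + fst x))) * ee (- (\<eta> * snd x))) (x, \<eta>)) \<in> borel_measurable (borel \<Otimes>\<^sub>M borel)"
    by (intro lborel.borel_measurable_lebesgue_integral) measurable
  then show "case_prod alphaF \<in> borel_measurable (borel \<Otimes>\<^sub>M borel)" unfolding alphaF_def aF_def case_prod_beta' by simp
  have "(\<lambda>x. LINT \<eta>|lborel. (\<lambda>(x, \<eta>). (G (\<eta> + fst x) * cnj (G \<eta>)) * ee (- (\<eta> * snd x))) (x, \<eta>)) \<in> borel_measurable (borel \<Otimes>\<^sub>M borel)"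
    by (intro lborel.borel_measurable_lebesgue_integral) measurable
  then show "case_prod gammaG \<in> borel_measurable (borel \<Otimes>\<^sub>M borel)" unfolding gammaG_def cG_def case_prod_beta' by simp
qed

lemma alphaF_meas2 [measurable]: "f \<in> borel_measurable M \<Longrightarrow> g \<in> borel_measurable M \<Longrightarrow> (\<lambda>x. alphaF (f x) (g x)) \<in> borel_measurable M"
  and gammaG_meas2 [measurable]: "f \<in> borel_measurable M \<Longrightarrow> g \<in> borel_measurable M \<Longrightarrow> (\<lambda>x. gammaG (f x) (g x)) \<in> borel_measurable M"
  using measurable_compose[OF borel_measurable_Pair alphaF_measurable[unfolded borel_prod], of f M g]
    measurable_compose[OF borel_measurable_Pair gammaG_measurable[unfolded borel_prod], of f M g] by simp_all

text \<open>\<open>conv_inner\<close> for the modulated functions. The characters depending on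
  \<eta> and \<zeta> see only \<open>q - p\<close> and \<open>P q - P p\<close>; the shift \<tau>
  leaves over the factor \<open>ee (\<tau> * (P p - q))\<close>.\<close>

lemma slice_inner:
  "(LINT \<xi>|lborel. slice p \<xi> * cnj (slice q \<xi>)) = (LINT \<tau>|lborel. alphaF \<tau> (q - p) * gammaG \<tau> (P q - P p) * ee (\<tau> * (P p - q)))"
proof -
  have mi: "integrable lborel (\<lambda>\<eta>. f \<eta> * ee (\<eta> * y))" if "integrable lborel f" for f y
    using that by (rule integrable_mult_bounded[where C=1]) auto
  have "(LINT \<xi>|lborel. slice p \<xi> * cnj (slice q \<xi>))
    = (LINT \<tau>|lborel. (LINT \<eta>|lborel. (F \<eta> * ee (\<eta> * p)) * cnj (F (\<eta> + \<tau>) * ee ((\<eta> + \<tau>) * q))) * (LINT \<zeta>|lborel. (G (\<zeta> + \<tau>) * ee ((\<zeta> + \<tau>) * P p)) * cnj (G \<zeta> * ee (\<zeta> * P q))))"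
    unfolding slice_def
    by (rule conv_inner[where Bu=BF and Bv=BG]) (auto intro!: mi F G simp: norm_mult FB GB)
  also have "\<dots> = (LINT \<tau>|lborel. alphaF \<tau> (q - p) * gammaG \<tau> (P q - P p) * ee (\<tau> * (P p - q)))"
  proof (rule Bochner_Integration.integral_cong)
    fix \<tau>
    have 1: "(LINT \<eta>|lborel. (F \<eta> * ee (\<eta> * p)) * cnj (F (\<eta> + \<tau>) * ee ((\<eta> + \<tau>) * q))) = alphaF \<tau> (q - p) * cnj (ee (\<tau> * q))"
      unfolding alphaF_def aF_def
      by (subst integral_mult_left_zero[symmetric]) (simp add: ee_diff ee_add ee_minus algebra_simps)
    have 2: "(LINT \<zeta>|lborel. (G (\<zeta> + \<tau>) * ee ((\<zeta> + \<tau>) * P p)) * cnj (G \<zeta> * ee (\<zeta> * P q))) = gammaG \<tau> (P q - P p) * ee (\<tau> * P p)"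
      unfolding gammaG_def cG_def
      by (subst integral_mult_left_zero[symmetric]) (simp add: ee_diff ee_add ee_minus algebra_simps)
    show "(LINT \<eta>|lborel. (F \<eta> * ee (\<eta> * p)) * cnj (F (\<eta> + \<tau>) * ee ((\<eta> + \<tau>) * q))) * (LINT \<zeta>|lborel. (G (\<zeta> + \<tau>) * ee ((\<zeta> + \<tau>) * P p)) * cnj (G \<zeta> * ee (\<zeta> * P q)))
      = alphaF \<tau> (q - p) * gammaG \<tau> (P q - P p) * ee (\<tau> * (P p - q))"
      unfolding 1 2 by (simp add: ee_diff right_diff_distrib mult_ac)
  qed auto
  finally show ?thesis .
qed

lemma LINT_chi: "continuous_on {a..b} f \<Longrightarrow> (LINT p|lborel. of_real (chi p) * f p) = integral {a..b} (\<lambda>p. of_real (chi p) * f p)" for f :: "real \<Rightarrow> complex"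
proof -
  assume f: "continuous_on {a..b} f"
  have c: "continuous_on {a..b} (\<lambda>p. of_real (chi p) * f p)" by (intro continuous_intros contchi f)
  have "of_real (chi p) * f p = (if a \<le> p \<and> p \<le> b then of_real (chi p) * f p else 0)" for p using chi_supp[of p] by auto
  then show ?thesis unfolding LINT_Icc_eq_integral(1)[OF c, symmetric] by simp
qed

definition diag_multiplier :: "real \<Rightarrow> complex" where "diag_multiplier \<tau> = (LINT p|lborel. of_real (chi p) * ee (\<tau> * (P p - p)))"

text \<open>The trivial bound for \<open>|\<tau>| \<le> 1\<close> and two integrations by parts
  beyond, merged into a multiple of a function whose integral is \<pi>.\<close>

lemma diag_multiplier_le: "cmod (diag_multiplier \<tau>) \<le> 2 * K ^ 7 * inverse (1 + \<tau>\<^sup>2)"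
proof -
  have X1: "cmod (diag_multiplier \<tau>) \<le> K"
  proof -
    have "cmod (diag_multiplier \<tau>) \<le> (LINT p|lborel. chi p)" unfolding diag_multiplier_def
      by (rule order_trans[OF integral_norm_bound]) (simp add: norm_mult chi_nonneg)
    then show ?thesis using chi_integral by linarith
  qed
  have K7: "K \<le> K ^ 7" using K_power[of 1 7] by simp
  show ?thesis
  proof (cases "\<bar>\<tau>\<bar> \<le> 1")
    case True
    then have "\<tau>\<^sup>2 \<le> 1" using abs_square_le_1 by blast
    then have "1 / 2 \<le> inverse (1 + \<tau>\<^sup>2)" by (simp add: field_simps add_pos_nonneg)
    then have "2 * K ^ 7 * (1 / 2) \<le> 2 * K ^ 7 * inverse (1 + \<tau>\<^sup>2)" using K_pos by (intro mult_left_mono) auto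
    then show ?thesis using X1 K7 by simp
  next
    case False
    then have t: "\<tau> \<noteq> 0" "\<tau>\<^sup>2 \<ge> 1" using abs_square_le_1[of \<tau>] by auto
    have "diag_multiplier \<tau> = integral {a..b} (\<lambda>p. of_real (chi p) * cis (2 * pi * (\<tau> * (P p - p))))"
      unfolding diag_multiplier_def ee_def[symmetric] by (rule LINT_chi) (intro continuous_intros contP)
    then have "cmod (diag_multiplier \<tau>) \<le> K ^ 7 / \<tau>\<^sup>2" using oscillatory_no_stationary[OF t(1)] by simp
    also have "\<dots> \<le> 2 * K ^ 7 * inverse (1 + \<tau>\<^sup>2)" using t K_pos by (simp add: field_simps add_pos_nonneg)
    finally show ?thesis .
  qed
qed

lemma inv_sq_integrable: "integrable lborel (\<lambda>x::real. inverse (1 + x\<^sup>2))" "(LINT x|lborel. inverse (1 + x\<^sup>2)) = pi"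
  using integrable_inverse_1_plus_square LBINT_inverse_1_plus_square
  unfolding set_integrable_def set_lebesgue_integral_def by (auto simp: einterval_eq interval_lebesgue_integral_def set_integrable_def set_lebesgue_integral_def)

text \<open>For \<open>q = p\<close> the factors \<open>alphaF\<close> and \<open>gammaG\<close> are
  taken at 0 and no longer depend on \<open>p\<close>, so the p-integral is
  \<open>diag_multiplier\<close>, integrable in \<tau>. On the physical side this is the change of
  variables \<open>(x, p) -> (x + p, x + P p)\<close>, with Jacobian \<open>P' - 1\<close>.\<close>

lemma diagonal_energy:
  "integrable lborel (\<lambda>\<xi>. LINT p|lborel. chi p * (cmod (slice p \<xi>))\<^sup>2)"
  "(LINT \<xi>|lborel. LINT p|lborel. chi p * (cmod (slice p \<xi>))\<^sup>2) \<le> 2 * pi * K ^ 7 * nF * nG"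
proof -
  have i0: "integrable (lborel \<Otimes>\<^sub>M lborel) (\<lambda>z. complex_of_real (chi (fst z)) * (slice (fst z) (snd z) * cnj (slice (fst z) (snd z))))"
  proof (rule integrable_prod_dominated[OF lborel_sigma_finite(1) lborel_sigma_finite(1) chi_integrable(1), of "\<lambda>\<xi>. env \<xi> * MB"])
    show "integrable lborel (\<lambda>\<xi>. env \<xi> * MB)" using env_integrable by auto
    show "cmod (complex_of_real (chi (fst (p, \<xi>))) * (slice (fst (p, \<xi>)) (snd (p, \<xi>)) * cnj (slice (fst (p, \<xi>)) (snd (p, \<xi>))))) \<le> chi p * (env \<xi> * MB)" for p \<xi>
      using slice_le[of p \<xi>] chi_nonneg[of p] env_le by (auto simp: norm_mult intro!: mult_left_mono mult_mono)
  qed measurable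
  have e: "cmod (complex_of_real (chi p) * (slice p \<xi> * cnj (slice p \<xi>))) = chi p * (cmod (slice p \<xi>))\<^sup>2" for p \<xi>
    using chi_nonneg[of p] by (simp add: norm_mult power2_eq_square)
  have i1: "integrable (lborel \<Otimes>\<^sub>M lborel) (\<lambda>(p, \<xi>). chi p * (cmod (slice p \<xi>))\<^sup>2)"
    using integrable_norm[OF i0] unfolding e by (simp add: case_prod_beta')
  show "integrable lborel (\<lambda>\<xi>. LINT p|lborel. chi p * (cmod (slice p \<xi>))\<^sup>2)"
    using lborel_pair.integrable_snd[OF i1] .
  have "complex_of_real (LINT \<xi>|lborel. LINT p|lborel. chi p * (cmod (slice p \<xi>))\<^sup>2) = of_real (LINT p|lborel. LINT \<xi>|lborel. chi p * (cmod (slice p \<xi>))\<^sup>2)"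
    using lborel_pair.Fubini_integral[OF i1] by simp
  also have "\<dots> = (LINT p|lborel. of_real (chi p) * (LINT \<xi>|lborel. slice p \<xi> * cnj (slice p \<xi>)))"
    by (subst integral_complex_of_real[symmetric]) (simp add: complex_norm_square[symmetric] del: of_real_power)
  also have "\<dots> = (LINT p|lborel. LINT \<tau>|lborel. of_real (chi p) * (alphaF \<tau> 0 * gammaG \<tau> 0 * ee (\<tau> * (P p - p))))"
    unfolding slice_inner by simp
  also have "\<dots> = (LINT \<tau>|lborel. LINT p|lborel. of_real (chi p) * (alphaF \<tau> 0 * gammaG \<tau> 0 * ee (\<tau> * (P p - p))))"
  proof (rule lborel_pair.Fubini_integral[symmetric])
    have "integrable (lborel \<Otimes>\<^sub>M lborel) (\<lambda>z. complex_of_real (chi (fst z)) * (alphaF (snd z) 0 * gammaG (snd z) 0 * ee (snd z * (P (fst z) - fst z))))"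
    proof (rule integrable_prod_dominated[OF lborel_sigma_finite(1) lborel_sigma_finite(1) chi_integrable(1), of "\<lambda>\<tau>. envF \<tau> * nG"])
      show "integrable lborel (\<lambda>\<tau>. envF \<tau> * nG)" using aF_facts(4) by auto
      show "cmod (complex_of_real (chi (fst (p, \<tau>))) * (alphaF (snd (p, \<tau>)) 0 * gammaG (snd (p, \<tau>)) 0 * ee (snd (p, \<tau>) * (P (fst (p, \<tau>)) - fst (p, \<tau>))))) \<le> chi p * (envF \<tau> * nG)" for p \<tau>
        using alphaF_le[of \<tau> 0] gammaG_le[of \<tau> 0] chi_nonneg[of p] order_trans[OF norm_ge_zero alphaF_le[of \<tau> 0]] nF_nonneg
        by (auto simp: norm_mult intro!: mult_left_mono mult_mono)
    qed measurable
    then show "integrable (lborel \<Otimes>\<^sub>M lborel) (\<lambda>(p, \<tau>). of_real (chi p) * (alphaF \<tau> 0 * gammaG \<tau> 0 * ee (\<tau> * (P p - p))))"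
      by (simp add: case_prod_beta')
  qed
  also have "\<dots> = (LINT \<tau>|lborel. alphaF \<tau> 0 * gammaG \<tau> 0 * diag_multiplier \<tau>)"
    unfolding diag_multiplier_def by (simp flip: integral_mult_right_zero add: mult_ac)
  finally have eq: "complex_of_real (LINT \<xi>|lborel. LINT p|lborel. chi p * (cmod (slice p \<xi>))\<^sup>2) = (LINT \<tau>|lborel. alphaF \<tau> 0 * gammaG \<tau> 0 * diag_multiplier \<tau>)" .
  have "(LINT \<xi>|lborel. LINT p|lborel. chi p * (cmod (slice p \<xi>))\<^sup>2) \<le> cmod (complex_of_real (LINT \<xi>|lborel. LINT p|lborel. chi p * (cmod (slice p \<xi>))\<^sup>2))" by simp
  also have "\<dots> \<le> (LINT \<tau>|lborel. nF * nG * (2 * K ^ 7 * inverse (1 + \<tau>\<^sup>2)))" unfolding eq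
  proof (rule order_trans[OF integral_norm_bound integral_mono'])
    show "integrable lborel (\<lambda>\<tau>. nF * nG * (2 * K ^ 7 * inverse (1 + \<tau>\<^sup>2)))" using inv_sq_integrable by auto
    show "cmod (alphaF \<tau> 0 * gammaG \<tau> 0 * diag_multiplier \<tau>) \<le> nF * nG * (2 * K ^ 7 * inverse (1 + \<tau>\<^sup>2))" for \<tau>
      unfolding norm_mult using order_trans[OF alphaF_le[of \<tau> 0] aF_facts(3)] gammaG_le[of \<tau> 0] diag_multiplier_le nF_nonneg
      by (intro mult_mono) auto
  qed (use nF_nonneg K_pos in \<open>auto intro!: mult_nonneg_nonneg add_nonneg_nonneg\<close>)
  also have "\<dots> = 2 * pi * K ^ 7 * nF * nG" using inv_sq_integrable by simp
  finally show "(LINT \<xi>|lborel. LINT p|lborel. chi p * (cmod (slice p \<xi>))\<^sup>2) \<le> 2 * pi * K ^ 7 * nF * nG" .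
qed

end

section \<open>Diagonal and off-diagonal parts of the square\<close>

context curve_pair
begin

text \<open>Only the half \<open>q \<ge> p + \<rho>\<close> of the off-diagonal region; the other
  half contributes the complex conjugate.\<close>

definition offdiag_weight :: "real \<Rightarrow> real \<times> real \<Rightarrow> complex" where
  "offdiag_weight \<rho> z = (if fst z + \<rho> \<le> snd z then of_real (chi (fst z) * chi (snd z)) else 0)"

definition offdiag_freq :: "real \<Rightarrow> real \<Rightarrow> complex" where
  "offdiag_freq \<rho> \<tau> = (LINT z|(lborel \<Otimes>\<^sub>M lborel). offdiag_weight \<rho> z * (alphaF \<tau> (snd z - fst z) * gammaG \<tau> (P (snd z) - P (fst z)) * ee (\<tau> * (P (fst z) - snd z))))"

lemma offdiag_weight_measurable [measurable]: "offdiag_weight \<rho> \<in> borel_measurable (borel \<Otimes>\<^sub>M borel)" unfolding offdiag_weight_def by measurable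

lemma offdiag_weight_le: "cmod (offdiag_weight \<rho> z) \<le> chi (fst z) * chi (snd z)" by (auto simp: offdiag_weight_def norm_mult abs_mult chi_nonneg)

lemma chi2_integrable: "integrable (lborel \<Otimes>\<^sub>M lborel) (\<lambda>z. complex_of_real (chi (fst z) * chi (snd z)))"
  using integrable_prod_bounded[OF lborel_sigma_finite(1) lborel_sigma_finite(1) chi_integrable(2) chi_integrable(2), of "\<lambda>_. 1" 1] by simp

lemma offdiag_weight_integrable: "integrable (lborel \<Otimes>\<^sub>M lborel) (offdiag_weight \<rho>)"
  by (rule Bochner_Integration.integrable_bound[OF chi2_integrable]) (auto simp: offdiag_weight_def)

lemma chi2_integrable': "integrable (lborel \<Otimes>\<^sub>M lborel) (\<lambda>z. chi (fst z) * chi (snd z))"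
  using integrable_norm[OF chi2_integrable] by (simp add: norm_mult abs_mult chi_nonneg)

definition offdiag :: "real \<Rightarrow> real \<Rightarrow> complex" where
  "offdiag \<rho> \<xi> = (LINT z|(lborel \<Otimes>\<^sub>M lborel). offdiag_weight \<rho> z * (slice (fst z) \<xi> * cnj (slice (snd z) \<xi>)))"

lemma offdiag_integral:
  "integrable lborel (offdiag \<rho>)" "integrable lborel (offdiag_freq \<rho>)" "(LINT \<xi>|lborel. offdiag \<rho> \<xi>) = (LINT \<tau>|lborel. offdiag_freq \<rho> \<tau>)"
proof -
  interpret PP: pair_sigma_finite "lborel \<Otimes>\<^sub>M lborel :: (real \<times> real) measure" "lborel :: real measure"
    using lborel_sigma_finite by (simp add: pair_sigma_finite_def)
  have i1: "integrable ((lborel \<Otimes>\<^sub>M lborel) \<Otimes>\<^sub>M lborel) (\<lambda>(z, \<xi>). offdiag_weight \<rho> z * (slice (fst z) \<xi> * cnj (slice (snd z) \<xi>)))"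
  proof (rule integrable_prod_dominated[OF lborel_sigma_finite(2) lborel_sigma_finite(1) chi2_integrable', of "\<lambda>\<xi>. env \<xi> * MB"])
    show "integrable lborel (\<lambda>\<xi>. env \<xi> * MB)" using env_integrable by auto
    show "cmod (case (z, \<xi>) of (z, \<xi>) \<Rightarrow> offdiag_weight \<rho> z * (slice (fst z) \<xi> * cnj (slice (snd z) \<xi>))) \<le> chi (fst z) * chi (snd z) * (env \<xi> * MB)" for z \<xi>
    proof -
      have h: "cmod (slice (fst z) \<xi>) * cmod (slice (snd z) \<xi>) \<le> env \<xi> * MB" using slice_le env_le by (intro mult_mono) auto
      show ?thesis unfolding prod.case norm_mult complex_mod_cnj
        by (rule mult_mono[OF offdiag_weight_le h]) (auto simp: chi_nonneg)
    qed
  qed measurable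
  show "integrable lborel (offdiag \<rho>)" using PP.integrable_snd[OF i1] by (simp add: offdiag_def[abs_def])
  have i2: "integrable ((lborel \<Otimes>\<^sub>M lborel) \<Otimes>\<^sub>M lborel) (\<lambda>(z, \<tau>). offdiag_weight \<rho> z * (alphaF \<tau> (snd z - fst z) * gammaG \<tau> (P (snd z) - P (fst z)) * ee (\<tau> * (P (fst z) - snd z))))"
  proof (rule integrable_prod_dominated[OF lborel_sigma_finite(2) lborel_sigma_finite(1) chi2_integrable', of "\<lambda>\<tau>. envF \<tau> * nG"])
    show "integrable lborel (\<lambda>\<tau>. envF \<tau> * nG)" using aF_facts(4) by auto
    show "cmod (case (z, \<tau>) of (z, \<tau>) \<Rightarrow> offdiag_weight \<rho> z * (alphaF \<tau> (snd z - fst z) * gammaG \<tau> (P (snd z) - P (fst z)) * ee (\<tau> * (P (fst z) - snd z)))) \<le> chi (fst z) * chi (snd z) * (envF \<tau> * nG)" for z \<tau>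
    proof -
      have h: "cmod (alphaF \<tau> (snd z - fst z)) * cmod (gammaG \<tau> (P (snd z) - P (fst z))) \<le> envF \<tau> * nG"
        using alphaF_le gammaG_le order_trans[OF norm_ge_zero alphaF_le[of \<tau> 0]] by (intro mult_mono) auto
      show ?thesis unfolding prod.case norm_mult norm_ee mult_1_right
        by (rule mult_mono[OF offdiag_weight_le h]) (auto simp: chi_nonneg)
    qed
  qed measurable
  show "integrable lborel (offdiag_freq \<rho>)" using PP.integrable_snd[OF i2] by (simp add: offdiag_freq_def[abs_def])
  have "(LINT \<xi>|lborel. offdiag \<rho> \<xi>) = (LINT z|(lborel \<Otimes>\<^sub>M lborel). LINT \<xi>|lborel. offdiag_weight \<rho> z * (slice (fst z) \<xi> * cnj (slice (snd z) \<xi>)))"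
    unfolding offdiag_def by (rule PP.Fubini_integral[OF i1])
  also have "\<dots> = (LINT z|(lborel \<Otimes>\<^sub>M lborel). LINT \<tau>|lborel. offdiag_weight \<rho> z * (alphaF \<tau> (snd z - fst z) * gammaG \<tau> (P (snd z) - P (fst z)) * ee (\<tau> * (P (fst z) - snd z))))"
    by (simp add: slice_inner)
  also have "\<dots> = (LINT \<tau>|lborel. offdiag_freq \<rho> \<tau>)"
    unfolding offdiag_freq_def by (rule PP.Fubini_integral[OF i2, symmetric])
  finally show "(LINT \<xi>|lborel. offdiag \<rho> \<xi>) = (LINT \<tau>|lborel. offdiag_freq \<rho> \<tau>)" .
qed

text \<open>The square is a double integral over \<open>p\<close>, \<open>q\<close>, split into
  \<open>|p - q| < \<rho>\<close> and two off-diagonal halves exchanged by conjugation. Schur's test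
  bounds the near part, because \<open>chi\<close> has mass at most \<open>2 * \<rho> * K\<close> in
  a window of radius \<rho>. For the far part the real part is kept instead of the modulus: its
  smallness appears only after integration over \<xi>.\<close>

lemma slice_form_sq_le:
  assumes \<rho>: "\<rho> > 0"
  shows "(cmod (slice_form \<xi>))\<^sup>2 \<le> 2 * \<rho> * K * (LINT p|lborel. chi p * (cmod (slice p \<xi>))\<^sup>2) + 2 * Re (offdiag \<rho> \<xi>)"
proof -
  define Kx where "Kx z = complex_of_real (chi (fst z) * chi (snd z)) * (slice (fst z) \<xi> * cnj (slice (snd z) \<xi>))" for z
  define S where "S p = chi p * (cmod (slice p \<xi>))\<^sup>2" for p
  have [measurable]: "(\<lambda>p. slice p \<xi>) \<in> borel_measurable borel" by measurable
  have [measurable]: "Kx \<in> borel_measurable (borel \<Otimes>\<^sub>M borel)" unfolding Kx_def by measurable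
  have ci: "integrable lborel (\<lambda>p. complex_of_real (chi p) * slice p \<xi>)"
    by (rule integrable_mult_bounded[OF chi_integrable(2), where C=MB]) (use slice_le in auto)
  have Si: "integrable lborel S"
  proof -
    have "integrable lborel (\<lambda>p. (complex_of_real (chi p) * slice p \<xi>) * cnj (slice p \<xi>))"
      by (rule integrable_mult_bounded[OF ci, where C=MB]) (use slice_le in auto)
    from integrable_norm[OF this] show ?thesis
      by (simp add: S_def[abs_def] norm_mult power2_eq_square chi_nonneg mult_ac)
  qed
  have Ki: "integrable (lborel \<Otimes>\<^sub>M lborel) Kx"
  proof -
    have "integrable (lborel \<Otimes>\<^sub>M lborel) (\<lambda>z. (complex_of_real (chi (fst z)) * slice (fst z) \<xi>) * cnj (complex_of_real (chi (snd z)) * slice (snd z) \<xi>) * 1)"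
      by (rule integrable_prod_bounded[OF lborel_sigma_finite(1) lborel_sigma_finite(1) ci, of "\<lambda>p. cnj (complex_of_real (chi p) * slice p \<xi>)" "\<lambda>_. 1" 1])
        (subst complex_integrable_cnj, rule ci, auto)
    then show ?thesis by (simp add: Kx_def[abs_def] mult_ac)
  qed
  have indi: "integrable (lborel \<Otimes>\<^sub>M lborel) (\<lambda>z. if Q z then Kx z else 0)" if [measurable]: "Measurable.pred (borel \<Otimes>\<^sub>M borel) Q" for Q
    by (rule Bochner_Integration.integrable_bound[OF Ki]) auto
  define D where "D z = (if \<bar>fst z - snd z\<bar> < \<rho> then Kx z else 0)" for z
  define O1 where "O1 z = (if fst z + \<rho> \<le> snd z then Kx z else 0)" for z
  define O2 where "O2 z = (if snd z + \<rho> \<le> fst z then Kx z else 0)" for z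
  have Di: "integrable (lborel \<Otimes>\<^sub>M lborel) D" unfolding D_def by (rule indi) measurable
  have O1i: "integrable (lborel \<Otimes>\<^sub>M lborel) O1" unfolding O1_def by (rule indi) measurable
  have O2i: "integrable (lborel \<Otimes>\<^sub>M lborel) O2" unfolding O2_def by (rule indi) measurable
  have O1e: "(LINT z|(lborel \<Otimes>\<^sub>M lborel). O1 z) = offdiag \<rho> \<xi>" unfolding offdiag_def O1_def offdiag_weight_def Kx_def
    by (intro Bochner_Integration.integral_cong) auto
  have O2e: "(LINT z|(lborel \<Otimes>\<^sub>M lborel). O2 z) = cnj (offdiag \<rho> \<xi>)"
  proof -
    have "(LINT z|(lborel \<Otimes>\<^sub>M lborel). O2 z) = (LINT (x,y)|(lborel \<Otimes>\<^sub>M lborel). O2 (y, x))"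
      by (rule lborel_pair.integral_product_swap[symmetric]) (use O2i in auto)
    also have "\<dots> = (LINT z|(lborel \<Otimes>\<^sub>M lborel). cnj (O1 z))"
      by (intro Bochner_Integration.integral_cong) (auto simp: O1_def O2_def Kx_def split: prod.splits)
    finally show ?thesis unfolding O1e[symmetric] by simp
  qed
  have split: "Kx z = D z + (O1 z + O2 z)" for z using \<rho> by (auto simp: D_def O1_def O2_def)
  have "complex_of_real ((cmod (slice_form \<xi>))\<^sup>2) = slice_form \<xi> * cnj (slice_form \<xi>)" by (rule complex_norm_square)
  also have "\<dots> = (LINT p|lborel. LINT q|lborel. Kx (p, q))"
  proof -
    have "cnj (slice_form \<xi>) = (LINT q|lborel. of_real (chi q) * cnj (slice q \<xi>))"
      unfolding slice_form_def by (simp flip: Bochner_Integration.integral_cnj)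
    then have "of_real (chi p) * slice p \<xi> * cnj (slice_form \<xi>) = (LINT q|lborel. Kx (p, q))" for p
      by (simp add: Kx_def mult_ac flip: integral_mult_right_zero)
    moreover have "slice_form \<xi> * cnj (slice_form \<xi>) = (LINT p|lborel. of_real (chi p) * slice p \<xi> * cnj (slice_form \<xi>))"
      unfolding slice_form_def by simp
    ultimately show ?thesis by simp
  qed
  also have "\<dots> = (LINT z|(lborel \<Otimes>\<^sub>M lborel). Kx z)"
    using lborel_pair.integral_fst[of "\<lambda>p q. Kx (p, q)"] Ki by simp
  also have "\<dots> = (LINT z|(lborel \<Otimes>\<^sub>M lborel). D z) + (offdiag \<rho> \<xi> + cnj (offdiag \<rho> \<xi>))"
    unfolding split using Di O1i O2i O1e O2e by simp
  finally have "(cmod (slice_form \<xi>))\<^sup>2 = Re ((LINT z|(lborel \<Otimes>\<^sub>M lborel). D z) + (offdiag \<rho> \<xi> + cnj (offdiag \<rho> \<xi>)))"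
    by (metis Re_complex_of_real)
  also have "\<dots> \<le> cmod (LINT z|(lborel \<Otimes>\<^sub>M lborel). D z) + 2 * Re (offdiag \<rho> \<xi>)"
    using complex_Re_le_cmod[of "LINT z|(lborel \<Otimes>\<^sub>M lborel). D z"] by simp
  also have "cmod (LINT z|(lborel \<Otimes>\<^sub>M lborel). D z) \<le> 2 * \<rho> * K * (LINT p|lborel. S p)"
  proof -
    define w where "w x = (if \<bar>x\<bar> < \<rho> then 1 else 0 :: real)" for x
    have [measurable]: "w \<in> borel_measurable borel" unfolding w_def by measurable
    have w0: "w x \<ge> 0" for x by (simp add: w_def)
    have S0: "S p \<ge> 0" for p by (simp add: S_def chi_nonneg)
    have wc: "(\<integral>\<^sup>+q. ennreal (w (p - q) * chi q) \<partial>lborel) \<le> ennreal (2 * \<rho> * K)" for p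
    proof -
      have "(\<integral>\<^sup>+q. ennreal (w (p - q) * chi q) \<partial>lborel) \<le> (\<integral>\<^sup>+q. ennreal K * indicator {p-\<rho>..p+\<rho>} q \<partial>lborel)"
        using chi_le by (intro nn_integral_mono) (auto simp: w_def indicator_def intro: ennreal_leI)
      also have "\<dots> = ennreal (2 * \<rho> * K)" using \<rho> K_pos by (simp add: nn_integral_cmult_indicator mult_ac flip: ennreal_mult)
      finally show ?thesis .
    qed
    have "ennreal (cmod (LINT z|(lborel \<Otimes>\<^sub>M lborel). D z)) \<le> (\<integral>\<^sup>+z. ennreal (cmod (D z)) \<partial>(lborel \<Otimes>\<^sub>M lborel))"
      by (rule norm_LINT_le_nn_integral)
    also have "\<dots> \<le> (\<integral>\<^sup>+z. (ennreal (S (fst z) / 2) * ennreal (w (fst z - snd z) * chi (snd z)) + ennreal (S (snd z) / 2) * ennreal (w (fst z - snd z) * chi (fst z))) \<partial>(lborel \<Otimes>\<^sub>M lborel))"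
    proof (rule nn_integral_mono)
      fix z :: "real \<times> real"
      have "2 * (cmod (slice (fst z) \<xi>) * cmod (slice (snd z) \<xi>)) \<le> (cmod (slice (fst z) \<xi>))\<^sup>2 + (cmod (slice (snd z) \<xi>))\<^sup>2"
        using sum_squares_bound[of "cmod (slice (fst z) \<xi>)" "cmod (slice (snd z) \<xi>)"] by (simp add: mult.assoc)
      then have "(chi (fst z) * chi (snd z) * w (fst z - snd z)) * (cmod (slice (fst z) \<xi>) * cmod (slice (snd z) \<xi>)) \<le> (chi (fst z) * chi (snd z) * w (fst z - snd z)) * (((cmod (slice (fst z) \<xi>))\<^sup>2 + (cmod (slice (snd z) \<xi>))\<^sup>2) / 2)"
        using chi_nonneg w0 by (intro mult_left_mono) auto
      then have "cmod (D z) \<le> S (fst z) / 2 * (w (fst z - snd z) * chi (snd z)) + S (snd z) / 2 * (w (fst z - snd z) * chi (fst z))"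
        using chi_nonneg by (auto simp: D_def Kx_def w_def S_def norm_mult field_simps)
      then show "ennreal (cmod (D z)) \<le> ennreal (S (fst z) / 2) * ennreal (w (fst z - snd z) * chi (snd z)) + ennreal (S (snd z) / 2) * ennreal (w (fst z - snd z) * chi (fst z))"
        using S0 w0 chi_nonneg by (simp flip: ennreal_mult ennreal_plus add: ennreal_leI)
    qed
    also have "\<dots> = (\<integral>\<^sup>+p. ennreal (S p / 2) * (\<integral>\<^sup>+q. ennreal (w (p - q) * chi q) \<partial>lborel) \<partial>lborel) + (\<integral>\<^sup>+p. ennreal (S p / 2) * (\<integral>\<^sup>+q. ennreal (w (q - p) * chi q) \<partial>lborel) \<partial>lborel)"
    proof -
      have [measurable]: "S \<in> borel_measurable borel" unfolding S_def by measurable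
      have 1: "(\<integral>\<^sup>+z. ennreal (S (fst z) / 2) * ennreal (w (fst z - snd z) * chi (snd z)) \<partial>(lborel \<Otimes>\<^sub>M lborel)) = (\<integral>\<^sup>+p. ennreal (S p / 2) * (\<integral>\<^sup>+q. ennreal (w (p - q) * chi q) \<partial>lborel) \<partial>lborel)"
        by (subst lborel.nn_integral_fst[symmetric]) (auto simp: nn_integral_cmult)
      have 2: "(\<integral>\<^sup>+z. ennreal (S (snd z) / 2) * ennreal (w (fst z - snd z) * chi (fst z)) \<partial>(lborel \<Otimes>\<^sub>M lborel)) = (\<integral>\<^sup>+p. ennreal (S p / 2) * (\<integral>\<^sup>+q. ennreal (w (q - p) * chi q) \<partial>lborel) \<partial>lborel)"
        by (subst lborel_pair.nn_integral_snd[symmetric]) (auto simp: nn_integral_cmult)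
      show ?thesis unfolding 1[symmetric] 2[symmetric] by (rule nn_integral_add) measurable
    qed
    also have "\<dots> \<le> (\<integral>\<^sup>+p. ennreal (S p / 2) * ennreal (2 * \<rho> * K) \<partial>lborel) + (\<integral>\<^sup>+p. ennreal (S p / 2) * ennreal (2 * \<rho> * K) \<partial>lborel)"
    proof -
      have ws: "w (q - p) = w (p - q)" for p q by (simp add: w_def abs_minus_commute)
      show ?thesis unfolding ws[of _ "_::real"] by (intro add_mono nn_integral_mono mult_left_mono) (use wc ws in auto)
    qed
    also have "\<dots> = ennreal (2 * \<rho> * K * (LINT p|lborel. S p))"
    proof -
      have "ennreal (S p / 2) * ennreal (2 * \<rho> * K) = ennreal (S p * (\<rho> * K))" for p
        using S0[of p] \<rho> K_pos by (subst ennreal_mult[symmetric]) (auto simp del: ennreal_mult')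
      then have "(\<integral>\<^sup>+p. ennreal (S p / 2) * ennreal (2 * \<rho> * K) \<partial>lborel) = (\<integral>\<^sup>+p. ennreal (S p * (\<rho> * K)) \<partial>lborel)" by simp
      also have "\<dots> = ennreal (LINT p|lborel. S p * (\<rho> * K))"
        using S0 \<rho> K_pos Si by (intro nn_integral_eq_integral) auto
      also have "(LINT p|lborel. S p * (\<rho> * K)) = \<rho> * K * (LINT p|lborel. S p)" by simp
      finally show ?thesis using S0 \<rho> K_pos by (simp flip: ennreal_plus add: integral_nonneg_AE)
    qed
    finally show ?thesis using S0 \<rho> K_pos by (subst (asm) ennreal_le_iff) (auto simp: integral_nonneg_AE)
  qed
  finally show ?thesis by (simp add: S_def[abs_def])
qed

end

section \<open>High and low frequency differences\<close>

context curve_pair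
begin

text \<open>With \<open>q = p + r\<close> the phase factor splits into
  \<open>ee (\<tau> * (P p - p))\<close> and \<open>ee (- (\<tau> * r))\<close>. The second is
  absorbed into \<alpha>, and what remains is the form of \<open>hoermander\<close>. Bessel's
  inequality then replaces the L2 norms of \<open>alphaF \<tau>\<close> and
  \<open>gammaG \<tau>\<close> by those of \<open>aF \<tau>\<close> and
  \<open>cG \<tau>\<close>.\<close>

lemma offdiag_freq_high:
  assumes \<rho>: "0 < \<rho>" "\<rho> \<le> 1" and \<delta>: "0 < \<delta>" "\<delta> \<le> 1" and \<tau>: "\<tau> \<noteq> 0"
  shows "cmod (offdiag_freq \<rho> \<tau>) \<le> sqrt (2 * \<delta> * (2 * K ^ 5 * (K / \<rho>)\<^sup>2) + K ^ 55 * (K / \<rho>) ^ 7 / (\<bar>\<tau>\<bar> * \<delta>\<^sup>2))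
     * (sqrt (LINT \<eta>|lborel. (cmod (aF \<tau> \<eta>))\<^sup>2) * sqrt (LINT \<eta>|lborel. (cmod (cG \<tau> \<eta>))\<^sup>2))"
proof -
  define \<alpha> where "\<alpha> r = alphaF \<tau> r * ee (- (\<tau> * r))" for r
  define Hc where "Hc = 2 * \<delta> * (2 * K ^ 5 * (K / \<rho>)\<^sup>2) + K ^ 55 * (K / \<rho>) ^ 7 / (\<bar>\<tau>\<bar> * \<delta>\<^sup>2)"
  have Hc0: "Hc \<ge> 0" unfolding Hc_def using \<delta> \<rho> K_pos by simp
  have [measurable]: "alphaF \<tau> \<in> borel_measurable borel" "gammaG \<tau> \<in> borel_measurable borel"
    by (rule alphaF_meas2[of "\<lambda>_. \<tau>" borel "\<lambda>x. x"]; simp) (rule gammaG_meas2[of "\<lambda>_. \<tau>" borel "\<lambda>x. x"]; simp)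
  have [measurable]: "\<alpha> \<in> borel_measurable borel" unfolding \<alpha>_def by measurable
  have na: "cmod (\<alpha> r) = cmod (alphaF \<tau> r)" for r by (simp add: \<alpha>_def norm_mult)
  define fz where "fz z = offdiag_weight \<rho> z * (alphaF \<tau> (snd z - fst z) * gammaG \<tau> (P (snd z) - P (fst z)) * ee (\<tau> * (P (fst z) - snd z)))" for z
  have env0: "envF \<tau> \<ge> 0" by (simp add: envF_def)
  have fzi: "integrable (lborel \<Otimes>\<^sub>M lborel) fz" unfolding fz_def
    by (rule integrable_mult_bounded[OF offdiag_weight_integrable, where C="envF \<tau> * nG"])
      (measurable, simp only: norm_mult norm_ee mult_1_right, intro mult_mono alphaF_le gammaG_le env0 norm_ge_zero)
  have "offdiag_freq \<rho> \<tau> = (LINT p|lborel. LINT q|lborel. fz (p, q))"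
    unfolding offdiag_freq_def fz_def[symmetric] using lborel_pair.integral_fst[of "\<lambda>p q. fz (p, q)"] fzi by simp
  also have "\<dots> = (LINT p|lborel. LINT r|lborel. (if \<rho> \<le> r then \<alpha> r * (of_real (chi p * chi (p + r)) * gammaG \<tau> (lev r p) * ee (\<tau> * (P p - p))) else 0))"
  proof (rule Bochner_Integration.integral_cong)
    fix p
    have "(LINT q|lborel. fz (p, q)) = (LINT r|lborel. fz (p, r + p))" by (rule LINT_shift(1)[symmetric])
    also have "\<dots> = (LINT r|lborel. (if \<rho> \<le> r then \<alpha> r * (of_real (chi p * chi (p + r)) * gammaG \<tau> (lev r p) * ee (\<tau> * (P p - p))) else 0))"
      by (intro Bochner_Integration.integral_cong)
        (auto simp: fz_def offdiag_weight_def \<alpha>_def lev_def ee_diff ee_minus ee_add distrib_left right_diff_distrib add.commute mult_ac)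
    finally show "(LINT q|lborel. fz (p, q)) = \<dots>" .
  qed auto
  also have "\<dots> = (LINT r|lborel. LINT p|lborel. (if \<rho> \<le> r then \<alpha> r * (of_real (chi p * chi (p + r)) * gammaG \<tau> (lev r p) * ee (\<tau> * (P p - p))) else 0))"
  proof (rule lborel_pair.Fubini_integral[symmetric])
    define w where "w z = (if \<rho> \<le> snd z then \<alpha> (snd z) * (gammaG \<tau> (P (fst z + snd z) - P (fst z)) * ee (\<tau> * (P (fst z) - fst z))) else 0)" for z :: "real \<times> real"
    have [measurable]: "w \<in> borel_measurable (lborel \<Otimes>\<^sub>M lborel)" unfolding w_def by measurable
    have "cmod (w z) \<le> envF \<tau> * nG" for z
      using env0 nF_nonneg mult_mono[OF alphaF_le gammaG_le env0 norm_ge_zero] by (simp add: w_def norm_mult na)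
    from integrable_conv_bounded(2)[OF chi_integrable(2) chi_integrable(2) \<open>w \<in> _\<close> this]
    have "integrable (lborel \<Otimes>\<^sub>M lborel) (\<lambda>z. complex_of_real (chi (fst z)) * complex_of_real (chi (snd z + fst z)) * w z)" .
    also have "(\<lambda>z. complex_of_real (chi (fst z)) * complex_of_real (chi (snd z + fst z)) * w z) = (\<lambda>(p, r). if \<rho> \<le> r then \<alpha> r * (of_real (chi p * chi (p + r)) * gammaG \<tau> (lev r p) * ee (\<tau> * (P p - p))) else 0)"
      by (auto simp: fun_eq_iff w_def lev_def add.commute mult_ac)
    finally show "integrable (lborel \<Otimes>\<^sub>M lborel) \<dots>" .
  qed
  also have "\<dots> = (LINT r|lborel. (if \<rho> \<le> r then \<alpha> r * (LINT p|lborel. of_real (chi p * chi (p + r)) * gammaG \<tau> (lev r p) * ee (\<tau> * (P p - p))) else 0))"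
    by (intro Bochner_Integration.integral_cong) auto
  finally have JJe: "offdiag_freq \<rho> \<tau> = \<dots>" .
  have ba: "integrable lborel (\<lambda>r. (cmod (alphaF \<tau> r))\<^sup>2)" "(LINT r|lborel. (cmod (alphaF \<tau> r))\<^sup>2) \<le> (LINT \<eta>|lborel. (cmod (aF \<tau> \<eta>))\<^sup>2)"
    unfolding alphaF_def using bessel_fourier[OF aF_facts(1,2)] by auto
  have bg: "integrable lborel (\<lambda>r. (cmod (gammaG \<tau> r))\<^sup>2)" "(LINT r|lborel. (cmod (gammaG \<tau> r))\<^sup>2) \<le> (LINT \<eta>|lborel. (cmod (cG \<tau> \<eta>))\<^sup>2)"
    unfolding gammaG_def using bessel_fourier[OF cG_facts(1,2)] by auto
  have "(cmod (offdiag_freq \<rho> \<tau>))\<^sup>2 \<le> Hc * (LINT r|lborel. (cmod (\<alpha> r))\<^sup>2) * (LINT r|lborel. (cmod (gammaG \<tau> r))\<^sup>2)"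
    unfolding JJe Hc_def
  proof (rule hoermander[OF \<rho> \<delta> \<tau>, where Ba="envF \<tau>" and Bg=nG])
    show "continuous_on UNIV (gammaG \<tau>)" unfolding gammaG_def by (rule continuous_fourier[OF cG_facts(1)])
  qed (use ba bg alphaF_le gammaG_le na in auto)
  also have "\<dots> \<le> Hc * (LINT \<eta>|lborel. (cmod (aF \<tau> \<eta>))\<^sup>2) * (LINT \<eta>|lborel. (cmod (cG \<tau> \<eta>))\<^sup>2)"
    unfolding na using ba bg Hc0 by (intro mult_mono) auto
  finally have "cmod (offdiag_freq \<rho> \<tau>) \<le> sqrt (Hc * (LINT \<eta>|lborel. (cmod (aF \<tau> \<eta>))\<^sup>2) * (LINT \<eta>|lborel. (cmod (cG \<tau> \<eta>))\<^sup>2))"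
    by (rule real_le_rsqrt)
  then show ?thesis unfolding Hc_def[symmetric] by (simp add: real_sqrt_mult mult.assoc)
qed

text \<open>The transforms \<open>alphaF\<close> and \<open>gammaG\<close> are written out again. At
  fixed frequencies the p-integral is the multiplier truncated at \<open>q - \<rho>\<close>, which
  is why \<mu> must control all truncations; the q-integral costs a factor \<open>K\<close>. Asking
  for \<mu> only where \<open>F\<close> and \<open>G\<close> do not vanish brings in the frequency
  localisation of a block.\<close>

lemma offdiag_freq_low:
  assumes \<mu>: "\<And>\<eta> \<zeta> q. F \<eta> \<noteq> 0 \<Longrightarrow> G \<zeta> \<noteq> 0 \<Longrightarrow> cmod (LINT p|lborel. (if p \<le> q then of_real (chi p) * ee (\<eta> * p + \<zeta> * P p) else 0)) \<le> \<mu>"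
    and \<mu>0: "\<mu> \<ge> 0"
  shows "cmod (offdiag_freq \<rho> \<tau>) \<le> K * \<mu> * nF * nG"
proof -
  interpret PP: pair_sigma_finite "lborel \<Otimes>\<^sub>M lborel :: (real \<times> real) measure" "lborel \<Otimes>\<^sub>M lborel :: (real \<times> real) measure"
    using lborel_sigma_finite by (simp add: pair_sigma_finite_def)
  define w where "w z y = ee (- (fst y * (snd z - fst z))) * ee (- (snd y * (P (snd z) - P (fst z)))) * ee (\<tau> * (P (fst z) - snd z))" for z y :: "real \<times> real"
  define ac where "ac y = aF \<tau> (fst y) * cG \<tau> (snd y)" for y
  have aci: "integrable (lborel \<Otimes>\<^sub>M lborel) ac"
    using integrable_prod_bounded[OF lborel_sigma_finite(1) lborel_sigma_finite(1) aF_facts(1) cG_facts(1), of "\<lambda>_. 1" 1] by (simp add: ac_def[abs_def])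
  have w1: "cmod (w z y) = 1" for z y by (simp add: w_def norm_mult)
  have wm: "(\<lambda>x. w (fst x) (snd x)) \<in> borel_measurable ((lborel \<Otimes>\<^sub>M lborel) \<Otimes>\<^sub>M (lborel \<Otimes>\<^sub>M lborel))"
    unfolding w_def by measurable
  have hi: "integrable ((lborel \<Otimes>\<^sub>M lborel) \<Otimes>\<^sub>M (lborel \<Otimes>\<^sub>M lborel)) (\<lambda>(z, y). offdiag_weight \<rho> z * ac y * w z y)"
    using integrable_prod_bounded[OF lborel_sigma_finite(2) lborel_sigma_finite(2) offdiag_weight_integrable aci wm, of 1] w1 by (simp add: case_prod_beta')
  have alga: "alphaF \<tau> (snd z - fst z) * gammaG \<tau> (P (snd z) - P (fst z)) * ee (\<tau> * (P (fst z) - snd z)) = (LINT y|(lborel \<Otimes>\<^sub>M lborel). ac y * w z y)" for z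
  proof -
    have i: "integrable (lborel \<Otimes>\<^sub>M lborel) (\<lambda>(\<eta>, \<zeta>). ac (\<eta>, \<zeta>) * w z (\<eta>, \<zeta>))"
    proof -
      have "integrable (lborel \<Otimes>\<^sub>M lborel) (\<lambda>y. ac y * w z y)"
        by (rule integrable_mult_bounded[OF aci, where C=1]) (use w1 in \<open>auto simp: w_def\<close>)
      then show ?thesis by (simp add: case_prod_beta')
    qed
    have "(LINT y|(lborel \<Otimes>\<^sub>M lborel). ac y * w z y) = (LINT \<eta>|lborel. LINT \<zeta>|lborel. ac (\<eta>, \<zeta>) * w z (\<eta>, \<zeta>))"
      using lborel_pair.integral_fst[OF i] by (simp add: case_prod_beta')
    also have "\<dots> = (LINT \<eta>|lborel. (aF \<tau> \<eta> * ee (- (\<eta> * (snd z - fst z)))) * (gammaG \<tau> (P (snd z) - P (fst z)) * ee (\<tau> * (P (fst z) - snd z))))"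
    proof (rule Bochner_Integration.integral_cong)
      fix \<eta>
      have "(LINT \<zeta>|lborel. ac (\<eta>, \<zeta>) * w z (\<eta>, \<zeta>)) = (LINT \<zeta>|lborel. (aF \<tau> \<eta> * ee (- (\<eta> * (snd z - fst z))) * ee (\<tau> * (P (fst z) - snd z))) * (cG \<tau> \<zeta> * ee (- (\<zeta> * (P (snd z) - P (fst z))))))"
        by (simp add: ac_def w_def mult_ac)
      also have "\<dots> = (aF \<tau> \<eta> * ee (- (\<eta> * (snd z - fst z))) * ee (\<tau> * (P (fst z) - snd z))) * gammaG \<tau> (P (snd z) - P (fst z))"
        unfolding gammaG_def by simp
      finally show "(LINT \<zeta>|lborel. ac (\<eta>, \<zeta>) * w z (\<eta>, \<zeta>)) = (aF \<tau> \<eta> * ee (- (\<eta> * (snd z - fst z)))) * (gammaG \<tau> (P (snd z) - P (fst z)) * ee (\<tau> * (P (fst z) - snd z)))"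
        by (simp add: mult_ac)
    qed auto
    also have "\<dots> = alphaF \<tau> (snd z - fst z) * (gammaG \<tau> (P (snd z) - P (fst z)) * ee (\<tau> * (P (fst z) - snd z)))"
      unfolding alphaF_def by simp
    finally show ?thesis by (simp add: mult.assoc)
  qed
  have "offdiag_freq \<rho> \<tau> = (LINT z|(lborel \<Otimes>\<^sub>M lborel). LINT y|(lborel \<Otimes>\<^sub>M lborel). offdiag_weight \<rho> z * ac y * w z y)"
    unfolding offdiag_freq_def alga by (simp flip: integral_mult_right_zero add: mult.assoc)
  also have "\<dots> = (LINT y|(lborel \<Otimes>\<^sub>M lborel). LINT z|(lborel \<Otimes>\<^sub>M lborel). offdiag_weight \<rho> z * ac y * w z y)"
    by (rule PP.Fubini_integral[OF hi, symmetric])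
  also have "\<dots> = (LINT y|(lborel \<Otimes>\<^sub>M lborel). ac y * (LINT z|(lborel \<Otimes>\<^sub>M lborel). offdiag_weight \<rho> z * w z y))"
    by (simp flip: integral_mult_right_zero add: mult_ac)
  finally have JJe: "offdiag_freq \<rho> \<tau> = \<dots>" .
  have inner: "cmod (LINT z|(lborel \<Otimes>\<^sub>M lborel). offdiag_weight \<rho> z * w z y) \<le> K * \<mu>" if y: "ac y \<noteq> 0" for y
  proof -
    define \<eta> where "\<eta> = fst y"
    define \<zeta> where "\<zeta> = snd y"
    have FG: "F \<eta> \<noteq> 0" "G (\<zeta> + \<tau>) \<noteq> 0" using y by (auto simp: ac_def aF_def cG_def \<eta>_def \<zeta>_def)
    define e2 where "e2 q = ee (- ((\<eta> + \<tau>) * q) - \<zeta> * P q)" for q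
    have e21: "cmod (e2 q) = 1" for q by (simp add: e2_def)
    have [measurable]: "e2 \<in> borel_measurable borel" unfolding e2_def by measurable
    have [measurable]: "(\<lambda>z. w z y) \<in> borel_measurable (borel \<Otimes>\<^sub>M borel)" unfolding w_def by measurable
    \<comment> \<open>The frequencies seen by \<open>p\<close> are \<eta> and
      \<open>\<zeta> + \<tau>\<close>, points where \<open>F\<close> and \<open>G\<close> are
      nonzero, so the hypothesis on \<mu> applies.\<close>
    define In where "In q = (LINT p|lborel. (if p \<le> q - \<rho> then of_real (chi p) * ee (\<eta> * p + (\<zeta> + \<tau>) * P p) else 0))" for q
    have i: "integrable (lborel \<Otimes>\<^sub>M lborel) (\<lambda>(p, q). offdiag_weight \<rho> (p, q) * w (p, q) y)"
      using integrable_mult_bounded[OF offdiag_weight_integrable[of \<rho>], of "\<lambda>z. w z y" 1] w1 by (simp add: case_prod_beta')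
    have "(LINT z|(lborel \<Otimes>\<^sub>M lborel). offdiag_weight \<rho> z * w z y) = (LINT q|lborel. LINT p|lborel. offdiag_weight \<rho> (p, q) * w (p, q) y)"
      using lborel_pair.integral_snd[OF i] by (simp add: case_prod_beta')
    also have "\<dots> = (LINT q|lborel. of_real (chi q) * e2 q * In q)"
    proof (rule Bochner_Integration.integral_cong)
      fix q
      have "offdiag_weight \<rho> (p, q) * w (p, q) y = of_real (chi q) * e2 q * (if p \<le> q - \<rho> then of_real (chi p) * ee (\<eta> * p + (\<zeta> + \<tau>) * P p) else 0)" for p
        by (auto simp: offdiag_weight_def w_def e2_def \<eta>_def[symmetric] \<zeta>_def[symmetric] ee_diff ee_minus ee_add algebra_simps)
      then show "(LINT p|lborel. offdiag_weight \<rho> (p, q) * w (p, q) y) = of_real (chi q) * e2 q * In q" by (simp add: In_def)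
    qed auto
    finally have "cmod (LINT z|(lborel \<Otimes>\<^sub>M lborel). offdiag_weight \<rho> z * w z y) \<le> (LINT q|lborel. cmod (of_real (chi q) * e2 q * In q))"
      by (simp add: integral_norm_bound)
    also have "\<dots> \<le> (LINT q|lborel. chi q * \<mu>)"
    proof (rule integral_mono')
      show "integrable lborel (\<lambda>q. chi q * \<mu>)" using chi_integrable by auto
      have "cmod (In q) \<le> \<mu>" for q unfolding In_def by (rule \<mu>[OF FG])
      then show "cmod (of_real (chi q) * e2 q * In q) \<le> chi q * \<mu>" for q
        using chi_nonneg[of q] by (simp add: norm_mult e21 mult_left_mono)
    qed (use chi_nonneg \<mu>0 in auto)
    also have "\<dots> \<le> K * \<mu>" using chi_integral \<mu>0 by (simp add: mult_right_mono)
    finally show ?thesis .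
  qed
  have Kmu: "K * \<mu> \<ge> 0" using K_pos \<mu>0 by simp
  have "cmod (offdiag_freq \<rho> \<tau>) \<le> (LINT y|(lborel \<Otimes>\<^sub>M lborel). cmod (ac y) * (K * \<mu>))" unfolding JJe
  proof (rule order_trans[OF integral_norm_bound integral_mono'])
    show "integrable (lborel \<Otimes>\<^sub>M lborel) (\<lambda>y. cmod (ac y) * (K * \<mu>))" using aci by auto
    show "cmod (ac y * (LINT z|(lborel \<Otimes>\<^sub>M lborel). offdiag_weight \<rho> z * w z y)) \<le> cmod (ac y) * (K * \<mu>)" for y
      using inner[of y] by (cases "ac y = 0") (auto simp: norm_mult)
  qed (use Kmu in auto)
  also have "\<dots> = (LINT y|(lborel \<Otimes>\<^sub>M lborel). cmod (ac y)) * (K * \<mu>)" by simp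
  also have "(LINT y|(lborel \<Otimes>\<^sub>M lborel). cmod (ac y)) = envF \<tau> * (LINT \<zeta>|lborel. cmod (cG \<tau> \<zeta>))"
  proof -
    have i: "integrable (lborel \<Otimes>\<^sub>M lborel) (\<lambda>(\<eta>, \<zeta>). cmod (ac (\<eta>, \<zeta>)))" using integrable_norm[OF aci] by (simp add: case_prod_beta')
    have "(LINT y|(lborel \<Otimes>\<^sub>M lborel). cmod (ac y)) = (LINT \<eta>|lborel. LINT \<zeta>|lborel. cmod (ac (\<eta>, \<zeta>)))"
      using lborel_pair.integral_fst[OF i] by (simp add: case_prod_beta')
    then show ?thesis by (simp add: ac_def norm_mult envF_def)
  qed
  also have "envF \<tau> * (LINT \<zeta>|lborel. cmod (cG \<tau> \<zeta>)) * (K * \<mu>) \<le> (nF * nG) * (K * \<mu>)"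
    using aF_facts(3) cG_facts(3) nF_nonneg Kmu by (intro mult_right_mono mult_mono) auto
  finally show ?thesis by (simp add: mult_ac)
qed

lemma slice_form_measurable [measurable]: "slice_form \<in> borel_measurable borel"
proof -
  have "(\<lambda>\<xi>. LINT p|lborel. (\<lambda>(\<xi>, p). of_real (chi p) * slice p \<xi>) (\<xi>, p)) \<in> borel_measurable borel"
    by (intro lborel.borel_measurable_lebesgue_integral) measurable
  then show ?thesis by (simp add: slice_form_def[abs_def])
qed

text \<open>\<Theta> separates the two estimates for \<open>offdiag_freq\<close>. Below it the
  pointwise bound by \<mu> is integrated over an interval of length \<open>2 * \<Theta>\<close>.
  Above it \<open>h\<close> bounds the constant of the oscillatory form uniformly in \<tau>, and
  Cauchy-Schwarz in \<tau> uses the exact energies \<open>nF^2\<close> and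
  \<open>nG^2\<close>.\<close>

lemma energy_bound:
  assumes \<mu>: "\<And>\<eta> \<zeta> q. F \<eta> \<noteq> 0 \<Longrightarrow> G \<zeta> \<noteq> 0 \<Longrightarrow> cmod (LINT p|lborel. (if p \<le> q then of_real (chi p) * ee (\<eta> * p + \<zeta> * P p) else 0)) \<le> \<mu>"
    and \<mu>0: "\<mu> \<ge> 0" and \<rho>: "0 < \<rho>" "\<rho> \<le> 1" and \<delta>: "0 < \<delta>" "\<delta> \<le> 1" and \<Theta>: "\<Theta> > 0"
    and H: "2 * \<delta> * (2 * K ^ 5 * (K / \<rho>)\<^sup>2) + K ^ 55 * (K / \<rho>) ^ 7 / (\<Theta> * \<delta>\<^sup>2) \<le> h\<^sup>2" and h: "h \<ge> 0"
  shows "integrable lborel (\<lambda>\<xi>. (cmod (slice_form \<xi>))\<^sup>2)"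
    "(LINT \<xi>|lborel. (cmod (slice_form \<xi>))\<^sup>2) \<le> (4 * pi * \<rho> * K ^ 8 + 4 * \<Theta> * K * \<mu> + 2 * h) * (nF * nG)"
proof -
  define S where "S \<xi> = (LINT p|lborel. chi p * (cmod (slice p \<xi>))\<^sup>2)" for \<xi>
  have Si: "integrable lborel S" and Sb: "(LINT \<xi>|lborel. S \<xi>) \<le> 2 * pi * K ^ 7 * nF * nG"
    unfolding S_def[abs_def] using diagonal_energy by auto
  have rhs: "integrable lborel (\<lambda>\<xi>. 2 * \<rho> * K * S \<xi> + 2 * Re (offdiag \<rho> \<xi>))" using Si offdiag_integral(1)[of \<rho>] by auto
  have le: "(cmod (slice_form \<xi>))\<^sup>2 \<le> 2 * \<rho> * K * S \<xi> + 2 * Re (offdiag \<rho> \<xi>)" for \<xi> unfolding S_def by (rule slice_form_sq_le[OF \<rho>(1)])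
  show i: "integrable lborel (\<lambda>\<xi>. (cmod (slice_form \<xi>))\<^sup>2)"
    by (rule Bochner_Integration.integrable_bound[OF rhs]) (auto intro!: AE_I2 order_trans[OF le])
  define A2 where "A2 \<tau> = (LINT \<eta>|lborel. (cmod (aF \<tau> \<eta>))\<^sup>2)" for \<tau>
  define C2 where "C2 \<tau> = (LINT \<eta>|lborel. (cmod (cG \<tau> \<eta>))\<^sup>2)" for \<tau>
  have AC0: "A2 \<tau> \<ge> 0" "C2 \<tau> \<ge> 0" for \<tau> by (simp_all add: A2_def C2_def)
  have Ai: "integrable lborel A2" "(LINT \<tau>|lborel. A2 \<tau>) = nF\<^sup>2" unfolding A2_def[abs_def] using aF_facts by auto
  have Ci: "integrable lborel C2" "(LINT \<tau>|lborel. C2 \<tau>) = nG\<^sup>2" unfolding C2_def[abs_def] using cG_facts by auto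
  have [measurable]: "A2 \<in> borel_measurable borel" "C2 \<in> borel_measurable borel" using Ai Ci by auto
  have cs: "integrable lborel (\<lambda>\<tau>. sqrt (A2 \<tau>) * sqrt (C2 \<tau>))" "(LINT \<tau>|lborel. sqrt (A2 \<tau>) * sqrt (C2 \<tau>)) \<le> nF * nG"
    using integral_Cauchy_Schwarz[of "\<lambda>\<tau>. sqrt (A2 \<tau>)" lborel "\<lambda>\<tau>. sqrt (C2 \<tau>)"] AC0 Ai Ci nF_nonneg by simp_all
  have ind: "integrable lborel (\<lambda>\<tau>. K * \<mu> * nF * nG * indicator {-\<Theta>..\<Theta>} \<tau>)"
    by (intro integrable_mult_right integrable_real_indicator) (auto simp: emeasure_lborel_Icc_eq)
  have Jb: "cmod (offdiag_freq \<rho> \<tau>) \<le> K * \<mu> * nF * nG * indicator {-\<Theta>..\<Theta>} \<tau> + h * (sqrt (A2 \<tau>) * sqrt (C2 \<tau>))" for \<tau>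
  proof (cases "\<tau> \<in> {-\<Theta>..\<Theta>}")
    case True
    have "cmod (offdiag_freq \<rho> \<tau>) \<le> K * \<mu> * nF * nG" by (rule offdiag_freq_low[OF \<mu> \<mu>0])
    then show ?thesis using True h AC0 by (simp add: add_increasing2)
  next
    case False
    then have t: "\<bar>\<tau>\<bar> \<ge> \<Theta>" "\<tau> \<noteq> 0" using \<Theta> by auto
    have "K ^ 55 * (K / \<rho>) ^ 7 / (\<bar>\<tau>\<bar> * \<delta>\<^sup>2) \<le> K ^ 55 * (K / \<rho>) ^ 7 / (\<Theta> * \<delta>\<^sup>2)"
      using t \<Theta> \<delta> \<rho> K_pos by (intro divide_left_mono mult_right_mono mult_pos_pos) auto
    then have "2 * \<delta> * (2 * K ^ 5 * (K / \<rho>)\<^sup>2) + K ^ 55 * (K / \<rho>) ^ 7 / (\<bar>\<tau>\<bar> * \<delta>\<^sup>2) \<le> h\<^sup>2" using H by linarith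
    then have s: "sqrt (2 * \<delta> * (2 * K ^ 5 * (K / \<rho>)\<^sup>2) + K ^ 55 * (K / \<rho>) ^ 7 / (\<bar>\<tau>\<bar> * \<delta>\<^sup>2)) \<le> h"
      using h real_le_lsqrt by blast
    have "cmod (offdiag_freq \<rho> \<tau>) \<le> h * (sqrt (A2 \<tau>) * sqrt (C2 \<tau>))"
      by (rule order_trans[OF offdiag_freq_high[OF \<rho> \<delta> t(2)]]) (use s AC0 in \<open>auto simp: A2_def[symmetric] C2_def[symmetric] intro!: mult_right_mono\<close>)
    then show ?thesis using False by simp
  qed
  have Jint: "cmod (LINT \<tau>|lborel. offdiag_freq \<rho> \<tau>) \<le> (2 * \<Theta> * K * \<mu> + h) * (nF * nG)"
  proof -
    have "cmod (LINT \<tau>|lborel. offdiag_freq \<rho> \<tau>) \<le> (LINT \<tau>|lborel. K * \<mu> * nF * nG * indicator {-\<Theta>..\<Theta>} \<tau> + h * (sqrt (A2 \<tau>) * sqrt (C2 \<tau>)))"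
      by (rule order_trans[OF integral_norm_bound integral_mono]) (use ind cs offdiag_integral(2)[of \<rho>] Jb in auto)
    also have "\<dots> = (LINT \<tau>|lborel. K * \<mu> * nF * nG * indicator {-\<Theta>..\<Theta>} \<tau>) + (LINT \<tau>|lborel. h * (sqrt (A2 \<tau>) * sqrt (C2 \<tau>)))"
      by (rule Bochner_Integration.integral_add[OF ind]) (use cs in auto)
    also have "\<dots> = 2 * \<Theta> * (K * \<mu> * nF * nG) + h * (LINT \<tau>|lborel. sqrt (A2 \<tau>) * sqrt (C2 \<tau>))"
      using \<Theta> by simp
    also have "\<dots> \<le> 2 * \<Theta> * (K * \<mu> * nF * nG) + h * (nF * nG)" using cs h by (intro add_left_mono mult_left_mono) auto
    finally show ?thesis by (simp add: algebra_simps)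
  qed
  have "(LINT \<xi>|lborel. (cmod (slice_form \<xi>))\<^sup>2) \<le> (LINT \<xi>|lborel. 2 * \<rho> * K * S \<xi> + 2 * Re (offdiag \<rho> \<xi>))"
    by (rule integral_mono[OF i rhs le])
  also have "\<dots> = 2 * \<rho> * K * (LINT \<xi>|lborel. S \<xi>) + 2 * Re (LINT \<xi>|lborel. offdiag \<rho> \<xi>)"
    using Si offdiag_integral(1)[of \<rho>] by simp
  also have "\<dots> \<le> 2 * \<rho> * K * (2 * pi * K ^ 7 * nF * nG) + 2 * ((2 * \<Theta> * K * \<mu> + h) * (nF * nG))"
    unfolding offdiag_integral(3) using complex_Re_le_cmod[of "LINT \<tau>|lborel. offdiag_freq \<rho> \<tau>"] Jint Sb \<rho> K_pos
    by (intro add_mono mult_left_mono) auto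
  also have "\<dots> = (4 * pi * \<rho> * K ^ 8 + 4 * \<Theta> * K * \<mu> + 2 * h) * (nF * nG)"
    by (simp add: algebra_simps power_numeral_reduce)
  finally show "(LINT \<xi>|lborel. (cmod (slice_form \<xi>))\<^sup>2) \<le> \<dots>" .
qed

text \<open>The radius \<open>1 / N ^ 72\<close> balances the two terms of
  \<open>oscillatory_decay\<close> at frequency \<open>N ^ 216\<close>. The case
  \<open>N = 1\<close> is the trivial bound and serves blocks whose frequencies have no lower
  bound.\<close>

lemma truncated_multiplier_bound:
  assumes N: "N \<ge> 1" and L: "N = 1 \<or> \<bar>\<eta>\<bar> \<ge> N ^ 216 \<or> \<bar>\<zeta>\<bar> \<ge> N ^ 216"
  shows "cmod (LINT p|lborel. (if p \<le> q then of_real (chi p) * ee (\<eta> * p + \<zeta> * P p) else 0)) \<le> 10 * K ^ 5 / N ^ 72"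
proof (cases "N = 1")
  case True
  have "cmod (LINT p|lborel. (if p \<le> q then of_real (chi p) * ee (\<eta> * p + \<zeta> * P p) else 0)) \<le> (LINT p|lborel. chi p)"
    by (rule order_trans[OF integral_norm_bound integral_mono'[OF chi_integrable(1)]]) (auto simp: norm_mult chi_nonneg)
  also have "\<dots> \<le> K" by (rule chi_integral)
  also have "\<dots> \<le> 10 * K ^ 5" using K_power[of 1 5] K_pos by simp
  finally show ?thesis using True by simp
next
  case False
  define d where "d = min b q"
  define f where "f t = of_real (chi t) * cis (2 * pi * (\<eta> * t + \<zeta> * P t))" for t
  have fc: "continuous_on {a..d} f" unfolding f_def cis_conv_exp by (intro continuous_intros contP contchi)
  have "(if p \<le> q then of_real (chi p) * ee (\<eta> * p + \<zeta> * P p) else 0) = (if a \<le> p \<and> p \<le> d then f p else 0)" for p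
    using chi_supp[of p] by (auto simp: d_def f_def ee_def)
  then have e: "(LINT p|lborel. (if p \<le> q then of_real (chi p) * ee (\<eta> * p + \<zeta> * P p) else 0)) = integral {a..d} f"
    using LINT_Icc_eq_integral(1)[OF fc] by simp
  show ?thesis
  proof (cases "a \<le> d")
    case True
    have "cmod (integral {a..d} f) \<le> 2 * (1 / N ^ 72) * K + 8 * K ^ 5 / (N ^ 216 * (1 / N ^ 72)\<^sup>2)"
      unfolding f_def by (rule oscillatory_decay) (use True L N False in \<open>auto simp: d_def\<close>)
    also have "\<dots> = (2 * K + 8 * K ^ 5) / N ^ 72"
    proof -
      have "N ^ 216 * (1 / N ^ 72)\<^sup>2 = N ^ 72"
        using N by (simp add: power_divide field_simps flip: power_mult power_add)
      then show ?thesis by (simp add: add_divide_distrib)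
    qed
    also have "\<dots> \<le> 10 * K ^ 5 / N ^ 72" using K_power[of 1 5] N by (intro divide_right_mono) auto
    finally show ?thesis unfolding e .
  qed (use K_pos N in \<open>simp add: e\<close>)
qed

text \<open>With frequency at least \<open>N\<^sup>2\<^sup>1\<^sup>6\<close> the parameters are \<open>\<rho> = 1 / N\<close> (diagonal), \<open>\<Theta> = N\<^sup>3\<^sup>6\<close> (threshold for
  \<open>\<bar>\<tau>\<bar>\<close>) and \<open>\<delta> = N\<^sup>-\<^sup>1\<^sup>2\<close>, all chosen as powers of \<open>N\<close> to avoid fractional exponents.\<close>

lemma energy_decay:
  assumes N: "N \<ge> 1" and supp: "N = 1 \<or> (\<forall>\<eta> \<zeta>. F \<eta> \<noteq> 0 \<longrightarrow> G \<zeta> \<noteq> 0 \<longrightarrow> \<bar>\<eta>\<bar> \<ge> N ^ 216 \<or> \<bar>\<zeta>\<bar> \<ge> N ^ 216)"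
  shows "integrable lborel (\<lambda>\<xi>. (cmod (slice_form \<xi>))\<^sup>2)"
    "(LINT \<xi>|lborel. (cmod (slice_form \<xi>))\<^sup>2) \<le> K ^ 37 / N * (nF * nG)"
proof -
  have Npow: "N ^ m \<le> N ^ n" if "m \<le> n" for m n using N that by (intro power_increasing) auto
  have N0: "N > 0" using N by simp
  \<comment> \<open>For \<rho> = 1 / N the two terms become \<open>4 * K ^ 7 / N ^ 10\<close> and
    \<open>K ^ 62 / N ^ 5\<close>; both are absorbed in \<open>9 * K ^ 62 / N ^ 2\<close>.\<close>
  have H: "2 * (1 / N ^ 12) * (2 * K ^ 5 * (K / (1 / N))\<^sup>2) + K ^ 55 * (K / (1 / N)) ^ 7 / (N ^ 36 * (1 / N ^ 12)\<^sup>2) \<le> (3 * K ^ 31 / N)\<^sup>2"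
  proof -
    have e1: "2 * (1 / N ^ 12) * (2 * K ^ 5 * (K / (1 / N))\<^sup>2) = 4 * K ^ 7 / N ^ 10"
    proof -
      have d: "N ^ 12 = N ^ 10 * N\<^sup>2" by (simp flip: power_add)
      have n: "2 * (1 / M) * (2 * K ^ 5 * (K / (1 / N))\<^sup>2) = (4 * K ^ 7) * N\<^sup>2 / M" for M
        by (simp add: power_mult_distrib flip: power_add mult.assoc)
      show ?thesis unfolding n unfolding d using N0 by (intro nonzero_mult_divide_mult_cancel_right) simp
    qed
    have e2: "K ^ 55 * (K / (1 / N)) ^ 7 / (N ^ 36 * (1 / N ^ 12)\<^sup>2) = K ^ 62 / N ^ 5"
    proof -
      have "N ^ 36 * (1 / N ^ 12)\<^sup>2 = N ^ 12" using N0 by (simp add: power_divide field_simps flip: power_mult power_add)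
      also have "\<dots> = N ^ 5 * N ^ 7" by (simp flip: power_add)
      finally have d: "N ^ 36 * (1 / N ^ 12)\<^sup>2 = N ^ 5 * N ^ 7" .
      have n: "K ^ 55 * (K / (1 / N)) ^ 7 = K ^ 62 * N ^ 7"
        by (simp add: power_mult_distrib flip: power_add mult.assoc)
      show ?thesis unfolding n d using N0 by (intro nonzero_mult_divide_mult_cancel_right) simp
    qed
    have "4 * K ^ 7 / N ^ 10 + K ^ 62 / N ^ 5 \<le> 4 * K ^ 62 / N ^ 2 + K ^ 62 / N ^ 2"
      using K_power[of 7 62] Npow[of 2 10] Npow[of 2 5] N0 K_pos by (intro add_mono frac_le) auto
    also have "\<dots> \<le> 9 * K ^ 62 / N ^ 2" using N0 K_pos by (simp add: divide_right_mono flip: add_divide_distrib)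
    also have "\<dots> = (3 * K ^ 31 / N)\<^sup>2" by (simp add: power_divide power_mult_distrib flip: power_mult)
    finally show ?thesis unfolding e1 e2 .
  qed
  have mu: "cmod (LINT p|lborel. (if p \<le> q then of_real (chi p) * ee (\<eta> * p + \<zeta> * P p) else 0)) \<le> 10 * K ^ 5 / N ^ 72"
    if "F \<eta> \<noteq> 0" "G \<zeta> \<noteq> 0" for \<eta> \<zeta> q
    by (rule truncated_multiplier_bound[OF N]) (use supp that in blast)
  have Npos: "0 < 1 / N" "1 / N \<le> 1" "0 < 1 / N ^ 12" "1 / N ^ 12 \<le> 1" "N ^ 36 > 0" "10 * K ^ 5 / N ^ 72 \<ge> 0" "3 * K ^ 31 / N \<ge> 0"
    using N N0 K_pos by auto
  note eb = energy_bound[OF mu Npos(6,1,2,3,4,5) H Npos(7)]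
  show "integrable lborel (\<lambda>\<xi>. (cmod (slice_form \<xi>))\<^sup>2)" by (rule eb(1))
  \<comment> \<open>Diagonal, low and high parts contribute at most 16, 40 and 6 times
    \<open>K ^ 31 / N\<close>; the total 62 is below \<open>2^6 \<le> K ^ 6\<close>.\<close>
  have "4 * pi * (1 / N) * K ^ 8 + 4 * N ^ 36 * K * (10 * K ^ 5 / N ^ 72) + 2 * (3 * K ^ 31 / N) \<le> K ^ 37 / N"
  proof -
    have "4 * pi * (1 / N) * K ^ 8 \<le> 16 * K ^ 31 / N"
    proof -
      have "4 * pi * K ^ 8 \<le> 16 * K ^ 31" using K_power[of 8 31] pi_less_4 K_pos by (intro mult_mono) auto
      then show ?thesis using N0 by (simp add: divide_right_mono)
    qed
    moreover have "4 * N ^ 36 * K * (10 * K ^ 5 / N ^ 72) \<le> 40 * K ^ 31 / N"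
    proof -
      have d: "N ^ 72 = N ^ 36 * N ^ 36" by (simp flip: power_add)
      have n: "4 * N ^ 36 * K * (10 * K ^ 5 / M) = (40 * K ^ 6) * N ^ 36 / M" for M by (simp add: power_numeral_reduce)
      have "4 * N ^ 36 * K * (10 * K ^ 5 / N ^ 72) = 40 * K ^ 6 / N ^ 36" unfolding n
        unfolding d using N0 by (intro nonzero_mult_divide_mult_cancel_right) simp
      also have "\<dots> \<le> 40 * K ^ 31 / N ^ 1" using K_power[of 6 31] Npow[of 1 36] N0 K_pos by (intro frac_le) auto
      finally show ?thesis by simp
    qed
    moreover have "16 * K ^ 31 / N + 40 * K ^ 31 / N + 2 * (3 * K ^ 31 / N) \<le> K ^ 37 / N"
    proof -
      have "(2::real) ^ 6 \<le> K ^ 6" using K2 by (intro power_mono) auto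
      then have "64 * K ^ 31 \<le> K ^ 6 * K ^ 31" using K_pos by (intro mult_right_mono) auto
      then have "62 * K ^ 31 \<le> K ^ 37" using K_pos by (simp flip: power_add) (smt (verit) zero_less_power)
      then show ?thesis using N0 by (simp add: divide_right_mono flip: add_divide_distrib)
    qed
    ultimately show ?thesis by linarith
  qed
  then have "(4 * pi * (1 / N) * K ^ 8 + 4 * N ^ 36 * K * (10 * K ^ 5 / N ^ 72) + 2 * (3 * K ^ 31 / N)) * (nF * nG) \<le> K ^ 37 / N * (nF * nG)"
    using nF_nonneg by (intro mult_right_mono) auto
  with eb(2) show "(LINT \<xi>|lborel. (cmod (slice_form \<xi>))\<^sup>2) \<le> K ^ 37 / N * (nF * nG)" by linarith
qed

end

subsection \<open>Dyadic decomposition\<close>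

text \<open>A pair of blocks \<open>j\<close>, \<open>k\<close> gains
  \<open>2^(-(j + k) / 864)\<close> up to a constant, while the three Sobolev weights lose
  \<open>2^(2 * s * (j + k))\<close> for the exponent \<open>s\<close>. The value
  \<open>s = 1 / 3456\<close> spends half of the gain.\<close>

definition smoothing_exponent :: real where "smoothing_exponent = 1 / 3456"
text \<open>Fourth root of the factor \<open>2^(-1 / 1728)\<close> per unit of \<open>j + k\<close>
  that survives in the energy of a block. Two of the four powers pay for Cauchy-Schwarz over the
  blocks, and the other two make the remaining sum converge.\<close>

definition dyadic_ratio :: real where "dyadic_ratio = 2 powr (- 1 / 6912)"

definition C0 :: real where "C0 = 1 / (1 - dyadic_ratio\<^sup>2)"

lemma dyadic_ratio: "0 < dyadic_ratio" "dyadic_ratio\<^sup>2 < 1" "C0 > 0"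
proof -
  show "0 < dyadic_ratio" by (simp add: dyadic_ratio_def)
  have "dyadic_ratio < 2 powr 0" unfolding dyadic_ratio_def by (intro powr_less_mono) auto
  then have "dyadic_ratio < 1" by simp
  then show "dyadic_ratio\<^sup>2 < 1" using \<open>0 < dyadic_ratio\<close> by (simp add: power_less_one_iff)
  then show "C0 > 0" by (simp add: C0_def)
qed

lemma double_geometric: "(\<Sum>j<n. \<Sum>k<n. (dyadic_ratio\<^sup>2) ^ (j + k)) \<le> C0\<^sup>2"
proof -
  have "(\<Sum>j<n. \<Sum>k<n. (dyadic_ratio\<^sup>2) ^ (j + k)) = (\<Sum>j<n. (dyadic_ratio\<^sup>2) ^ j)\<^sup>2"
    by (simp add: power_add power2_eq_square sum_product)
  also have "\<dots> \<le> C0\<^sup>2"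
  proof (intro power_mono sum_nonneg)
    have "(\<Sum>j<n. (dyadic_ratio\<^sup>2) ^ j) = (1 - (dyadic_ratio\<^sup>2) ^ n) / (1 - dyadic_ratio\<^sup>2)" using dyadic_ratio by (subst sum_gp_strict) auto
    also have "\<dots> \<le> 1 / (1 - dyadic_ratio\<^sup>2)" using dyadic_ratio by (intro divide_right_mono) auto
    finally show "(\<Sum>j<n. (dyadic_ratio\<^sup>2) ^ j) \<le> C0" by (simp add: C0_def)
  qed auto
  finally show ?thesis .
qed

section \<open>The form on dyadic blocks and its summation\<close>

context curve
begin

text \<open>This is \<open>slice_form\<close> with \<open>F\<close> and \<open>G\<close> as
  arguments, so that it can be applied to all pairs of dyadic pieces.\<close>

definition bform :: "(real \<Rightarrow> complex) \<Rightarrow> (real \<Rightarrow> complex) \<Rightarrow> real \<Rightarrow> complex" where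
  "bform F G \<xi> = (LINT p|lborel. of_real (chi p) * (LINT \<eta>|lborel. (F \<eta> * ee (\<eta> * p)) * (G (\<xi> - \<eta>) * ee ((\<xi> - \<eta>) * P p))))"

definition multiplier :: "real \<Rightarrow> real \<Rightarrow> complex" where "multiplier \<eta> \<zeta> = (LINT p|lborel. of_real (chi p) * ee (\<eta> * p + \<zeta> * P p))"

lemma bform_decay:
  assumes F: "integrable lborel F" "\<And>x. cmod (F x) \<le> BF" and G: "integrable lborel G" "\<And>x. cmod (G x) \<le> BG"
    and N: "N \<ge> 1" and supp: "N = 1 \<or> (\<forall>\<eta> \<zeta>. F \<eta> \<noteq> 0 \<longrightarrow> G \<zeta> \<noteq> 0 \<longrightarrow> \<bar>\<eta>\<bar> \<ge> N ^ 216 \<or> \<bar>\<zeta>\<bar> \<ge> N ^ 216)"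
  shows "bform F G \<in> borel_measurable borel" "integrable lborel (\<lambda>\<xi>. (cmod (bform F G \<xi>))\<^sup>2)"
    "(LINT \<xi>|lborel. (cmod (bform F G \<xi>))\<^sup>2) \<le> K ^ 37 / N * ((LINT x|lborel. (cmod (F x))\<^sup>2) * (LINT x|lborel. (cmod (G x))\<^sup>2))"
proof -
  interpret cp: curve_pair P P1 P2 P3 chi chi1 chi2 a b K F G BF BG
    using F G by unfold_locales auto
  have e: "bform F G = cp.slice_form" by (auto simp: fun_eq_iff bform_def cp.slice_form_def cp.slice_def)
  show "bform F G \<in> borel_measurable borel" unfolding e by (rule cp.slice_form_measurable)
  show "integrable lborel (\<lambda>\<xi>. (cmod (bform F G \<xi>))\<^sup>2)" unfolding e by (rule cp.energy_decay(1)[OF N supp])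
  show "(LINT \<xi>|lborel. (cmod (bform F G \<xi>))\<^sup>2) \<le> K ^ 37 / N * ((LINT x|lborel. (cmod (F x))\<^sup>2) * (LINT x|lborel. (cmod (G x))\<^sup>2))"
    unfolding e using cp.energy_decay(2)[OF N supp] by (simp add: cp.nF_def cp.nG_def)
qed

lemma multiplier_facts: "cmod (multiplier \<eta> \<zeta>) \<le> K" "case_prod multiplier \<in> borel_measurable (borel \<Otimes>\<^sub>M borel)"
    "integrable lborel (\<lambda>p. complex_of_real (chi p))"
proof -
  \<comment> \<open>The zero pair gives access to the facts about \<open>chi\<close> proved in
    \<open>curve_pair\<close>.\<close>
  interpret cp: curve_pair P P1 P2 P3 chi chi1 chi2 a b K "\<lambda>_. 0" "\<lambda>_. 0" 0 0
    by unfold_locales auto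
  show "cmod (multiplier \<eta> \<zeta>) \<le> K" unfolding multiplier_def
    using order_trans[OF integral_norm_bound, of lborel "\<lambda>p. of_real (chi p) * ee (\<eta> * p + \<zeta> * P p)" K] cp.chi_integral
    by (simp add: norm_mult chi_nonneg)
  have "(\<lambda>x. LINT p|lborel. (\<lambda>(x, p). of_real (chi p) * ee (fst x * p + snd x * P p)) (x, p)) \<in> borel_measurable (borel \<Otimes>\<^sub>M borel)"
    by (intro lborel.borel_measurable_lebesgue_integral) measurable
  then show "case_prod multiplier \<in> borel_measurable (borel \<Otimes>\<^sub>M borel)" unfolding multiplier_def case_prod_beta' by simp
  show "integrable lborel (\<lambda>p. complex_of_real (chi p))" by (rule cp.chi_integrable)
qed

lemma multiplier_meas [measurable]: "f \<in> borel_measurable M \<Longrightarrow> g \<in> borel_measurable M \<Longrightarrow> (\<lambda>x. multiplier (f x) (g x)) \<in> borel_measurable M"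
  using measurable_compose[OF borel_measurable_Pair multiplier_facts(2)[unfolded borel_prod], of f M g] by simp

text \<open>One absolutely convergent integral, linear in each of \<open>F\<close> and
  \<open>G\<close>; the dyadic expansion and its limit are read off from it.\<close>

lemma bform_multiplier:
  assumes F: "integrable lborel F" and G: "G \<in> borel_measurable borel" "\<And>x. cmod (G x) \<le> BG"
  shows "bform F G \<xi> = (LINT \<eta>|lborel. F \<eta> * (G (\<xi> - \<eta>) * multiplier \<eta> (\<xi> - \<eta>)))"
    "integrable lborel (\<lambda>\<eta>. F \<eta> * (G (\<xi> - \<eta>) * multiplier \<eta> (\<xi> - \<eta>)))"
proof -
  have [measurable]: "F \<in> borel_measurable borel" "G \<in> borel_measurable borel" using F G by auto
  have lborel_sigma_finite: "sigma_finite_measure (lborel :: real measure)" by unfold_locales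
  have BG0: "BG \<ge> 0" by (rule order_trans[OF norm_ge_zero G(2)[of 0]])
  show "integrable lborel (\<lambda>\<eta>. F \<eta> * (G (\<xi> - \<eta>) * multiplier \<eta> (\<xi> - \<eta>)))"
  proof (rule integrable_mult_bounded[OF F, where C="BG * K"])
    show "cmod (G (\<xi> - \<eta>) * multiplier \<eta> (\<xi> - \<eta>)) \<le> BG * K" for \<eta>
      unfolding norm_mult by (rule mult_mono[OF G(2) multiplier_facts(1) BG0 norm_ge_zero])
  qed measurable
  have "bform F G \<xi> = (LINT p|lborel. LINT \<eta>|lborel. (of_real (chi p) * ee (\<eta> * p + (\<xi> - \<eta>) * P p)) * (F \<eta> * G (\<xi> - \<eta>)))"
    unfolding bform_def by (simp flip: integral_mult_right_zero add: ee_add mult_ac)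
  also have "\<dots> = (LINT \<eta>|lborel. LINT p|lborel. (of_real (chi p) * ee (\<eta> * p + (\<xi> - \<eta>) * P p)) * (F \<eta> * G (\<xi> - \<eta>)))"
  proof (rule lborel_pair.Fubini_integral[symmetric])
    have FG: "integrable lborel (\<lambda>\<eta>. F \<eta> * G (\<xi> - \<eta>))" by (rule integrable_mult_bounded[OF F _ G(2)]) measurable
    have "integrable (lborel \<Otimes>\<^sub>M lborel) (\<lambda>z. of_real (chi (fst z)) * (F (snd z) * G (\<xi> - snd z)) * ee (snd z * fst z + (\<xi> - snd z) * P (fst z)))"
      by (rule integrable_prod_bounded[OF lborel_sigma_finite lborel_sigma_finite multiplier_facts(3) FG, where C=1]) auto
    then show "integrable (lborel \<Otimes>\<^sub>M lborel) (\<lambda>(p, \<eta>). (of_real (chi p) * ee (\<eta> * p + (\<xi> - \<eta>) * P p)) * (F \<eta> * G (\<xi> - \<eta>)))"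
      by (simp add: case_prod_beta' mult_ac)
  qed
  also have "\<dots> = (LINT \<eta>|lborel. F \<eta> * (G (\<xi> - \<eta>) * multiplier \<eta> (\<xi> - \<eta>)))"
  proof (rule Bochner_Integration.integral_cong)
    fix \<eta>
    have "(LINT p|lborel. (of_real (chi p) * ee (\<eta> * p + (\<xi> - \<eta>) * P p)) * (F \<eta> * G (\<xi> - \<eta>))) = multiplier \<eta> (\<xi> - \<eta>) * (F \<eta> * G (\<xi> - \<eta>))"
      unfolding multiplier_def by (rule integral_mult_left_zero)
    then show "(LINT p|lborel. (of_real (chi p) * ee (\<eta> * p + (\<xi> - \<eta>) * P p)) * (F \<eta> * G (\<xi> - \<eta>))) = F \<eta> * (G (\<xi> - \<eta>) * multiplier \<eta> (\<xi> - \<eta>))"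
      by (simp add: mult_ac)
  qed auto
  finally show "bform F G \<xi> = (LINT \<eta>|lborel. F \<eta> * (G (\<xi> - \<eta>) * multiplier \<eta> (\<xi> - \<eta>)))" .
qed

text \<open>Blocks are measured by \<open>1 + \<eta>^2\<close> instead of \<open>|\<eta>|\<close>:
  they cover the line from \<open>j = 0\<close> on, and the Sobolev weight on a block is comparable
  to \<open>2^(s * j)\<close>.\<close>

definition dyad :: "nat \<Rightarrow> (real \<Rightarrow> complex) \<Rightarrow> real \<Rightarrow> complex" where
  "dyad j F \<eta> = (if 2 ^ j \<le> 1 + \<eta>\<^sup>2 \<and> 1 + \<eta>\<^sup>2 < 2 ^ Suc j then F \<eta> else 0)"

definition low :: "nat \<Rightarrow> (real \<Rightarrow> complex) \<Rightarrow> real \<Rightarrow> complex" where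
  "low n F \<eta> = (if 1 + \<eta>\<^sup>2 < 2 ^ n then F \<eta> else 0)"

lemma low_sum: "low n F \<eta> = (\<Sum>j<n. dyad j F \<eta>)"
proof (induction n)
  case 0 have "\<not> 1 + \<eta>\<^sup>2 < 1" by (simp add: not_less)
  then show ?case by (simp add: low_def)
next
  case (Suc n)
  have "(2::real) ^ n \<le> 2 ^ Suc n" by simp
  then have "1 + \<eta>\<^sup>2 < 2 ^ n \<Longrightarrow> 1 + \<eta>\<^sup>2 < 2 ^ Suc n" by linarith
  then show ?case unfolding sum.lessThan_Suc Suc.IH[symmetric] unfolding low_def dyad_def by (auto simp del: power_Suc)
qed

lemma dyad_norm: "cmod (dyad j F \<eta>) \<le> cmod (F \<eta>)" by (simp add: dyad_def)
lemma low_norm: "cmod (low j F \<eta>) \<le> cmod (F \<eta>)" by (simp add: low_def)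

lemma dyad_meas:
  assumes [measurable]: "F \<in> borel_measurable borel" shows "dyad j F \<in> borel_measurable borel"
  unfolding dyad_def[abs_def] by measurable

lemma low_meas:
  assumes [measurable]: "F \<in> borel_measurable borel" shows "low j F \<in> borel_measurable borel"
  unfolding low_def[abs_def] by measurable

lemma dyad_integrable: "integrable lborel F \<Longrightarrow> integrable lborel (dyad j F)"
  by (rule Bochner_Integration.integrable_bound) (auto intro: dyad_norm dyad_meas)
lemma low_integrable: "integrable lborel F \<Longrightarrow> integrable lborel (low j F)"
  by (rule Bochner_Integration.integrable_bound) (auto intro: low_norm low_meas)

lemma bform_low:
  assumes F: "integrable lborel F" and G: "integrable lborel G" "\<And>x. cmod (G x) \<le> BG"
  shows "bform (low n F) (low n G) \<xi> = (\<Sum>j<n. \<Sum>k<n. bform (dyad j F) (dyad k G) \<xi>)"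
proof -
  have [measurable]: "F \<in> borel_measurable borel" "G \<in> borel_measurable borel" using F G by auto
  have db: "cmod (dyad k G x) \<le> BG" "cmod (low k G x) \<le> BG" for k x using order_trans[OF dyad_norm G(2)] order_trans[OF low_norm G(2)] by auto
  note m1 = bform_multiplier[OF low_integrable[OF F], of "low n G" BG n] 
  note m2 = bform_multiplier[OF dyad_integrable[OF F], of "dyad k G" BG j for j k]
  have "bform (low n F) (low n G) \<xi> = (LINT \<eta>|lborel. (\<Sum>j<n. \<Sum>k<n. dyad j F \<eta> * (dyad k G (\<xi> - \<eta>) * multiplier \<eta> (\<xi> - \<eta>))))"
  proof -
    have "low n F \<eta> * (low n G (\<xi> - \<eta>) * multiplier \<eta> (\<xi> - \<eta>)) = (\<Sum>j<n. \<Sum>k<n. dyad j F \<eta> * (dyad k G (\<xi> - \<eta>) * multiplier \<eta> (\<xi> - \<eta>)))" for \<eta>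
      unfolding low_sum sum_distrib_right[of _ _ "multiplier \<eta> (\<xi> - \<eta>)"] by (rule sum_product)
    then show ?thesis using m1(1)[OF low_meas db(2)] by simp
  qed
  also have "\<dots> = (\<Sum>j<n. \<Sum>k<n. (LINT \<eta>|lborel. dyad j F \<eta> * (dyad k G (\<xi> - \<eta>) * multiplier \<eta> (\<xi> - \<eta>))))"
    by (subst Bochner_Integration.integral_sum | intro sum.cong refl Bochner_Integration.integrable_sum m2(2) dyad_meas db | simp)+
  also have "\<dots> = (\<Sum>j<n. \<Sum>k<n. bform (dyad j F) (dyad k G) \<xi>)"
    by (intro sum.cong refl m2(1)[symmetric] db dyad_meas) auto
  finally show ?thesis .
qed

text \<open>At each point the truncations are eventually equal to the function, and the boundedness
  of \<open>G\<close> and of the multiplier provides an integrable majorant.\<close>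

lemma bform_low_tendsto:
  assumes F: "integrable lborel F" and G: "integrable lborel G" "\<And>x. cmod (G x) \<le> BG"
  shows "(\<lambda>n. bform (low n F) (low n G) \<xi>) \<longlonglongrightarrow> bform F G \<xi>"
proof -
  have [measurable]: "F \<in> borel_measurable borel" "G \<in> borel_measurable borel" using F G by auto
  have db: "cmod (low k G x) \<le> BG" for k x using order_trans[OF low_norm G(2)] by auto
  have BG0: "BG \<ge> 0" by (rule order_trans[OF norm_ge_zero G(2)[of 0]])
  have e: "bform (low n F) (low n G) \<xi> = (LINT \<eta>|lborel. low n F \<eta> * (low n G (\<xi> - \<eta>) * multiplier \<eta> (\<xi> - \<eta>)))" for n
    by (rule bform_multiplier(1)[OF low_integrable[OF F] _ db]) (auto intro: low_meas)
  have lm: "low n F \<in> borel_measurable borel" "low n G \<in> borel_measurable borel" for n by (auto intro: low_meas)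
  show ?thesis unfolding e bform_multiplier(1)[OF F \<open>G \<in> _\<close> G(2)]
  proof (rule integral_dominated_convergence[where w="\<lambda>\<eta>. cmod (F \<eta>) * (BG * K)"])
    show "(\<lambda>\<eta>. low n F \<eta> * (low n G (\<xi> - \<eta>) * multiplier \<eta> (\<xi> - \<eta>))) \<in> borel_measurable lborel" for n
      using lm[of n] by measurable
    show "AE \<eta> in lborel. (\<lambda>n. low n F \<eta> * (low n G (\<xi> - \<eta>) * multiplier \<eta> (\<xi> - \<eta>))) \<longlonglongrightarrow> F \<eta> * (G (\<xi> - \<eta>) * multiplier \<eta> (\<xi> - \<eta>))"
    proof (rule AE_I2)
      fix \<eta>
      have l: "(\<lambda>n. low n h x) \<longlonglongrightarrow> h x" for h :: "real \<Rightarrow> complex" and x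
      proof (rule tendsto_eventually)
        obtain n0 where "1 + x\<^sup>2 < 2 ^ n0" using real_arch_pow[of 2 "1 + x\<^sup>2"] by auto
        then have "1 + x\<^sup>2 < 2 ^ n" if "n \<ge> n0" for n
          using that power_increasing[of n0 n "2::real"] by linarith
        then show "eventually (\<lambda>n. low n h x = h x) sequentially"
          unfolding eventually_sequentially low_def by auto
      qed
      show "(\<lambda>n. low n F \<eta> * (low n G (\<xi> - \<eta>) * multiplier \<eta> (\<xi> - \<eta>))) \<longlonglongrightarrow> F \<eta> * (G (\<xi> - \<eta>) * multiplier \<eta> (\<xi> - \<eta>))"
        by (intro tendsto_mult l tendsto_const)
    qed
    show "AE \<eta> in lborel. norm (low n F \<eta> * (low n G (\<xi> - \<eta>) * multiplier \<eta> (\<xi> - \<eta>))) \<le> cmod (F \<eta>) * (BG * K)" for n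
      unfolding norm_mult
      by (intro AE_I2 mult_mono low_norm db multiplier_facts(1)) (use BG0 K_pos in auto)
  qed (use F in auto)
qed

lemma dyad_weight:
  assumes F: "integrable lborel F" "\<And>x. cmod (F x) \<le> BF" and s: "s \<ge> 0"
  shows "integrable lborel (\<lambda>\<eta>. (cmod (F \<eta>))\<^sup>2 * (1 + \<eta>\<^sup>2) powr - s)"
    "(LINT \<eta>|lborel. (cmod (dyad j F \<eta>))\<^sup>2) \<le> 2 powr (s * (j + 1)) * (LINT \<eta>|lborel. (cmod (F \<eta>))\<^sup>2 * (1 + \<eta>\<^sup>2) powr - s)"
proof -
  have [measurable]: "F \<in> borel_measurable borel" using F by auto
  have F2: "integrable lborel (\<lambda>x. (cmod (F x))\<^sup>2)" by (rule autocorrelation(1)[OF F])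
  show i: "integrable lborel (\<lambda>\<eta>. (cmod (F \<eta>))\<^sup>2 * (1 + \<eta>\<^sup>2) powr - s)"
  proof (rule Bochner_Integration.integrable_bound[OF F2])
    show "AE \<eta> in lborel. norm ((cmod (F \<eta>))\<^sup>2 * (1 + \<eta>\<^sup>2) powr - s) \<le> norm ((cmod (F \<eta>))\<^sup>2)"
    proof (rule AE_I2)
      fix \<eta>
      have "(1 + \<eta>\<^sup>2) powr - s \<le> (1 + \<eta>\<^sup>2) powr 0" using s by (intro powr_mono) auto
      then have "(1 + \<eta>\<^sup>2) powr - s \<le> 1" by (simp add: add_nonneg_eq_0_iff split: if_splits)
      then show "norm ((cmod (F \<eta>))\<^sup>2 * (1 + \<eta>\<^sup>2) powr - s) \<le> norm ((cmod (F \<eta>))\<^sup>2)"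
        by (simp add: mult_left_le abs_mult)
    qed
  qed measurable
  have "(LINT \<eta>|lborel. (cmod (dyad j F \<eta>))\<^sup>2) \<le> (LINT \<eta>|lborel. 2 powr (s * (j + 1)) * ((cmod (F \<eta>))\<^sup>2 * (1 + \<eta>\<^sup>2) powr - s))"
  proof (rule integral_mono')
    show "integrable lborel (\<lambda>\<eta>. 2 powr (s * (j + 1)) * ((cmod (F \<eta>))\<^sup>2 * (1 + \<eta>\<^sup>2) powr - s))" using i by auto
    fix \<eta>
    show "(cmod (dyad j F \<eta>))\<^sup>2 \<le> 2 powr (s * (j + 1)) * ((cmod (F \<eta>))\<^sup>2 * (1 + \<eta>\<^sup>2) powr - s)"
    proof (cases "1 + \<eta>\<^sup>2 < 2 ^ Suc j")
      case True
      have p: "1 + \<eta>\<^sup>2 > 0" by (simp add: add_pos_nonneg)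
      have "(1 + \<eta>\<^sup>2) powr s \<le> (2 ^ Suc j) powr s" using True s p by (intro powr_mono2) auto
      also have "(2 ^ Suc j) powr s = 2 powr (s * (j + 1))"
        by (subst powr_realpow[symmetric]) (simp_all add: powr_powr mult.commute del: power_Suc powr_realpow)
      finally have "1 \<le> 2 powr (s * (j + 1)) * (1 + \<eta>\<^sup>2) powr - s" using p by (simp add: powr_minus field_simps)
      from mult_right_mono[OF this, of "(cmod (F \<eta>))\<^sup>2"]
      have "(cmod (F \<eta>))\<^sup>2 \<le> 2 powr (s * (j + 1)) * ((cmod (F \<eta>))\<^sup>2 * (1 + \<eta>\<^sup>2) powr - s)" by (simp add: mult_ac)
      moreover have "(cmod (dyad j F \<eta>))\<^sup>2 \<le> (cmod (F \<eta>))\<^sup>2" by (intro power_mono dyad_norm) auto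
      ultimately show ?thesis by linarith
    qed (simp add: dyad_def)
  qed auto
  then show "(LINT \<eta>|lborel. (cmod (dyad j F \<eta>))\<^sup>2) \<le> 2 powr (s * (j + 1)) * (LINT \<eta>|lborel. (cmod (F \<eta>))\<^sup>2 * (1 + \<eta>\<^sup>2) powr - s)"
    by simp
qed

text \<open>\<open>N\<close> is read off from the larger index, since only one of the two
  frequencies has to be large. The output weight is harmless because the form vanishes unless
  \<open>1 + \<xi>^2 \<le> 2^(j + k + 3)\<close>, a consequence of
  \<open>1 + (x + y)^2 \<le> 2 * (1 + x^2) * (1 + y^2)\<close>. The gain \<open>1 / N\<close> then
  beats the three weights.\<close>

lemma block_estimate:
  assumes F: "integrable lborel F" "\<And>x. cmod (F x) \<le> BF" and G: "integrable lborel G" "\<And>x. cmod (G x) \<le> BG"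
  defines "NF \<equiv> (LINT \<eta>|lborel. (cmod (F \<eta>))\<^sup>2 * (1 + \<eta>\<^sup>2) powr - smoothing_exponent)"
    and "NG \<equiv> (LINT \<eta>|lborel. (cmod (G \<eta>))\<^sup>2 * (1 + \<eta>\<^sup>2) powr - smoothing_exponent)"
  shows "integrable lborel (\<lambda>\<xi>. (cmod (bform (dyad j F) (dyad k G) \<xi>))\<^sup>2 * (1 + \<xi>\<^sup>2) powr smoothing_exponent)"
    "(LINT \<xi>|lborel. (cmod (bform (dyad j F) (dyad k G) \<xi>))\<^sup>2 * (1 + \<xi>\<^sup>2) powr smoothing_exponent) \<le> 4 * K ^ 37 * NF * NG * dyadic_ratio ^ (4 * (j + k))"
    "bform (dyad j F) (dyad k G) \<in> borel_measurable borel"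
proof -
  have Fm[measurable]: "F \<in> borel_measurable borel" "G \<in> borel_measurable borel" using F G by auto
  define M where "M = max j k"
  \<comment> \<open>Chosen so that \<open>N ^ 216 = 2^((M - 1) / 2)\<close>: from
    \<open>1 + \<eta>^2 \<ge> 2^M\<close> with \<open>M \<ge> 1\<close> follows
    \<open>\<eta>^2 \<ge> 2^(M - 1)\<close>. For \<open>M = 0\<close> truncated subtraction gives
    \<open>N = 1\<close>, the case without a frequency condition.\<close>
  define e where "e = (real (M - 1)) / 432"
  define N where "N = 2 powr e"
  have N1: "N \<ge> 1" unfolding N_def e_def by (intro ge_one_powr_ge_zero) auto
  have N216: "N ^ 216 = 2 powr (real (M - 1) / 2)"
    unfolding N_def e_def by (subst powr_realpow[symmetric]) (simp_all add: powr_powr)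
  have big: "\<bar>\<eta>\<bar> \<ge> N ^ 216" if "M \<ge> 1" "2 ^ M \<le> 1 + \<eta>\<^sup>2" for \<eta>
  proof -
    have "(2::real) ^ M = 2 * 2 ^ (M - 1)" using that(1) by (metis Suc_diff_1 le_eq_less_or_eq less_one not_gr0 not_le power_Suc)
    moreover have "(1::real) \<le> 2 ^ (M - 1)" by simp
    ultimately have "2 ^ (M - 1) \<le> \<eta>\<^sup>2" using that(2) by linarith
    then have "sqrt (2 ^ (M - 1)) \<le> \<bar>\<eta>\<bar>" using real_sqrt_le_mono by fastforce
    moreover have "N ^ 216 = sqrt (2 ^ (M - 1))"
      unfolding N216 by (subst powr_half_sqrt[symmetric]) (simp_all add: powr_powr flip: powr_realpow)
    ultimately show ?thesis by simp
  qed
  have supp: "N = 1 \<or> (\<forall>\<eta> \<zeta>. dyad j F \<eta> \<noteq> 0 \<longrightarrow> dyad k G \<zeta> \<noteq> 0 \<longrightarrow> \<bar>\<eta>\<bar> \<ge> N ^ 216 \<or> \<bar>\<zeta>\<bar> \<ge> N ^ 216)"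
  proof (cases "M \<ge> 1")
    case True
    have "\<bar>\<eta>\<bar> \<ge> N ^ 216 \<or> \<bar>\<zeta>\<bar> \<ge> N ^ 216" if "dyad j F \<eta> \<noteq> 0" "dyad k G \<zeta> \<noteq> 0" for \<eta> \<zeta>
    proof (cases "j \<ge> k")
      case jk: True
      then have "2 ^ M \<le> 1 + \<eta>\<^sup>2" using that by (auto simp: dyad_def M_def max_def split: if_splits)
      then show ?thesis using big[OF True] by blast
    next
      case jk: False
      then have "2 ^ M \<le> 1 + \<zeta>\<^sup>2" using that by (auto simp: dyad_def M_def max_def split: if_splits)
      then show ?thesis using big[OF True] by blast
    qed
    then show ?thesis by blast
  next
    case False then show ?thesis by (simp add: N_def e_def)
  qed
  have Fb: "cmod (dyad j F x) \<le> BF" "cmod (dyad k G x) \<le> BG" for x using order_trans[OF dyad_norm F(2)] order_trans[OF dyad_norm G(2)] by auto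
  note bd = bform_decay[OF dyad_integrable[OF F(1)] Fb(1) dyad_integrable[OF G(1)] Fb(2) N1 supp]
  show [measurable]: "bform (dyad j F) (dyad k G) \<in> borel_measurable borel" by (rule bd(1))
  have smoothing_exponent: "smoothing_exponent \<ge> 0" by (simp add: smoothing_exponent_def)
  \<comment> \<open>Maximum of the output weight on the support of the block.\<close>
  define A where "A = 2 powr (smoothing_exponent * (j + k + 3))"
  have pt: "(cmod (bform (dyad j F) (dyad k G) \<xi>))\<^sup>2 * (1 + \<xi>\<^sup>2) powr smoothing_exponent \<le> A * (cmod (bform (dyad j F) (dyad k G) \<xi>))\<^sup>2" for \<xi>
  proof (cases "1 + \<xi>\<^sup>2 \<le> 2 ^ (j + k + 3)")
    case True
    have "(1 + \<xi>\<^sup>2) powr smoothing_exponent \<le> (2 ^ (j + k + 3)) powr smoothing_exponent" using True smoothing_exponent by (intro powr_mono2) (auto simp: add_nonneg_nonneg)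
    also have "(2 ^ (j + k + 3)) powr smoothing_exponent = A" unfolding A_def
      by (subst powr_realpow[symmetric]) (simp_all add: powr_powr mult.commute del: powr_realpow)
    finally have "(1 + \<xi>\<^sup>2) powr smoothing_exponent \<le> A" .
    then show ?thesis by (simp add: mult.commute mult_right_mono)
  next
    case False
    have z: "dyad j F \<eta> * ee (\<eta> * p) * (dyad k G (\<xi> - \<eta>) * ee ((\<xi> - \<eta>) * P p)) = 0" for \<eta> p
    proof (rule ccontr)
      assume "\<not> ?thesis"
      then have h: "1 + \<eta>\<^sup>2 < 2 ^ Suc j" "1 + (\<xi> - \<eta>)\<^sup>2 < 2 ^ Suc k" by (auto simp: dyad_def split: if_splits)
      have "1 + \<xi>\<^sup>2 \<le> 2 * ((1 + \<eta>\<^sup>2) * (1 + (\<xi> - \<eta>)\<^sup>2))"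
      proof -
        have "1 + (x + y)\<^sup>2 \<le> 2 * ((1 + x\<^sup>2) * (1 + y\<^sup>2))" for x y :: real
        proof -
          have "2 * ((1 + x\<^sup>2) * (1 + y\<^sup>2)) - (1 + (x + y)\<^sup>2) = 1 + (x - y)\<^sup>2 + 2 * (x * y)\<^sup>2"
            by (simp add: power2_eq_square algebra_simps)
          also have "\<dots> \<ge> 0" by simp
          finally show ?thesis by simp
        qed
        from this[of \<eta> "\<xi> - \<eta>"] show ?thesis by simp
      qed
      also have "\<dots> \<le> 2 * (2 ^ Suc j * 2 ^ Suc k)" using h by (intro mult_left_mono mult_mono) auto
      also have "\<dots> = 2 ^ (j + k + 3)" by (simp add: power_add)
      finally show False using False by simp
    qed
    have "bform (dyad j F) (dyad k G) \<xi> = 0" unfolding bform_def z by simp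
    then show ?thesis by simp
  qed
  have Ai: "integrable lborel (\<lambda>\<xi>. A * (cmod (bform (dyad j F) (dyad k G) \<xi>))\<^sup>2)" using bd(2) by auto
  show "integrable lborel (\<lambda>\<xi>. (cmod (bform (dyad j F) (dyad k G) \<xi>))\<^sup>2 * (1 + \<xi>\<^sup>2) powr smoothing_exponent)"
    by (rule Bochner_Integration.integrable_bound[OF Ai]) (auto simp: abs_mult A_def intro!: AE_I2 order_trans[OF pt])
  have NFG: "NF \<ge> 0" "NG \<ge> 0" by (simp_all add: NF_def NG_def)
  have dF: "(LINT \<eta>|lborel. (cmod (dyad j F \<eta>))\<^sup>2) \<le> 2 powr (smoothing_exponent * (j + 1)) * NF" unfolding NF_def by (rule dyad_weight(2)[OF F smoothing_exponent])
  have dG: "(LINT \<eta>|lborel. (cmod (dyad k G \<eta>))\<^sup>2) \<le> 2 powr (smoothing_exponent * (k + 1)) * NG" unfolding NG_def by (rule dyad_weight(2)[OF G smoothing_exponent])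
  have "(LINT \<xi>|lborel. (cmod (bform (dyad j F) (dyad k G) \<xi>))\<^sup>2 * (1 + \<xi>\<^sup>2) powr smoothing_exponent) \<le> (LINT \<xi>|lborel. A * (cmod (bform (dyad j F) (dyad k G) \<xi>))\<^sup>2)"
    by (rule integral_mono'[OF Ai pt]) (simp add: A_def)
  also have "\<dots> = A * (LINT \<xi>|lborel. (cmod (bform (dyad j F) (dyad k G) \<xi>))\<^sup>2)" by simp
  also have "\<dots> \<le> A * (K ^ 37 / N * ((2 powr (smoothing_exponent * (j + 1)) * NF) * (2 powr (smoothing_exponent * (k + 1)) * NG)))"
  proof (intro mult_left_mono order_trans[OF bd(3)] mult_mono dF dG)
    show "K ^ 37 / N \<ge> 0" "A \<ge> 0" using K_pos N1 by (auto simp: A_def)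
  qed (use NFG in auto)
  also have "\<dots> = K ^ 37 * NF * NG * (A / N * (2 powr (smoothing_exponent * (j + 1)) * 2 powr (smoothing_exponent * (k + 1))))" by simp
  also have "\<dots> \<le> K ^ 37 * NF * NG * (4 * dyadic_ratio ^ (4 * (j + k)))"
  proof (intro mult_left_mono)
    have "A / N * (2 powr (smoothing_exponent * (j + 1)) * 2 powr (smoothing_exponent * (k + 1))) = 2 powr (smoothing_exponent * (j + k + 3) - e + (smoothing_exponent * (j + 1) + smoothing_exponent * (k + 1)))"
      unfolding A_def N_def by (simp only: powr_add powr_diff)
    \<comment> \<open>The losses are \<open>(j + k) / 1728\<close> up to a constant. Since the
      maximum of \<open>j\<close> and \<open>k\<close> is at least half their sum, the gain
      \<open>e\<close> is at least \<open>(j + k) / 864 - 1 / 432\<close>. The leftover constants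
      are below 2.\<close>
    also have "\<dots> \<le> 2 powr (2 - (j + k) / 1728)"
    proof (intro powr_mono)
      have "real (M - 1) \<ge> real M - 1" by simp
      moreover have "2 * real M \<ge> j + k" by (simp add: M_def)
      moreover have "x / 2 - 1 \<le> z" if "m - 1 \<le> z" "x \<le> 2 * m" for x z m :: real using that by linarith
      ultimately have "real (j + k) / 2 - 1 \<le> real (M - 1)" by blast
      then have "e \<ge> (real (j + k) / 2 - 1) / 432" unfolding e_def by (intro divide_right_mono) auto
      then show "smoothing_exponent * (j + k + 3) - e + (smoothing_exponent * (j + 1) + smoothing_exponent * (k + 1)) \<le> 2 - real (j + k) / 1728" by (simp add: smoothing_exponent_def field_simps)
    qed auto
    also have "2 - real (j + k) / 1728 = 2 + (- 1 / 6912 * (4 * real (j + k)))" by simp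
    also have "2 powr (2 + (- 1 / 6912 * (4 * real (j + k)))) = 2 powr 2 * 2 powr (- 1 / 6912 * (4 * (j + k)))"
      unfolding powr_add by simp
    also have "2 powr (- 1 / 6912 * (4 * (j + k))) = dyadic_ratio ^ (4 * (j + k))"
      unfolding dyadic_ratio_def by (subst powr_realpow[symmetric]) (simp_all add: powr_powr)
    finally show "A / N * (2 powr (smoothing_exponent * (j + 1)) * 2 powr (smoothing_exponent * (k + 1))) \<le> 4 * dyadic_ratio ^ (4 * (j + k))" by simp
  qed (use NFG K_pos in auto)
  finally show "(LINT \<xi>|lborel. (cmod (bform (dyad j F) (dyad k G) \<xi>))\<^sup>2 * (1 + \<xi>\<^sup>2) powr smoothing_exponent) \<le> 4 * K ^ 37 * NF * NG * dyadic_ratio ^ (4 * (j + k))"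
    by (simp add: mult_ac)
qed

text \<open>Cauchy-Schwarz over the pairs of blocks with geometric weights bounds the square of the
  truncated form pointwise by \<open>R n\<close>. The integrals of \<open>R n\<close> are bounded
  independently of \<open>n\<close>, and Fatou's lemma removes the truncation.\<close>

lemma sobolev_bilinear:
  assumes F: "integrable lborel F" "\<And>x. cmod (F x) \<le> BF" and G: "integrable lborel G" "\<And>x. cmod (G x) \<le> BG"
  shows "(\<integral>\<^sup>+\<xi>. ennreal ((cmod (bform F G \<xi>))\<^sup>2 * (1 + \<xi>\<^sup>2) powr smoothing_exponent) \<partial>lborel)
    \<le> ennreal (4 * C0 ^ 4 * K ^ 37 * (LINT \<eta>|lborel. (cmod (F \<eta>))\<^sup>2 * (1 + \<eta>\<^sup>2) powr - smoothing_exponent) * (LINT \<eta>|lborel. (cmod (G \<eta>))\<^sup>2 * (1 + \<eta>\<^sup>2) powr - smoothing_exponent))"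
proof -
  define NF where "NF = (LINT \<eta>|lborel. (cmod (F \<eta>))\<^sup>2 * (1 + \<eta>\<^sup>2) powr - smoothing_exponent)"
  define NG where "NG = (LINT \<eta>|lborel. (cmod (G \<eta>))\<^sup>2 * (1 + \<eta>\<^sup>2) powr - smoothing_exponent)"
  have NFG: "NF \<ge> 0" "NG \<ge> 0" by (simp_all add: NF_def NG_def)
  note be = block_estimate[OF F G, folded NF_def NG_def]
  define x where "x j k \<xi> = bform (dyad j F) (dyad k G) \<xi>" for j k \<xi>
  define w where "w \<xi> = (1 + \<xi>\<^sup>2) powr smoothing_exponent" for \<xi> :: real
  have [measurable]: "x j k \<in> borel_measurable borel" for j k unfolding x_def by (rule be(3))
  have [measurable]: "w \<in> borel_measurable borel" unfolding w_def by measurable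
  have w0: "w \<xi> \<ge> 0" for \<xi> by (simp add: w_def)
  define D where "D = 4 * K ^ 37 * NF * NG"
  have D0: "D \<ge> 0" using NFG K_pos by (simp add: D_def)
  \<comment> \<open>The prefactor \<open>C0^2\<close> is the sum of the squared weights; another
    \<open>C0^2\<close> arises from the integrals of the terms, which explains \<open>C0 ^ 4\<close>
    in the bound.\<close>
  define R where "R n \<xi> = C0\<^sup>2 * (\<Sum>j<n. \<Sum>k<n. (cmod (x j k \<xi>))\<^sup>2 * w \<xi> / (dyadic_ratio\<^sup>2) ^ (j + k))" for n \<xi>
  have xi: "integrable lborel (\<lambda>\<xi>. (cmod (x j k \<xi>))\<^sup>2 * w \<xi>)" "(LINT \<xi>|lborel. (cmod (x j k \<xi>))\<^sup>2 * w \<xi>) \<le> D * dyadic_ratio ^ (4 * (j + k))" for j k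
    unfolding x_def w_def D_def using be(1,2) by auto
  have Ri: "integrable lborel (R n)" for n unfolding R_def using xi(1) by auto
  have RL: "(LINT \<xi>|lborel. R n \<xi>) \<le> D * C0 ^ 4" for n
  proof -
    have "(LINT \<xi>|lborel. R n \<xi>) = C0\<^sup>2 * (\<Sum>j<n. \<Sum>k<n. (LINT \<xi>|lborel. (cmod (x j k \<xi>))\<^sup>2 * w \<xi>) / (dyadic_ratio\<^sup>2) ^ (j + k))"
      unfolding R_def using xi(1) by (simp add: Bochner_Integration.integral_sum)
    also have "\<dots> \<le> C0\<^sup>2 * (\<Sum>j<n. \<Sum>k<n. D * (dyadic_ratio\<^sup>2) ^ (j + k))"
    proof (intro mult_left_mono sum_mono)
      fix j k
      have "(LINT \<xi>|lborel. (cmod (x j k \<xi>))\<^sup>2 * w \<xi>) / (dyadic_ratio\<^sup>2) ^ (j + k) \<le> D * dyadic_ratio ^ (4 * (j + k)) / (dyadic_ratio\<^sup>2) ^ (j + k)"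
        using xi(2) by (intro divide_right_mono) auto
      also have "dyadic_ratio ^ (4 * (j + k)) = (dyadic_ratio\<^sup>2) ^ (j + k) * (dyadic_ratio\<^sup>2) ^ (j + k)"
        by (simp flip: power_mult power_add power_mult_distrib)
      finally show "(LINT \<xi>|lborel. (cmod (x j k \<xi>))\<^sup>2 * w \<xi>) / (dyadic_ratio\<^sup>2) ^ (j + k) \<le> D * (dyadic_ratio\<^sup>2) ^ (j + k)" using dyadic_ratio by simp
    qed auto
    also have "\<dots> = C0\<^sup>2 * (D * (\<Sum>j<n. \<Sum>k<n. (dyadic_ratio\<^sup>2) ^ (j + k)))" by (simp add: sum_distrib_left)
    also have "\<dots> \<le> C0\<^sup>2 * (D * C0\<^sup>2)" using D0 by (intro mult_left_mono double_geometric) auto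
    finally show ?thesis by (simp add: power2_eq_square power4_eq_xxxx mult_ac)
  qed
  have pt: "(cmod (bform (low n F) (low n G) \<xi>))\<^sup>2 * w \<xi> \<le> R n \<xi>" for n \<xi>
  proof -
    define S where "S = {..<n} \<times> {..<n}"
    have "cmod (bform (low n F) (low n G) \<xi>) \<le> (\<Sum>z\<in>S. cmod (x (fst z) (snd z) \<xi>))"
      unfolding bform_low[OF F(1) G] x_def[symmetric] S_def sum.cartesian_product
      by (rule order_trans[OF norm_sum]) (simp add: case_prod_beta')
    also have "\<dots> = (\<Sum>z\<in>S. dyadic_ratio ^ (fst z + snd z) * (cmod (x (fst z) (snd z) \<xi>) / dyadic_ratio ^ (fst z + snd z)))" using dyadic_ratio by simp
    finally have "(cmod (bform (low n F) (low n G) \<xi>))\<^sup>2 \<le> (\<Sum>z\<in>S. dyadic_ratio ^ (fst z + snd z) * (cmod (x (fst z) (snd z) \<xi>) / dyadic_ratio ^ (fst z + snd z)))\<^sup>2"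
      by (intro power_mono) auto
    also have "\<dots> \<le> (\<Sum>z\<in>S. (dyadic_ratio ^ (fst z + snd z))\<^sup>2) * (\<Sum>z\<in>S. (cmod (x (fst z) (snd z) \<xi>) / dyadic_ratio ^ (fst z + snd z))\<^sup>2)"
      by (rule Cauchy_Schwarz_ineq_sum)
    also have "(\<Sum>z\<in>S. (dyadic_ratio ^ (fst z + snd z))\<^sup>2) = (\<Sum>j<n. \<Sum>k<n. (dyadic_ratio\<^sup>2) ^ (j + k))"
      unfolding S_def sum.cartesian_product by (simp add: case_prod_beta' mult.commute flip: power_mult)
    also have "(\<Sum>z\<in>S. (cmod (x (fst z) (snd z) \<xi>) / dyadic_ratio ^ (fst z + snd z))\<^sup>2) = (\<Sum>j<n. \<Sum>k<n. (cmod (x j k \<xi>))\<^sup>2 / (dyadic_ratio\<^sup>2) ^ (j + k))"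
      unfolding S_def sum.cartesian_product by (simp add: case_prod_beta' power_divide mult.commute flip: power_mult)
    also have "(\<Sum>j<n. \<Sum>k<n. (dyadic_ratio\<^sup>2) ^ (j + k)) * (\<Sum>j<n. \<Sum>k<n. (cmod (x j k \<xi>))\<^sup>2 / (dyadic_ratio\<^sup>2) ^ (j + k))
      \<le> C0\<^sup>2 * (\<Sum>j<n. \<Sum>k<n. (cmod (x j k \<xi>))\<^sup>2 / (dyadic_ratio\<^sup>2) ^ (j + k))"
      by (intro mult_right_mono double_geometric sum_nonneg) auto
    finally have "(cmod (bform (low n F) (low n G) \<xi>))\<^sup>2 * w \<xi> \<le> C0\<^sup>2 * (\<Sum>j<n. \<Sum>k<n. (cmod (x j k \<xi>))\<^sup>2 / (dyadic_ratio\<^sup>2) ^ (j + k)) * w \<xi>"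
      by (intro mult_right_mono w0)
    also have "\<dots> = R n \<xi>" unfolding R_def mult.assoc sum_distrib_right by simp
    finally show ?thesis .
  qed
  have bm[measurable]: "bform (low n F) (low n G) \<in> borel_measurable borel" for n
  proof -
    have "(\<lambda>\<xi>. \<Sum>j<n. \<Sum>k<n. x j k \<xi>) \<in> borel_measurable borel" by measurable
    then show ?thesis unfolding bform_low[OF F(1) G, abs_def] x_def .
  qed
  have "(\<integral>\<^sup>+\<xi>. ennreal ((cmod (bform F G \<xi>))\<^sup>2 * w \<xi>) \<partial>lborel) = (\<integral>\<^sup>+\<xi>. liminf (\<lambda>n. ennreal ((cmod (bform (low n F) (low n G) \<xi>))\<^sup>2 * w \<xi>)) \<partial>lborel)"
  proof (rule nn_integral_cong)
    fix \<xi>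
    have lim: "(\<lambda>n. ennreal ((cmod (bform (low n F) (low n G) \<xi>))\<^sup>2 * w \<xi>)) \<longlonglongrightarrow> ennreal ((cmod (bform F G \<xi>))\<^sup>2 * w \<xi>)"
      by (intro tendsto_intros bform_low_tendsto[OF F(1) G])
    show "ennreal ((cmod (bform F G \<xi>))\<^sup>2 * w \<xi>) = liminf (\<lambda>n. ennreal ((cmod (bform (low n F) (low n G) \<xi>))\<^sup>2 * w \<xi>))"
      using lim_imp_Liminf[OF _ lim] by simp
  qed
  also have "\<dots> \<le> liminf (\<lambda>n. \<integral>\<^sup>+\<xi>. ennreal ((cmod (bform (low n F) (low n G) \<xi>))\<^sup>2 * w \<xi>) \<partial>lborel)"
    by (rule nn_integral_liminf) measurable
  also have "\<dots> \<le> liminf (\<lambda>n. ennreal (D * C0 ^ 4))"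
  proof (intro Liminf_mono always_eventually allI)
    fix n
    have R0: "R n \<xi> \<ge> 0" for \<xi> using order_trans[OF _ pt[of n \<xi>]] w0 by simp
    have "(\<integral>\<^sup>+\<xi>. ennreal ((cmod (bform (low n F) (low n G) \<xi>))\<^sup>2 * w \<xi>) \<partial>lborel) \<le> (\<integral>\<^sup>+\<xi>. ennreal (R n \<xi>) \<partial>lborel)"
      by (intro nn_integral_mono ennreal_leI pt)
    also have "\<dots> = ennreal (LINT \<xi>|lborel. R n \<xi>)" using Ri R0 by (intro nn_integral_eq_integral) auto
    also have "\<dots> \<le> ennreal (D * C0 ^ 4)" by (intro ennreal_leI RL)
    finally show "(\<integral>\<^sup>+\<xi>. ennreal ((cmod (bform (low n F) (low n G) \<xi>))\<^sup>2 * w \<xi>) \<partial>lborel) \<le> ennreal (D * C0 ^ 4)" .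
  qed
  also have "\<dots> = ennreal (D * C0 ^ 4)" by (simp add: Liminf_const)
  finally show ?thesis unfolding w_def D_def NF_def NG_def by (simp add: mult_ac)
qed

end

subsection \<open>Schwartz functions\<close>

text \<open>The fundamental theorem on \<open>{- n..n}\<close> leaves two boundary values, which
  tend to 0 by the decay of \<open>h\<close>.\<close>

lemma integral_derivative_vanishing:
  fixes h h' :: "real \<Rightarrow> complex"
  assumes d: "\<And>x. (h has_vector_derivative h' x) (at x)" and c: "continuous_on UNIV h'" and i: "integrable lborel h'"
    and b: "\<And>x. cmod (h x) \<le> C / (1 + x\<^sup>2)"
  shows "(LINT x|lborel. h' x) = 0"
proof -
  define I where "I n = (LINT x|lborel. indicator {- real n..real n} x *\<^sub>R h' x)" for n
  have "I \<longlonglongrightarrow> (LINT x|lborel. h' x)" unfolding I_def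
  proof (rule integral_dominated_convergence[where w="\<lambda>x. cmod (h' x)"])
    show "AE x in lborel. (\<lambda>n. indicator {- real n..real n} x *\<^sub>R h' x) \<longlonglongrightarrow> h' x"
    proof (rule AE_I2, rule tendsto_eventually)
      fix x :: real
      obtain n0 where "\<bar>x\<bar> \<le> real n0" using real_arch_simple by blast
      then have "indicator {- real n..real n} x *\<^sub>R h' x = h' x" if "n \<ge> n0" for n
        using that by (auto simp: indicator_def)
      then show "eventually (\<lambda>n. indicator {- real n..real n} x *\<^sub>R h' x = h' x) sequentially"
        unfolding eventually_sequentially by blast
    qed
  qed (use i in \<open>auto simp: indicator_def\<close>)
  moreover have "I n = h (real n) - h (- real n)" for n unfolding I_def
    by (rule integral_FTC_atLeastAtMost) (auto intro: has_vector_derivative_at_within d continuous_on_subset[OF c])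
  then have "I \<longlonglongrightarrow> 0"
  proof -
    assume In: "\<And>n. I n = h (real n) - h (- real n)"
    have "(\<lambda>n. 2 * C / (1 + (real n)\<^sup>2)) \<longlonglongrightarrow> 0" by real_asymp
    moreover have "cmod (I n) \<le> 2 * C / (1 + (real n)\<^sup>2)" for n
      unfolding In using norm_triangle_ineq4[of "h (real n)" "h (- real n)"] b[of "real n"] b[of "- real n"] by simp
    ultimately show ?thesis using Lim_null_comparison[of I "\<lambda>n. 2 * C / (1 + (real n)\<^sup>2)" sequentially] by simp
  qed
  ultimately show ?thesis by (rule LIMSEQ_unique)
qed

lemma iter_deriv_Suc: "iter_deriv (Suc k) f x = vector_derivative (iter_deriv k f) (at x)"
  by (simp add: iter_deriv_def)

lemma iter_deriv_0: "iter_deriv 0 f = f" by (simp add: iter_deriv_def)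

lemma smooth_derivative:
  assumes "smooth f"
  shows "(iter_deriv k f has_vector_derivative iter_deriv (Suc k) f x) (at x)"
  using assms vector_derivative_works unfolding smooth_def iter_deriv_Suc by blast

lemma smooth_continuous: "smooth f \<Longrightarrow> continuous_on S (iter_deriv k f)"
  by (rule continuous_at_imp_continuous_on) (auto intro: has_vector_derivative_continuous smooth_derivative)

lemma schwartz_decay:
  assumes "schwartz f"
  obtains C where "C \<ge> 0" "\<And>x. cmod (iter_deriv k f x) \<le> C / (1 + x\<^sup>2)"
proof -
  have b: "bounded (range (\<lambda>x. x ^ m *\<^sub>R iter_deriv k f x))" for m using assms by (simp add: schwartz_def)
  obtain C0 where C0: "\<And>x. cmod (x ^ 0 *\<^sub>R iter_deriv k f x) \<le> C0" using b[of 0] unfolding bounded_iff by auto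
  obtain C2 where C2: "\<And>x. cmod (x ^ 2 *\<^sub>R iter_deriv k f x) \<le> C2" using b[of 2] unfolding bounded_iff by auto
  show ?thesis
  proof (rule that[of "C0 + C2"])
    show "C0 + C2 \<ge> 0" using order_trans[OF norm_ge_zero C0[of 0]] order_trans[OF norm_ge_zero C2[of 0]] by simp
    fix x :: real
    have "(1 + x\<^sup>2) * cmod (iter_deriv k f x) \<le> C0 + C2" using C0[of x] C2[of x] by (simp add: distrib_right)
    then show "cmod (iter_deriv k f x) \<le> (C0 + C2) / (1 + x\<^sup>2)" by (simp add: field_simps add_pos_nonneg)
  qed
qed

lemma integrable_decay:
  fixes f :: "real \<Rightarrow> complex"
  assumes f: "f \<in> borel_measurable borel" and b: "\<And>x. cmod (f x) \<le> C / (1 + x\<^sup>2)"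
  shows "integrable lborel f"
proof (rule Bochner_Integration.integrable_bound)
  have "integrable lborel (\<lambda>x::real. inverse (1 + x\<^sup>2))"
    using integrable_inverse_1_plus_square unfolding set_integrable_def by (simp add: einterval_eq)
  then show "integrable lborel (\<lambda>x::real. C * inverse (1 + x\<^sup>2))" by auto
  show "AE x in lborel. norm (f x) \<le> norm (C * inverse (1 + x\<^sup>2))"
    using b by (auto intro!: AE_I2 order_trans[OF b] simp: divide_inverse)
qed (use f in auto)

lemma decay_le: "C \<ge> 0 \<Longrightarrow> C / (1 + x\<^sup>2) \<le> C" for x :: real
  by (simp add: divide_le_eq add_pos_nonneg mult_left_mono[of 1 "1 + x\<^sup>2" C, simplified])

lemma schwartz_integrable:
  assumes f: "schwartz f" shows "integrable lborel (iter_deriv k f)"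
proof -
  obtain C where C: "\<And>x. cmod (iter_deriv k f x) \<le> C / (1 + x\<^sup>2)" by (rule schwartz_decay[OF f]) blast
  have "smooth f" using f by (simp add: schwartz_def)
  then have "iter_deriv k f \<in> borel_measurable borel" by (intro borel_measurable_continuous_onI smooth_continuous)
  then show ?thesis by (rule integrable_decay[OF _ C])
qed

lemma fourier_iter_deriv:
  assumes f: "schwartz f"
  shows "fourier (iter_deriv (Suc k) f) \<xi> = of_real (2 * pi * \<xi>) * \<i> * fourier (iter_deriv k f) \<xi>"
proof -
  have sm: "smooth f" using f by (simp add: schwartz_def)
  obtain C where C: "\<And>x. cmod (iter_deriv k f x) \<le> C / (1 + x\<^sup>2)" by (rule schwartz_decay[OF f]) blast
  define h where "h x = iter_deriv k f x * ee (- (x * \<xi>))" for x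
  define c where "c = of_real (2 * pi * \<xi>) * \<i>"
  define h' where "h' x = iter_deriv (Suc k) f x * ee (- (x * \<xi>)) - c * (iter_deriv k f x * ee (- (x * \<xi>)))" for x
  have de: "((\<lambda>x. ee (- (x * \<xi>))) has_vector_derivative (- c * ee (- (x * \<xi>)))) (at x)" for x
  proof -
    have "((\<lambda>x. 2 * pi * (- (x * \<xi>))) has_real_derivative (- (2 * pi * \<xi>))) (at x)"
      by (auto intro!: derivative_eq_intros)
    from has_vector_derivative_cis[OF this] show ?thesis by (simp add: ee_def c_def mult_ac)
  qed
  have "(LINT x|lborel. h' x) = 0"
  proof (rule integral_derivative_vanishing)
    show "(h has_vector_derivative h' x) (at x)" for x
    proof -
      have "(h has_vector_derivative (iter_deriv k f x * (- c * ee (- (x * \<xi>))) + iter_deriv (Suc k) f x * ee (- (x * \<xi>)))) (at x)"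
        unfolding h_def by (rule has_vector_derivative_mult[OF smooth_derivative[OF sm] de])
      then show ?thesis by (simp add: h'_def mult_ac)
    qed
    show "continuous_on UNIV h'" unfolding h'_def by (intro continuous_intros smooth_continuous sm)
    show "integrable lborel h'" unfolding h'_def
      by (intro Bochner_Integration.integrable_diff integrable_mult_right integrable_mult_bounded[where C=1] schwartz_integrable f) auto
    show "cmod (h x) \<le> C / (1 + x\<^sup>2)" for x using C[of x] by (simp add: h_def norm_mult)
  qed
  moreover have "(LINT x|lborel. h' x) = fourier (iter_deriv (Suc k) f) \<xi> - c * fourier (iter_deriv k f) \<xi>"
    unfolding h'_def fourier_ee
    by (subst Bochner_Integration.integral_diff)
      (auto intro!: integrable_mult_right integrable_mult_bounded[where C=1] schwartz_integrable f)
  ultimately show ?thesis by (simp add: c_def)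
qed

text \<open>Two derivatives of \<open>f\<close> bound \<open>\<xi>^2\<close> times the transform;
  together with the trivial bound this gives decay of order
  \<open>1 / (1 + \<xi>^2)\<close>.\<close>

lemma schwartz_fourier:
  assumes f: "schwartz f"
  obtains B where "\<And>\<xi>. cmod (fourier f \<xi>) \<le> B" "integrable lborel (fourier f)"
proof -
  define M where "M k = (LINT x|lborel. cmod (iter_deriv k f x))" for k
  have Mb: "cmod (fourier (iter_deriv k f) \<xi>) \<le> M k" for k \<xi>
    unfolding M_def fourier_ee by (rule fourier_bounded[OF schwartz_integrable[OF f]])
  have f0: "integrable lborel f" using schwartz_integrable[OF f, of 0] by (simp add: iter_deriv_0)
  have b0: "cmod (fourier f \<xi>) \<le> M 0" for \<xi> using Mb[of 0 \<xi>] by (simp add: iter_deriv_0)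
  have b: "cmod (fourier f \<xi>) \<le> (M 0 + M 2) / (1 + \<xi>\<^sup>2)" for \<xi>
  proof -
    have "fourier (iter_deriv 2 f) \<xi> = of_real (2 * pi * \<xi>) * \<i> * (of_real (2 * pi * \<xi>) * \<i> * fourier f \<xi>)"
      using fourier_iter_deriv[OF f, of 1 \<xi>] fourier_iter_deriv[OF f, of 0 \<xi>] by (simp add: numeral_2_eq_2 iter_deriv_0)
    then have "cmod (fourier (iter_deriv 2 f) \<xi>) = (2 * pi)\<^sup>2 * \<xi>\<^sup>2 * cmod (fourier f \<xi>)"
      by (simp add: norm_mult power2_eq_square abs_mult_self_eq mult_ac)
    then have 2: "(2 * pi)\<^sup>2 * (\<xi>\<^sup>2 * cmod (fourier f \<xi>)) \<le> M 2" using Mb[of 2 \<xi>] by (simp add: mult_ac)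
    have "1 * (\<xi>\<^sup>2 * cmod (fourier f \<xi>)) \<le> (2 * pi)\<^sup>2 * (\<xi>\<^sup>2 * cmod (fourier f \<xi>))"
      using pi_ge_two by (intro mult_right_mono one_le_power) auto
    then have "(1 + \<xi>\<^sup>2) * cmod (fourier f \<xi>) \<le> M 0 + M 2" using 2 b0[of \<xi>] by (simp add: distrib_right)
    then show ?thesis by (simp add: field_simps add_pos_nonneg)
  qed
  have fm: "fourier f \<in> borel_measurable borel" unfolding fourier_ee[abs_def]
    by (intro borel_measurable_continuous_onI continuous_fourier f0)
  show ?thesis by (rule that[OF b0 integrable_decay[OF fm b]])
qed

lemma schwartz_basic:
  assumes f: "schwartz f"
  obtains B where "integrable lborel f" "continuous_on UNIV f" "\<And>x. cmod (f x) \<le> B" "f \<in> borel_measurable borel"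
proof -
  obtain C where C: "C \<ge> 0" "\<And>x. cmod (iter_deriv 0 f x) \<le> C / (1 + x\<^sup>2)" by (rule schwartz_decay[OF f]) blast
  have fc: "continuous_on UNIV f" using smooth_continuous[of f UNIV 0] f by (simp add: schwartz_def iter_deriv_0)
  have b: "cmod (f x) \<le> C" for x using order_trans[OF C(2)[of x] decay_le[OF C(1)]] by (simp add: iter_deriv_0)
  show ?thesis
    by (rule that[OF _ fc b]) (use schwartz_integrable[OF f, of 0] fc in \<open>auto simp: iter_deriv_0 intro: borel_measurable_continuous_onI\<close>)
qed

section \<open>The bilinear operator on the Fourier side and in Sobolev norms\<close>

lemma fourier_translate: "fourier (\<lambda>x. f (x + t)) \<eta> = fourier f \<eta> * ee (\<eta> * t)"
proof -
  have "fourier (\<lambda>x. f (x + t)) \<eta> = (LINT x|lborel. f (x + t) * ee (- ((x + t) * \<eta>)) * ee (\<eta> * t))"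
    unfolding fourier_ee by (intro Bochner_Integration.integral_cong) (auto simp: algebra_simps simp flip: ee_add)
  also have "\<dots> = (LINT x|lborel. f x * ee (- (x * \<eta>)) * ee (\<eta> * t))"
    by (rule LINT_shift(1)[of "\<lambda>x. f x * ee (- (x * \<eta>)) * ee (\<eta> * t)"])
  finally show ?thesis by (simp add: fourier_ee)
qed

text \<open>Fubini moves the transform inside the t-integral. For fixed \<open>t\<close> the
  integrand is a product of two translates, whose transform is a convolution of modulated
  transforms, namely the slice at \<open>t\<close>.\<close>

lemma (in curve) fourier_bilinear:
  assumes f: "schwartz f" and g: "schwartz g"
  shows "fourier (\<lambda>x. LINT t|lborel. f (x + t) * g (x + P t) * of_real (chi t)) \<xi> = bform (fourier f) (fourier g) \<xi>"
proof -
  obtain Bf where F: "integrable lborel f" "continuous_on UNIV f" "\<And>x. cmod (f x) \<le> Bf" and [measurable]: "f \<in> borel_measurable borel"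
    by (rule schwartz_basic[OF f]) blast
  obtain Bg where G: "integrable lborel g" "continuous_on UNIV g" "\<And>x. cmod (g x) \<le> Bg" and [measurable]: "g \<in> borel_measurable borel"
    by (rule schwartz_basic[OF g]) blast
  have Ff: "integrable lborel (fourier f)" by (rule schwartz_fourier[OF f]) blast
  have "fourier (\<lambda>x. LINT t|lborel. f (x + t) * g (x + P t) * of_real (chi t)) \<xi>
    = (LINT x|lborel. LINT t|lborel. of_real (chi t) * (f (x + t) * g (x + P t) * ee (- (x * \<xi>))))"
    unfolding fourier_ee
  proof (rule Bochner_Integration.integral_cong)
    fix x
    have "(LINT t|lborel. f (x + t) * g (x + P t) * of_real (chi t)) * ee (- (x * \<xi>)) = (LINT t|lborel. f (x + t) * g (x + P t) * of_real (chi t) * ee (- (x * \<xi>)))"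
      by (rule integral_mult_left_zero[symmetric])
    then show "(LINT t|lborel. f (x + t) * g (x + P t) * of_real (chi t)) * ee (- (x * \<xi>)) = (LINT t|lborel. of_real (chi t) * (f (x + t) * g (x + P t) * ee (- (x * \<xi>))))"
      by (simp add: mult_ac)
  qed auto
  also have "\<dots> = (LINT t|lborel. LINT x|lborel. of_real (chi t) * (f (x + t) * g (x + P t) * ee (- (x * \<xi>))))"
  proof (rule lborel_pair.Fubini_integral)
    have "integrable (lborel \<Otimes>\<^sub>M lborel) (\<lambda>z. of_real (chi (fst z)) * f (snd z + fst z) * (g (snd z + P (fst z)) * ee (- (snd z * \<xi>))))"
      by (rule integrable_conv_bounded(2)[OF multiplier_facts(3) F(1), where C=Bg]) (measurable, simp add: norm_mult G(3))
    then show "integrable (lborel \<Otimes>\<^sub>M lborel) (\<lambda>(t, x). of_real (chi t) * (f (x + t) * g (x + P t) * ee (- (x * \<xi>))))"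
      by (simp add: case_prod_beta' mult_ac)
  qed
  also have "\<dots> = bform (fourier f) (fourier g) \<xi>" unfolding bform_def
  proof (rule Bochner_Integration.integral_cong)
    fix t
    have "fourier (\<lambda>x. f (x + t) * g (x + P t)) \<xi> = (LINT \<eta>|lborel. fourier (\<lambda>x. f (x + t)) \<eta> * fourier (\<lambda>x. g (x + P t)) (\<xi> - \<eta>))"
    proof (rule fourier_mult[where B=Bf])
      show "continuous_on UNIV (\<lambda>x. f (x + t))" by (intro continuous_on_compose2[OF F(2)] continuous_intros) auto
      show "integrable lborel (fourier (\<lambda>x. f (x + t)))" unfolding fourier_translate[abs_def]
        by (rule integrable_mult_bounded[OF Ff, where C=1]) auto
    qed (use F G in \<open>auto intro: integrable_shift\<close>)
    then show "(LINT x|lborel. of_real (chi t) * (f (x + t) * g (x + P t) * ee (- (x * \<xi>)))) = of_real (chi t) * (LINT \<eta>|lborel. (fourier f \<eta> * ee (\<eta> * t)) * (fourier g (\<xi> - \<eta>) * ee ((\<xi> - \<eta>) * P t)))"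
      unfolding fourier_translate by (simp add: fourier_ee[of "\<lambda>x. f (x + t) * g (x + P t)"])
  qed auto
  finally show ?thesis .
qed

lemma sobolev_norm_leI:
  assumes "(\<integral>\<^sup>+ \<xi>. ennreal ((cmod (fourier f \<xi>))\<^sup>2 * (1 + \<xi>\<^sup>2) powr s) \<partial>lborel) \<le> ennreal C" "C \<ge> 0"
  shows "sobolev_norm s f \<le> ennreal (sqrt C)"
proof -
  define I where "I = (\<integral>\<^sup>+ \<xi>. ennreal ((cmod (fourier f \<xi>))\<^sup>2 * (1 + \<bar>\<xi>\<bar>\<^sup>2) powr s) \<partial>lborel)"
  have I: "I \<le> ennreal C" using assms by (simp add: I_def)
  then have "I \<noteq> \<infinity>" by (auto simp: top_unique)
  moreover have "enn2real I \<le> C" using I assms(2) by (metis enn2real_leI)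
  ultimately show ?thesis unfolding sobolev_norm_def I_def[symmetric] by (simp add: Let_def ennreal_leI)
qed

lemma sobolev_norm_eq:
  assumes "integrable lborel (\<lambda>\<xi>. (cmod (fourier f \<xi>))\<^sup>2 * (1 + \<xi>\<^sup>2) powr s)"
  shows "sobolev_norm s f = ennreal (sqrt (LINT \<xi>|lborel. (cmod (fourier f \<xi>))\<^sup>2 * (1 + \<xi>\<^sup>2) powr s))"
proof -
  have "(\<integral>\<^sup>+ \<xi>. ennreal ((cmod (fourier f \<xi>))\<^sup>2 * (1 + \<bar>\<xi>\<bar>\<^sup>2) powr s) \<partial>lborel) = ennreal (LINT \<xi>|lborel. (cmod (fourier f \<xi>))\<^sup>2 * (1 + \<xi>\<^sup>2) powr s)"
    using nn_integral_eq_integral[OF assms] by simp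
  then show ?thesis unfolding sobolev_norm_def by (simp add: Let_def)
qed

lemma (in curve) sobolev_estimate:
  assumes f: "schwartz f" and g: "schwartz g"
  shows "sobolev_norm smoothing_exponent (\<lambda>x. LINT t|lborel. f (x + t) * g (x + P t) * of_real (chi t))
    \<le> ennreal (2 * C0\<^sup>2 * K ^ 19) * sobolev_norm (- smoothing_exponent) f * sobolev_norm (- smoothing_exponent) g"
proof -
  obtain Bf where F: "integrable lborel (fourier f)" "\<And>x. cmod (fourier f x) \<le> Bf" by (rule schwartz_fourier[OF f]) blast
  obtain Bg where G: "integrable lborel (fourier g)" "\<And>x. cmod (fourier g x) \<le> Bg" by (rule schwartz_fourier[OF g]) blast
  define NF where "NF = (LINT \<eta>|lborel. (cmod (fourier f \<eta>))\<^sup>2 * (1 + \<eta>\<^sup>2) powr - smoothing_exponent)"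
  define NG where "NG = (LINT \<eta>|lborel. (cmod (fourier g \<eta>))\<^sup>2 * (1 + \<eta>\<^sup>2) powr - smoothing_exponent)"
  have NFG: "NF \<ge> 0" "NG \<ge> 0" by (simp_all add: NF_def NG_def)
  have s: "smoothing_exponent \<ge> 0" by (simp add: smoothing_exponent_def)
  have nf: "sobolev_norm (- smoothing_exponent) f = ennreal (sqrt NF)" unfolding NF_def by (rule sobolev_norm_eq[OF dyad_weight(1)[OF F s]])
  have ng: "sobolev_norm (- smoothing_exponent) g = ennreal (sqrt NG)" unfolding NG_def by (rule sobolev_norm_eq[OF dyad_weight(1)[OF G s]])
  have "sobolev_norm smoothing_exponent (\<lambda>x. LINT t|lborel. f (x + t) * g (x + P t) * of_real (chi t)) \<le> ennreal (sqrt (4 * C0 ^ 4 * K ^ 37 * NF * NG))"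
    by (rule sobolev_norm_leI) (use sobolev_bilinear[OF F G] NFG K_pos dyadic_ratio(3) in \<open>simp_all add: fourier_bilinear[OF f g] NF_def NG_def\<close>)
  also have "\<dots> \<le> ennreal (2 * C0\<^sup>2 * K ^ 19 * sqrt NF * sqrt NG)"
  proof (rule ennreal_leI)
    \<comment> \<open>\<open>K ^ 37\<close> is rounded up to \<open>K ^ 38\<close> to obtain a
      perfect square.\<close>
    have "sqrt (4 * C0 ^ 4 * K ^ 37 * NF * NG) \<le> sqrt ((2 * C0\<^sup>2 * K ^ 19)\<^sup>2 * NF * NG)"
    proof (intro real_sqrt_le_mono mult_right_mono NFG)
      have "(2 * C0\<^sup>2 * K ^ 19)\<^sup>2 = 4 * C0 ^ 4 * K ^ 38" by (simp add: power_mult_distrib flip: power_mult)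
      then show "4 * C0 ^ 4 * K ^ 37 \<le> (2 * C0\<^sup>2 * K ^ 19)\<^sup>2" using K_power[of 37 38] dyadic_ratio(3) by simp
    qed
    also have "\<dots> = 2 * C0\<^sup>2 * K ^ 19 * sqrt NF * sqrt NG" using K_pos by (simp add: real_sqrt_mult)
    finally show "sqrt (4 * C0 ^ 4 * K ^ 37 * NF * NG) \<le> 2 * C0\<^sup>2 * K ^ 19 * sqrt NF * sqrt NG" .
  qed
  also have "\<dots> = ennreal (2 * C0\<^sup>2 * K ^ 19) * ennreal (sqrt NF) * ennreal (sqrt NG)"
    using NFG K_pos by (subst ennreal_mult[symmetric], simp, simp, subst ennreal_mult[symmetric]) auto
  finally show ?thesis unfolding nf ng .
qed

subsection \<open>Polynomial curves near the origin\<close>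

text \<open>The exponent is the order of vanishing at 0. The cofactor is nonzero at 0 and by
  continuity stays above half of its value there.\<close>

lemma poly_lower_bound:
  fixes q :: "real poly"
  assumes "q \<noteq> 0"
  obtains A n \<epsilon> where "A \<ge> 1" "0 < \<epsilon>" "\<epsilon> \<le> 1" "\<And>t. 0 < t \<Longrightarrow> t < \<epsilon> \<Longrightarrow> t ^ n / A \<le> \<bar>poly q t\<bar>"
proof -
  obtain r where r: "q = [:- 0, 1:] ^ order 0 q * r" "\<not> [:- 0, 1:] dvd r" using order_decomp[OF assms, of 0] by blast
  define c where "c = \<bar>poly r 0\<bar>"
  have c: "c > 0" using r(2) by (simp add: c_def dvd_iff_poly_eq_0)
  have "isCont (poly r) 0" by simp
  then have "\<exists>d>0. \<forall>x. \<bar>x\<bar> < d \<longrightarrow> \<bar>poly r x - poly r 0\<bar> < c / 2"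
    using c unfolding continuous_at_eps_delta dist_real_def by (metis diff_zero half_gt_zero)
  then obtain d where d: "d > 0" "\<And>x. \<bar>x\<bar> < d \<Longrightarrow> \<bar>poly r x - poly r 0\<bar> < c / 2" by blast
  show ?thesis
  proof (rule that[of "max 1 (2 / c)" "min d 1" "order 0 q"])
    fix t assume t: "0 < t" "t < min d 1"
    have "\<bar>poly r t - poly r 0\<bar> < c / 2" using d(2)[of t] t by simp
    then have "\<bar>poly r t\<bar> \<ge> c / 2" unfolding c_def by linarith
    moreover have "1 / max 1 (2 / c) \<le> c / 2"
    proof -
      have "1 / max 1 (2 / c) \<le> 1 / (2 / c)" using c by (intro divide_left_mono) auto
      then show ?thesis by simp
    qed
    ultimately have "t ^ order 0 q * (1 / max 1 (2 / c)) \<le> t ^ order 0 q * \<bar>poly r t\<bar>" using t by (intro mult_left_mono) auto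
    also have "\<dots> = \<bar>poly q t\<bar>" using t by (subst (2) r(1)) (simp add: abs_mult)
    finally show "t ^ order 0 q / max 1 (2 / c) \<le> \<bar>poly q t\<bar>" by simp
  qed (use d in auto)
qed

lemma poly_lower_bound_dyadic:
  fixes q :: "real poly"
  assumes "q \<noteq> 0"
  obtains B m A0 where "B \<ge> 1" "A0 \<ge> 2"
    "\<And>A t. A \<ge> A0 \<Longrightarrow> 1 / A \<le> t \<Longrightarrow> t \<le> 2 / A \<Longrightarrow> 1 / (B * A ^ m) \<le> \<bar>poly q t\<bar>"
proof -
  obtain B n \<epsilon> where B: "B \<ge> 1" "0 < \<epsilon>" "\<epsilon> \<le> 1" "\<And>t. 0 < t \<Longrightarrow> t < \<epsilon> \<Longrightarrow> t ^ n / B \<le> \<bar>poly q t\<bar>"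
    by (rule poly_lower_bound[OF assms]) blast
  show ?thesis
  \<comment> \<open>From \<open>A \<ge> 4 / \<epsilon>\<close> the whole interval from
    \<open>1 / A\<close> to \<open>2 / A\<close> lies in the range of
    \<open>poly_lower_bound\<close>.\<close>
  proof (rule that[of B "4 / \<epsilon>" n])
    show "4 / \<epsilon> \<ge> 2" using B by (simp add: field_simps)
    fix A t assume A: "4 / \<epsilon> \<le> A" and t: "1 / A \<le> t" "t \<le> 2 / A"
    have "4 / \<epsilon> > 0" using B by simp
    then have A0: "A > 0" using A by linarith
    have "2 / A < \<epsilon>" using A A0 B by (simp add: field_simps)
    then have te: "t < \<epsilon>" using t by linarith
    have "1 / A > 0" using A0 by simp
    then have t0: "t > 0" using t by linarith
    have "1 / (B * A ^ n) = (1 / A) ^ n / B" by (simp add: power_one_over field_simps)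
    also have "\<dots> \<le> t ^ n / B" using t A0 B by (intro divide_right_mono power_mono) auto
    also have "\<dots> \<le> \<bar>poly q t\<bar>" by (rule B(4)[OF t0 te])
    finally show "1 / (B * A ^ n) \<le> \<bar>poly q t\<bar>" .
  qed (use B in auto)
qed

lemma poly_upper_bound:
  fixes q :: "real poly"
  obtains B where "B \<ge> 1" "\<And>t. 0 \<le> t \<Longrightarrow> t \<le> 1 \<Longrightarrow> \<bar>poly q t\<bar> \<le> B"
proof -
  have "compact (poly q ` {0..1})" by (intro compact_continuous_image continuous_intros) auto
  then obtain B where B: "\<And>x. x \<in> poly q ` {0..1} \<Longrightarrow> norm x \<le> B" using compact_imp_bounded bounded_iff by metis
  show ?thesis by (rule that[of "max 1 B"]) (use B in \<open>auto simp: le_max_iff_disj\<close>)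
qed

text \<open>The numerator of the derivative of \<open>u' / (u (u - 1))\<close> for \<open>u = P'\<close>. It does not vanish identically:
  comparing leading coefficients in \<open>u'' u (u - 1) = u'\<^sup>2 (2 u - 1)\<close> would give \<open>d (d - 1) = 2 d\<^sup>2\<close> for the degree \<open>d\<close> of \<open>u\<close>.\<close>

definition curvature_numerator :: "real poly \<Rightarrow> real poly" where
  "curvature_numerator u = pderiv (pderiv u) * (u * (u - 1)) - pderiv u * pderiv u * (2 * u - 1)"

lemma curvature_numerator_nonzero:
  assumes d: "degree u \<ge> 1"
  shows "curvature_numerator u \<noteq> 0"
proof
  assume "curvature_numerator u = 0"
  then have eq: "pderiv (pderiv u) * (u * (u - 1)) = pderiv u * pderiv u * (2 * u - 1)" by (simp add: curvature_numerator_def)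
  define c where "c = lead_coeff u"
  define n where "n = degree u"
  have u0: "u \<noteq> 0" using d by auto
  have c0: "c \<noteq> 0" using u0 by (simp add: c_def)
  have n1: "n \<ge> 1" using d by (simp add: n_def)
  have d1: "degree (u - 1) = n" using n1 degree_add_eq_left[of "- 1" u] by (simp add: n_def)
  have l1: "lead_coeff (u - 1) = c" using n1 unfolding d1 by (simp add: c_def n_def coeff_eq_0)
  have d2: "degree (2 * u - 1) = n"
  proof -
    have "degree (2 * u) = n" by (simp add: n_def numeral_poly)
    then show ?thesis using n1 degree_add_eq_left[of "- 1" "2 * u"] by simp
  qed
  have l2: "lead_coeff (2 * u - 1) = 2 * c" using n1 unfolding d2 by (simp add: c_def n_def coeff_eq_0 numeral_poly)
  have dp: "degree (pderiv u) = n - 1" by (simp add: degree_pderiv n_def)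
  have lp: "lead_coeff (pderiv u) = real n * c" unfolding dp using n1 by (simp add: coeff_pderiv c_def n_def)
  \<comment> \<open>For \<open>n = 1\<close> the second derivative is the zero polynomial, and the
    factor \<open>real n - 1\<close> gives its leading coefficient 0.\<close>
  have lhs: "lead_coeff (pderiv (pderiv u)) = real n * (real n - 1) * c"
  proof (cases "n = 1")
    case True
    then have "pderiv (pderiv u) = 0" using dp by (simp add: pderiv_eq_0_iff)
    then show ?thesis using True by simp
  next
    case False
    then have "n \<ge> 2" using n1 by simp
    moreover have "degree (pderiv (pderiv u)) = n - 2" by (simp add: degree_pderiv n_def)
    ultimately show ?thesis using lp by (simp add: coeff_pderiv dp c_def n_def numeral_2_eq_2 Suc_diff_Suc of_nat_diff)
  qed
  have "lead_coeff (pderiv (pderiv u) * (u * (u - 1))) = real n * (real n - 1) * c * (c * c)"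
    unfolding lead_coeff_mult lhs l1 c_def[symmetric] by simp
  moreover have "lead_coeff (pderiv u * pderiv u * (2 * u - 1)) = (real n * c) * (real n * c) * (2 * c)"
    unfolding lead_coeff_mult lp l2 by simp
  ultimately have "real n * (real n - 1) * c * (c * c) = (real n * c) * (real n * c) * (2 * c)" using eq by simp
  then have "(real n * c ^ 3) * (real n + 1) = 0" by (simp add: algebra_simps power3_eq_cube)
  then show False using c0 n1 by simp
qed

section \<open>The rescaled bump and the constants of the curve\<close>

lemma vector_derivative_zero_open:
  assumes "open S" "x \<in> S" "\<And>y. y \<in> S \<Longrightarrow> h y = (0 :: real)"
  shows "vector_derivative h (at x) = 0"
proof (rule vector_derivative_at)
  show "(h has_vector_derivative 0) (at x)"
    by (rule has_vector_derivative_transform_within_open[OF has_vector_derivative_const assms(1,2)]) (use assms(3) in auto)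
qed

lemma bump_facts:
  assumes "bump_on_1_2 \<tau>"
  obtains B where "B \<ge> 1" "\<And>k x. k \<le> 2 \<Longrightarrow> \<bar>iter_deriv k \<tau> x\<bar> \<le> B" "\<And>x. x \<le> 1 \<or> 2 \<le> x \<Longrightarrow> \<tau> x = 0"
proof -
  have sm: "smooth \<tau>" and cl: "closure {t. \<tau> t \<noteq> 0} \<subseteq> {1..2}" using assms by (auto simp: bump_on_1_2_def)
  have z: "\<tau> x = 0" if "x < 1 \<or> x > 2" for x
    using cl closure_subset[of "{t. \<tau> t \<noteq> 0}"] that by fastforce
  have zk: "iter_deriv k \<tau> x = 0" if "x < 1 \<or> x > 2" for k x
    using that
  proof (induction k arbitrary: x)
    case 0 then show ?case using z by (simp add: iter_deriv_0)
  next
    case (Suc k)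
    have "open ({..<1} \<union> {2<..} :: real set)" by auto
    then show ?case unfolding iter_deriv_Suc using Suc by (intro vector_derivative_zero_open[of "{..<1} \<union> {2<..}"]) auto
  qed
  \<comment> \<open>The support condition still admits the endpoints 1 and 2; there \<tau> vanishes
    by continuity.\<close>
  have z': "\<tau> x = 0" if "x \<le> 1 \<or> 2 \<le> x" for x
  proof -
    have tc: "continuous_on UNIV \<tau>" using smooth_continuous[OF sm, of UNIV 0] by (simp add: iter_deriv_0)
    have cz: "closed {x. \<tau> x = 0}" using continuous_closed_preimage_constant[OF tc, of 0] by simp
    have "closure ({..<1} \<union> {2<..}) \<subseteq> {x. \<tau> x = 0}" by (rule closure_minimal[OF _ cz]) (use z in auto)
    then show ?thesis using that by (auto simp: closure_Un)
  qed
  have "\<exists>B. \<forall>x. \<bar>iter_deriv k \<tau> x\<bar> \<le> B" for k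
  proof -
    have "compact (iter_deriv k \<tau> ` {1..2})" by (intro compact_continuous_image smooth_continuous sm) auto
    then obtain B where B: "\<And>x. x \<in> iter_deriv k \<tau> ` {1..2} \<Longrightarrow> norm x \<le> B" using compact_imp_bounded bounded_iff by metis
    have "\<bar>iter_deriv k \<tau> x\<bar> \<le> max 0 B" for x
      using B zk[of x k] by (cases "x \<in> {1..2}") (auto simp: le_max_iff_disj)
    then show ?thesis by blast
  qed
  then obtain B where B: "\<And>k x. \<bar>iter_deriv k \<tau> x\<bar> \<le> B k" by metis
  show ?thesis
  proof (rule that[of "max 1 (max (B 0) (max (B 1) (B 2)))"])
    fix k :: nat and x assume "k \<le> 2"
    then have "k = 0 \<or> k = 1 \<or> k = 2" by auto
    then show "\<bar>iter_deriv k \<tau> x\<bar> \<le> max 1 (max (B 0) (max (B 1) (B 2)))"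
      using B[of 0 x] B[of 1 x] B[of 2 x] by auto
  qed (use z' in auto)
qed

text \<open>The polynomials \<open>P'\<close>, \<open>P' - 1\<close>, \<open>P''\<close> and
  \<open>curvature_numerator P'\<close> are nonzero because the degree exceeds one, so each is at
  least a negative power of \<open>A\<close> where t is comparable to \<open>1 / A\<close>; upper
  bounds hold on the whole unit interval. The derivative of \<open>W\<close> is
  \<open>curvature_numerator\<close> over the square of \<open>P' (P' - 1)\<close>, so the mean
  value theorem yields \<open>W_ge\<close>.\<close>

lemma dyadic_curve:
  fixes \<tau> :: "real \<Rightarrow> real" and P :: "real poly"
  assumes bump: "bump_on_1_2 \<tau>" and deg: "degree P > 1"
  obtains B m A0 where "B \<ge> 2" "A0 \<ge> 2"
    "\<And>A. A \<ge> A0 \<Longrightarrow> curve (poly P) (poly (pderiv P)) (poly (pderiv (pderiv P))) (poly (pderiv (pderiv (pderiv P))))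
        (\<lambda>t. \<tau> (A * t)) (\<lambda>t. A * iter_deriv 1 \<tau> (A * t)) (\<lambda>t. A\<^sup>2 * iter_deriv 2 \<tau> (A * t)) (1 / A) (2 / A) (B * A ^ m)"
proof -
  define u where "u = pderiv P"
  define u1 where "u1 = pderiv u"
  define u2 where "u2 = pderiv u1"
  have du: "degree u \<ge> 1" using deg by (simp add: u_def degree_pderiv)
  have n0: "u \<noteq> 0" using du by auto
  have n1: "u - 1 \<noteq> 0"
  proof
    assume "u - 1 = 0" then have "u = 1" by simp
    then show False using du by simp
  qed
  have n2: "u1 \<noteq> 0" using du by (simp add: u1_def pderiv_eq_0_iff)
  have n3: "curvature_numerator u \<noteq> 0" by (rule curvature_numerator_nonzero[OF du])
  obtain B0 m0 A0 where L0: "B0 \<ge> 1" "A0 \<ge> 2" "\<And>A t. A \<ge> A0 \<Longrightarrow> 1 / A \<le> t \<Longrightarrow> t \<le> 2 / A \<Longrightarrow> 1 / (B0 * A ^ m0) \<le> \<bar>poly u t\<bar>"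
    by (rule poly_lower_bound_dyadic[OF n0]) blast
  obtain B1 m1 A1 where L1: "B1 \<ge> 1" "A1 \<ge> 2" "\<And>A t. A \<ge> A1 \<Longrightarrow> 1 / A \<le> t \<Longrightarrow> t \<le> 2 / A \<Longrightarrow> 1 / (B1 * A ^ m1) \<le> \<bar>poly (u - 1) t\<bar>"
    by (rule poly_lower_bound_dyadic[OF n1]) blast
  obtain B2 m2 A2 where L2: "B2 \<ge> 1" "A2 \<ge> 2" "\<And>A t. A \<ge> A2 \<Longrightarrow> 1 / A \<le> t \<Longrightarrow> t \<le> 2 / A \<Longrightarrow> 1 / (B2 * A ^ m2) \<le> \<bar>poly u1 t\<bar>"
    by (rule poly_lower_bound_dyadic[OF n2]) blast
  obtain B3 m3 A3 where L3: "B3 \<ge> 1" "A3 \<ge> 2" "\<And>A t. A \<ge> A3 \<Longrightarrow> 1 / A \<le> t \<Longrightarrow> t \<le> 2 / A \<Longrightarrow> 1 / (B3 * A ^ m3) \<le> \<bar>poly (curvature_numerator u) t\<bar>"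
    by (rule poly_lower_bound_dyadic[OF n3]) blast
  obtain U0 where U0: "U0 \<ge> 1" "\<And>t. 0 \<le> t \<Longrightarrow> t \<le> 1 \<Longrightarrow> \<bar>poly u t\<bar> \<le> U0" by (rule poly_upper_bound) blast
  obtain U1 where U1: "U1 \<ge> 1" "\<And>t. 0 \<le> t \<Longrightarrow> t \<le> 1 \<Longrightarrow> \<bar>poly u1 t\<bar> \<le> U1" by (rule poly_upper_bound) blast
  obtain U2 where U2: "U2 \<ge> 1" "\<And>t. 0 \<le> t \<Longrightarrow> t \<le> 1 \<Longrightarrow> \<bar>poly u2 t\<bar> \<le> U2" by (rule poly_upper_bound) blast
  obtain U3 where U3: "U3 \<ge> 1" "\<And>t. 0 \<le> t \<Longrightarrow> t \<le> 1 \<Longrightarrow> \<bar>poly (u * (u - 1)) t\<bar> \<le> U3" by (rule poly_upper_bound) blast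
  obtain T where T: "T \<ge> 1" "\<And>k x. k \<le> 2 \<Longrightarrow> \<bar>iter_deriv k \<tau> x\<bar> \<le> T" "\<And>x. x \<le> 1 \<or> 2 \<le> x \<Longrightarrow> \<tau> x = 0"
    by (rule bump_facts[OF bump]) blast
  \<comment> \<open>All factors are at least 1, so the product dominates every constant that occurs.
    The factor 2 provides \<open>K \<ge> 2\<close>, and the square of \<open>U3\<close> comes from
    the denominator of the derivative of \<open>W\<close>.\<close>
  define B where "B = 2 * (T * U0 * U1 * U2 * (B0 * B1 * B2 * B3) * U3\<^sup>2)"
  \<comment> \<open>The last summand accounts for \<open>A\<^sup>2\<close> in the second derivative
    of the rescaled bump.\<close>
  define m where "m = m0 + m1 + m2 + m3 + 2"
  define AA where "AA = max (max A0 A1) (max A2 A3)"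
  note one = T(1) U0(1) U1(1) U2(1) U3(1) L0(1) L1(1) L2(1) L3(1)
  have prod1: "1 \<le> x * y" if "1 \<le> x" "1 \<le> y" for x y :: real using mult_mono[OF that] that by simp
  have mono: "x \<le> x * y" "x \<le> y * x" if "1 \<le> x" "1 \<le> y" for x y :: real
    using that mult_left_mono[of 1 y x] by (simp_all add: mult.commute)
  have sq: "1 \<le> U3\<^sup>2" using U3(1) by (rule one_le_power)
  define BB where "BB = B0 * B1 * B2 * B3"
  have BB: "1 \<le> BB" "B0 \<le> BB" "B1 \<le> BB" "B2 \<le> BB" "B3 \<le> BB"
  proof -
    have a: "1 \<le> B0 * B1" "1 \<le> B0 * B1 * B2" using one by (auto intro!: prod1)
    show "1 \<le> BB" unfolding BB_def using one by (intro prod1)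
    show "B3 \<le> BB" unfolding BB_def using a(2) one by (intro mono)
    have b: "B0 * B1 * B2 \<le> BB" unfolding BB_def using a one by (intro mono)
    have c: "B2 \<le> B0 * B1 * B2" using a one by (intro mono)
    show "B2 \<le> BB" using b c by linarith
    have d: "B0 * B1 \<le> B0 * B1 * B2" using a one by (intro mono)
    have e: "B0 \<le> B0 * B1" "B1 \<le> B0 * B1" using one by (auto intro!: mono)
    show "B0 \<le> BB" "B1 \<le> BB" using b d e by linarith+
  qed
  define UU where "UU = T * U0 * U1 * U2"
  have UU: "1 \<le> UU" "T \<le> UU" "U0 \<le> UU" "U1 \<le> UU" "U2 \<le> UU"
  proof -
    have a: "1 \<le> T * U0" "1 \<le> T * U0 * U1" using one by (auto intro!: prod1)
    show "1 \<le> UU" unfolding UU_def using one by (intro prod1)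
    show "U2 \<le> UU" unfolding UU_def using a(2) one by (intro mono)
    have b: "T * U0 * U1 \<le> UU" unfolding UU_def using a one by (intro mono)
    have c: "U1 \<le> T * U0 * U1" using a one by (intro mono)
    show "U1 \<le> UU" using b c by linarith
    have d: "T * U0 \<le> T * U0 * U1" using a one by (intro mono)
    have e: "T \<le> T * U0" "U0 \<le> T * U0" using one by (auto intro!: mono)
    show "T \<le> UU" "U0 \<le> UU" using b d e by linarith+
  qed
  have Beq: "B = 2 * (UU * BB * U3\<^sup>2)" by (simp add: B_def UU_def BB_def)
  have BUU: "UU \<le> B" "BB \<le> B" "BB * U3\<^sup>2 \<le> B" "2 \<le> B"
  proof -
    have a: "1 \<le> UU * BB" "1 \<le> BB * U3\<^sup>2" using UU BB sq by (auto intro!: prod1)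
    have b: "BB * U3\<^sup>2 \<le> UU * BB * U3\<^sup>2" using mono(2)[OF a(2) UU(1)] by (simp add: mult_ac)
    have c: "UU * BB \<le> UU * BB * U3\<^sup>2" using a sq by (intro mono)
    have d: "UU \<le> UU * BB" "BB \<le> UU * BB" using UU BB by (auto intro!: mono)
    show "UU \<le> B" "BB \<le> B" "BB * U3\<^sup>2 \<le> B" "2 \<le> B" unfolding Beq using a b c d by linarith+
  qed
  show ?thesis
  proof (rule that[of B AA m])
    show "B \<ge> 2" by (rule BUU)
    show "AA \<ge> 2" using L0(2) by (simp add: AA_def le_max_iff_disj)
    fix A assume A: "A \<ge> AA"
    have AS: "A \<ge> A0" "A \<ge> A1" "A \<ge> A2" "A \<ge> A3" "A \<ge> 2" using A L0(2) by (auto simp: AA_def)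
    then have A0: "A > 0" "A \<ge> 1" by auto
    define K where "K = B * A ^ m"
    have Apow: "1 \<le> A ^ k" for k using A0 by (intro one_le_power) auto
    have Am: "A ^ k \<le> A ^ m" if "k \<le> m" for k using A0 that by (intro power_increasing) auto
    have KB: "x * A ^ k \<le> K" if "0 \<le> x" "x \<le> B" "k \<le> m" for x k
      unfolding K_def using that Am Apow[of k] BUU by (intro mult_mono) auto
    have KB0: "x \<le> K" if "0 \<le> x" "x \<le> B" for x using KB[of x 0] that by simp
    have inv: "1 / K \<le> y" if "1 / (C * A ^ k) \<le> y" "1 \<le> C" "C \<le> B" "k \<le> m" for C k y
    proof -
      have "C * A ^ k > 0" using that A0 by simp
      then have "1 / K \<le> 1 / (C * A ^ k)" using KB[of C k] that by (intro divide_left_mono) (auto intro!: mult_pos_pos)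
      then show ?thesis using that by linarith
    qed
    have tin: "0 \<le> t \<and> t \<le> 1" if "1 / A \<le> t" "t \<le> 2 / A" for t
    proof -
      have "1 / A > 0" "2 / A \<le> 1" using AS by (auto simp: field_simps)
      then show ?thesis using that by linarith
    qed
    have tder: "((\<lambda>t. c * iter_deriv k \<tau> (A * t)) has_real_derivative (c * A) * iter_deriv (Suc k) \<tau> (A * t)) (at t)" for c k t
    proof -
      have d1: "(iter_deriv k \<tau> has_real_derivative iter_deriv (Suc k) \<tau> (A * t)) (at (A * t))"
        using smooth_derivative[of \<tau> k "A * t"] bump by (simp add: bump_on_1_2_def has_real_derivative_iff_has_vector_derivative)
      have d2: "((\<lambda>t. A * t) has_real_derivative A) (at t)" by (auto intro!: derivative_eq_intros)
      have "((\<lambda>t. iter_deriv k \<tau> (A * t)) has_real_derivative iter_deriv (Suc k) \<tau> (A * t) * A) (at t)"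
        by (rule DERIV_chain2[where f="iter_deriv k \<tau>" and g="\<lambda>t. A * t", OF d1 d2])
      from DERIV_cmult[OF this, of c] show ?thesis by (simp add: mult_ac)
    qed
    define W where "W x = poly u1 x / (poly u x * (poly u x - 1))" for x
    have Wsep: "\<bar>W x - W y\<bar> \<ge> \<bar>x - y\<bar> / K" if xy: "x < y" "1 / A \<le> x" "y \<le> 2 / A" for x y
    proof -
      \<comment> \<open>The derivative of \<open>W\<close>, in the notation of the curvature
        numerator.\<close>
      define W1 where "W1 z = poly (curvature_numerator u) z / (poly (u * (u - 1)) z)\<^sup>2" for z
      have nz: "poly u z \<noteq> 0" "poly u z - 1 \<noteq> 0" if "x \<le> z" "z \<le> y" for z
      proof -
        have "1 / K > 0" using KB0[of 1] BUU by simp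
        moreover have "1 / K \<le> \<bar>poly u z\<bar>" "1 / K \<le> \<bar>poly (u - 1) z\<bar>"
          using L0(3)[OF AS(1), of z] L1(3)[OF AS(2), of z] that xy BB BUU one by (auto intro!: inv simp: m_def)
        ultimately show "poly u z \<noteq> 0" "poly u z - 1 \<noteq> 0" by auto
      qed
      have dW: "(W has_real_derivative W1 z) (at z)" if "x \<le> z" "z \<le> y" for z
      proof -
        have "(W has_real_derivative (poly u2 z * (poly u z * (poly u z - 1)) - poly u1 z * (poly u1 z * (poly u z - 1) + poly u1 z * poly u z)) / ((poly u z * (poly u z - 1)) * (poly u z * (poly u z - 1)))) (at z)"
          unfolding W_def u2_def u1_def using nz[OF that]
          by (auto intro!: derivative_eq_intros poly_DERIV simp: algebra_simps)
        moreover have "(poly u2 z * (poly u z * (poly u z - 1)) - poly u1 z * (poly u1 z * (poly u z - 1) + poly u1 z * poly u z)) / ((poly u z * (poly u z - 1)) * (poly u z * (poly u z - 1))) = W1 z"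
          unfolding W1_def curvature_numerator_def u1_def[symmetric] u2_def[symmetric] by (simp add: power2_eq_square algebra_simps)
        ultimately show ?thesis by simp
      qed
      obtain z where z: "x < z" "z < y" "W y - W x = (y - x) * W1 z"
        using MVT2[OF xy(1), of W W1] dW by blast
      have zin: "1 / A \<le> z" "z \<le> 2 / A" using z xy by auto
      have "1 / K \<le> \<bar>W1 z\<bar>"
      proof (rule inv[of "B3 * U3\<^sup>2" m3])
        have "1 / (B3 * U3\<^sup>2 * A ^ m3) = (1 / (B3 * A ^ m3)) / U3\<^sup>2" by (simp add: mult_ac)
        also have "\<dots> \<le> \<bar>poly (curvature_numerator u) z\<bar> / \<bar>poly (u * (u - 1)) z\<bar>\<^sup>2"
        proof (intro frac_le L3(3)[OF AS(4)] zin power_mono U3(2))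
          show "\<bar>poly (u * (u - 1)) z\<bar>\<^sup>2 > 0" using nz[of z] z by simp
        qed (use tin[OF zin] in auto)
        also have "\<dots> = \<bar>W1 z\<bar>" by (simp add: W1_def abs_divide)
        finally show "1 / (B3 * U3\<^sup>2 * A ^ m3) \<le> \<bar>W1 z\<bar>" .
        show "1 \<le> B3 * U3\<^sup>2" using one sq by (intro prod1)
        have "B3 * U3\<^sup>2 \<le> BB * U3\<^sup>2" using BB by (intro mult_right_mono) auto
        then show "B3 * U3\<^sup>2 \<le> B" using BUU by linarith
      qed (simp add: m_def)
      then have "(y - x) * (1 / K) \<le> (y - x) * \<bar>W1 z\<bar>" using xy by (intro mult_left_mono) auto
      also have "\<dots> = \<bar>W x - W y\<bar>" using z(3) xy(1) by (metis abs_minus_commute abs_mult abs_of_pos diff_gt_0_iff_gt)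
      finally show ?thesis using xy by simp
    qed
    show "curve (poly P) (poly (pderiv P)) (poly (pderiv (pderiv P))) (poly (pderiv (pderiv (pderiv P))))
        (\<lambda>t. \<tau> (A * t)) (\<lambda>t. A * iter_deriv 1 \<tau> (A * t)) (\<lambda>t. A\<^sup>2 * iter_deriv 2 \<tau> (A * t)) (1 / A) (2 / A) (B * A ^ m)"
      unfolding K_def[symmetric] u_def[symmetric] u1_def[symmetric] u2_def[symmetric]
    proof
      show "1 / A < 2 / A" "2 / A - 1 / A \<le> 1" using A0 by (auto simp: field_simps)
      show "2 \<le> K" using KB0[of 2] BUU by simp
      show "(poly P has_real_derivative poly u x) (at x)" for x unfolding u_def by (rule poly_DERIV)
      show "(poly u has_real_derivative poly u1 x) (at x)" for x unfolding u1_def by (rule poly_DERIV)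
      show "(poly u1 has_real_derivative poly u2 x) (at x)" for x unfolding u2_def by (rule poly_DERIV)
      show "((\<lambda>t. \<tau> (A * t)) has_real_derivative A * iter_deriv 1 \<tau> (A * x)) (at x)" for x
        using tder[of 1 0 x] by (simp add: iter_deriv_0)
      show "((\<lambda>t. A * iter_deriv 1 \<tau> (A * t)) has_real_derivative A\<^sup>2 * iter_deriv 2 \<tau> (A * x)) (at x)" for x
        using tder[of A 1 x] by (simp add: numeral_2_eq_2 power2_eq_square)
      show "0 \<le> \<tau> (A * x)" for x using bump by (simp add: bump_on_1_2_def)
      show "\<tau> (A * x) = 0" if "x \<le> 1 / A \<or> 2 / A \<le> x" for x
        by (rule T(3)) (use that A0 in \<open>auto simp: field_simps\<close>)
      show "\<tau> (A * x) \<le> K" for x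
      proof -
        have "\<tau> (A * x) \<le> T" using T(2)[of 0 "A * x"] by (simp add: iter_deriv_0)
        moreover have "T \<le> K" using KB0[of T] T UU BUU by simp
        ultimately show ?thesis by linarith
      qed
      show "\<bar>A * iter_deriv 1 \<tau> (A * x)\<bar> \<le> K" for x
      proof -
        have "\<bar>A * iter_deriv 1 \<tau> (A * x)\<bar> \<le> A * T" using T(2)[of 1 "A * x"] A0 by (simp add: abs_mult mult_left_mono)
        also have "A * T \<le> K" using KB[of T 1] T UU BUU by (simp add: m_def mult.commute)
        finally show ?thesis .
      qed
      show "\<bar>A\<^sup>2 * iter_deriv 2 \<tau> (A * x)\<bar> \<le> K" for x
      proof -
        have "\<bar>A\<^sup>2 * iter_deriv 2 \<tau> (A * x)\<bar> \<le> A\<^sup>2 * T" using T(2)[of 2 "A * x"] A0 by (simp add: abs_mult mult_left_mono)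
        also have "A\<^sup>2 * T \<le> K" using KB[of T 2] T UU BUU by (simp add: m_def mult.commute)
        finally show ?thesis .
      qed
      fix x assume x: "1 / A \<le> x" "x \<le> 2 / A"
      note xx = tin[OF x]
      show "\<bar>poly u x\<bar> \<le> K" using U0(2)[of x] xx KB0[of U0] U0(1) UU BUU by linarith
      show "\<bar>poly u1 x\<bar> \<le> K" using U1(2)[of x] xx KB0[of U1] U1(1) UU BUU by linarith
      show "\<bar>poly u2 x\<bar> \<le> K" using U2(2)[of x] xx KB0[of U2] U2(1) UU BUU by linarith
      show "1 / K \<le> \<bar>poly u x\<bar>" by (rule inv[OF L0(3)[OF AS(1) x]]) (use BB BUU one in \<open>auto simp: m_def\<close>)
      show "1 / K \<le> \<bar>poly u x - 1\<bar>" using inv[OF L1(3)[OF AS(2) x]] BB BUU one by (auto simp: m_def)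
      show "1 / K \<le> \<bar>poly u1 x\<bar>" by (rule inv[OF L2(3)[OF AS(3) x]]) (use BB BUU one in \<open>auto simp: m_def\<close>)
      fix y assume y: "1 / A \<le> y" "y \<le> 2 / A"
      show "\<bar>x - y\<bar> / K \<le> \<bar>poly u1 x / (poly u x * (poly u x - 1)) - poly u1 y / (poly u y * (poly u y - 1))\<bar>"
        using Wsep[of x y] Wsep[of y x] x y unfolding W_def
        by (cases x y rule: linorder_cases) (auto simp: abs_minus_commute)
    qed
  qed
qed

theorem proposition1p2:
  fixes \<tau>\<^sub>0 :: "real \<Rightarrow> real" and P :: "real poly"
  assumes "bump_on_1_2 \<tau>\<^sub>0"
    and "coeff P 0 = 0" and "degree P > 1"
  shows "\<exists>(s\<^sub>0::real) (l\<^sub>0::real) (\<gamma>\<^sub>0::real). s\<^sub>0 > 0 \<and> l\<^sub>0 > 0 \<and> \<gamma>\<^sub>0 > 0 \<and>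
    (\<forall>(l::int) f g. of_int l \<ge> l\<^sub>0 \<longrightarrow> schwartz f \<longrightarrow> schwartz g \<longrightarrow>
      sobolev_norm s\<^sub>0 (bilinear_T \<tau>\<^sub>0 P l f g)
        \<le> ennreal (2 powr (\<gamma>\<^sub>0 * of_int l)) * sobolev_norm (- s\<^sub>0) f * sobolev_norm (- s\<^sub>0) g)"
proof -
  obtain B m A0 where B: "B \<ge> 2" "A0 \<ge> 2"
    and cv: "\<And>A. A \<ge> A0 \<Longrightarrow> curve (poly P) (poly (pderiv P)) (poly (pderiv (pderiv P))) (poly (pderiv (pderiv (pderiv P))))
        (\<lambda>t. \<tau>\<^sub>0 (A * t)) (\<lambda>t. A * iter_deriv 1 \<tau>\<^sub>0 (A * t)) (\<lambda>t. A\<^sup>2 * iter_deriv 2 \<tau>\<^sub>0 (A * t)) (1 / A) (2 / A) (B * A ^ m)"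
    by (rule dyadic_curve[OF assms(1,3)]) blast
  \<comment> \<open>The part of \<open>2 * C0\<^sup>2 * K ^ 19\<close> that does not depend on
    \<open>l\<close>, where \<open>K = B * A ^ m\<close>. The maximum with 2 makes
    \<open>log 2 D\<close> at least 1.\<close>
  define D where "D = max 2 (2 * C0\<^sup>2 * B ^ 19)"
  define l\<^sub>0 where "l\<^sub>0 = log 2 A0"
  define \<gamma>\<^sub>0 where "\<gamma>\<^sub>0 = log 2 D + 19 * m"
  have l0: "l\<^sub>0 \<ge> 1" using B(2) by (simp add: l\<^sub>0_def le_log_iff)
  have D1: "log 2 D \<ge> 1" by (simp add: le_log_iff D_def)
  have est: "sobolev_norm smoothing_exponent (bilinear_T \<tau>\<^sub>0 P l f g) \<le> ennreal (2 powr (\<gamma>\<^sub>0 * of_int l)) * sobolev_norm (- smoothing_exponent) f * sobolev_norm (- smoothing_exponent) g"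
    if l: "of_int l \<ge> l\<^sub>0" and f: "schwartz f" and g: "schwartz g" for l :: int and f g
  proof -
    define A where "A = 2 powr (of_int l :: real)"
    have Ai: "2 powi l = A" unfolding A_def by (rule powr_real_of_int'[symmetric]) auto
    have "A0 = 2 powr l\<^sub>0" using B(2) by (simp add: l\<^sub>0_def)
    also have "\<dots> \<le> A" unfolding A_def using l by (intro powr_mono) auto
    finally have A: "A \<ge> A0" .
    interpret curve "poly P" "poly (pderiv P)" "poly (pderiv (pderiv P))" "poly (pderiv (pderiv (pderiv P)))"
      "\<lambda>t. \<tau>\<^sub>0 (A * t)" "\<lambda>t. A * iter_deriv 1 \<tau>\<^sub>0 (A * t)" "\<lambda>t. A\<^sup>2 * iter_deriv 2 \<tau>\<^sub>0 (A * t)" "1 / A" "2 / A" "B * A ^ m"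
      by (rule cv[OF A])
    have Te: "bilinear_T \<tau>\<^sub>0 P l f g = (\<lambda>x. LINT t|lborel. f (x + t) * g (x + poly P t) * of_real (\<tau>\<^sub>0 (A * t)))"
      unfolding bilinear_T_def[abs_def] dyadic_scale_def Ai by simp
    have "2 * C0\<^sup>2 * (B * A ^ m) ^ 19 \<le> 2 powr (\<gamma>\<^sub>0 * of_int l)"
    proof -
      have l1: "real_of_int l \<ge> 1" using l l0 by linarith
      have "2 * C0\<^sup>2 * (B * A ^ m) ^ 19 = (2 * C0\<^sup>2 * B ^ 19) * A ^ (19 * m)"
        by (simp add: power_mult_distrib mult.commute flip: power_mult)
      also have "\<dots> \<le> D * A ^ (19 * m)" by (intro mult_right_mono) (auto simp: D_def A_def)
      also have "D = 2 powr (log 2 D)" by (simp add: D_def)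
      also have "A ^ (19 * m) = 2 powr (19 * m * of_int l)"
        unfolding A_def by (subst powr_realpow[symmetric]) (simp_all add: powr_powr mult_ac)
      \<comment> \<open>The constant \<open>D\<close> is absorbed into an exponential in
        \<open>l\<close> by \<open>D \<le> D powr l\<close>, valid because \<open>l \<ge> 1\<close>
        and \<open>D \<ge> 2\<close>.\<close>
      also have "2 powr (log 2 D) * 2 powr (19 * m * of_int l) \<le> 2 powr (log 2 D * of_int l) * 2 powr (19 * m * of_int l)"
        using mult_left_mono[OF l1, of "log 2 D"] D1 by (intro mult_right_mono powr_mono) auto
      also have "\<dots> = 2 powr (\<gamma>\<^sub>0 * of_int l)" by (simp add: \<gamma>\<^sub>0_def distrib_right flip: powr_add)
      finally show ?thesis .
    qed
    then show ?thesis unfolding Te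
      by (intro order_trans[OF sobolev_estimate[OF f g]] mult_right_mono ennreal_leI) auto
  qed
  have pos: "smoothing_exponent > 0" "l\<^sub>0 > 0" "\<gamma>\<^sub>0 > 0"
    using l0 D1 by (auto simp: smoothing_exponent_def \<gamma>\<^sub>0_def intro!: add_pos_nonneg)
  show ?thesis
    by (intro exI[of _ smoothing_exponent] exI[of _ l\<^sub>0] exI[of _ \<gamma>\<^sub>0] conjI allI impI pos est)
qed

end
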